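(* Let $n\ge 1$ and let $G$ be a $GBS_n$ group. Then $G$ is virtually a hierarchically hyperbolic group (that is, $G$ has some finite index subgroup which is a hierarchically hyperbolic group) if and only if $G$ has finite monodromy.
   Context: Let $n\ge 1$. A generalised rank $n$ Baumslag-Solitar group ($GBS_n$ group) is a group $G$ which is the fundamental group of a finite (connected) graph of groups in which all vertex and edge groups are isomorphic to $\mathbb{Z}^n$; a $GBS_n$ group is understood to come with such a decomposition. $G$ then acts without edge inversions and cocompactly on the Bass-Serre tree $T$ of the decomposition, which is locally finite. Modular homomorphism and monodromy: choose a base vertex $v_0$ of $T$, a finite index subgroup $A\cong\mathbb{Z}^n$ of $\mathrm{Stab}_G(v_0)\cong\mathbb{Z}^n$ (called a base $\mathbb{Z}^n$-subgroup of $G$) and an ordered basis $a_1,\ldots,a_n$ of $A$. For any $g\in G$ the subgroups $A$ and $g^{-1}Ag$ are commensurable, so there is $m>0$ such that $\langle a_1^m,\ldots,a_n^m\rangle$ is a finite index subgroup of $A\cap g^{-1}Ag$. Hence there are unique integers $g_{ij}$ with $g a_j^m g^{-1}=a_1^{g_{1j}}\cdots a_n^{g_{nj}}$ for each $j$. The modular homomorphism $\mathcal{M}:G\to GL(n,\mathbb{Q})$ sends $g$ to the matrix with $(i,j)$ entry $g_{ij}/m$. This is independent of $m$, is a homomorphism, and changing the choices of $v_0$, $A$ and basis changes $\mathcal{M}$ only by conjugation in $GL(n,\mathbb{Q})$. The monodromy of $G$ is the image $\mathcal{M}(G)$. Hierarchically hyperbolic spaces (Behrstock-Hagen-Sisto).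 A quasigeodesic metric space $(X,d)$ is a hierarchically hyperbolic space (HHS) if there are $\delta\ge0$, an index set $\mathfrak{S}$ (its elements are called domains) and $\delta$-hyperbolic geodesic spaces $\{\mathcal{C}W: W\in\mathfrak{S}\}$ satisfying the following, where $d_W$ denotes distance in $\mathcal{C}W$ and $d_W(x,y)$ abbreviates $d_W(\pi_W(x),\pi_W(y))$ for $x,y \in X$ (similarly $d_W(x,p)$ abbreviates $d_W(\pi_W(x),p)$). (1) Projections: there are $\xi\ge 0$, $K$ and maps $\pi_W:X\to 2^{\mathcal{C}W}$ sending points to nonempty sets of diameter at most $\xi$, each $(K,K)$-coarsely Lipschitz, with $\pi_W(X)$ $K$-quasiconvex in $\mathcal{C}W$. (2) Nesting: $\mathfrak{S}$ has a partial order $\sqsubseteq$, and either $\mathfrak{S}=\emptyset$ or there is a unique $\sqsubseteq$-maximal element. Put $\mathfrak{S}_W=\{V: V\sqsubseteq W\}$. For $V\sqsubsetneq W$ there are a specified nonempty subset $\rho^V_W\subseteq\mathcal{C}W$ of diameter at most $\xi$ and a map $\rho^W_V:\mathcal{C}W\to 2^{\mathcal{C}V}$. (3) Orthogonality: $\mathfrak{S}$ has a symmetric anti-reflexive relation $\perp$; if $V\sqsubseteq W$ and $W\perp U$ then $V\perp U$; for each $T\in\mathfrak{S}$ and $U\in\mathfrak{S}_T$ with $\{V\in\mathfrak{S}_T: V\perp U\}\neq\emptyset$ there is $W\in\mathfrak{S}_T\setminus\{T\}$ such that $V\sqsubseteq W$ whenever $V\perp U$ and $V\sqsubseteq T$;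 if $V\perp W$ then $V,W$ are not $\sqsubseteq$-comparable. (4) Transversality and consistency: $V,W$ are transverse, $V\pitchfork W$, if they are not orthogonal and neither is nested in the other. There is $\kappa_0\ge0$ such that if $V\pitchfork W$ there are nonempty sets $\rho^V_W\subseteq\mathcal{C}W$, $\rho^W_V\subseteq\mathcal{C}V$ of diameter at most $\xi$ with $\min\{d_W(\pi_W(x),\rho^V_W),d_V(\pi_V(x),\rho^W_V)\}\le\kappa_0$ for all $x\in X$; if $V\sqsubsetneq W$ then $\min\{d_W(\pi_W(x),\rho^V_W),\mathrm{diam}_{\mathcal{C}V}(\pi_V(x)\cup\rho^W_V(\pi_W(x)))\}\le\kappa_0$ for all $x\in X$; and if $U\sqsubseteq V$ then $d_W(\rho^U_W,\rho^V_W)\le\kappa_0$ whenever $V\sqsubsetneq W$, or $V\pitchfork W$ and $W\not\perp U$. (5) Finite complexity: there is a bound on the cardinality of sets of pairwise $\sqsubseteq$-comparable elements. (6) Large links: there are $\lambda\ge1$ and $E\ge\max\{\xi,\kappa_0\}$ such that for $W\in\mathfrak{S}$, $x,x'\in X$ and $N=\lambda d_W(\pi_W(x),\pi_W(x'))+\lambda$, there are $T_1,\ldots,T_{\lfloor N\rfloor}\in\mathfrak{S}_W\setminus\{W\}$ such that every $T\in\mathfrak{S}_W\setminus\{W\}$ satisfies $T\in\mathfrak{S}_{T_i}$ for some $i$ or $d_T(\pi_T(x),\pi_T(x'))<E$; also $d_W(\pi_W(x),\rho^{T_i}_W)\le N$ for each $i$. (7) Bounded geodesic image: there is $E>0$ such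 that for all $W$, all $V\in\mathfrak{S}_W\setminus\{W\}$ and all geodesics $\gamma$ of $\mathcal{C}W$, either $\mathrm{diam}_{\mathcal{C}V}(\rho^W_V(\gamma))\le E$ or $\gamma$ meets the $E$-neighbourhood of $\rho^V_W$. (8) Partial realization: there is $\alpha$ such that for any family $\{V_j\}$ of pairwise orthogonal elements of $\mathfrak{S}$ and any $p_j\in\pi_{V_j}(X)$ there is $x\in X$ with $d_{V_j}(x,p_j)\le\alpha$ for all $j$; $d_V(x,\rho^{V_j}_V)\le\alpha$ for each $j$ and each $V$ with $V_j\sqsubsetneq V$; and $d_W(x,\rho^{V_j}_W)\le\alpha$ whenever $W\pitchfork V_j$ for some $j$. (9) Uniqueness: for each $\kappa\ge0$ there is $\theta(\kappa)$ such that if $x,y\in X$ and $d(x,y)\ge\theta(\kappa)$ then $d_V(x,y)\ge\kappa$ for some $V\in\mathfrak{S}$. Hierarchically hyperbolic groups. A finitely generated group $G$ is a hierarchically hyperbolic group (HHG) if $X=G$ with a word metric from a finite generating set has an HHS structure $\mathfrak{S}$ (that is, $X=G$ with this word metric is a hierarchically hyperbolic space with index set $\mathfrak{S}$, hyperbolic spaces $\mathcal{C}W$, projections $\pi_W$, relations $\sqsubseteq$, $\perp$, $\pitchfork$ and sets and maps $\rho^V_W$ having all the properties required in the definition of a hierarchically hyperbolic space) such that: $G$ acts on $\mathfrak{S}$ with finitely many orbits, preserving $\sqsubseteq$, $\perp$ and $\pitchfork$; for each $g\in G$ and $U\in\mathfrak{S}$ there is an isometry $g:\mathcal{C}U\to\mathcal{C}(gU)$,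 and these satisfy that the isometry for $gh$ is the composition of those for $h$ and $g$; and $g(\pi_U(x))=\pi_{gU}(gx)$ for all $x\in G$, and $g(\rho^U_V)=\rho^{gU}_{gV}$ whenever $U\pitchfork V$ or $U\sqsubsetneq V$.
   Formalization: The large links axiom is required only for domains W that have some domain properly nested in them; read literally it asks for at least one such domain even when W is minimal, so no infinite group would be hierarchically hyperbolic. *)

theory Defs
  imports
    "HOL-Analysis.Abstract_Metric_Spaces"
    "HOL-Algebra.Group_Action"
    "HOL-Algebra.Product_Groups"
    "Graph_Theory.Digraph_Component"
    "Graph_Theory.Bidirected_Digraph"
    "Jordan_Normal_Form.Matrix"
begin

section \<open>Graphs of groups and their fundamental groups\<close>

text \<open>
  Graphs of groups in the sense of Serre: the underlying graph is a digraph with an orientation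
  reversing, fixed-point free involution on its arcs. The edge groups of an arc and of its reverse
  coincide, and \<open>emb e\<close> embeds the edge group of \<open>e\<close> into the vertex group at the head of \<open>e\<close>; the
  embedding at the tail is \<open>emb (erev e)\<close>.
\<close>

record ('v, 'e, 'a, 'b) graph_of_groups =
  graph :: "('v, 'e) pre_digraph"
  erev :: "'e \<Rightarrow> 'e"
  vgrp :: "'v \<Rightarrow> 'a monoid"
  egrp :: "'e \<Rightarrow> 'b monoid"
  emb :: "'e \<Rightarrow> 'b \<Rightarrow> 'a"

definition is_graph_of_groups :: "('v, 'e, 'a, 'b) graph_of_groups \<Rightarrow> bool" where
  "is_graph_of_groups \<G> \<longleftrightarrow>
     bidirected_digraph (graph \<G>) (erev \<G>) \<and>
     (\<forall>u\<in>verts (graph \<G>). group (vgrp \<G> u)) \<and>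
     (\<forall>e\<in>arcs (graph \<G>).
        group (egrp \<G> e) \<and> egrp \<G> (erev \<G> e) = egrp \<G> e \<and>
        emb \<G> e \<in> mon (egrp \<G> e) (vgrp \<G> (head (graph \<G>) e)))"

datatype ('v, 'e, 'a) gog_letter = Elt 'v 'a | Edge 'e

text \<open>
  Equality of words in the path group of \<open>\<G>\<close>, i.e. the group generated by the vertex groups and the
  arcs, subject to \<open>erev e = e\<^sup>-\<^sup>1\<close> and to \<open>e \<cdot> emb e c \<cdot> e\<^sup>-\<^sup>1 = emb (erev e) c\<close>. Formal
  inverses of letters are not needed, as every letter has an inverse letter.
\<close>

inductive gog_eq ::
  "('v, 'e, 'a, 'b) graph_of_groups \<Rightarrow> ('v, 'e, 'a) gog_letter list
     \<Rightarrow> ('v, 'e, 'a) gog_letter list \<Rightarrow> bool"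
  for \<G> where
  eq_refl: "gog_eq \<G> p p"
| eq_sym: "gog_eq \<G> p q \<Longrightarrow> gog_eq \<G> q p"
| eq_trans: "gog_eq \<G> p q \<Longrightarrow> gog_eq \<G> q r \<Longrightarrow> gog_eq \<G> p r"
| eq_cong: "gog_eq \<G> p q \<Longrightarrow> gog_eq \<G> (l @ p @ r) (l @ q @ r)"
| vertex_mult: "\<lbrakk>u \<in> verts (graph \<G>); a \<in> carrier (vgrp \<G> u); b \<in> carrier (vgrp \<G> u)\<rbrakk>
    \<Longrightarrow> gog_eq \<G> [Elt u a, Elt u b] [Elt u (a \<otimes>\<^bsub>vgrp \<G> u\<^esub> b)]"
| vertex_one: "u \<in> verts (graph \<G>) \<Longrightarrow> gog_eq \<G> [Elt u \<one>\<^bsub>vgrp \<G> u\<^esub>] []"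
| edge_inv: "e \<in> arcs (graph \<G>) \<Longrightarrow> gog_eq \<G> [Edge e, Edge (erev \<G> e)] []"
| edge_conj: "\<lbrakk>e \<in> arcs (graph \<G>); c \<in> carrier (egrp \<G> e)\<rbrakk>
    \<Longrightarrow> gog_eq \<G> [Edge e, Elt (head (graph \<G>) e) (emb \<G> e c), Edge (erev \<G> e)]
          [Elt (tail (graph \<G>) e) (emb \<G> (erev \<G> e) c)]"

definition gog_class ::
  "('v, 'e, 'a, 'b) graph_of_groups \<Rightarrow> ('v, 'e, 'a) gog_letter list
     \<Rightarrow> ('v, 'e, 'a) gog_letter list set" where
  "gog_class \<G> p = {q. gog_eq \<G> p q}"

definition gog_mult ::
  "('v, 'e, 'a, 'b) graph_of_groups \<Rightarrow> ('v, 'e, 'a) gog_letter list set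
     \<Rightarrow> ('v, 'e, 'a) gog_letter list set \<Rightarrow> ('v, 'e, 'a) gog_letter list set" where
  "gog_mult \<G> P Q = (\<Union>p\<in>P. \<Union>q\<in>Q. gog_class \<G> (p @ q))"

inductive gog_path ::
  "('v, 'e, 'a, 'b) graph_of_groups \<Rightarrow> 'v \<Rightarrow> ('v, 'e, 'a) gog_letter list \<Rightarrow> 'v \<Rightarrow> bool"
  for \<G> where
  path_Nil: "u \<in> verts (graph \<G>) \<Longrightarrow> gog_path \<G> u [] u"
| path_Elt: "\<lbrakk>u \<in> verts (graph \<G>); a \<in> carrier (vgrp \<G> u); gog_path \<G> u p w\<rbrakk>
    \<Longrightarrow> gog_path \<G> u (Elt u a # p) w"
| path_Edge: "\<lbrakk>e \<in> arcs (graph \<G>); gog_path \<G> (head (graph \<G>) e) p w\<rbrakk>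
    \<Longrightarrow> gog_path \<G> (tail (graph \<G>) e) (Edge e # p) w"

definition gog_pi1 ::
  "('v, 'e, 'a, 'b) graph_of_groups \<Rightarrow> 'v \<Rightarrow> ('v, 'e, 'a) gog_letter list set monoid" where
  "gog_pi1 \<G> v =
     \<lparr>carrier = gog_class \<G> ` {p. gog_path \<G> v p v}, monoid.mult = gog_mult \<G>, one = gog_class \<G> []\<rparr>"

text \<open>
  The vertices of the Bass--Serre tree over \<open>u\<close> are the cosets \<open>p \<cdot> G\<^sub>u\<close> in the path group, where
  \<open>p\<close> is represented by a path from the base vertex \<open>v\<close> to \<open>u\<close>. The fundamental group at \<open>v\<close> acts on
  them by left multiplication. Only the vertex set of the tree is needed below.
\<close>

definition bass_serre_verts ::
  "('v, 'e, 'a, 'b) graph_of_groups \<Rightarrow> 'v \<Rightarrow> ('v \<times> ('v, 'e, 'a) gog_letter list set) set" where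
  "bass_serre_verts \<G> v =
     {(u, \<Union>a\<in>carrier (vgrp \<G> u). gog_class \<G> (p @ [Elt u a])) | u p. gog_path \<G> v p u}"

definition bass_serre_act ::
  "('v, 'e, 'a, 'b) graph_of_groups \<Rightarrow> ('v, 'e, 'a) gog_letter list set
     \<Rightarrow> 'v \<times> ('v, 'e, 'a) gog_letter list set \<Rightarrow> 'v \<times> ('v, 'e, 'a) gog_letter list set" where
  "bass_serre_act \<G> g x = (fst x, gog_mult \<G> g (snd x))"

section \<open>Generalised Baumslag--Solitar groups and their monodromy\<close>

abbreviation Z_power :: "nat \<Rightarrow> (nat \<Rightarrow> int) monoid" where
  "Z_power n \<equiv> product_group {..<n} (\<lambda>_. integer_group)"

text \<open>
  \<open>G\<close> together with a rank \<open>n\<close> GBS decomposition: an identification \<open>\<phi>\<close> of \<open>G\<close> with the fundamental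
  group, based at \<open>v\<close>, of a finite connected graph of groups \<open>\<G>\<close>.
\<close>

definition GBS_decomposition ::
  "nat \<Rightarrow> ('g, 'm) monoid_scheme \<Rightarrow> ('v, 'e, 'a, 'b) graph_of_groups \<Rightarrow> 'v
     \<Rightarrow> ('g \<Rightarrow> ('v, 'e, 'a) gog_letter list set) \<Rightarrow> bool" where
  "GBS_decomposition n G \<G> v \<phi> \<longleftrightarrow>
     is_graph_of_groups \<G> \<and> fin_digraph (graph \<G>) \<and> Digraph_Component.connected (graph \<G>) \<and>
     (\<forall>u\<in>verts (graph \<G>). vgrp \<G> u \<cong> Z_power n) \<and>
     (\<forall>e\<in>arcs (graph \<G>). egrp \<G> e \<cong> Z_power n) \<and>
     v \<in> verts (graph \<G>) \<and> group G \<and> \<phi> \<in> iso G (gog_pi1 \<G> v)"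

definition finite_index_subgroup :: "'g set \<Rightarrow> 'g set \<Rightarrow> ('g, 'm) monoid_scheme \<Rightarrow> bool" where
  "finite_index_subgroup H K G \<longleftrightarrow>
     subgroup H (G\<lparr>carrier := K\<rparr>) \<and> finite (rcosets\<^bsub>G\<lparr>carrier := K\<rparr>\<^esub> H)"

definition list_product :: "('g, 'm) monoid_scheme \<Rightarrow> 'g list \<Rightarrow> 'g" where
  "list_product G xs = foldr (\<otimes>\<^bsub>G\<^esub>) xs \<one>\<^bsub>G\<^esub>"

definition monomial :: "nat \<Rightarrow> ('g, 'm) monoid_scheme \<Rightarrow> (nat \<Rightarrow> 'g) \<Rightarrow> (nat \<Rightarrow> int) \<Rightarrow> 'g" where
  "monomial n G a k = list_product G (map (\<lambda>i. a i [^]\<^bsub>G\<^esub> k i) [0..<n])"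

text \<open>Bases are indexed by \<open>0, \<dots>, n - 1\<close>, in line with the indexing of matrices.\<close>

definition ordered_basis ::
  "nat \<Rightarrow> ('g, 'm) monoid_scheme \<Rightarrow> 'g set \<Rightarrow> (nat \<Rightarrow> 'g) \<Rightarrow> bool" where
  "ordered_basis n G A a \<longleftrightarrow>
     (\<forall>i<n. a i \<in> A) \<and> (\<forall>x\<in>A. \<exists>!k. k \<in> {..<n} \<rightarrow>\<^sub>E UNIV \<and> x = monomial n G a k)"

definition modular_hom ::
  "nat \<Rightarrow> ('g, 'm) monoid_scheme \<Rightarrow> 'g set \<Rightarrow> (nat \<Rightarrow> 'g) \<Rightarrow> 'g \<Rightarrow> rat mat" where
  "modular_hom n G A a g =
     (THE M. \<exists>(m::nat) c. m > 0 \<and>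
        finite_index_subgroup (generate G {a j [^]\<^bsub>G\<^esub> m | j. j < n})
          (A \<inter> (inv\<^bsub>G\<^esub> g <#\<^bsub>G\<^esub> A #>\<^bsub>G\<^esub> g)) G \<and>
        (\<forall>j<n. g \<otimes>\<^bsub>G\<^esub> (a j [^]\<^bsub>G\<^esub> m) \<otimes>\<^bsub>G\<^esub> inv\<^bsub>G\<^esub> g = monomial n G a (\<lambda>i. c i j)) \<and>
        M = Matrix.mat n n (\<lambda>(i, j). rat_of_int (c i j) / rat_of_nat m))"

definition monodromy ::
  "nat \<Rightarrow> ('g, 'm) monoid_scheme \<Rightarrow> 'g set \<Rightarrow> (nat \<Rightarrow> 'g) \<Rightarrow> rat mat set" where
  "monodromy n G A a = modular_hom n G A a ` carrier G"

section \<open>Coarse geometry\<close>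

text \<open>
  The distance of two sets is the infimum of the distances of their points; it is only ever applied
  to nonempty sets.
\<close>

definition set_distance :: "('p \<Rightarrow> 'p \<Rightarrow> real) \<Rightarrow> 'p set \<Rightarrow> 'p set \<Rightarrow> real" where
  "set_distance d A B = (INF (a, b)\<in>A \<times> B. d a b)"

definition diam_le :: "('p \<Rightarrow> 'p \<Rightarrow> real) \<Rightarrow> 'p set \<Rightarrow> real \<Rightarrow> bool" where
  "diam_le d A r \<longleftrightarrow> (\<forall>a\<in>A. \<forall>b\<in>A. d a b \<le> r)"

definition geodesic_segment :: "'p set \<Rightarrow> ('p \<Rightarrow> 'p \<Rightarrow> real) \<Rightarrow> 'p \<Rightarrow> 'p \<Rightarrow> 'p set \<Rightarrow> bool" where
  "geodesic_segment M d x y S \<longleftrightarrow>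
     (\<exists>L\<ge>0. \<exists>c. c \<in> {0..L} \<rightarrow> M \<and> c 0 = x \<and> c L = y \<and> S = c ` {0..L} \<and>
        (\<forall>s\<in>{0..L}. \<forall>t\<in>{0..L}. d (c s) (c t) = \<bar>s - t\<bar>))"

definition geodesic_space :: "'p set \<Rightarrow> ('p \<Rightarrow> 'p \<Rightarrow> real) \<Rightarrow> bool" where
  "geodesic_space M d \<longleftrightarrow> Metric_space M d \<and> (\<forall>x\<in>M. \<forall>y\<in>M. \<exists>S. geodesic_segment M d x y S)"

definition hyperbolic_space :: "real \<Rightarrow> 'p set \<Rightarrow> ('p \<Rightarrow> 'p \<Rightarrow> real) \<Rightarrow> bool" where
  "hyperbolic_space \<delta> M d \<longleftrightarrow> geodesic_space M d \<and>
     (\<forall>x y z S1 S2 S3. geodesic_segment M d x y S1 \<and> geodesic_segment M d y z S2 \<and>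
        geodesic_segment M d x z S3 \<longrightarrow> (\<forall>p\<in>S1. \<exists>q\<in>S2 \<union> S3. d p q \<le> \<delta>))"

definition quasiconvex :: "real \<Rightarrow> 'p set \<Rightarrow> ('p \<Rightarrow> 'p \<Rightarrow> real) \<Rightarrow> 'p set \<Rightarrow> bool" where
  "quasiconvex K M d Y \<longleftrightarrow>
     (\<forall>x\<in>Y. \<forall>y\<in>Y. \<forall>S. geodesic_segment M d x y S \<longrightarrow> (\<forall>p\<in>S. \<exists>q\<in>Y. d p q \<le> K))"

definition quasigeodesic_space :: "'x set \<Rightarrow> ('x \<Rightarrow> 'x \<Rightarrow> real) \<Rightarrow> bool" where
  "quasigeodesic_space X d \<longleftrightarrow> Metric_space X d \<and>
     (\<exists>k\<ge>1. \<exists>C\<ge>0. \<forall>x\<in>X. \<forall>y\<in>X. \<exists>L\<ge>0. \<exists>c. c \<in> {0..L} \<rightarrow> X \<and> c 0 = x \<and> c L = y \<and>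
        (\<forall>s\<in>{0..L}. \<forall>t\<in>{0..L}.
           \<bar>s - t\<bar> / k - C \<le> d (c s) (c t) \<and> d (c s) (c t) \<le> k * \<bar>s - t\<bar> + C))"

section \<open>Hierarchically hyperbolic spaces\<close>

text \<open>
  \<open>rho V W\<close> is the subset \<open>\<rho>\<^sup>V\<^sub>W\<close> of \<open>space W\<close>, for \<open>V\<close> properly nested in or transverse to \<open>W\<close>;
  \<open>rho_map W V\<close> is the map \<open>\<rho>\<^sup>W\<^sub>V\<close> from \<open>space W\<close> to subsets of \<open>space V\<close>, for \<open>V\<close> properly
  nested in \<open>W\<close>.
\<close>

record ('x, 's, 'p) hhs =
  domains :: "'s set"
  space :: "'s \<Rightarrow> 'p set"
  sdist :: "'s \<Rightarrow> 'p \<Rightarrow> 'p \<Rightarrow> real"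
  proj :: "'s \<Rightarrow> 'x \<Rightarrow> 'p set"
  nested :: "'s \<Rightarrow> 's \<Rightarrow> bool"
  orth :: "'s \<Rightarrow> 's \<Rightarrow> bool"
  rho :: "'s \<Rightarrow> 's \<Rightarrow> 'p set"
  rho_map :: "'s \<Rightarrow> 's \<Rightarrow> 'p \<Rightarrow> 'p set"

definition pnested :: "('x, 's, 'p) hhs \<Rightarrow> 's \<Rightarrow> 's \<Rightarrow> bool" where
  "pnested H V W \<longleftrightarrow> nested H V W \<and> V \<noteq> W"

definition transverse :: "('x, 's, 'p) hhs \<Rightarrow> 's \<Rightarrow> 's \<Rightarrow> bool" where
  "transverse H V W \<longleftrightarrow> \<not> orth H V W \<and> \<not> nested H V W \<and> \<not> nested H W V"

abbreviation below :: "('x, 's, 'p) hhs \<Rightarrow> 's \<Rightarrow> 's set" where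
  "below H W \<equiv> {V \<in> domains H. nested H V W}"

abbreviation dst :: "('x, 's, 'p) hhs \<Rightarrow> 's \<Rightarrow> 'p set \<Rightarrow> 'p set \<Rightarrow> real" where
  "dst H W \<equiv> set_distance (sdist H W)"

definition hhs_projections ::
  "'x set \<Rightarrow> ('x \<Rightarrow> 'x \<Rightarrow> real) \<Rightarrow> ('x, 's, 'p) hhs \<Rightarrow> real \<Rightarrow> real \<Rightarrow> bool" where
  "hhs_projections X d H \<xi> K \<longleftrightarrow>
     (\<forall>W\<in>domains H.
        (\<forall>x\<in>X. proj H W x \<noteq> {} \<and> proj H W x \<subseteq> space H W \<and> diam_le (sdist H W) (proj H W x) \<xi>) \<and>
        (\<forall>x\<in>X. \<forall>y\<in>X. dst H W (proj H W x) (proj H W y) \<le> K * d x y + K) \<and>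
        quasiconvex K (space H W) (sdist H W) (\<Union>x\<in>X. proj H W x))"

definition hhs_nesting :: "('x, 's, 'p) hhs \<Rightarrow> real \<Rightarrow> bool" where
  "hhs_nesting H \<xi> \<longleftrightarrow>
     reflp_on (domains H) (nested H) \<and> transp_on (domains H) (nested H) \<and>
     antisymp_on (domains H) (nested H) \<and>
     (domains H = {} \<or> (\<exists>!S. S \<in> domains H \<and> (\<forall>W\<in>domains H. nested H S W \<longrightarrow> W = S))) \<and>
     (\<forall>V\<in>domains H. \<forall>W\<in>domains H. pnested H V W \<longrightarrow>
        rho H V W \<noteq> {} \<and> rho H V W \<subseteq> space H W \<and> diam_le (sdist H W) (rho H V W) \<xi> \<and>
        rho_map H W V \<in> space H W \<rightarrow> Pow (space H V))"

definition hhs_orthogonality :: "('x, 's, 'p) hhs \<Rightarrow> bool" where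
  "hhs_orthogonality H \<longleftrightarrow>
     symp_on (domains H) (orth H) \<and> irreflp_on (domains H) (orth H) \<and>
     (\<forall>U\<in>domains H. \<forall>V\<in>domains H. \<forall>W\<in>domains H. nested H V W \<and> orth H W U \<longrightarrow> orth H V U) \<and>
     (\<forall>T\<in>domains H. \<forall>U\<in>below H T. {V \<in> below H T. orth H V U} \<noteq> {} \<longrightarrow>
        (\<exists>W\<in>below H T - {T}. \<forall>V\<in>below H T. orth H V U \<longrightarrow> nested H V W)) \<and>
     (\<forall>V\<in>domains H. \<forall>W\<in>domains H. orth H V W \<longrightarrow> \<not> nested H V W \<and> \<not> nested H W V)"

definition hhs_consistency :: "'x set \<Rightarrow> ('x, 's, 'p) hhs \<Rightarrow> real \<Rightarrow> real \<Rightarrow> bool" where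
  "hhs_consistency X H \<xi> \<kappa>0 \<longleftrightarrow>
     (\<forall>V\<in>domains H. \<forall>W\<in>domains H. transverse H V W \<longrightarrow>
        rho H V W \<noteq> {} \<and> rho H V W \<subseteq> space H W \<and> diam_le (sdist H W) (rho H V W) \<xi> \<and>
        (\<forall>x\<in>X. min (dst H W (proj H W x) (rho H V W)) (dst H V (proj H V x) (rho H W V)) \<le> \<kappa>0)) \<and>
     (\<forall>V\<in>domains H. \<forall>W\<in>domains H. pnested H V W \<longrightarrow>
        (\<forall>x\<in>X. dst H W (proj H W x) (rho H V W) \<le> \<kappa>0 \<or>
           diam_le (sdist H V) (proj H V x \<union> (\<Union>p\<in>proj H W x. rho_map H W V p)) \<kappa>0)) \<and>
     (\<forall>U\<in>domains H. \<forall>V\<in>domains H. \<forall>W\<in>domains H.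
        nested H U V \<and> (pnested H V W \<or> transverse H V W \<and> \<not> orth H W U) \<longrightarrow>
          dst H W (rho H U W) (rho H V W) \<le> \<kappa>0)"

definition hhs_finite_complexity :: "('x, 's, 'p) hhs \<Rightarrow> bool" where
  "hhs_finite_complexity H \<longleftrightarrow>
     (\<exists>N::nat. \<forall>\<U>\<subseteq>domains H. (\<forall>V\<in>\<U>. \<forall>W\<in>\<U>. nested H V W \<or> nested H W V) \<longrightarrow>
        finite \<U> \<and> card \<U> \<le> N)"

text \<open>
  If no domain is properly nested in \<open>W\<close> then the large links condition for \<open>W\<close> is void; in
  particular the domains \<open>T i\<close> are not asked to exist.
\<close>

definition hhs_large_links :: "'x set \<Rightarrow> ('x, 's, 'p) hhs \<Rightarrow> real \<Rightarrow> real \<Rightarrow> bool" where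
  "hhs_large_links X H lam E \<longleftrightarrow>
     (\<forall>W\<in>domains H. below H W - {W} \<noteq> {} \<longrightarrow> (\<forall>x\<in>X. \<forall>x'\<in>X.
        let N = lam * dst H W (proj H W x) (proj H W x') + lam in
        \<exists>T. (\<forall>i\<in>{1..nat \<lfloor>N\<rfloor>}. T i \<in> below H W - {W} \<and> dst H W (proj H W x) (rho H (T i) W) \<le> N) \<and>
          (\<forall>V\<in>below H W - {W}.
             (\<exists>i\<in>{1..nat \<lfloor>N\<rfloor>}. V \<in> below H (T i)) \<or> dst H V (proj H V x) (proj H V x') < E)))"

definition hhs_bounded_geodesic_image :: "('x, 's, 'p) hhs \<Rightarrow> real \<Rightarrow> bool" where
  "hhs_bounded_geodesic_image H E \<longleftrightarrow>
     (\<forall>W\<in>domains H. \<forall>V\<in>below H W - {W}. \<forall>x y \<gamma>.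
        geodesic_segment (space H W) (sdist H W) x y \<gamma> \<longrightarrow>
          diam_le (sdist H V) (\<Union>p\<in>\<gamma>. rho_map H W V p) E \<or>
          (\<exists>p\<in>\<gamma>. \<exists>q\<in>rho H V W. sdist H W p q \<le> E))"

text \<open>Pairwise orthogonal elements are distinct, so the families here may be taken to be sets.\<close>

definition hhs_partial_realization :: "'x set \<Rightarrow> ('x, 's, 'p) hhs \<Rightarrow> real \<Rightarrow> bool" where
  "hhs_partial_realization X H \<alpha> \<longleftrightarrow>
     (\<forall>\<V> p. \<V> \<subseteq> domains H \<and> (\<forall>V\<in>\<V>. \<forall>W\<in>\<V>. V \<noteq> W \<longrightarrow> orth H V W) \<and>
        (\<forall>V\<in>\<V>. p V \<in> (\<Union>x\<in>X. proj H V x)) \<longrightarrow>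
        (\<exists>x\<in>X. \<forall>V\<in>\<V>. dst H V (proj H V x) {p V} \<le> \<alpha> \<and>
           (\<forall>W\<in>domains H. pnested H V W \<or> transverse H W V \<longrightarrow>
              dst H W (proj H W x) (rho H V W) \<le> \<alpha>)))"

definition hhs_uniqueness :: "'x set \<Rightarrow> ('x \<Rightarrow> 'x \<Rightarrow> real) \<Rightarrow> ('x, 's, 'p) hhs \<Rightarrow> bool" where
  "hhs_uniqueness X d H \<longleftrightarrow>
     (\<forall>\<kappa>\<ge>0. \<exists>\<theta>. \<forall>x\<in>X. \<forall>y\<in>X. d x y \<ge> \<theta> \<longrightarrow>
        (\<exists>V\<in>domains H. dst H V (proj H V x) (proj H V y) \<ge> \<kappa>))"

definition hhs_structure :: "'x set \<Rightarrow> ('x \<Rightarrow> 'x \<Rightarrow> real) \<Rightarrow> ('x, 's, 'p) hhs \<Rightarrow> bool" where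
  "hhs_structure X d H \<longleftrightarrow>
     quasigeodesic_space X d \<and>
     (\<exists>\<delta>\<ge>0. \<forall>W\<in>domains H. hyperbolic_space \<delta> (space H W) (sdist H W)) \<and>
     (\<exists>\<xi>\<ge>0. \<exists>\<kappa>0\<ge>0.
        (\<exists>K. hhs_projections X d H \<xi> K) \<and>
        hhs_nesting H \<xi> \<and>
        hhs_consistency X H \<xi> \<kappa>0 \<and>
        (\<exists>lam\<ge>1. \<exists>E\<ge>max \<xi> \<kappa>0. hhs_large_links X H lam E)) \<and>
     hhs_orthogonality H \<and>
     hhs_finite_complexity H \<and>
     (\<exists>E>0. hhs_bounded_geodesic_image H E) \<and>
     (\<exists>\<alpha>. hhs_partial_realization X H \<alpha>) \<and>
     hhs_uniqueness X d H"

section \<open>Hierarchically hyperbolic groups\<close>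

definition word_length :: "('g, 'm) monoid_scheme \<Rightarrow> 'g set \<Rightarrow> 'g \<Rightarrow> nat" where
  "word_length G S g =
     (LEAST k. \<exists>xs. length xs = k \<and> set xs \<subseteq> S \<union> (\<lambda>s. inv\<^bsub>G\<^esub> s) ` S \<and> list_product G xs = g)"

text \<open>Outside the carrier the value is irrelevant, but \<open>Metric_space\<close> asks for symmetry there.\<close>

definition word_metric :: "('g, 'm) monoid_scheme \<Rightarrow> 'g set \<Rightarrow> 'g \<Rightarrow> 'g \<Rightarrow> real" where
  "word_metric G S x y =
     (if x \<in> carrier G \<and> y \<in> carrier G then real (word_length G S (inv\<^bsub>G\<^esub> x \<otimes>\<^bsub>G\<^esub> y)) else 0)"

text \<open>
  \<open>act\<close> is the action on domains and \<open>isom g U\<close> is the isometry from \<open>space U\<close> to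
  \<open>space (act g U)\<close> induced by \<open>g\<close>.
\<close>

definition hhg_structure ::
  "('g, 'm) monoid_scheme \<Rightarrow> 'g set \<Rightarrow> ('g, 's, 'p) hhs \<Rightarrow> ('g \<Rightarrow> 's \<Rightarrow> 's)
     \<Rightarrow> ('g \<Rightarrow> 's \<Rightarrow> 'p \<Rightarrow> 'p) \<Rightarrow> bool" where
  "hhg_structure G S H act isom \<longleftrightarrow>
     hhs_structure (carrier G) (word_metric G S) H \<and>
     group_action G (domains H) act \<and> finite (orbits G (domains H) act) \<and>
     (\<forall>g\<in>carrier G. \<forall>U\<in>domains H. \<forall>V\<in>domains H.
        (nested H (act g U) (act g V) \<longleftrightarrow> nested H U V) \<and>
        (orth H (act g U) (act g V) \<longleftrightarrow> orth H U V) \<and>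
        (transverse H (act g U) (act g V) \<longleftrightarrow> transverse H U V)) \<and>
     (\<forall>g\<in>carrier G. \<forall>U\<in>domains H.
        bij_betw (isom g U) (space H U) (space H (act g U)) \<and>
        (\<forall>p\<in>space H U. \<forall>q\<in>space H U.
           sdist H (act g U) (isom g U p) (isom g U q) = sdist H U p q)) \<and>
     (\<forall>g\<in>carrier G. \<forall>h\<in>carrier G. \<forall>U\<in>domains H. \<forall>p\<in>space H U.
        isom (g \<otimes>\<^bsub>G\<^esub> h) U p = isom g (act h U) (isom h U p)) \<and>
     (\<forall>g\<in>carrier G. \<forall>x\<in>carrier G. \<forall>U\<in>domains H.
        isom g U ` proj H U x = proj H (act g U) (g \<otimes>\<^bsub>G\<^esub> x)) \<and>
     (\<forall>g\<in>carrier G. \<forall>U\<in>domains H. \<forall>V\<in>domains H. transverse H U V \<or> pnested H U V \<longrightarrow>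
        isom g V ` rho H U V = rho H (act g U) (act g V))"

text \<open>
  HOL cannot quantify existentially over types, so the types \<open>'s\<close> of domains and \<open>'p\<close> of points of
  the hyperbolic spaces are parameters of the following notions. There are only countably many domains
  in an HHG structure, and the hyperbolic spaces can be cut down equivariantly to subspaces of at most
  the cardinality of the continuum; hence the notions do not depend on the choice of \<open>'s\<close> and \<open>'p\<close>
  as soon as \<open>'s\<close> is infinite and \<open>'p\<close> is at least as large as the reals.
\<close>

definition hierarchically_hyperbolic_group ::
  "'s itself \<Rightarrow> 'p itself \<Rightarrow> ('g, 'm) monoid_scheme \<Rightarrow> bool" where
  "hierarchically_hyperbolic_group TS TP G \<longleftrightarrow> group G \<and>
     (\<exists>S. finite S \<and> S \<subseteq> carrier G \<and> generate G S = carrier G \<and>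
        (\<exists>(H :: ('g, 's, 'p) hhs) act isom. hhg_structure G S H act isom))"

definition virtually_HHG ::
  "'s itself \<Rightarrow> 'p itself \<Rightarrow> ('g, 'm) monoid_scheme \<Rightarrow> bool" where
  "virtually_HHG TS TP G \<longleftrightarrow>
     (\<exists>H. finite_index_subgroup H (carrier G) G \<and>
        hierarchically_hyperbolic_group TS TP (G\<lparr>carrier := H\<rparr>))"

end

(* If a finite index subgroup is a hierarchically hyperbolic group, some power of every element of A acts on
each domain either trivially up to bounded error or by translation, and only finitely many domains see a nonzero
translation length.  The translation lengths on these domains are virtually preserved by conjugation, and they
determine an element of the torsion-free group A up to signs; hence conjugation induces finitely many matrices.
Conversely, if the monodromy is finite, a finite index subgroup centralises A up to finite index.  It acts on the
Bass-Serre tree and, by extending A -> Z^n affinely, on R^n; the product of a tree and n lines carries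
the hierarchical structure with n + 1 pairwise orthogonal unbounded domains. *)

theory Submission
  imports Defs "Jordan_Normal_Form.Determinant"
begin

text \<open>The hard point of the forward direction is that an element of infinite order has
  positive translation length somewhere: on a single hyperbolic space its orbits could be unbounded
  with translation length zero, as the action there need not be proper. Such an isometry moves
  points deep inside a long geodesic between orbit points only a bounded amount. A tuple of
  coordinates assembled from such points is realized by a point that the first N powers move a
  bounded amount in all domains, with a bound free of N; uniqueness and the finiteness of balls in
  the group then contradict infinite order. Translation lengths see an element only up to sign, so
  for conjugations with equal lengths the sign on each domain has to be recorded; it is well defined
  because a group is not a union of two proper subgroups. In the converse, A -> Z^n need not extend
  to a homomorphism on the fundamental group. It extends to a cocycle, read off from affine maps
  attached to the letters of the path group, and this cocycle is additive where conjugation on A is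
  virtually trivial.\<close>

no_notation matrix_matrix_mult (infixl "**" 70)
notation monoid.mult (infixl "**\<index>" 70)

abbreviation (in monoid) "CG == carrier G"

section \<open>The partial order of domains: levels and orthogonal families\<close>

locale domain_order =
 fixes D :: "'s set" and le :: "'s => 's => bool" and orth :: "'s => 's => bool" and n :: nat
 assumes le_refl: "V : D ==> le V V"
  and le_trans: "U : D ==> V : D ==> W : D ==> le U V ==> le V W ==> le U W"
  and le_antisym: "V : D ==> W : D ==> le V W ==> le W V ==> V = W"
  and top_ex: "D ~= {} ==> EX S:D. ALL V:D. le V S"
  and chain_bound: "C <= D ==> (!!V W. V : C ==> W : C ==> le V W | le W V) ==> finite C & card C <= n"
  and orth_sym: "V : D ==> W : D ==> orth V W ==> orth W V"
  and orth_irrefl: "V : D ==> ~ orth V V"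
  and orth_le: "U : D ==> V : D ==> W : D ==> le V W ==> orth W U ==> orth V U"
  and orth_not_le: "V : D ==> W : D ==> orth V W ==> ~ le V W"
  and container: "T : D ==> U : D ==> le U T ==> V : D ==> le V T ==> orth V U ==>
   EX W:D. le W T & W ~= T & (ALL V:D. le V T & orth V U --> le V W)"
begin

definition lt :: "'s => 's => bool" where "lt V W \<longleftrightarrow> le V W & V ~= W"
definition tr :: "'s => 's => bool" where "tr V W \<longleftrightarrow> ~ orth V W & ~ le V W & ~ le W V"

lemma tr_sym: "V : D ==> W : D ==> tr V W ==> tr W V"
 using orth_sym by (auto simp: tr_def)

lemma lt_trans: "U : D ==> V : D ==> W : D ==> lt U V ==> lt V W ==> lt U W"
 unfolding lt_def using le_trans le_antisym by blast

lemma lt_not_orth: "V : D ==> W : D ==> lt V W ==> ~ orth V W & ~ orth W V"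
 using orth_not_le orth_sym lt_def by metis

lemma trichotomy:
 "V : D ==> W : D ==> V = W | lt V W | lt W V | orth V W | tr V W"
 by (auto simp: lt_def tr_def)

definition is_chain :: "'s set => bool" where
 "is_chain C \<longleftrightarrow> C <= D & (ALL V:C. ALL W:C. le V W | le W V)"

text \<open>The rank that governs all inductions over the nesting order: it grows strictly with the
  domain and is at most \<open>n\<close>.\<close>

definition lev :: "'s => nat" where
 "lev V = (GREATEST k. EX C. is_chain C & (ALL W:C. le W V) & card C = k)"

lemma chain_finite: "is_chain C ==> finite C & card C <= n"
 unfolding is_chain_def using chain_bound by auto

lemma lev_chain: "EX C. is_chain C & (ALL W:C. le W V) & card C = lev V"
 unfolding lev_def
proof (rule GreatestI_nat)
 show "EX C. is_chain C & (ALL W:C. le W V) & card C = 0"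
  by (rule exI[of _ "{}"]) (auto simp: is_chain_def)
 show "!!k. EX C. is_chain C & (ALL W:C. le W V) & card C = k ==> k <= n"
  using chain_finite by auto
qed

lemma lev_le: "lev V <= n"
 using lev_chain[of V] chain_finite by metis

lemma lev_ge: "is_chain C ==> (!!W. W : C ==> le W V) ==> card C <= lev V"
 unfolding lev_def by (rule Greatest_le_nat[where b = n]) (use chain_finite in auto)

lemma lev_pos: assumes "V : D" shows "lev V >= 1"
 using lev_ge[of "{V}" V] le_refl assms by (auto simp: is_chain_def)

lemma lev_strict: assumes "V : D" "W : D" "lt V W" shows "lev V < lev W"
proof -
 obtain C where C: "is_chain C" "ALL U:C. le U V" "card C = lev V" using lev_chain by blast
 have "W ~: C" using C(2) assms le_antisym by (auto simp: lt_def)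
 moreover have "is_chain (insert W C)" "ALL U:insert W C. le U W"
  using C assms le_trans le_refl unfolding is_chain_def lt_def by (metis insertE insert_subset subset_eq)+
 ultimately have "card (insert W C) <= lev W" using lev_ge[of "insert W C" W] by blast
 thus ?thesis using \<open>W ~: C\<close> C chain_finite[of C] by simp
qed

definition ofam :: "'s set => bool" where
 "ofam F \<longleftrightarrow> F <= D & (ALL V:F. ALL W:F. V ~= W --> orth V W)"

lemma ofam_subset: "ofam F ==> F' <= F ==> ofam F'"
 unfolding ofam_def by (meson subset_iff)

text \<open>If one member \<open>U\<close> is removed, the others lie in a container, a domain
  properly nested in \<open>T\<close> and so of smaller level. Each member of the family thus costs
  one level.\<close>

lemma ofam_below:
 "finite F ==> T : D ==> ofam F ==> (ALL V:F. le V T) ==> card F <= lev T"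
proof (induction F arbitrary: T rule: finite_induct)
 case (insert U F)
 show ?case
 proof (cases "F = {}")
  case True
  thus ?thesis using lev_pos[OF insert.prems(1)] by simp
 next
  case False
  then obtain V where V: "V : F" by auto
  have UV: "U : D" "V : D" "orth V U" "le U T" "le V T"
   using V insert.hyps insert.prems unfolding ofam_def by auto
  then obtain W where W: "W : D" "le W T" "W ~= T" "ALL V:D. le V T & orth V U --> le V W"
   using container[OF insert.prems(1) UV(1,4,2,5,3)] by blast
  have "ofam F" using insert.prems unfolding ofam_def by auto
  moreover have "ALL V:F. le V W"
  proof
   fix V assume V: "V : F"
   hence "V : D" "orth V U" "le V T" using insert.hyps insert.prems unfolding ofam_def by auto
   thus "le V W" using W(4) by blast
  qed
  ultimately have "card F <= lev W" using insert.IH[OF W(1)] by blast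
  moreover have "lev W < lev T" using lev_strict W insert.prems(1) by (auto simp: lt_def)
  ultimately show ?thesis using insert.hyps by auto
 qed
qed simp

lemma ofam_finite: assumes "ofam F" shows "finite F & card F <= n"
proof (cases "F = {}")
 case False
 hence "D ~= {}" using assms unfolding ofam_def by auto
 then obtain S where S: "S : D" "ALL V:D. le V S" using top_ex by blast
 have *: "card F' <= n" if "finite F'" "F' <= F" for F'
 proof -
  have "ofam F'" using ofam_subset that assms by blast
  moreover have "ALL V:F'. le V S" using that(2) assms S(2) unfolding ofam_def by (meson subsetD)
  ultimately    show ?thesis using ofam_below[OF that(1) S(1)] lev_le[of S] by linarith
 qed
 have "finite F"
 proof (rule ccontr)
  assume "infinite F"
  then obtain F' where "finite F'" "card F' = Suc n" "F' <= F"
   using infinite_arbitrarily_large by blast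
  thus False using *[of F'] by auto
 qed
 thus ?thesis using * by auto
qed simp

end

section \<open>Coarse distances in a hierarchically hyperbolic space\<close>

text \<open>
  \<open>P W x y\<close> and \<open>R V W x\<close> are the distances in the hyperbolic space of \<open>W\<close> from the projection of \<open>x\<close>
  to that of \<open>y\<close> and to \<open>\<rho>\<^sup>V\<^sub>W\<close>, and \<open>RR U V W\<close> is the distance from \<open>\<rho>\<^sup>U\<^sub>W\<close> to \<open>\<rho>\<^sup>V\<^sub>W\<close>. They are suprema
  over pairs of points, so the triangle inequality is exact but \<open>P W x x\<close> may be positive.
  All constants of the structure are bounded by \<open>\<kappa>\<close>.
\<close>

locale hhs_distances = domain_order D le orth n
 for D :: "'s set" and le :: "'s => 's => bool" and orth :: "'s => 's => bool" and n :: nat +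
 fixes X :: "'x set" and d :: "'x => 'x => real"
  and P :: "'s => 'x => 'x => real" and R :: "'s => 's => 'x => real"
  and RR :: "'s => 's => 's => real" and kp :: real
 assumes kappa: "kp >= 1"
  and X_ne: "X ~= {}"
  and P_sym: "W : D ==> x : X ==> y : X ==> P W x y = P W y x"
  and P_nonneg: "W : D ==> x : X ==> y : X ==> 0 <= P W x y"
  and P_refl: "W : D ==> x : X ==> P W x x <= kp"
  and P_tri: "W : D ==> x : X ==> y : X ==> z : X ==> P W x z <= P W x y + P W y z"
  and P_lipschitz: "W : D ==> x : X ==> y : X ==> P W x y <= kp * d x y + kp"
  and R_nonneg: "V : D ==> W : D ==> lt V W | tr V W ==> x : X ==> 0 <= R V W x"
  and R_le: "V : D ==> W : D ==> lt V W | tr V W ==> x : X ==> y : X ==> R V W x <= R V W y + P W y x"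
  and P_le_R: "V : D ==> W : D ==> lt V W | tr V W ==> x : X ==> y : X ==> P W x y <= R V W x + R V W y"
  and R_RR: "U : D ==> V : D ==> W : D ==> lt U W | tr U W ==> lt V W | tr V W ==> x : X ==>
   R U W x <= R V W x + RR U V W"
  and RR_le: "U : D ==> V : D ==> W : D ==> lt U W | tr U W ==> lt V W | tr V W ==> x : X ==>
   RR U V W <= R U W x + R V W x"
  and RR_sym: "U : D ==> V : D ==> W : D ==> lt U W | tr U W ==> lt V W | tr V W ==> RR U V W = RR V U W"
  and RR_nested: "U : D ==> V : D ==> W : D ==> le U V ==> lt V W | tr V W & ~ orth W U ==> RR U V W <= kp"
  and consistency: "V : D ==> W : D ==> tr V W ==> x : X ==> R V W x <= kp | R W V x <= kp"
  and large_links: "W : D ==> x : X ==> y : X ==>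
   EX F. finite F & F <= D & real (card F) <= kp * P W x y + kp &
   (ALL T:F. lt T W & R T W x <= kp * P W x y + kp) &
   (ALL V:D. lt V W --> (EX T:F. le V T) | P V x y <= kp)"
  and realization: "ofam F ==> (!!V. V : F ==> b V : X) ==>
   EX z:X. ALL V:F. P V z (b V) <= kp & (ALL W:D. lt V W | tr V W --> R V W z <= kp)"
  and uniqueness: "EX tht. ALL x:X. ALL y:X. (ALL V:D. P V x y <= c) --> d x y <= tht"
begin

lemma rel_nested:
 assumes "U : D" "V : D" "W : D" "le U V" "lt V W | tr V W & ~ orth W U"
 shows "lt U W | tr U W"
proof -
 have "U ~= W" using assms le_antisym by (auto simp: lt_def tr_def)
 moreover have "~ le W U" using assms le_trans le_antisym unfolding lt_def tr_def by metis
 moreover have "le U W | ~ orth U W"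
  using assms le_trans orth_sym unfolding lt_def tr_def by metis
 ultimately show ?thesis unfolding lt_def tr_def by auto
qed

lemma R_nested:
 assumes "U : D" "V : D" "W : D" "le U V" "lt V W | tr V W & ~ orth W U" "x : X"
 shows "R U W x <= R V W x + kp" "R V W x <= R U W x + kp"
 using R_RR[of U V W x] R_RR[of V U W x] RR_nested[OF assms(1-5)] RR_sym[of U V W]
  rel_nested[OF assms(1-5)] assms by auto

text \<open>A weak form of bounded geodesic image that follows from large links: a domain that
  separates \<open>x\<close> from \<open>y\<close> lies below one of the listed domains, whose rho
  set is close to \<open>x\<close>, and nested domains have close rho sets.\<close>

lemma weak_gi:
 assumes "V : D" "W : D" "lt V W" "x : X" "y : X" "P V x y > kp"
 shows "R V W x <= kp * P W x y + 2 * kp"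
proof -
 obtain F where F: "F <= D" "ALL T:F. lt T W & R T W x <= kp * P W x y + kp"
  "ALL V:D. lt V W --> (EX T:F. le V T) | P V x y <= kp"
  using large_links[OF assms(2,4,5)] by blast
 then obtain T where T: "T : F" "le V T" using assms by force
 hence "R V W x <= R T W x + kp" using R_nested(1)[of V T W x] F assms by auto
 thus ?thesis using F T by force
qed

text \<open>Partial realization of the pair \<open>U\<close>, \<open>V\<close> yields a point near
  both rho sets in \<open>W\<close>, so these are near each other.\<close>

lemma orth_rho_close:
 assumes "U : D" "V : D" "W : D" "orth U V" "lt U W | tr U W" "lt V W | tr V W" "x : X"
 shows "R U W x <= R V W x + 2 * kp"
proof -
 have "ofam {U, V}" using assms orth_sym by (auto simp: ofam_def)
 then obtain z where z: "z : X" "R U W z <= kp" "R V W z <= kp"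
  using realization[of "{U, V}" "%_. x"] assms by auto
 have "P W z x <= R V W z + R V W x" using P_le_R[of V W z x] assms z by auto
 moreover have "R U W x <= R U W z + P W z x" using R_le[of U W x z] assms z by auto
 ultimately show ?thesis using z by auto
qed

text \<open>Apart from \<open>T\<close> itself, large links leaves only domains below finitely many
  proper subdomains of \<open>T\<close>; the level bounds the depth of this recursion.\<close>

lemma relevant_finite:
 assumes "x : X" "y : X"
 shows "finite {V:D. P V x y > kp}"
proof (cases "D = {}")
 case False
 have *: "T : D ==> lev T = k ==> finite {V:D. le V T & P V x y > kp}" for k T
 proof (induction k arbitrary: T rule: less_induct)
  case (less k)
  obtain F where F: "finite F" "F <= D" "ALL U:F. lt U T"
   "ALL V:D. lt V T --> (EX U:F. le V U) | P V x y <= kp"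
   using large_links[OF less.prems(1) assms] by blast
  have "finite {V:D. le V U & P V x y > kp}" if "U : F" for U
   using less.IH[of "lev U" U] lev_strict[of U T] F that less.prems by auto
  hence "finite ({T} \<union> (\<Union>U\<in>F. {V:D. le V U & P V x y > kp}))" using F by blast
  moreover have "{V:D. le V T & P V x y > kp} <= {T} \<union> (\<Union>U\<in>F. {V:D. le V U & P V x y > kp})"
   using F(4) by (fastforce simp: lt_def)
  ultimately show ?case by (rule rev_finite_subset)
 qed
 obtain S where "S : D" "ALL V:D. le V S" using top_ex False by blast
 hence "{V:D. P V x y > kp} = {V:D. le V S & P V x y > kp}" by auto
 thus ?thesis using *[OF \<open>S : D\<close> refl] by simp
qed simp

text \<open>
  Descending through large links from \<open>T\<close>, each domain on the way has distance at most \<open>B\<close>, so the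
  number of branches at each step is bounded in terms of \<open>B\<close>.
\<close>
lemma relevant_count:
 "EX f::nat. ALL T:D. ALL x:X. ALL y:X. ALL \<V><=D. lev T <= k -->
   (ALL V:\<V>. lt V T & P V x y > kp & (ALL U:D. lt V U & le U T --> P U x y <= B)) -->
   finite \<V> & card \<V> <= f"
proof (induction k)
 case 0
 show ?case using lev_pos by force
next
 case (Suc k)
 then obtain f :: nat where f: "ALL T:D. ALL x:X. ALL y:X. ALL \<V><=D. lev T <= k -->
   (ALL V:\<V>. lt V T & P V x y > kp & (ALL U:D. lt V U & le U T --> P U x y <= B)) -->
   finite \<V> & card \<V> <= f" by blast
 define m where "m = nat \<lceil>kp * B + kp\<rceil>"
 show ?case
 proof (intro exI[of _ "m * (f + 1)"] ballI allI impI)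
  fix T x y \<V> assume T: "T : D" "x : X" "y : X" "\<V> <= D" "lev T <= Suc k"
   and V: "ALL V:\<V>. lt V T & P V x y > kp & (ALL U:D. lt V U & le U T --> P U x y <= B)"
  show "finite \<V> & card \<V> <= m * (f + 1)"
  proof (cases "\<V> = {}")
   case False
   hence PT: "P T x y <= B" using V T le_refl by (meson all_not_in_conv)
   obtain F where F: "finite F" "F <= D" "real (card F) <= kp * P T x y + kp" "ALL U:F. lt U T"
   "ALL V:D. lt V T --> (EX U:F. le V U) | P V x y <= kp"
   using large_links[OF T(1-3)] by blast
   have "real (card F) <= kp * B + kp" using F(3) PT kappa by (smt (verit) mult_left_mono)
   hence cF: "card F <= m" unfolding m_def by linarith
   define A where "A U = {V:\<V>. lt V U}" for U
   have A: "finite (A U) & card (A U) <= f" if U: "U : F" for U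
   proof -
   have U': "U : D" "lt U T" using F U by auto
   have "lev U <= k" using lev_strict[OF U'(1) T(1) U'(2)] T by auto
   moreover have "ALL V:A U. lt V U & P V x y > kp & (ALL W:D. lt V W & le W U --> P W x y <= B)"
   proof (intro ballI conjI impI)
   fix V assume VA: "V : A U"
   show "lt V U" "P V x y > kp" using VA V unfolding A_def by auto
   fix W assume W: "W : D" "lt V W & le W U"
   hence "le W T" using le_trans[of W U T] U' T unfolding lt_def by auto
   thus "P W x y <= B" using V VA W unfolding A_def by auto
   qed
   moreover have "A U <= D" using T unfolding A_def by auto
   ultimately show ?thesis using f[rule_format, OF U'(1) T(2,3), of "A U"] by blast
   qed
   have sub: "\<V> <= (\<Union>U\<in>F. insert U (A U))"
   proof
   fix V' assume V': "V' : \<V>"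
   then obtain U where "U : F" "le V' U" using F(5) V T by (metis not_le subsetD)
   thus "V' : (\<Union>U\<in>F. insert U (A U))" using V' unfolding A_def lt_def by auto
   qed
   have fin: "finite (\<Union>U\<in>F. insert U (A U))" using F A by auto
   have "card (\<Union>U\<in>F. insert U (A U)) <= (\<Sum>U\<in>F. card (insert U (A U)))"
   using card_UN_le F by blast
   also have "... <= (\<Sum>U\<in>F. f + 1)"
   by (rule sum_mono) (use A in "auto simp: card_insert_if le_SucI")
   also have "... = card F * (f + 1)" by simp
   also have "... <= m * (f + 1)" using cF by (rule mult_right_mono) simp
   finally show ?thesis using card_mono[OF fin sub] finite_subset[OF sub fin] by linarith
  qed simp
 qed
qed

end

section \<open>Realization of consistent tuples\<close>

context hhs_distances
begin

text \<open>The coordinates are not points of the hyperbolic spaces but are represented by points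
  \<open>bt V\<close> of \<open>X\<close>, so that all distances involved are instances of
  \<open>P\<close> and \<open>R\<close>.\<close>

definition ctuple :: "real => ('s => 'x) => bool" where
 "ctuple c bt \<longleftrightarrow> (ALL V:D. bt V : X) &
   (ALL V:D. ALL W:D. tr V W --> R V W (bt W) <= c | R W V (bt V) <= c) &
   (ALL V:D. ALL W:D. lt V W --> R V W (bt W) <= c | P V (bt V) (bt W) <= c)"

text \<open>
  Among the coordinates where \<open>z\<close> is far from the tuple, those that are maximal for nesting and pairwise
  transverse are ordered along the way from \<open>z\<close> to the tuple; the last one is as required.
\<close>
lemma last_bad_domain:
 assumes cons: "ctuple c bt" and z: "z : X" and c: "c >= kp" and th: "tht >= c + 4 * kp"
  and finB: "finite {V:D. P V z (bt V) > tht}" and neB: "{V:D. P V z (bt V) > tht} ~= {}"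
 shows "EX W:D. P W z (bt W) > tht &
  (ALL V:D. lt W V | tr W V --> R W V (bt V) <= kp * tht + 2 * kp + tht)"
proof -
 define B where "B = {V:D. P V z (bt V) > tht}"
 define M where "M = {V:B. ALL U:B. ~ lt V U}"
 have BX: "!!V. V : D ==> bt V : X"
  and con_tr: "!!V W. V : D ==> W : D ==> tr V W ==> R V W (bt W) <= c | R W V (bt V) <= c"
  and con_ne: "!!V W. V : D ==> W : D ==> lt V W ==> R V W (bt W) <= c | P V (bt V) (bt W) <= c"
  using cons unfolding ctuple_def by auto
 have above: "EX U:M. le V U" if V: "V : B" for V
 proof -
  have "finite {U:B. le V U}" by (rule finite_subset[OF _ finB]) (auto simp: B_def)
  moreover have "{U:B. le V U} ~= {}" using V le_refl unfolding B_def by auto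
  moreover have "asymp_on {U:B. le V U} lt" "transp_on {U:B. le V U} lt"
   unfolding B_def by (rule asymp_onI, use le_antisym lt_def in force)
   (rule transp_onI, use lt_trans in blast)
  ultimately obtain m where m: "m : {U:B. le V U}" "!!x. x : {U:B. le V U} ==> x ~= m ==> ~ lt m x"
   using Finite_Set.bex_max_element[of "{U:B. le V U}" lt] by blast
  have "m : M" unfolding M_def
  proof (intro CollectI conjI ballI notI)
   show "m : B" using m by auto
   fix U assume U: "U : B" "lt m U"
   hence "le V U" using m V le_trans[of V m U] unfolding B_def lt_def by auto
   thus False using m(2)[of U] U lt_def by auto
  qed
  thus ?thesis using m by auto
 qed
 have MB: "M <= B" and BD: "B <= D" unfolding M_def B_def by auto
 have bad: "!!V. V : B ==> P V z (bt V) > tht" unfolding B_def by auto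
 have MM: "V = W | orth V W | tr V W" if "V : M" "W : M" for V W
  using trichotomy[of V W] that MB BD unfolding M_def by blast
 \<comment> \<open>On the way from \<open>z\<close> to the tuple, \<open>V\<close> is crossed first
   and \<open>W\<close> later: the final coordinate in \<open>V\<close> is near the rho set of
   \<open>W\<close>, while \<open>z\<close> is still near the rho set of \<open>V\<close> in
   \<open>W\<close> (\<open>nearz\<close>).\<close>
 define before where "before V W \<longleftrightarrow> tr V W & R W V (bt V) <= c" for V W
 have notnear: "R W V z > kp" if "V : B" "W : D" "lt W V | tr W V" "R W V (bt V) <= c" for V W
  using P_le_R[of W V z "bt V"] bad[of V] that BD BX z th kappa by auto
 have nearz: "R V W z <= kp" if "V : B" "W : D" "before V W" for V W
  using consistency[of V W z] notnear[of V W] that BD z tr_sym[of V W] unfolding before_def by auto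
 have notboth: "~ R V W (bt W) <= c" if "V : B" "W : B" "before V W" for V W
  using nearz[of V W] notnear[of W V] that BD unfolding before_def by force
 have asy: "~ before W V" if "V : B" "W : B" "before V W" for V W
  using notboth[OF that] unfolding before_def by auto
 have trans: "before U W" if U: "U : M" "V : M" "W : M" "before U V" "before V W" for U V W
 proof -
  have UB: "U : B" "V : B" "W : B" and UD: "U : D" "V : D" "W : D" using U MB BD by auto
  have UV: "tr U V" "R U V z <= kp" and VW: "tr V W" "R W V (bt V) <= c" "R V W z <= kp"
   using U(4,5) nearz[OF UB(1) UD(2) U(4)] nearz[OF UB(2) UD(3) U(5)] unfolding before_def by auto
  have WV: "tr W V" by (rule tr_sym[OF UD(2,3) VW(1)])
  have "U ~= W"
  proof
   assume "U = W"
   hence "P V z (bt V) <= kp + c"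
   using P_le_R[of U V z "bt V"] UV VW UD BX z by auto
   thus False using bad[OF UB(2)] th kappa by auto
  qed
  moreover have "~ orth U W"
  proof
   assume "orth U W"
   hence "orth W U" by (rule orth_sym[OF UD(1,3)])
   hence "R W V z <= 3 * kp"
   using orth_rho_close[of W U V z] UD UV WV z by auto
   hence "P V z (bt V) <= 3 * kp + c"
   using P_le_R[of W V z "bt V"] WV VW UD BX z by auto
   thus False using bad[OF UB(2)] th kappa by auto
  qed
  ultimately have UW: "tr U W" using MM U by blast
  have WU: "tr W U" by (rule tr_sym[OF UD(1,3) UW])
  show ?thesis
  proof (rule ccontr)
   assume "~ before U W"
   hence bW: "R U W (bt W) <= c" using con_tr[of U W] UD UW unfolding before_def by auto
   \<comment> \<open>Realizing \<open>{U}\<close> gives a point \<open>q\<close> at the rho sets of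
     \<open>U\<close> in \<open>V\<close> and in \<open>W\<close>. Consistency of \<open>q\<close>
     for the pair \<open>V\<close>, \<open>W\<close> forces \<open>z\<close> to be close to the
     tuple in \<open>V\<close> or in \<open>W\<close>, contrary to badness.\<close>
   have "ofam {U}" using UD by (auto simp: ofam_def)
   then obtain q where q0: "q : X" "ALL V:{U}. P V q z <= kp & (ALL W:D. lt V W | tr V W --> R V W q <= kp)"
   using realization[of "{U}" "%_. z"] z by blast
   have q: "q : X" "R U V q <= kp" "R U W q <= kp"
   using q0 UD UV(1) UW by blast+
   consider "R W V q <= kp" | "R V W q <= kp" using consistency[of V W q] q VW UD by auto
   thus False
   proof cases
   case 1
   have "P V z q <= R U V z + R U V q" "P V q (bt V) <= R W V q + R W V (bt V)"
   using P_le_R[of U V z q] P_le_R[of W V q "bt V"] q UD UV WV z BX by auto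
   hence "P V z (bt V) <= 3 * kp + c"
   using P_tri[of V z q "bt V"] 1 q UV VW UD z BX by auto
   thus False using bad[OF UB(2)] th kappa by auto
   next
   case 2
   have "P W z q <= R V W z + R V W q" "P W q (bt W) <= R U W q + R U W (bt W)"
   using P_le_R[of V W z q] P_le_R[of U W q "bt W"] q UD UW VW z BX by auto
   hence "P W z (bt W) <= 3 * kp + c"
   using P_tri[of W z q "bt W"] 2 q VW UD z BX bW by auto
   thus False using bad[OF UB(3)] th kappa by auto
   qed
  qed
 qed
 have "finite M" using MB finB finite_subset unfolding B_def by blast
 moreover have "M ~= {}" using above neB unfolding B_def by blast
 moreover have "asymp_on M before" by (rule asymp_onI) (use asy MB in blast)
 moreover have "transp_on M before" by (rule transp_onI) (use trans in blast)
 ultimately obtain W where W: "W : M" "!!V. V : M ==> V ~= W ==> ~ before W V"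
  using Finite_Set.bex_max_element[of M before] by blast
 have WB: "W : B" and WD: "W : D" using W MB BD by auto
 have th0: "tht >= 0" "c <= tht" and kth: "kp * tht >= 0" using th c kappa by auto
 have "R W V (bt V) <= kp * tht + 2 * kp + tht" if V: "V : D" "lt W V | tr W V" for V
 proof (cases "R W V (bt V) <= c")
  case True
  thus ?thesis using th0 kth kappa by linarith
 next
  case far: False
  from V(2) show ?thesis
  proof
   \<comment> \<open>By maximality of \<open>W\<close> the coordinate in \<open>V\<close> is not
     bad. So \<open>weak_gi\<close> puts \<open>z\<close> near the rho set of \<open>W\<close> in
     \<open>V\<close>, and moving on to \<open>bt V\<close> costs another \<open>tht\<close>; this
     is the origin of the bound.\<close>
   assume WV: "lt W V"
   hence "V ~: B" using W(1) unfolding M_def by auto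
   hence PV: "P V z (bt V) <= tht" using V unfolding B_def by auto
   have PW: "P W (bt W) (bt V) <= c" using con_ne[OF WD V(1) WV] far by auto
   have "P W z (bt W) <= P W z (bt V) + P W (bt V) (bt W)" using P_tri[of W] WD z BX V by auto
   hence "P W z (bt V) > kp" using PW P_sym[of W "bt V" "bt W"] WD BX V bad[OF WB] th kappa by auto
   hence "R W V z <= kp * P V z (bt V) + 2 * kp"
   using weak_gi[OF WD V(1) WV z] BX V by auto
   also have "... <= kp * tht + 2 * kp" using PV kappa by auto
   finally show ?thesis using R_le[of W V "bt V" z] WD V WV z BX PV by auto
  next
   assume WV: "tr W V"
   have VW: "tr V W" by (rule tr_sym[OF WD V(1) WV])
   have bW: "R V W (bt W) <= c" using con_tr[of W V] far WV WD V by auto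
   show ?thesis
   proof (cases "V : B")
   case False
   hence PV: "P V z (bt V) <= tht" using V unfolding B_def by auto
   have "R V W z > kp" using notnear[OF WB V(1) _ bW] VW by auto
   hence "R W V z <= kp" using consistency[OF V(1) WD VW z] by auto
   thus ?thesis using R_le[of W V "bt V" z] WD V WV z BX PV kth kappa by auto
   next
   case True
   then obtain V' where V': "V' : M" "le V V'" using above by blast
   have V'D: "V' : D" "V' : B" using V' MB BD by auto
   have "V' ~= W" using WV V' unfolding tr_def by auto
   moreover have "~ orth V' W" using orth_le[of W V V'] V' V'D V WD VW unfolding tr_def by auto
   ultimately have VW': "tr V' W" using MM V'(1) W(1) by blast
   have WV': "tr W V'" by (rule tr_sym[OF V'D(1) WD VW'])
   have "~ before W V'" using W(2)[OF V'(1)] \<open>V' ~= W\<close> by auto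
   hence "before V' W" using con_tr[of V' W] V'D WD VW' WV' unfolding before_def by auto
   hence "R V' W z <= kp" using nearz V'D WD by auto
   moreover have "R V W z <= R V' W z + kp"
   using R_nested(1)[of V V' W z] V V'D WD V'(2) VW' z WV unfolding tr_def by auto
   ultimately have "P W z (bt W) <= 2 * kp + c"
   using P_le_R[of V W z "bt W"] bW VW V WD z BX by auto
   thus ?thesis using bad[OF WB] th kappa by auto
   qed
  qed
 qed
 thus ?thesis using W WD bad[OF WB] by blast
qed

text \<open>A point that realizes the coordinates of such an \<open>F\<close> is right, up to a
  bounded error, in every domain in which a member of \<open>F\<close> is properly nested or to
  which it is transverse.\<close>

definition realizable :: "real => ('s => 'x) => 's set => bool" where
 "realizable c bt F \<longleftrightarrow> ofam F &
   (ALL V:F. ALL W:D. lt V W | tr V W --> R V W (bt W) <= c)"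

text \<open>Members of low level count more, so replacing a domain by one properly nested in it
  increases the weight.\<close>

definition weight :: "'s set => nat" where
 "weight F = (\<Sum>V\<in>F. Suc n - lev V)"

lemma weight_le: assumes "ofam F" shows "weight F <= n * n"
proof -
 have "weight F <= (\<Sum>V\<in>F. n)"
  unfolding weight_def by (rule sum_mono) (use assms lev_pos in "fastforce simp: ofam_def")
 also have "... = card F * n" by simp
 finally show ?thesis using ofam_finite[OF assms] by (meson order_trans mult_le_mono1)
qed

text \<open>At most one member of \<open>F\<close> contains \<open>W\<close>: a domain nested in one
  of two orthogonal domains is orthogonal to the other. So \<open>W\<close> is either added to
  \<open>F\<close> or replaces a single member of higher level.\<close>

lemma weight_refine:
 assumes F: "ofam F" and W: "W : D" "W ~: F"
  and pos: "!!V. V : F ==> lt W V | orth V W"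
 shows "ofam (insert W {V:F. orth V W})" "weight F < weight (insert W {V:F. orth V W})"
proof -
 show "ofam (insert W {V:F. orth V W})"
  using F W orth_sym unfolding ofam_def by auto
 have fin: "finite F" using ofam_finite F by auto
 have w: "weight (insert W {V:F. orth V W}) = (Suc n - lev W) + weight {V:F. orth V W}"
  unfolding weight_def using fin W by simp
 have levW: "Suc n - lev W >= 1" using lev_le[of W] by linarith
 have one: "V = V'" if "V : F" "V' : F" "lt W V" "lt W V'" for V V'
 proof (rule ccontr)
  assume ne: "V ~= V'"
  have D': "V : D" "V' : D" "orth V V'" using F that ne unfolding ofam_def by auto
  hence "orth W V'" using orth_le[of V' W V] W that unfolding lt_def by auto
  thus False using lt_not_orth[of W V'] that D' W by auto
 qed
 show "weight F < weight (insert W {V:F. orth V W})"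
 proof (cases "EX V:F. lt W V")
  case False
  hence "{V:F. orth V W} = F" using pos by auto
  thus ?thesis using w levW by auto
 next
  case True
  then obtain V where V: "V : F" "lt W V" by auto
  have VD: "V : D" using V F unfolding ofam_def by auto
  have "{V:F. orth V W} = F - {V}"
   using pos one V lt_not_orth[of W V] VD W by auto
  hence "weight F = (Suc n - lev V) + weight {V:F. orth V W}"
   unfolding weight_def using fin V by (simp add: sum.remove)
  moreover have "lev W < lev V" using lev_strict W VD V by auto
  ultimately show ?thesis using w lev_le[of V] by linarith
 qed
qed

text \<open>Starting from the empty family, a point realizing the current family is taken; while
  some coordinate is bad, the family is refined by the last bad domain. The weight is at most
  \<open>n * n\<close>, so the constants deteriorate a bounded number of times. That
  \<open>bt\<close> has finitely many values keeps the set of bad domains finite.\<close>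

theorem tuple_realization:
 "EX tht. ALL bt. ctuple c bt & finite (bt ` D) --> (EX z:X. ALL V:D. P V z (bt V) <= tht)"
proof -
 have *: "EX tht. ALL bt F. ctuple c0 bt & finite (bt ` D) & realizable c' bt F & n * n - weight F <= k
   --> (EX z:X. ALL V:D. P V z (bt V) <= tht)" if "c0 >= kp" "c' >= c0" for c0 c' k
  using that
 proof (induction k arbitrary: c' rule: less_induct)
  case (less k)
  note c0k = less.prems(1)
  \<comment> \<open>Large enough for \<open>last_bad_domain\<close> and larger than
    \<open>kp + c'\<close>, so that a bad domain is not a member of \<open>F\<close>, nor does it
    properly contain one or lie transverse to one.\<close>
  define t where "t = c' + 4 * kp"
  define c'' where "c'' = max c' (kp * t + 2 * kp + t)"
  have t: "t >= c0 + 4 * kp" "t > 0" using less.prems kappa unfolding t_def by auto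
  have "EX tht'. k > 0 --> (ALL bt F. ctuple c0 bt & finite (bt ` D) & realizable c'' bt F & n * n - weight F <= k - 1
   --> (EX z:X. ALL V:D. P V z (bt V) <= tht'))"
   using less.IH[of "k - 1" c''] less.prems unfolding c''_def by (cases "k > 0") auto
  then obtain tht' where th': "k > 0 ==> ALL bt F. ctuple c0 bt & finite (bt ` D) & realizable c'' bt F & n * n - weight F <= k - 1
   --> (EX z:X. ALL V:D. P V z (bt V) <= tht')" by blast
  show ?case
  proof (intro exI[of _ "max t tht'"] allI impI, elim conjE)
   fix bt F assume cons: "ctuple c0 bt" and fin: "finite (bt ` D)" and re: "realizable c' bt F"
   and wk: "n * n - weight F <= k"
   have BX: "!!V. V : D ==> bt V : X" using cons unfolding ctuple_def by auto
   have F: "ofam F" "!!V. V : F ==> V : D" using re unfolding realizable_def ofam_def by auto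
   obtain z where z: "z : X" "ALL V:F. P V z (bt V) <= kp & (ALL W:D. lt V W | tr V W --> R V W z <= kp)"
   using realization[OF F(1), of bt] F BX by blast
   define B where "B = {V:D. P V z (bt V) > t}"
   show "EX z:X. ALL V:D. P V z (bt V) <= max t tht'"
   proof (cases "B = {}")
   case True
   thus ?thesis using z unfolding B_def by (intro bexI[of _ z]) force+
   next
   case False
   have "finite (\<Union>y\<in>bt ` D. {V:D. P V z y > kp})" by (rule finite_UN_I[OF fin]) (use relevant_finite z BX in blast)
   moreover have "B <= (\<Union>y\<in>bt ` D. {V:D. P V z y > kp})"
   using t kappa c0k unfolding B_def by auto
   ultimately have "finite B" by (rule rev_finite_subset)
   then obtain W where W: "W : D" "P W z (bt W) > t"
   "ALL V:D. lt W V | tr W V --> R W V (bt V) <= kp * t + 2 * kp + t"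
   using last_bad_domain[OF cons z(1) c0k t(1)] False unfolding B_def by blast
   have good: "P W z (bt W) <= t" if "V : F" "V = W | lt V W | tr V W" for V
   proof (cases "V = W")
   case True
   thus ?thesis using z that kappa less.prems c0k unfolding t_def by force
   next
   case False
   have "R V W (bt W) <= c'" using re that False W unfolding realizable_def by auto
   thus ?thesis using P_le_R[of V W z "bt W"] z that False W BX F kappa
   unfolding t_def by force
   qed
   have pos: "lt W V | orth V W" if "V : F" for V
   using good[OF that] W trichotomy[of V W] F that by force
   have WF: "W ~: F" using good W by force
   note wr = weight_refine[OF F(1) W(1) WF pos]
   have re': "realizable c'' bt (insert W {V:F. orth V W})"
   using wr(1) re W unfolding realizable_def c''_def by fastforce
   have "weight F < n * n" using weight_le[OF wr(1)] wr(2) by linarith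
   hence k: "k > 0" "n * n - weight (insert W {V:F. orth V W}) <= k - 1"
   using wk wr(2) weight_le[OF wr(1)] by linarith+
   then obtain z' where "z' : X" "ALL V:D. P V z' (bt V) <= tht'"
   using th' cons fin re' by blast
   thus ?thesis by (intro bexI[of _ z']) force+
   qed
  qed
 qed
 obtain tht where th: "ALL bt F. ctuple (max c kp) bt & finite (bt ` D) & realizable (max c kp) bt F & n * n - weight F <= n * n
   --> (EX z:X. ALL V:D. P V z (bt V) <= tht)" using *[of "max c kp" "max c kp" "n * n"] by auto
 show ?thesis
 proof (intro exI[of _ tht] allI impI)
  fix bt assume "ctuple c bt & finite (bt ` D)"
  hence "ctuple (max c kp) bt" "finite (bt ` D)"
   unfolding ctuple_def by fastforce+
  thus "EX z:X. ALL V:D. P V z (bt V) <= tht"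
   using th[rule_format, of bt "{}"] by (auto simp: realizable_def ofam_def)
 qed
qed

end

section \<open>Group actions: isometries that are not loxodromic\<close>

text \<open>Hyperbolicity enters through two consequences for points of the group: a four-point
  inequality and the existence of coarse geodesics, the latter from quasiconvexity of the
  projections.\<close>

locale hhg_distances = hhs_distances D le orth n "carrier G" d P R RR kp + group G
 for D :: "'s set" and le orth n and G :: "('g, 'm) monoid_scheme" (structure) and d P R RR kp +
 fixes act :: "'g => 's => 's"
 assumes four_point: "W : D ==> x : CG ==> y : CG ==> z : CG ==> w : CG ==>
   P W x y + P W z w <= max (P W x z + P W y w) (P W x w + P W y z) + kp"
  and coarse_geodesic: "W : D ==> x : CG ==> y : CG ==>
   EX (c :: nat => 'g) l. (ALL i<=l. c i : CG) & P W (c 0) x <= kp & P W (c l) y <= kp &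
   (ALL i<=l. ALL j<=l. abs(P W (c i) (c j) - abs(real i - real j)) <= kp)"
  and act_closed: "g : CG ==> V : D ==> act g V : D"
  and act_mult: "g : CG ==> h : CG ==> V : D ==> act (g ** h) V = act g (act h V)"
  and act_one: "V : D ==> act \<one> V = V"
  and act_le: "g : CG ==> V : D ==> W : D ==> le (act g V) (act g W) \<longleftrightarrow> le V W"
  and act_orth: "g : CG ==> V : D ==> W : D ==> orth (act g V) (act g W) \<longleftrightarrow> orth V W"
  and P_act: "g : CG ==> W : D ==> x : CG ==> y : CG ==>
   P (act g W) (g ** x) (g ** y) = P W x y"
  and R_act: "g : CG ==> V : D ==> W : D ==> x : CG ==> lt V W | tr V W ==>
   R (act g V) (act g W) (g ** x) = R V W x"
  and d_act: "g : CG ==> x : CG ==> y : CG ==> d (g ** x) (g ** y) = d x y"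
  and d_nonneg: "0 <= d x y"
  and finite_balls: "finite {g : CG. d \<one> g <= r}"
begin

lemma act_inj: "g : CG ==> V : D ==> W : D ==> act g V = act g W \<longleftrightarrow> V = W"
 by (metis act_mult act_one inv_closed l_inv)

lemma act_lt: "g : CG ==> V : D ==> W : D ==> lt (act g V) (act g W) \<longleftrightarrow> lt V W"
 by (simp add: lt_def act_le act_inj)

lemma act_tr: "g : CG ==> V : D ==> W : D ==> tr (act g V) (act g W) \<longleftrightarrow> tr V W"
 by (simp add: tr_def act_le act_orth)

lemma act_inv_act: "g : CG ==> V : D ==> act (inv g) (act g V) = V"
 by (metis act_mult act_one inv_closed l_inv)

lemma act_act_inv: "g : CG ==> V : D ==> act g (act (inv g) V) = V"
 by (metis act_mult act_one inv_closed r_inv)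

lemma act_pow: assumes "g : CG" "V : D" "act g V = V" shows "act (g [^] (k::nat)) V = V"
proof (induction k)
 case (Suc k)
 thus ?case using assms act_mult[of "g [^] k" g V] by simp
qed (use assms act_one in simp)

lemma act_fix_inv: "g : CG ==> V : D ==> act g V = V ==> act (inv g) V = V"
 by (metis act_inv_act)

lemma P_act_inv: "g : CG ==> W : D ==> x : CG ==> y : CG ==>
  P W (g ** x) (g ** y) = P (act (inv g) W) x y"
 using P_act[of g "act (inv g) W" x y] act_act_inv[of g W] act_closed[of "inv g" W] by simp

lemma P_fix: "g : CG ==> W : D ==> act g W = W ==> x : CG ==> y : CG ==>
  P W (g ** x) (g ** y) = P W x y"
 using P_act[of g W x y] by simp

lemma pow_mult_left: "a : CG ==> x : CG ==> a [^] (i::nat) ** (a [^] (j::nat) ** x) = a [^] (i + j) ** x"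
 by (simp add: m_assoc[symmetric] nat_pow_mult)

text \<open>If \<open>g\<close> moves \<open>x\<close> to \<open>g\<^sup>2x\<close> further than to \<open>g x\<close> then the four-point inequality forces linear growth.\<close>
lemma linear_growth:
 assumes W: "W : D" "g : CG" "act g W = W" "x : CG"
  and growth: "P W x (g [^] (2::nat) ** x) >= P W x (g ** x) + kp + \<eta>" and eta: "\<eta> > 0"
 shows "P W x (g [^] (Suc k) ** x) >= \<eta> * k"
proof -
 define u where "u k = P W x (g [^] (k::nat) ** x)" for k
 have g: "g [^] (k::nat) ** x : CG" for k using W by auto
 have shift: "P W (g [^] (i::nat) ** x) (g [^] (i + k) ** x) = u k" for i k
  using P_fix[OF _ W(1) act_pow[OF W(2,1,3)] W(4) g, of i k] W
  unfolding u_def by (simp add: pow_mult_left)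
 have step: "u (Suc (Suc k)) >= u (Suc k) + \<eta>" for k
 proof (induction k)
  case 0
  thus ?case using growth kappa W unfolding u_def by (simp add: numeral_2_eq_2)
 next
  case (Suc k)
  let ?x = "%i::nat. g [^] i ** x"
  have "P W (?x 0) (?x 2) + P W (?x 1) (?x (3 + k))
   <= max (P W (?x 0) (?x 1) + P W (?x 2) (?x (3 + k))) (P W (?x 0) (?x (3 + k)) + P W (?x 2) (?x 1)) + kp"
   using four_point[OF W(1), of "?x 0" "?x 2" "?x 1" "?x (3 + k)"] g by blast
  moreover have "P W (?x 0) (?x 2) = u 2" "P W (?x 1) (?x (3 + k)) = u (Suc (Suc k))" "P W (?x 0) (?x 1) = u 1"
   "P W (?x 2) (?x (3 + k)) = u (Suc k)" "P W (?x 0) (?x (3 + k)) = u (Suc (Suc (Suc k)))" "P W (?x 2) (?x 1) = u 1"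
   using shift[of 0 2] shift[of 1 "Suc (Suc k)"] shift[of 0 1] shift[of 2 "Suc k"] shift[of 0 "3 + k"] shift[of 1 1]
   P_sym[OF W(1) g g, of 1 2]
   by (simp_all add: numeral_eq_Suc)
  moreover have "u 2 >= u 1 + kp + \<eta>" using growth W unfolding u_def by simp
  ultimately have "u (Suc (Suc k)) + \<eta> <= max (u (Suc k)) (u (Suc (Suc (Suc k))))" by (auto simp: max_def split: if_splits)
  thus ?case using Suc eta by (auto simp: max_def split: if_splits)
 qed
 have "u (Suc k) >= \<eta> * k"
 proof (induction k)
  case 0
  show ?case using P_nonneg[OF W(1,4) g, of "Suc 0"] unfolding u_def by (simp del: nat_pow_Suc)
 next
  case (Suc k)
  thus ?case using step[of k] by (simp add: algebra_simps)
 qed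
 thus ?thesis unfolding u_def .
qed

text \<open>If \<open>a\<close> fixes \<open>W\<close> and the inequality fails for some
  \<open>i\<close>, then \<open>linear_growth\<close> applies to \<open>a [^] i\<close>. In this
  form the absence of loxodromic powers can be used at every point \<open>x\<close>.\<close>

definition non_loxodromic :: "'s => 'g => bool" where
 "non_loxodromic W a \<longleftrightarrow> (ALL i::nat>=1. ALL x:CG.
   P W x (a [^] (2 * i) ** x) <= P W x (a [^] i ** x) + kp)"

text \<open>
  An isometry that is not loxodromic moves points far from the ends of a long geodesic joining two points
  of an orbit by a uniformly bounded amount, as it cannot shift the geodesic along itself.
\<close>
lemma displacement_deep:
 fixes i m :: nat
 assumes U: "U : D" "a : CG" "act a U = U" and nl: "non_loxodromic U a" and i: "i >= 1"
  and xs: "o' : CG" "p : CG"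
  and D0: "P U o' (a [^] i ** o') <= D0" "P U o' (a [^] (2 * i) ** o') <= D0"
  and y: "y = a [^] m ** o'"
  and deep: "P U o' p >= 4 * D0 + 40 * kp" "P U y p >= 4 * D0 + 40 * kp"
  and geo: "P U o' p + P U p y <= P U o' y + 7 * kp"
 shows "P U p (a [^] i ** p) <= 22 * kp"
proof -
 have yc: "y : CG" using y xs U by auto
 have fixU: "act (a [^] (j::nat)) U = U" for j using act_pow U by auto
 have mv: "P U (a [^] (j::nat) ** s) (a [^] j ** t) = P U s t" if "s : CG" "t : CG" for j s t
  using P_fix[OF _ U(1) fixU] that U by auto
 have cl: "a [^] (j::nat) ** s : CG" if "s : CG" for j s using that U by auto
 note sym = P_sym[OF U(1)]
 have D0pos: "D0 >= 0" using P_nonneg[OF U(1) xs(1) cl[OF xs(1)], of i] D0 by linarith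
 \<comment> \<open>Both \<open>o'\<close> and \<open>y\<close> are moved at most \<open>D0\<close>,
   because \<open>y\<close> is a power of \<open>a\<close> applied to \<open>o'\<close>. So
   translates of the deep point \<open>p\<close> stay close to the geodesic from \<open>o'\<close>
   to \<open>y\<close>.\<close>
 have near: "P U o' (a [^] j ** p) + P U (a [^] j ** p) y <= P U o' y + 9 * kp"
  if j: "P U o' (a [^] j ** o') <= D0" for j :: nat
 proof -
  define q go gy where "q = a [^] j ** p" and "go = a [^] j ** o'" and "gy = a [^] j ** y"
  have c: "q : CG" "go : CG" "gy : CG" unfolding q_def go_def gy_def using cl xs yc by auto
  have e: "P U go q = P U o' p" "P U q gy = P U p y" "P U go gy = P U o' y"
   unfolding q_def go_def gy_def using mv xs yc by auto
  have "gy = a [^] m ** go" unfolding gy_def go_def y using xs U by (simp add: pow_mult_left add.commute)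
  hence ygy: "P U y gy <= D0" using mv[of o' go m] j c xs unfolding y go_def by simp
  have "P U q o' + P U go gy <= max (P U q go + P U o' gy) (P U q gy + P U o' go) + kp"
   using four_point[OF U(1), of q o' go gy] c xs by blast
  hence 1: "P U q o' + P U q gy <= P U o' gy + 8 * kp"
   using e geo deep(1) j sym[of q go] sym[of q o'] P_nonneg[OF U(1), of q o'] c xs D0pos kappa unfolding go_def[symmetric]
   by (auto simp: max_def split: if_splits)
  have "P U q y + P U o' gy <= max (P U q o' + P U y gy) (P U q gy + P U y o') + kp"
   using four_point[OF U(1), of q y o' gy] c xs yc by blast
  hence "P U q y + P U q o' <= P U o' y + 9 * kp"
   using 1 e deep(2) ygy sym[of y p] sym[of y o'] P_nonneg[OF U(1), of q y] c xs yc D0pos kappa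
   by (auto simp: max_def split: if_splits)
  thus ?thesis using sym[of q o'] c xs unfolding q_def by simp
 qed
 have hdist: "P U w w' <= abs(P U o' w - P U o' w') + 10 * kp"
  if "w : CG" "w' : CG" "P U o' w + P U w y <= P U o' y + 9 * kp"
   "P U o' w' + P U w' y <= P U o' y + 9 * kp" for w w'
 proof -
  have "P U o' y + P U w w' <= max (P U o' w + P U y w') (P U o' w' + P U y w) + kp"
   using four_point[OF U(1), of o' y w w'] that xs yc by blast
  thus ?thesis using that sym[of y w'] sym[of y w] yc by (auto simp: max_def split: if_splits)
 qed
 define q q2 go where "q = a [^] i ** p" and "q2 = a [^] (2 * i) ** p" and "go = a [^] i ** o'"
 have c: "q : CG" "q2 : CG" "go : CG" unfolding q_def q2_def go_def using cl xs by auto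
 have q2: "q2 = a [^] i ** q" unfolding q2_def q_def using xs U by (simp add: pow_mult_left mult_2)
 have u: "P U q q2 = P U p q" using mv[of p q i] xs c q2 unfolding q_def by auto
 have h: "P U go q2 = P U o' q" "P U go q = P U o' p"
  using mv[of o' q i] mv[of o' p i] xs c q2 unfolding q_def go_def by auto
 have E: "P U o' p + P U p y <= P U o' y + 9 * kp" "P U o' q + P U q y <= P U o' y + 9 * kp"
  using geo kappa near[OF D0(1)] unfolding q_def by auto
 have u1: "P U p q <= abs(P U o' q - P U o' p) + 10 * kp"
  using hdist[OF xs(2) c(1) E] by linarith
 have og: "P U o' go <= D0" using D0 unfolding go_def by simp
 have "P U o' q <= P U o' go + P U go q" "P U go q <= P U go o' + P U o' q"
  using P_tri[OF U(1)] c xs by auto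
 hence s1: "abs(P U o' q - P U o' p) <= D0" using h og sym[of go o'] c xs by auto
 have "P U o' q2 + P U go q <= max (P U o' go + P U q2 q) (P U o' q + P U q2 go) + kp"
  "P U o' q + P U go q2 <= max (P U o' go + P U q q2) (P U o' q2 + P U q go) + kp"
  using four_point[OF U(1), of o' q2 go q] four_point[OF U(1), of o' q go q2] c xs by auto
 moreover have "P U o' q2 >= P U o' q - D0"
 proof -
  have "P U go q2 <= P U go o' + P U o' q2" using P_tri[OF U(1)] c xs by auto
  thus ?thesis using h og sym[of go o'] c xs by auto
 qed
 \<comment> \<open>Measured by the distance to \<open>o'\<close>, the shift from \<open>q\<close> to
   \<open>q2\<close> repeats the shift from \<open>p\<close> to \<open>q\<close>. A shift by
   \<open>s\<close> therefore moves \<open>p\<close> to \<open>q2\<close> by about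
   \<open>2 * |s|\<close>, whereas \<open>non_loxodromic\<close> allows only about
   \<open>|s|\<close>; this bounds \<open>s\<close>.\<close>
 ultimately have sig: "abs((P U o' q2 - P U o' q) - (P U o' q - P U o' p)) <= kp"
  using h u u1 s1 og deep D0pos kappa sym[of q2 q] sym[of q2 go] sym[of q go] c
  by (auto simp: max_def abs_if split: if_splits)
 have "P U o' q2 <= P U o' p + P U p q2" "P U o' p <= P U o' q2 + P U q2 p"
  using P_tri[OF U(1)] c xs by auto
 hence "P U p q2 >= abs(P U o' q2 - P U o' p)" using sym[of q2 p] c xs by auto
 moreover have "P U p q2 <= P U p q + kp"
  using nl i xs unfolding non_loxodromic_def q_def q2_def by auto
 ultimately show ?thesis using sig u1 unfolding q_def[symmetric] by (auto simp: abs_if split: if_splits)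
qed

text \<open>The segment is the middle part of a coarse geodesic from \<open>x\<close> to a far orbit
  point. \<open>D0\<close> bounds the displacement of \<open>x\<close> by the first
  \<open>2 * N\<close> powers, and \<open>K\<close> is the depth at which
  \<open>displacement_deep\<close> applies.\<close>

lemma deep_region:
 assumes U: "U : D" "a : CG" "act a U = U" and nl: "non_loxodromic U a"
  and x: "x : CG" and unb: "!!B. EX m::nat. P U x (a [^] m ** x) > B"
 shows "EX c::nat => 'g. (ALL s<=L. c s : CG) &
  (ALL s<=L. ALL t<=L. abs(P U (c s) (c t) - abs(real s - real t)) <= kp) &
  (ALL s<=L. ALL i<=N. P U (c s) (a [^] (i::nat) ** c s) <= 22 * kp)"
proof -
 define D0 where "D0 = Max ((%i. P U x (a [^] i ** x)) ` {..2 * N})"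
 have D0: "P U x (a [^] i ** x) <= D0" if "i <= 2 * N" for i
  unfolding D0_def using that by (intro Max_ge) auto
 have cl: "a [^] (j::nat) ** s : CG" if "s : CG" for j s using that U by auto
 have "D0 >= 0" using D0[of 0] P_nonneg[OF U(1) x cl[OF x], of 0] by auto
 define K where "K = nat \<lceil>4 * D0 + 43 * kp\<rceil>"
 have K: "real K >= 4 * D0 + 43 * kp" unfolding K_def by linarith
 obtain m :: nat where m: "P U x (a [^] m ** x) > 2 * real K + real L + 3 * kp" using unb by blast
 define y where "y = a [^] m ** x"
 have y: "y : CG" unfolding y_def using cl x by auto
 obtain c :: "nat => 'g" and l where c: "ALL i<=l. c i : CG" "P U (c 0) x <= kp" "P U (c l) y <= kp"
  "ALL i<=l. ALL j<=l. abs(P U (c i) (c j) - abs(real i - real j)) <= kp"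
  using coarse_geodesic[OF U(1) x y] by blast
 have cc: "c 0 : CG" "c l : CG" using c by auto
 note tri = P_tri[OF U(1)] and sym = P_sym[OF U(1)]
 have xy: "P U x y <= P U (c 0) (c l) + 2 * kp" "P U (c 0) (c l) <= P U x y + 2 * kp"
  using tri[of x "c 0" y] tri[of "c 0" "c l" y] tri[of "c 0" x "c l"] tri[of x y "c l"]
   sym[of "c 0" x] sym[of "c l" y] c(2,3) cc x y by auto
 have lP: "abs(P U (c 0) (c l) - real l) <= kp" using c(4)[rule_format, of 0 l] by simp
 have l: "l >= 2 * K + L" using lP xy m unfolding y_def by linarith
 have P: "P U (c (K + s)) (a [^] i ** c (K + s)) <= 22 * kp" if s: "s <= L" and i: "i <= N" for s i
 proof (cases "i = 0")
  case True
  thus ?thesis using P_refl[OF U(1), of "c (K + s)"] c(1) s l kappa by auto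
 next
  case False
  define p where "p = c (K + s)"
  have pc: "p : CG" using c(1) s l unfolding p_def by auto
  have 1: "abs(P U (c 0) p - real (K + s)) <= kp" "abs(P U p (c l) - (real l - real (K + s))) <= kp"
   using c(4)[rule_format, of 0 "K + s"] c(4)[rule_format, of "K + s" l] s l unfolding p_def by auto
  have 2: "abs(P U x p - P U (c 0) p) <= kp" "abs(P U p y - P U p (c l)) <= kp"
   using tri[of x "c 0" p] tri[of "c 0" x p] tri[of p "c l" y] tri[of p y "c l"]
   sym[of "c 0" x] sym[of "c l" y] c(2,3) cc x y pc by auto
  have "real (K + s) >= real K" "real l - real (K + s) >= real K" using s l by linarith+
  hence "P U x p >= 4 * D0 + 40 * kp" "P U y p >= 4 * D0 + 40 * kp"
   using K 1 2 sym[of y p] y pc kappa by auto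
  moreover have "P U x p + P U p y <= P U x y + 7 * kp" using 1 2 xy lP by linarith
  ultimately show ?thesis
   using displacement_deep[OF U nl _ x pc D0 D0 y_def, of i] False i unfolding p_def by auto
 qed
 have "abs(P U (c (K + s)) (c (K + t)) - abs(real s - real t)) <= kp" if "s <= L" "t <= L" for s t
  using c(4)[rule_format, of "K + s" "K + t"] that l by simp
 thus ?thesis
  by (intro exI[of _ "%s. c (K + s)"]) (use c(1) l P in auto)
qed

end

section \<open>Domains nested in a domain with unbounded orbits\<close>

context hhg_distances
begin

lemma pow_split: "a : CG ==> x : CG ==> j > 0 ==>
  a [^] (m::nat) ** x = (a [^] (j::nat)) [^] (m div j) ** (a [^] (m mod j) ** x)"
 by (simp add: nat_pow_pow pow_mult_left)

text \<open>The rho set of \<open>V\<close> in \<open>U\<close> is a coarse fixed point of the power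
  \<open>a [^] j\<close>, and the remaining exponents modulo \<open>j\<close> add a bounded
  amount.\<close>

lemma fixed_rho_bounded:
 assumes V: "V : D" "U : D" "lt V U | tr V U" and a: "a : CG" "(j::nat) >= 1"
  and fixV: "act (a [^] j) V = V" and fixU: "act (a [^] j) U = U" and x: "x : CG"
 shows "EX B. ALL m::nat. P U x (a [^] m ** x) <= B"
proof -
 define b where "b = a [^] j"
 have b: "b : CG" unfolding b_def using a by auto
 have bV: "act (b [^] (k::nat)) V = V" "act (b [^] (k::nat)) U = U" for k
  using act_pow[OF b] V fixV fixU unfolding b_def by auto
 have Rk: "R V U (b [^] (k::nat) ** x) = R V U x" for k
  using R_act[of "b [^] k" V U x] bV[of k] b V x by simp
 define M where "M = Max ((%l. P U x (a [^] l ** x)) ` {..j})"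
 have M: "P U x (a [^] l ** x) <= M" if "l <= j" for l
  unfolding M_def using that by (intro Max_ge) auto
 have "P U x (a [^] m ** x) <= 2 * R V U x + M" for m :: nat
 proof -
  let ?k = "m div j" and ?l = "m mod j"
  have c: "b [^] ?k ** x : CG" "a [^] ?l ** x : CG" "b [^] ?k ** (a [^] ?l ** x) : CG"
   using a b x by auto
  have "P U x (b [^] ?k ** x) <= 2 * R V U x" using P_le_R[OF V(1,2,3) x c(1)] Rk by simp
  moreover have "P U (b [^] ?k ** x) (b [^] ?k ** (a [^] ?l ** x)) <= M"
   using P_fix[OF _ V(2) bV(2)[of ?k] x c(2)] M[of ?l] a b by (simp add: less_imp_le)
  moreover have eq: "a [^] m ** x = b [^] ?k ** (a [^] ?l ** x)"
   unfolding b_def using pow_split[of a x j m] a x by auto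
  ultimately show ?thesis unfolding eq using P_tri[OF V(2) x c(1,3)] by linarith
 qed
 thus ?thesis by blast
qed

lemma act_inv_pow_eq:
 assumes "a : CG" "V : D" "act (inv (a [^] (i::nat))) V = act (inv (a [^] (j::nat))) V" "i <= j"
 shows "act (a [^] (j - i)) V = V"
proof -
 have "a [^] j ** inv (a [^] i) = a [^] (j - i)"
  using assms nat_pow_mult[of a "j - i" i] by (simp add: inv_solve_right')
 hence "act (a [^] (j - i)) V = act (a [^] j) (act (inv (a [^] i)) V)"
  using act_mult[of "a [^] j" "inv (a [^] i)" V] assms by simp
 thus ?thesis using assms act_act_inv by auto
qed

text \<open>
  If the translates of \<open>V\<close> under powers of \<open>a\<close> are all relevant for one pair of points then they cannot be
  pairwise distinct.
\<close>
lemma periodic_of_relevant: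
 "EX f::nat. ALL T:D. ALL V:D. ALL a:CG. ALL x:CG. ALL y:CG.
   (ALL i<=f. lt (act (inv (a [^] i)) V) T & P (act (inv (a [^] i)) V) x y > kp &
   (ALL W:D. lt (act (inv (a [^] i)) V) W & le W T --> P W x y <= B)) -->
   (EX j. 1 <= j & j <= f & act (a [^] j) V = V)"
proof -
 obtain f :: nat where f: "ALL T:D. ALL x:CG. ALL y:CG. ALL \<V><=D. lev T <= n -->
   (ALL V:\<V>. lt V T & P V x y > kp & (ALL U:D. lt V U & le U T --> P U x y <= B)) -->
   finite \<V> & card \<V> <= f" using relevant_count[of n B] by blast
 show ?thesis
 proof (rule exI[of _ f], intro ballI impI)
  fix T V a x y assume as: "T : D" "V : D" "a : CG" "x : CG" "y : CG"
   and rel: "ALL i<=f. lt (act (inv (a [^] i)) V) T & P (act (inv (a [^] i)) V) x y > kp &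
   (ALL W:D. lt (act (inv (a [^] i)) V) W & le W T --> P W x y <= B)"
  let ?g = "%i::nat. act (inv (a [^] i)) V"
  have "?g ` {..f} <= D" using as act_closed by auto
  hence "card (?g ` {..f}) <= f"
   using f[rule_format, of T x y "?g ` {..f}"] lev_le as rel by blast
  hence "~ inj_on ?g {..f}" using card_image[of ?g "{..f}"] by auto
  then obtain i j where ij: "i <= f" "j <= f" "i ~= j" "?g i = ?g j" unfolding inj_on_def by auto
  have "EX i j. i < j & j <= f & ?g i = ?g j"
   using ij by (metis linorder_neqE_nat)
  then obtain i j where "i < j" "j <= f" "?g i = ?g j" by blast
  thus "EX j. 1 <= j & j <= f & act (a [^] j) V = V"
   using act_inv_pow_eq[OF as(3,2), of i j] by (intro exI[of _ "j - i"]) auto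
 qed
qed

definition dseg :: "'s => 'g => nat => nat => (nat => 'g) => bool" where
 "dseg U a N L c \<longleftrightarrow> (ALL s<=L. c s : CG) &
  (ALL s<=L. ALL t<=L. abs(P U (c s) (c t) - abs(real s - real t)) <= kp) &
  (ALL s<=L. ALL i<=N. P U (c s) (a [^] (i::nat) ** c s) <= 22 * kp)"

lemma dsegD:
 assumes "dseg U a N L c"
 shows "s <= L ==> c s : CG"
  "s <= L ==> t <= L ==> abs(P U (c s) (c t) - abs(real s - real t)) <= kp"
  "s <= L ==> i <= N ==> P U (c s) (a [^] i ** c s) <= 22 * kp"
 using assms unfolding dseg_def by blast+

text \<open>The radius for \<open>far_close\<close>: beyond this distance from the rho set of
  \<open>V\<close>, \<open>weak_gi\<close> forbids that \<open>V\<close> separates by more than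
  \<open>kp\<close> two points at distance at most \<open>24 * kp\<close> in
  \<open>U\<close>.\<close>

definition frad :: real where "frad = 24 * kp * kp + 2 * kp"

lemma frad_ge: "frad >= 22 * kp" "frad >= kp * kp + 2 * kp"
 "frad >= kp * (22 * kp) + 2 * kp" "frad >= kp * (2 * kp) + 2 * kp"
 "frad >= kp * (24 * kp) + 2 * kp"
proof -
 have "kp * kp >= kp * 1" by (rule mult_left_mono) (use kappa in auto)
 thus "frad >= 22 * kp" "frad >= kp * kp + 2 * kp"
  "frad >= kp * (22 * kp) + 2 * kp" "frad >= kp * (2 * kp) + 2 * kp"
  "frad >= kp * (24 * kp) + 2 * kp"
  unfolding frad_def using kappa by (simp_all add: algebra_simps)
qed

lemma far_close:
 assumes "V : D" "U : D" "lt V U" "x : CG" "y : CG"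
  "R V U x > frad" "P U x y <= 24 * kp"
 shows "P V x y <= kp"
proof (rule ccontr)
 assume "~ P V x y <= kp"
 hence "R V U x <= kp * P U x y + 2 * kp" using weak_gi[of V U x y] assms by auto
 also have "... <= kp * (24 * kp) + 2 * kp" using assms(7) kappa by (simp add: mult_left_mono)
 finally show False using frad_ge(5) assms by linarith
qed

lemma segment_far:
 assumes ds: "dseg U a N L c" and V: "V : D" "U : D" "lt V U" and a: "a : CG"
  and s: "s <= L" "R V U (c s) > frad"
 shows "!!i. i <= N ==> P V (c s) (a [^] (i::nat) ** c s) <= kp" "Suc s <= L ==> P V (c s) (c (Suc s)) <= kp"
  "!!i. i <= N ==> P V (a [^] (i::nat) ** c s) (c s) <= kp"
proof -
 note c = dsegD(1)[OF ds s(1)]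
 show 1: "P V (c s) (a [^] (i::nat) ** c s) <= kp" if "i <= N" for i
  by (rule far_close[OF V c _ s(2)]) (use dsegD(3)[OF ds s(1) that] c a kappa in auto)
 show "P V (a [^] (i::nat) ** c s) (c s) <= kp" if "i <= N" for i
  using 1[OF that] P_sym[OF V(1), of "c s" "a [^] i ** c s"] c a by auto
 assume L: "Suc s <= L"
 show "P V (c s) (c (Suc s)) <= kp"
  by (rule far_close[OF V c _ s(2)])
   (use dsegD(1)[OF ds L] dsegD(2)[OF ds s(1) L] kappa in auto)
qed

lemma segment_chain:
 assumes V: "V : D" and c: "!!s. s <= t + k ==> c s : CG"
  and st: "!!s. t <= s ==> s < t + k ==> P V (c s) (c (Suc s)) <= kp"
 shows "P V (c t) (c (t + k)) <= kp * k + kp"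
 using c st
proof (induction k)
 case 0
 thus ?case using P_refl[OF V, of "c t"] by auto
next
 case (Suc k)
 hence "P V (c t) (c (t + k)) <= kp * k + kp" "P V (c (t + k)) (c (t + Suc k)) <= kp" by auto
 moreover have "P V (c t) (c (t + Suc k)) <= P V (c t) (c (t + k)) + P V (c (t + k)) (c (t + Suc k))"
  by (rule P_tri[OF V]) (use Suc.prems(1) in auto)
 ultimately show ?case by (simp add: algebra_simps)
qed

text \<open>Induction from high levels down. If \<open>V\<close> separates the ends of the segment
  widely, then so do its translates by the first powers of \<open>a\<close>, which move the ends
  little. The bound for larger domains limits the number of such translates, so a power of
  \<open>a\<close> fixes \<open>V\<close>, and \<open>fixed_rho_bounded\<close> contradicts the
  unbounded orbit in \<open>U\<close>. The radius \<open>r + kp * lev V\<close> grows with the level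
  because passing to a larger domain moves the rho set by up to \<open>kp\<close>.\<close>

lemma near_domain_bound:
 assumes U: "U : D" "a : CG" "act a U = U"
  and x: "x : CG" and unb: "!!B. EX m::nat. P U x (a [^] m ** x) > B"
  and Q: "real Q > r + kp * n + frad + kp"
 shows "EX H N0. ALL N>=N0. ALL c. dseg U a N (2 * Q) c -->
  (ALL V:D. lt V U & R V U (c Q) <= r + kp * lev V --> P V (c 0) (c (2 * Q)) <= H)"
proof -
 have "EX H N0. ALL N>=N0. ALL c. dseg U a N (2 * Q) c -->
  (ALL V:D. n - lev V <= k & lt V U & R V U (c Q) <= r + kp * lev V --> P V (c 0) (c (2 * Q)) <= H)" for k
 proof (induction k)
  case 0
  have "~ n - lev V <= 0" if "V : D" "lt V U" for V
   using lev_strict[OF that(1) U(1) that(2)] lev_le[of U] by auto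
  thus ?case by blast
 next
  case (Suc k)
  then obtain H N0 where H: "ALL N>=N0. ALL c. dseg U a N (2 * Q) c -->
   (ALL V:D. n - lev V <= k & lt V U & R V U (c Q) <= r + kp * lev V --> P V (c 0) (c (2 * Q)) <= H)" by blast
  \<comment> \<open>The first entry is for larger domains properly nested in \<open>U\<close>, by
    induction and up to moving both ends; the second is the length of the segment in
    \<open>U\<close> itself.\<close>
  define B where "B = max (H + 2 * kp) (2 * Q + kp)"
  obtain f :: nat where f: "ALL T:D. ALL V:D. ALL a:CG. ALL x:CG. ALL y:CG.
   (ALL i<=f. lt (act (inv (a [^] i)) V) T & P (act (inv (a [^] i)) V) x y > kp &
   (ALL W:D. lt (act (inv (a [^] i)) V) W & le W T --> P W x y <= B)) -->
   (EX j. 1 <= j & j <= f & act (a [^] j) V = V)" using periodic_of_relevant[of B] by blast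
  show ?case
  proof (intro exI[of _ "max H (3 * kp)"] exI[of _ "max N0 f"] allI impI ballI, elim conjE)
   fix N c V assume N: "max N0 f <= N" and ds: "dseg U a N (2 * Q) c"
   and V: "V : D" "n - lev V <= Suc k" "lt V U" "R V U (c Q) <= r + kp * lev V"
   have cc: "c s : CG" if "s <= 2 * Q" for s by (rule dsegD(1)[OF ds that])
   define q q' where "q = c 0" and "q' = c (2 * Q)"
   have q: "q : CG" "q' : CG" unfolding q_def q'_def using cc by auto
   have ends: "P W q (a [^] i ** q) <= kp" "P W q' (a [^] i ** q') <= kp"
   "P W (a [^] i ** q) q <= kp" "P W (a [^] i ** q') q' <= kp"
   if W: "W : D" "lt W U" "R W U (c Q) <= r + kp * lev W" "i <= N" for W and i :: nat
   proof -
   have "kp * lev W <= kp * n" using lev_le[of W] kappa by auto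
   hence rb: "R W U (c Q) <= r + kp * n" using W by linarith
   have "abs(P U (c Q) q - abs(real Q - real 0)) <= kp" "abs(P U (c Q) q' - abs(real Q - real (2 * Q))) <= kp"
   using dsegD(2)[OF ds, of Q 0] dsegD(2)[OF ds, of Q "2 * Q"] unfolding q_def q'_def by auto
   hence "P U (c Q) q >= Q - kp" "P U (c Q) q' >= Q - kp" by auto
   hence "R W U q > frad" "R W U q' > frad"
   using rb Q P_le_R[of W U "c Q" q] P_le_R[of W U "c Q" q'] cc[of Q] q W U by auto
   thus "P W q (a [^] i ** q) <= kp" "P W q' (a [^] i ** q') <= kp"
   "P W (a [^] i ** q) q <= kp" "P W (a [^] i ** q') q' <= kp"
   using segment_far[OF ds W(1) U(1) W(2) U(2)] W(4) unfolding q_def q'_def by auto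
   qed
   show "P V (c 0) (c (2 * Q)) <= max H (3 * kp)"
   proof (rule ccontr)
   assume "~ P V (c 0) (c (2 * Q)) <= max H (3 * kp)"
   hence big: "P V q q' > 3 * kp" unfolding q_def q'_def by auto
   have rel: "lt (act (inv (a [^] i)) V) U & P (act (inv (a [^] i)) V) q q' > kp &
   (ALL W:D. lt (act (inv (a [^] i)) V) W & le W U --> P W q q' <= B)" if i: "i <= f" for i
   proof (intro conjI ballI impI)
   let ?g = "a [^] i" and ?V = "act (inv (a [^] i)) V"
   have g: "?g : CG" "inv ?g : CG" using U by auto
   have gU: "act ?g U = U" "act (inv ?g) U = U" using act_pow[OF U(2,1,3)] act_fix_inv[OF g(1) U(1)] by auto
   have iN: "i <= N" using i N by auto
   have gq: "?g ** q : CG" "?g ** q' : CG" using g q by auto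
   show "lt ?V U" using act_lt[OF g(2) V(1) U(1)] gU V by simp
   have "P V q q' <= P V q (?g ** q) + P V (?g ** q) (?g ** q') + P V (?g ** q') q'"
   using P_tri[OF V(1) q(1) gq(1) q(2)] P_tri[OF V(1) gq(1) gq(2) q(2)] by linarith
   thus "P ?V q q' > kp"
   using ends(1,4)[OF V(1,3,4) iN] big P_act_inv[OF g(1) V(1) q] by linarith
   fix W assume W: "W : D" "lt ?V W & le W U"
   show "P W q q' <= B"
   proof (cases "W = U")
   case True
   have "abs(P U (c 0) (c (2 * Q)) - abs(real 0 - real (2 * Q))) <= kp"
   by (rule dsegD(2)[OF ds]) auto
   thus ?thesis using True unfolding B_def q_def q'_def by auto
   next
   case False
   define T where "T = act ?g W"
   have T: "T : D" "lt T U" "lt V T"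
   using act_closed g W False act_lt[OF g(1), of W U] gU U act_lt[OF g(1), of ?V W] act_act_inv[OF g(1) V(1)] V
   unfolding T_def lt_def by auto
   have levT: "lev V < lev T" using lev_strict V T by auto
   have "R T U (c Q) <= R V U (c Q) + kp"
   using R_nested(2)[of V T U "c Q"] V T U cc[of Q] unfolding lt_def by auto
   also have "... <= r + kp * (real (lev V) + 1)" using V by (simp add: algebra_simps)
   also have "... <= r + kp * lev T" using levT kappa by simp
   finally have nT: "R T U (c Q) <= r + kp * lev T" .
   have "n - lev T <= k" using levT V by linarith
   hence "P T q q' <= H" using H N ds T nT unfolding q_def q'_def by auto
   moreover have "P T (?g ** q) (?g ** q') <= P T (?g ** q) q + P T q q' + P T q' (?g ** q')"
   using P_tri[OF T(1) gq(1) q(1) gq(2)] P_tri[OF T(1) q(1) q(2) gq(2)] by linarith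
   moreover have "P W q q' = P T (?g ** q) (?g ** q')"
   using P_act[OF g(1) W(1) q] unfolding T_def by simp
   ultimately show ?thesis using ends(2,3)[OF T(1,2) nT iN] unfolding B_def by linarith
   qed
   qed
   then obtain j where j: "1 <= j" "j <= f" "act (a [^] j) V = V"
   using f[rule_format, OF U(1) V(1) U(2) q] by blast
   obtain C where "ALL m::nat. P U x (a [^] m ** x) <= C"
   using fixed_rho_bounded[of V U a j x] V U j x act_pow[OF U(2,1,3)] by blast
   thus False using unb[of C] by (meson not_le)
   qed
  qed
 qed
 from this[of n] show ?thesis by (meson diff_le_self)
qed

end

section \<open>Recentring at a point that is moved little\<close>

context hhg_distances
begin

text \<open>
  A point \<open>z\<close> is assembled from a deep point of \<open>U\<close>, from \<open>x0\<close> in the domains orthogonal to \<open>U\<close>, and from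
  an end \<open>c 0\<close> of a deep segment in the domains nested in \<open>U\<close> close to the deep point.
\<close>
definition mixed_tuple :: "'s => real => 'g => 'g => 'g => 'g => 's => 'g" where
 "mixed_tuple U r p x0 q w V =
   (if orth V U then x0 else if lt V U & R V U p <= r then q else w)"

text \<open>Pairs of domains with the same entry inherit consistency from that point. The delicate
  pairs consist of a near and a far domain nested in \<open>U\<close>. They are settled by the
  agreement of \<open>q\<close> and \<open>w\<close> up to \<open>h\<close> in the zone between
  \<open>r1\<close> and \<open>r + kp\<close>, or by \<open>weak_gi\<close> if the near domain lies
  within \<open>r1\<close>.\<close>

lemma mixed_tuple_consistent:
 assumes U: "U : D" and x: "p : CG" "x0 : CG" "q : CG" "w : CG"
  and wp: "P U w p <= kp" and wrho: "!!V. V : D ==> lt U V | tr U V ==> R U V w <= kp"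
  and h: "h >= kp" and r1: "r1 >= 0"
  and zone: "!!V. V : D ==> lt V U ==> r1 < R V U p ==> R V U p <= r + kp ==> P V q w <= h"
  and r: "r >= kp * (r1 + 2 * kp) + 4 * kp" "r > r1 + kp"
 shows "ctuple (r + kp * h + h + 5 * kp) (mixed_tuple U r p x0 q w)"
proof -
 define c where "c = r + kp * h + h + 5 * kp"
 let ?bt = "mixed_tuple U r p x0 q w"
 have kh: "kp * h >= 0" using kappa h by auto
 have c: "c >= r + kp" "c >= h + 2 * kp" "c >= 3 * kp" "c >= kp * h + 2 * kp" "c >= kp"
  unfolding c_def using kappa h kh r r1 by auto
 define isO where "isO V \<longleftrightarrow> orth V U" for V
 define isN where "isN V \<longleftrightarrow> lt V U & R V U p <= r" for V
 have beta: "isO V ==> ?bt V = x0" "~ isO V ==> isN V ==> ?bt V = q" "~ isO V ==> ~ isN V ==> ?bt V = w" for V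
  unfolding mixed_tuple_def isO_def isN_def by auto
 have NO: "~ isO V" if "isN V" "V : D" for V
  using lt_not_orth[of V U] that U unfolding isO_def isN_def by auto
 have bX: "?bt V : CG" for V unfolding mixed_tuple_def using x by auto
 have OW: "R V W w <= c" if V: "V : D" "isO V" and W: "W : D" "~ isO W" "~ isN W" and rel: "lt V W | tr V W" for V W
 proof -
  have VU: "orth V U" "orth U V" using V orth_sym U unfolding isO_def by auto
  have "W ~= U" using VU rel orth_not_le[of V U] V U unfolding lt_def tr_def by auto
  moreover have "~ lt W U"
  proof
   assume "lt W U"
   hence "orth W V" using orth_le[of V W U] VU V W U unfolding lt_def by auto
   thus False using rel orth_sym[of W V] orth_not_le[of V W] V W unfolding lt_def tr_def by auto
  qed
  ultimately have UW: "lt U W | tr U W" using trichotomy[of U W] U W orth_sym[of U W] unfolding isO_def by auto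
  hence "R U W w <= kp" using wrho W by auto
  thus ?thesis using orth_rho_close[OF V(1) U W(1) VU(1) rel UW x(4)] c by linarith
 qed
 have NO_tr: "~ tr V W" "~ tr W V" "~ lt V W" "~ lt W V" if V: "V : D" "isN V" and W: "W : D" "isO W" for V W
 proof -
  have "orth V W" using orth_le[of W V U] orth_sym[of W U] V W U unfolding isN_def isO_def lt_def by auto
  thus "~ tr V W" "~ tr W V" "~ lt V W" "~ lt W V"
   using orth_sym[of V W] lt_not_orth[of V W] lt_not_orth[of W V] V W unfolding tr_def by auto
 qed
 have wU: "R V U w <= R V U p + kp" "R V U p <= R V U w + kp" if "V : D" "lt V U" for V
  using R_le[of V U w p] R_le[of V U p w] P_sym[OF U x(4,1)] wp that x U by auto
 have N_up: "R V W w <= c" if V: "V : D" "isN V" and W: "W : D" "~ lt W U" "~ isO W" and rel: "lt V W | tr V W" for V W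
 proof (cases "W = U")
  case True
  thus ?thesis using wU[of V] V c unfolding isN_def by auto
 next
  case False
  hence UW: "lt U W | tr U W" using trichotomy[of U W] W orth_sym[of U W] U unfolding isO_def by auto
  have VU: "le V U" using V unfolding isN_def lt_def by auto
  have "~ orth W V" using rel lt_not_orth[of V W] orth_sym[of W V] V W unfolding tr_def by auto
  hence "R V W w <= R U W w + kp" using R_nested(1)[of V U W w] V W U x UW VU by auto
  thus ?thesis using wrho[OF W(1) UW] c kappa by auto
 qed
 have N_tr: "R V W w <= c | R W V q <= c"
  if V: "V : D" "isN V" and W: "W : D" "~ isO W" "~ isN W" and rel: "tr V W" for V W
 proof (cases "lt W U")
  case False
  thus ?thesis using N_up V W rel by auto
 next
  case WU: True
  hence Wfar: "R W U p > r" using W unfolding isN_def by auto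
  have VU: "lt V U" "R V U p <= r" using V unfolding isN_def by auto
  have WV: "tr W V" using tr_sym[OF V(1) W(1) rel] .
  show ?thesis
  proof (cases "R V U p > r1")
   case True
   hence "P V q w <= h" using zone[of V] V VU kappa by auto
   hence "R W V q <= R W V w + h" using R_le[of W V q w] W V WV x P_sym[OF V(1) x(3,4)] by auto
   thus ?thesis using consistency[OF V(1) W(1) rel x(4)] c kappa by auto
  next
   case False
   \<comment> \<open>A point \<open>e\<close> realizing \<open>V\<close> lies within
     \<open>r1 + 2 * kp\<close> of \<open>w\<close> in \<open>U\<close>. As \<open>W\<close> is
     beyond \<open>r\<close>, it does not separate \<open>e\<close> from \<open>w\<close>, and
     \<open>e\<close> is at the rho set of \<open>V\<close> in \<open>W\<close>.\<close>
   have "ofam {V}" using V by (auto simp: ofam_def)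
   then obtain e where e0: "e : CG" "ALL V':{V}. P V' e w <= kp & (ALL W:D. lt V' W | tr V' W --> R V' W e <= kp)"
   using realization[of "{V}" "%_. w"] x by blast
   have e: "R V U e <= kp" "R V W e <= kp" using e0 U VU W rel by blast+
   have "P U w e <= R V U w + R V U e" using P_le_R[of V U w e] V U VU x e0 by auto
   hence "P U w e <= r1 + 2 * kp" using wU[of V] V VU False e by auto
   hence k: "kp * P U w e <= kp * (r1 + 2 * kp)" using kappa by (simp add: mult_left_mono)
   have far: "R W U w > r - kp" using wU(2)[of W] W WU Wfar by auto
   have "~ P W w e > kp"
   proof
   assume "P W w e > kp"
   hence "R W U w <= kp * P U w e + 2 * kp"
   using weak_gi[OF W(1) U WU x(4) e0(1)] by blast
   thus False using k far r kappa by linarith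
   qed
   hence "R V W w <= 2 * kp"
   using R_le[of V W w e] V W rel x e0 e P_sym[OF W(1) x(4) e0(1)] by auto
   thus ?thesis using c kappa by auto
  qed
 qed
 have zone2: "P V q w <= h" if V: "V : D" "lt V U" and W: "W : D" "lt W U" and VW: "lt V W | lt W V"
  and near: "R V U p <= r" and far: "R W U p > r" for V W
 proof -
  have "R W U p <= R V U p + kp"
   using VW R_nested[of V W U p] R_nested[of W V U p] V W U x unfolding lt_def by auto
  thus ?thesis using zone[of V] V near far r kappa by auto
 qed
 have tr_ok: "R V W (?bt W) <= c | R W V (?bt V) <= c" if VW: "V : D" "W : D" "tr V W" for V W
 proof -
  have WV: "tr W V" using tr_sym[OF VW] .
  have same: ?thesis if "?bt V = ?bt W" using consistency[OF VW bX, of V] that c by auto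
  consider "isO V" "isO W" | "isO V" "isN W" | "isO V" "~ isO W" "~ isN W" |
   "isN V" "isO W" | "isN V" "isN W" | "isN V" "~ isO W" "~ isN W" |
   "~ isO V" "~ isN V" "isO W" | "~ isO V" "~ isN V" "isN W" | "~ isO V" "~ isN V" "~ isO W" "~ isN W" by blast
  thus ?thesis
  proof cases
   case 1 thus ?thesis using same beta by auto
  next
   case 2 thus ?thesis using NO_tr VW by blast
  next
   case 3 thus ?thesis using OW[of V W] VW beta by auto
  next
   case 4 thus ?thesis using NO_tr VW by blast
  next
   case 5 thus ?thesis using same beta NO VW by auto
  next
   case 6 thus ?thesis using N_tr[of V W] VW beta NO[of V] by auto
  next
   case 7 thus ?thesis using OW[of W V] VW WV beta by auto
  next
   case 8 thus ?thesis using N_tr[of W V] VW WV beta NO[of W] by auto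
  next
   case 9 thus ?thesis using same beta by auto
  qed
 qed
 have lt_ok: "R V W (?bt W) <= c | P V (?bt V) (?bt W) <= c" if VW: "V : D" "W : D" "lt V W" for V W
 proof -
  have same: ?thesis if "?bt V = ?bt W" using P_refl[OF VW(1) bX, of V] that c by auto
  have inh: "isO V" if "isO W" using orth_le[of U V W] that VW U unfolding isO_def lt_def by auto
  have down: "lt V U" if "lt W U" using lt_trans[of V W U] VW U that by auto
  consider "isO V" "isO W" | "isO V" "isN W" | "isO V" "~ isO W" "~ isN W" |
   "isN V" "isN W" | "isN V" "~ isO W" "~ isN W" | "~ isO V" "isO W" |
   "~ isO V" "~ isN V" "isN W" | "~ isO V" "~ isN V" "~ isO W" "~ isN W" | "isN V" "isO W" by blast
  thus ?thesis
  proof cases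
   case 1 thus ?thesis using same beta by auto
  next
   case 2 thus ?thesis using NO_tr VW by blast
  next
   case 3 thus ?thesis using OW[of V W] VW beta by auto
  next
   case 4 thus ?thesis using same beta NO VW by auto
  next
   case 5
   show ?thesis
   proof (cases "lt W U")
   case False
   thus ?thesis using N_up[of V W] 5 VW beta by auto
   next
   case True
   hence "P V q w <= h" using zone2[of V W] VW 5 unfolding isN_def by auto
   thus ?thesis using beta(2)[of V] beta(3)[of W] NO[of V] 5 VW c kappa by auto
   qed
  next
   case 6 thus ?thesis using inh by auto
  next
   case 7
   have WU: "lt W U" "R W U p <= r" "lt V U" using 7 down unfolding isN_def by auto
   hence "R V U p > r" using 7 unfolding isN_def by auto
   hence Pq: "P W q w <= h" using zone2[of W V] VW WU by auto
   show ?thesis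
   proof (cases "P V q w <= kp")
   case True
   thus ?thesis using beta(2)[of W] beta(3)[of V] NO[of W] 7 VW c P_sym[OF VW(1) x(3,4)] by auto
   next
   case False
   hence "R V W q <= kp * P W q w + 2 * kp" using weak_gi[OF VW x(3,4)] by auto
   also have "... <= kp * h + 2 * kp" using Pq kappa by simp
   finally show ?thesis using beta(2)[of W] NO[of W] 7 VW c by auto
   qed
  next
   case 8 thus ?thesis using same beta by auto
  next
   case 9 thus ?thesis using NO_tr VW by blast
  qed
 qed
 show ?thesis using bX tr_ok lt_ok unfolding ctuple_def c_def by blast
qed

text \<open>The segment comes close to the rho set of \<open>V\<close> on at most one side of its
  midpoint \<open>c Q\<close>. If this does not happen between \<open>c 0\<close> and
  \<open>c Q\<close>, the steps of that half add up to the bound. Otherwise the other half is short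
  in \<open>V\<close>, and \<open>H\<close> compares the two ends.\<close>

lemma zone_estimate:
 assumes ds: "dseg U a N (2 * Q) c" and V: "V : D" "U : D" "lt V U" and a: "a : CG"
  and w: "w : CG" "P U w (c Q) <= kp"
  and far: "R V U (c Q) > 3 * frad + 2 * kp" and H: "P V (c 0) (c (2 * Q)) <= H"
 shows "P V (c 0) w <= kp * Q + max 0 H + 2 * kp"
proof -
 have cc: "c s : CG" if "s <= 2 * Q" for s by (rule dsegD(1)[OF ds that])
 have cQ: "c Q : CG" "c 0 : CG" "c (2 * Q) : CG" using cc by auto
 note sym = P_sym[OF V(1)] and tri = P_tri[OF V(1)]
 have Vrel: "lt V U | tr V U" using V by auto
 have fr: "frad > 0" using frad_ge kappa by linarith
 have end0: "P V (c 0) (c Q) <= kp * Q + max 0 H + kp"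
 proof (cases "ALL s<Q. R V U (c s) > frad")
  case True
  hence "P V (c s) (c (Suc s)) <= kp" if "s < Q" for s
   using segment_far(2)[OF ds V a, of s] that by auto
  hence "P V (c 0) (c (0 + Q)) <= kp * Q + kp" using cc by (intro segment_chain[OF V(1)]) auto
  thus ?thesis by auto
 next
  case False
  then obtain s where s: "s < Q" "R V U (c s) <= frad" by force
  have "R V U (c t) > frad" if t: "Q <= t" "t <= 2 * Q" for t
  proof (rule ccontr)
   assume "~ R V U (c t) > frad"
   moreover have "P U (c s) (c t) <= R V U (c s) + R V U (c t)"
   using P_le_R[OF V(1,2) Vrel] cc s t by auto
   moreover have "abs(P U (c s) (c t) - abs(real s - real t)) <= kp" "abs(P U (c s) (c Q) - abs(real s - real Q)) <= kp"
   using dsegD(2)[OF ds, of s t] dsegD(2)[OF ds, of s Q] s t by simp_all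
   moreover have "R V U (c Q) <= R V U (c s) + P U (c s) (c Q)"
   using R_le[OF V(1,2) Vrel] cc s by auto
   ultimately show False using far s t by linarith
  qed
  hence "P V (c s) (c (Suc s)) <= kp" if "Q <= s" "s < Q + Q" for s
   using segment_far(2)[OF ds V a, of s] that by auto
  hence "P V (c Q) (c (Q + Q)) <= kp * Q + kp" using cc by (intro segment_chain[OF V(1)]) auto
  hence "P V (c (2 * Q)) (c Q) <= kp * Q + kp" using sym[OF cQ(1,3)] by (simp add: mult_2)
  thus ?thesis using tri[OF cQ(2,3,1)] H by linarith
 qed
 have "P V (c Q) w <= kp"
 proof (rule far_close[OF V cQ(1) w(1)])
  show "R V U (c Q) > frad" using far fr kappa by linarith
  show "P U (c Q) w <= 24 * kp" using w P_sym[OF V(2) cQ(1) w(1)] kappa by linarith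
 qed
 thus ?thesis using end0 tri[OF cQ(2,1) w(1)] by linarith
qed

text \<open>Made to be iterated over pairwise orthogonal domains: in the domains orthogonal to
  \<open>U\<close> the gain already reached at \<open>x0\<close> is kept, and everywhere else the
  displacement becomes bounded. It matters that \<open>C\<close> is chosen before \<open>N\<close>
  and \<open>x0\<close>.\<close>

lemma recentre:
 assumes U: "U : D" "a : CG" "act a U = U" and nl: "non_loxodromic U a"
  and x: "x : CG" and unb: "!!B. EX m::nat. P U x (a [^] m ** x) > B"
 shows "EX C>=0. ALL N. ALL x0:CG. EX z:CG. ALL V:D. ALL i<=(N::nat).
  P V z (a [^] i ** z) <= C + (if orth V U then P V x0 (a [^] i ** x0) else 0)"
proof -
 \<comment> \<open>\<open>r1\<close> is the threshold of \<open>zone_estimate\<close> plus room for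
   displacements by \<open>22 * kp\<close>; \<open>r\<close> adds what
   \<open>mixed_tuple_consistent\<close> requires. The half-length \<open>Q\<close> then keeps the
   ends of the segment far from all rho sets within \<open>r\<close> of its midpoint.\<close>
 define r1 where "r1 = 3 * frad + 30 * kp"
 define r where "r = kp * (r1 + 2 * kp) + r1 + 60 * kp + frad"
 have fr: "frad > 0" using frad_ge kappa by linarith
 have r1: "r1 > 0" unfolding r1_def using fr kappa by linarith
 have kr: "kp * (r1 + 2 * kp) > 0" using kappa r1 by (simp add: add_pos_pos)
 obtain Q :: nat where Q: "real Q > r + kp * n + frad + kp" using reals_Archimedean2 by blast
 obtain H N0 where H: "ALL N>=N0. ALL c. dseg U a N (2 * Q) c -->
  (ALL V:D. lt V U & R V U (c Q) <= r + kp * lev V --> P V (c 0) (c (2 * Q)) <= H)"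
  using near_domain_bound[OF U x unb Q] by blast
 define h where "h = kp * Q + max 0 H + 2 * kp"
 have h: "h >= kp" "h >= 0" unfolding h_def using kappa by auto
 obtain tht where th: "ALL bt. ctuple (r + kp * h + h + 5 * kp) bt & finite (bt ` D) -->
  (EX z:CG. ALL V:D. P V z (bt V) <= tht)" using tuple_realization by blast
 define C where "C = 2 * max 0 tht + h + 30 * kp"
 show ?thesis
 proof (intro exI[of _ C] conjI allI ballI)
  show "C >= 0" unfolding C_def using h kappa by auto
  fix N x0 assume x0: "x0 : CG"
  define N' where "N' = max N N0"
  obtain c where ds: "dseg U a N' (2 * Q) c"
   using deep_region[OF U nl x unb, of "2 * Q" N'] unfolding dseg_def by blast
  define p q where "p = c Q" and "q = c 0"
  have pq: "p : CG" "q : CG" unfolding p_def q_def by (auto intro: dsegD(1)[OF ds])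
  have Hb: "P V (c 0) (c (2 * Q)) <= H" if "V : D" "lt V U" "R V U p <= r + kp" for V
  proof -
   have "kp * 1 <= kp * lev V" using lev_pos[OF that(1)] kappa by (intro mult_left_mono) auto
   hence "R V U (c Q) <= r + kp * lev V" using that unfolding p_def by auto
   thus ?thesis using H[rule_format, of N' c V] ds that unfolding N'_def by auto
  qed
  have "ofam {U}" using U by (auto simp: ofam_def)
  then obtain w where w0: "w : CG" "ALL V':{U}. P V' w p <= kp & (ALL W:D. lt V' W | tr V' W --> R V' W w <= kp)"
   using realization[of "{U}" "%_. p"] pq by blast
  have w: "P U w p <= kp" "!!V. V : D ==> lt U V | tr U V ==> R U V w <= kp" using w0 by blast+
  have zone: "P V q w <= h" if V: "V : D" "lt V U" "r1 - 25 * kp < R V U p" "R V U p <= r + kp" for V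
   using zone_estimate[OF ds V(1) U(1) V(2) U(2) w0(1) _ _ Hb] w V kappa unfolding h_def p_def q_def r1_def by auto
  let ?bt = "mixed_tuple U r p x0 q w"
  have "ctuple (r + kp * h + h + 5 * kp) ?bt"
  proof (rule mixed_tuple_consistent[OF U(1) pq(1) x0 pq(2) w0(1) w h(1), of r1])
   show "P V q w <= h" if "V : D" "lt V U" "r1 < R V U p" "R V U p <= r + kp" for V
   using zone[of V] that kappa by auto
   show "r >= kp * (r1 + 2 * kp) + 4 * kp" "r > r1 + kp" "r1 >= 0"
   unfolding r_def using r1 fr kappa kr by linarith+
  qed auto
  moreover have "finite (?bt ` D)"
   by (rule finite_subset[of _ "{x0, q, w}"]) (auto simp: mixed_tuple_def)
  ultimately obtain z where z: "z : CG" "ALL V:D. P V z (?bt V) <= tht" using th by blast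
  show "EX z:CG. ALL V:D. ALL i<=N. P V z (a [^] i ** z) <= C + (if orth V U then P V x0 (a [^] i ** x0) else 0)"
  proof (intro bexI[of _ z] ballI allI impI)
   fix V and i :: nat assume V: "V : D" and i: "i <= N"
   define g where "g = a [^] i"
   have g: "g : CG" "inv g : CG" unfolding g_def using U by auto
   have gU: "act g U = U" "act (inv g) U = U" using act_pow[OF U(2,1,3)] act_fix_inv[OF g(1) U(1)] unfolding g_def by auto
   \<comment> \<open>\<open>g\<close> carries the coordinate of \<open>z\<close> in
     \<open>V'\<close> to that of \<open>g ** z\<close> in \<open>V\<close>. So the displacement of
     \<open>z\<close> in \<open>V\<close> is a comparison of the entries of the tuple at
     \<open>V\<close> and at \<open>V'\<close>.\<close>
   define V' where "V' = act (inv g) V"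
   have V': "V' : D" "act g V' = V" unfolding V'_def using act_closed g V act_act_inv by auto
   have gx: "g ** z : CG" "g ** x0 : CG" "g ** q : CG" "g ** w : CG" "g ** p : CG"
   using g z x0 pq w0 by auto
   define b b' where "b = ?bt V" and "b' = ?bt V'"
   have b: "b : CG" "b' : CG" unfolding b_def b'_def mixed_tuple_def using x0 pq w0 by auto
   have "P V (g ** z) (g ** b') <= tht" using P_act[OF g(1) V'(1) z(1) b(2)] V' z unfolding b'_def by auto
   hence gzb: "P V (g ** b') (g ** z) <= tht" using P_sym[OF V, of "g ** b'" "g ** z"] g b gx by auto
   have gb: "g ** b' : CG" using g b by auto
   have main: "P V z (g ** z) <= 2 * max 0 tht + P V b (g ** b')"
   using P_tri[OF V z(1) b(1) gx(1)] P_tri[OF V b(1) gb gx(1)] z V gzb unfolding b_def by force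
   have relU: "lt V' U \<longleftrightarrow> lt V U" "orth V' U \<longleftrightarrow> orth V U"
   using act_lt[OF g(2) V U(1)] act_orth[OF g(2) V U(1)] gU unfolding V'_def by auto
   have dp: "P U p (g ** p) <= 22 * kp"
   using dsegD(3)[OF ds, of Q i] i unfolding N'_def p_def g_def by auto
   have dq: "P V q (g ** q) <= kp" if "lt V U" "R V U p <= r"
   proof -
   have "abs(P U (c Q) (c 0) - abs(real Q - real 0)) <= kp" by (rule dsegD(2)[OF ds]) auto
   moreover have "kp * n >= 0" using kappa by simp
   moreover have "P U (c Q) (c 0) <= R V U (c Q) + R V U (c 0)"
   using P_le_R[OF V U(1) _ pq] that unfolding p_def q_def by auto
   ultimately have "R V U (c 0) > frad" using that(2) Q unfolding p_def by linarith
   thus ?thesis using segment_far(1)[OF ds V U(1) that(1) U(2), of 0 i] i unfolding N'_def q_def g_def by auto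
   qed
   have dw: "P V w (g ** w) <= kp" if "lt V U" "R V U p > frad + kp"
   proof (rule far_close[OF V U(1) that(1) w0(1) gx(4)])
   show "R V U w > frad" using R_le[of V U p w] V U(1) that pq w0(1) w(1) by auto
   have "P U (g ** p) (g ** w) <= kp" using P_fix[OF g(1) U(1) gU(1) pq(1) w0(1)] P_sym[OF U(1) pq(1) w0(1)] w by auto
   thus "P U w (g ** w) <= 24 * kp"
   using P_tri[OF U(1) w0(1) pq(1) gx(4)] P_tri[OF U(1) pq(1) gx(5) gx(4)] w(1) dp by linarith
   qed
   have shift: "abs(R V U p - R V' U p) <= 22 * kp" if "lt V U"
   proof -
   have "R V U (g ** p) = R V' U p" using R_act[OF g(1) V'(1) U(1) pq(1)] V' gU relU that by auto
   thus ?thesis using R_le[of V U p "g ** p"] R_le[of V U "g ** p" p] P_sym[OF U(1) pq(1) gx(5)]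
   V U(1) that pq gx dp by auto
   qed
   have "P V b (g ** b') <= h + 30 * kp + (if orth V U then P V x0 (g ** x0) else 0)"
   proof -
   consider (O) "orth V U" | (L) "lt V U" | (W) "~ orth V U" "~ lt V U" by blast
   thus ?thesis
   proof cases
   case O
   thus ?thesis unfolding b_def b'_def mixed_tuple_def using relU h kappa by auto
   next
   case W
   hence bb: "b = w" "b' = w" unfolding b_def b'_def mixed_tuple_def using relU by auto
   have "P V w (g ** w) <= 24 * kp"
   proof (cases "V = U")
   case True
   have "P U (g ** p) (g ** w) <= kp" using P_fix[OF g(1) U(1) gU(1) pq(1) w0(1)] P_sym[OF U(1) pq(1) w0(1)] w by auto
   thus ?thesis unfolding True
   using P_tri[OF U(1) w0(1) pq(1) gx(4)] P_tri[OF U(1) pq(1) gx(5) gx(4)] w(1) dp by linarith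
   next
   case False
   hence UV: "lt U V | tr U V" using trichotomy[of U V] U(1) V W orth_sym[of U V] by auto
   hence UV': "lt U V' | tr U V'"
   using act_lt[OF g(2) U(1) V] act_tr[OF g(2) U(1) V] gU unfolding V'_def by auto
   have "R U V (g ** w) = R U V' w" using R_act[OF g(1) U(1) V'(1) w0(1) UV'] V' gU by auto
   hence "R U V (g ** w) <= kp" using w(2)[OF V'(1) UV'] by simp
   thus ?thesis using P_le_R[OF U(1) V UV w0(1) gx(4)] w(2)[OF V UV] kappa by linarith
   qed
   thus ?thesis using bb W h kappa by auto
   next
   case L
   have nO: "~ orth V U" "~ orth V' U" using lt_not_orth[OF V U(1) L] relU by auto
   have lt': "lt V' U" using L relU by auto
   have rbig: "r - 22 * kp > r1" "r - 22 * kp > frad + kp" unfolding r_def using r1 fr kappa kr unfolding r1_def by linarith+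
   note sh = shift[OF L]
   \<comment> \<open>The distances of the two rho sets from \<open>p\<close> differ by at most
     \<open>22 * kp\<close>. If they lie on different sides of \<open>r\<close>, the nearer one is
     in the zone where \<open>q\<close> and \<open>w\<close> agree.\<close>
   consider (nn) "R V U p <= r" "R V' U p <= r" | (nf) "R V U p <= r" "R V' U p > r" |
   (fn) "R V U p > r" "R V' U p <= r" | (ff) "R V U p > r" "R V' U p > r" by linarith
   hence "P V b (g ** b') <= h + kp"
   proof cases
   case nn
   hence "b = q" "b' = q" unfolding b_def b'_def mixed_tuple_def using nO L lt' by auto
   thus ?thesis using dq[OF L nn(1)] h by auto
   next
   case nf
   hence bb: "b = q" "b' = w" unfolding b_def b'_def mixed_tuple_def using nO L lt' by auto
   have "P V q w <= h" using zone[OF V L] nf sh rbig kappa by auto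
   moreover have "P V w (g ** w) <= kp" using dw[OF L] nf sh rbig by auto
   ultimately show ?thesis unfolding bb using P_tri[OF V pq(2) w0(1) gx(4)] by auto
   next
   case fn
   hence bb: "b = w" "b' = q" unfolding b_def b'_def mixed_tuple_def using nO L lt' by auto
   have "P V' q w <= h" using zone[OF V'(1) lt'] fn sh rbig kappa by auto
   hence "P V (g ** w) (g ** q) <= h"
   using P_act[OF g(1) V'(1) w0(1) pq(2)] V' P_sym[OF V'(1) pq(2) w0(1)] by auto
   moreover have "P V w (g ** w) <= kp" using dw[OF L] fn rbig kappa by auto
   ultimately show ?thesis unfolding bb using P_tri[OF V w0(1) gx(4) gx(3)] by auto
   next
   case ff
   hence bb: "b = w" "b' = w" unfolding b_def b'_def mixed_tuple_def using nO L lt' by auto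
   thus ?thesis using dw[OF L] ff rbig kappa h by auto
   qed
   thus ?thesis using nO kappa by auto
   qed
   qed
   thus "P V z (a [^] i ** z) <= C + (if orth V U then P V x0 (a [^] i ** x0) else 0)"
   using main unfolding C_def g_def by auto
  qed (rule z(1))
 qed
qed

end

section \<open>Domains with unbounded orbits, and loxodromic powers\<close>

context hhg_distances
begin

definition odiam :: "'s => 'g => 'g => real => bool" where
 "odiam V a x B \<longleftrightarrow> (ALL (i::nat) (j::nat). P V (a [^] i ** x) (a [^] j ** x) <= B)"

lemma odiam_mono: "odiam V a x B ==> B <= B' ==> odiam V a x B'"
 unfolding odiam_def by (meson order_trans)

definition sbound :: "'g => 'g => nat => real" where
 "sbound a x J = Max ((%k. kp * d x (a [^] k ** x) + kp) ` {..J})"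

lemma sbound:
 assumes "V : D" "a : CG" "x : CG" "k <= J"
 shows "P V (a [^] (i::nat) ** x) (a [^] (k + i) ** x) <= sbound a x J"
proof -
 have eq: "a [^] (k + i) ** x = a [^] i ** (a [^] k ** x)" using assms by (simp add: pow_mult_left add.commute)
 have "P V (a [^] i ** x) (a [^] (k + i) ** x) <= kp * d (a [^] i ** x) (a [^] (k + i) ** x) + kp"
  using P_lipschitz[of V "a [^] i ** x" "a [^] (k + i) ** x"] assms by auto
 also have "... = kp * d x (a [^] k ** x) + kp" unfolding eq using d_act assms by auto
 also have "... <= sbound a x J"
  unfolding sbound_def using assms by (intro Max_ge) auto
 finally show ?thesis .
qed

text \<open>The rho set of \<open>V\<close> in \<open>W\<close> is fixed by \<open>a [^] M\<close>,
  so the orbit stays near it. By consistency this applies to one of any two transverse domains fixed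
  by the power; hence fixed domains with unbounded orbits are never transverse.\<close>

lemma odiam_transverse:
 assumes V: "V : D" "W : D" "tr V W" and a: "a : CG" "x : CG" "M >= 1"
  and fixed: "act (a [^] (M::nat)) V = V" "act (a [^] M) W = W" and near: "R V W x <= kp"
 shows "odiam W a x (2 * (kp + sbound a x M))"
proof -
 define b where "b = a [^] M"
 have b: "b : CG" unfolding b_def using a by auto
 have bV: "act (b [^] (k::nat)) V = V" "act (b [^] (k::nat)) W = W" for k
  using act_pow[OF b] V fixed unfolding b_def by auto
 have "R V W (a [^] i ** x) <= kp + sbound a x M" for i :: nat
 proof -
  let ?k = "i div M" and ?l = "i mod M"
  have e: "b [^] ?k = a [^] (M * ?k)" unfolding b_def using a by (simp add: nat_pow_pow)
  have "R V W (b [^] ?k ** x) = R V W x" using R_act[of "b [^] ?k" V W x] bV[of ?k] b V a by simp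
  moreover have "P W (a [^] (M * ?k) ** x) (a [^] i ** x) <= sbound a x M"
   using sbound[OF V(2) a(1,2), of ?l M "M * ?k"] a(3) by (simp add: less_imp_le)
  moreover have "a [^] (M * ?k) ** x : CG" "a [^] i ** x : CG" using a by auto
  ultimately show ?thesis
   using R_le[of V W "a [^] i ** x" "a [^] (M * ?k) ** x"] V near unfolding e by auto
 qed
 note Ri = this
 show ?thesis unfolding odiam_def
 proof (intro allI)
  fix i j :: nat
  have "P W (a [^] i ** x) (a [^] j ** x) <= R V W (a [^] i ** x) + R V W (a [^] j ** x)"
   using P_le_R[of V W "a [^] i ** x" "a [^] j ** x"] V a by auto
  hence "P W (a [^] i ** x) (a [^] j ** x) <= (kp + sbound a x M) + (kp + sbound a x M)"
   using add_mono[OF Ri[of i] Ri[of j]] by (rule order_trans)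
  thus "P W (a [^] i ** x) (a [^] j ** x) <= 2 * (kp + sbound a x M)" by simp
 qed
qed

lemma act_pow_fact:
 assumes "a : CG" "V : D" "act (a [^] (j::nat)) V = V" "1 <= j" "j <= J"
 shows "act (a [^] (fact J :: nat)) V = V"
proof -
 have "j dvd fact J" using assms by (intro dvd_fact) auto
 then obtain q where "fact J = j * q" by blast
 thus ?thesis using act_pow[of "a [^] j" V q] assms by (simp add: nat_pow_pow)
qed

lemma act_top:
 assumes S: "S : D" "ALL V:D. le V S" and g: "g : CG"
 shows "act g S = S"
proof -
 have "le (act (inv g) S) S" using S act_closed g by auto
 hence "le (act g (act (inv g) S)) (act g S)" using act_le[of g "act (inv g) S" S] S act_closed g by auto
 hence "le S (act g S)" using act_act_inv g S by simp
 thus ?thesis using le_antisym[of S "act g S"] S act_closed g by auto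
qed

text \<open>If the orbit is bounded in all larger domains, a large diameter in \<open>V\<close>
  persists in the translates of \<open>V\<close> by the first few powers. Then
  \<open>periodic_of_relevant\<close> gives a period, and the factorial makes it the same for all
  \<open>V\<close>.\<close>

lemma translates_distinct_bound:
 assumes a: "a : CG" "x : CG"
 shows "EX J C. ALL V:D. (ALL T:D. lt V T --> odiam T a x B) & ~ odiam V a x C -->
  act (a [^] (fact J :: nat)) V = V"
proof (cases "D = {}")
 case False
 then obtain S where S: "S : D" "ALL V:D. le V S" using top_ex by blast
 obtain f :: nat where f: "ALL T:D. ALL V:D. ALL a:CG. ALL x:CG. ALL y:CG.
   (ALL i<=f. lt (act (inv (a [^] i)) V) T & P (act (inv (a [^] i)) V) x y > kp &
   (ALL W:D. lt (act (inv (a [^] i)) V) W & le W T --> P W x y <= B)) -->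
   (EX j. 1 <= j & j <= f & act (a [^] j) V = V)" using periodic_of_relevant[of B] by blast
 show ?thesis
 proof (intro exI[of _ f] exI[of _ "kp + 2 * sbound a x f"] ballI impI, elim conjE)
  fix V assume V: "V : D" "ALL T:D. lt V T --> odiam T a x B" "~ odiam V a x (kp + 2 * sbound a x f)"
  then obtain i j :: nat where ij: "P V (a [^] i ** x) (a [^] j ** x) > kp + 2 * sbound a x f"
   unfolding odiam_def not_all not_le by blast
  have cl: "a [^] (k::nat) ** x : CG" for k using a by auto
  show "act (a [^] (fact f :: nat)) V = V"
  proof (cases "V = S")
   case True
   thus ?thesis using act_top[OF S] a by auto
  next
   case VS: False
   have "EX j. 1 <= j & j <= f & act (a [^] j) V = V"
   proof (rule f[rule_format, OF S(1) V(1) a(1) cl cl])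
   fix k assume k: "k <= f"
   let ?g = "a [^] k" and ?V = "act (inv (a [^] k)) V"
   have g: "?g : CG" "inv ?g : CG" using a by auto
   have sh: "?g ** (a [^] l ** x) = a [^] (k + l) ** x" for l :: nat using a by (simp add: pow_mult_left)
   have Vc: "?V : D" using act_closed g V by auto
   have "?V ~= S" using act_act_inv[OF g(1) V(1)] act_top[OF S g(1)] VS by metis
   hence 1: "lt ?V S" using S Vc unfolding lt_def by auto
   have "P V (a [^] i ** x) (a [^] j ** x) <= P V (a [^] i ** x) (a [^] (k + i) ** x)
   + P V (a [^] (k + i) ** x) (a [^] (k + j) ** x) + P V (a [^] (k + j) ** x) (a [^] j ** x)"
   using P_tri[OF V(1) cl cl cl, of i j "k + i"] P_tri[OF V(1) cl cl cl, of "k + i" j "k + j"] by linarith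
   moreover have "P V (a [^] i ** x) (a [^] (k + i) ** x) <= sbound a x f"
   "P V (a [^] (k + j) ** x) (a [^] j ** x) <= sbound a x f"
   using sbound[OF V(1) a k] P_sym[OF V(1) cl cl, of "k + j" j] by auto
   moreover have "P ?V (a [^] i ** x) (a [^] j ** x) = P V (a [^] (k + i) ** x) (a [^] (k + j) ** x)"
   using P_act_inv[OF g(1) V(1) cl cl, of i j] by (simp add: sh)
   ultimately have 2: "P ?V (a [^] i ** x) (a [^] j ** x) > kp" using ij by linarith
   have 3: "P W (a [^] i ** x) (a [^] j ** x) <= B" if W: "W : D" "lt ?V W & le W S" for W
   proof -
   have "lt V (act ?g W)" using act_lt[OF g(1) Vc W(1)] act_act_inv[OF g(1) V(1)] W by auto
   hence "odiam (act ?g W) a x B" using V act_closed g W by auto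
   thus ?thesis using P_act[OF g(1) W(1) cl cl, of i j] unfolding odiam_def sh by metis
   qed
   show "lt ?V S & kp < P ?V (a [^] i ** x) (a [^] j ** x) &
   (ALL W:D. lt ?V W & le W S --> P W (a [^] i ** x) (a [^] j ** x) <= B)" using 1 2 3 by blast
   qed
   thus ?thesis using act_pow_fact a V by blast
  qed
 qed
qed simp

definition udoms :: "'g => 'g => 's set" where
 "udoms a x = {V:D. ALL B. ~ odiam V a x B}"

text \<open>Induction from the top level down, among domains with no unbounded domain properly
  above. On one level the domains with large orbits are periodic, hence not transverse, hence
  pairwise orthogonal and finite in number; so those of them with bounded orbits have a common
  bound.\<close>

lemma udoms_periodic:
 assumes a: "a : CG" "x : CG"
 shows "EX C M. M >= 1 & (ALL V:D. n - lev V <= k & (ALL T:udoms a x. ~ lt V T) -->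
  (V : udoms a x & act (a [^] (M::nat)) V = V) | odiam V a x C)"
proof -
 define UB where "UB = udoms a x"
 have UBD: "V : UB \<longleftrightarrow> V : D & (ALL B. ~ odiam V a x B)" for V
  unfolding UB_def udoms_def by auto
 have step: "EX C M. M >= 1 & (ALL V:D. n - lev V <= k' & (ALL T:UB. ~ lt V T) -->
  (V : UB & act (a [^] (M::nat)) V = V) | odiam V a x C)"
  if IH: "M0 >= 1" "ALL V:D. n - lev V < k' & (ALL T:UB. ~ lt V T) -->
  (V : UB & act (a [^] (M0::nat)) V = V) | odiam V a x C0" for k' M0 C0
 proof -
  obtain J C1 where J: "ALL V:D. (ALL T:D. lt V T --> odiam T a x C0) & ~ odiam V a x C1 -->
   act (a [^] (fact J :: nat)) V = V" using translates_distinct_bound[OF a, of C0] by blast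
  define M1 where "M1 = (fact J :: nat)"
  have M1: "M1 >= 1" unfolding M1_def by (simp add: fact_ge_1)
  define C2 where "C2 = max C1 (2 * (kp + sbound a x M1))"
  define L where "L = {V:D. n - lev V = k' & (ALL T:UB. ~ lt V T) & ~ odiam V a x C2}"
  have Lfix: "act (a [^] M1) V = V" if V: "V : L" for V
  proof -
   have "odiam T a x C0" if T: "T : D" "lt V T" for T
   proof -
   have VD: "V : D" "n - lev V = k'" "ALL T:UB. ~ lt V T" using V unfolding L_def by auto
   have "lev V < lev T" "lev T <= n" using lev_strict VD T lev_le by auto
   hence "n - lev T < k'" using VD by linarith
   moreover have "T ~: UB" "ALL T':UB. ~ lt T T'" using VD T lt_trans[of V T] UBD by blast+
   ultimately show ?thesis using IH T by blast
   qed
   moreover have "~ odiam V a x C1" using V odiam_mono unfolding L_def C2_def by fastforce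
   ultimately show ?thesis using J V unfolding L_def M1_def by blast
  qed
  have "ofam L" unfolding ofam_def
  proof (intro conjI ballI impI)
   show "L <= D" unfolding L_def by auto
   fix V W assume VW: "V : L" "W : L" "V ~= W"
   hence D': "V : D" "W : D" "lev V = lev W" using lev_le[of V] lev_le[of W] unfolding L_def by auto
   have "~ lt V W" "~ lt W V" using D' lev_strict[of V W] lev_strict[of W V] by auto
   moreover have "~ tr V W"
   proof
   assume tr: "tr V W"
   have "R V W x <= kp | R W V x <= kp" using consistency[OF D'(1,2) tr a(2)] .
   hence "odiam W a x (2 * (kp + sbound a x M1)) | odiam V a x (2 * (kp + sbound a x M1))"
   using odiam_transverse[OF D'(1,2) tr a M1] odiam_transverse[OF D'(2,1) tr_sym[OF D'(1,2) tr] a M1]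
   Lfix VW by blast
   thus False using VW odiam_mono unfolding L_def C2_def by fastforce
   qed
   ultimately show "orth V W" using trichotomy[of V W] D' VW by auto
  qed
  hence finL: "finite L" using ofam_finite by blast
  have "ALL V:L - UB. EX B. odiam V a x B" using UBD unfolding L_def by blast
  then obtain B where B: "ALL V:L - UB. odiam V a x (B V)" by metis
  define C where "C = Max (insert C0 (insert C2 (B ` (L - UB))))"
  have C: "C0 <= C" "C2 <= C" "!!V. V : L - UB ==> B V <= C"
   unfolding C_def using finL by (auto intro!: Max_ge simp del: Max_insert)
  show ?thesis
  proof (intro exI[of _ C] exI[of _ "M0 * M1"] conjI ballI impI, unfold not_less[symmetric])
   show "~ M0 * M1 < 1" using IH(1) M1 by (simp add: not_less)
   fix V assume V: "V : D" "~ k' < n - lev V & (ALL T:UB. ~ lt V T)"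
   show "V : UB & act (a [^] (M0 * M1)) V = V | odiam V a x C"
   proof (cases "n - lev V < k'")
   case True
   hence "(V : UB & act (a [^] M0) V = V) | odiam V a x C0" using IH(2) V by blast
   thus ?thesis
   proof
   assume "V : UB & act (a [^] M0) V = V"
   thus ?thesis using act_pow[of "a [^] M0" V M1] a V by (simp add: nat_pow_pow)
   next
   assume "odiam V a x C0"
   thus ?thesis using C odiam_mono by blast
   qed
   next
   case False
   hence k: "n - lev V = k'" using V by auto
   show ?thesis
   proof (cases "V : L")
   case True
   note f = Lfix[OF True]
   have "V : UB | odiam V a x C" using B C(3) True odiam_mono by blast
   thus ?thesis using act_pow[of "a [^] M1" V M0] f a V by (auto simp: nat_pow_pow mult.commute)
   next
   case False
   hence "odiam V a x C2" using V k unfolding L_def by blast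
   thus ?thesis using C odiam_mono by blast
   qed
   qed
  qed
 qed
 have "EX C M. M >= 1 & (ALL V:D. n - lev V <= k & (ALL T:UB. ~ lt V T) -->
  (V : UB & act (a [^] (M::nat)) V = V) | odiam V a x C)"
 proof (induction k)
  case 0
  show ?case by (rule step[of 1 0 0]) auto
 next
  case (Suc k)
  then obtain C M where M: "M >= 1" "ALL V:D. n - lev V <= k & (ALL T:UB. ~ lt V T) -->
   (V : UB & act (a [^] (M::nat)) V = V) | odiam V a x C" by blast
  show ?case by (rule step[OF M(1), of "Suc k" C]) (use M(2) in "simp add: less_Suc_eq_le")
 qed
 thus ?thesis unfolding UB_def .
qed

text \<open>\<open>BB\<close> consists of the maximal domains with unbounded orbits. They are
  periodic by \<open>udoms_periodic\<close>, hence not transverse, and incomparable by maximality,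
  so they are orthogonal.\<close>

lemma big_domains:
 assumes a: "a : CG" "x : CG"
 shows "EX M BB C. M >= 1 & ofam BB & (ALL U:BB. act (a [^] (M::nat)) U = U & U : udoms a x) &
  (ALL V:D. (ALL U:BB. ~ le V U) --> odiam V a x C)"
proof -
 define UB where "UB = udoms a x"
 have UBD: "V : UB \<longleftrightarrow> V : D & (ALL B. ~ odiam V a x B)" for V
  unfolding UB_def udoms_def by auto
 obtain C M where M: "M >= 1" "ALL V:D. n - lev V <= n & (ALL T:UB. ~ lt V T) -->
  (V : UB & act (a [^] (M::nat)) V = V) | odiam V a x C"
  using udoms_periodic[OF a, of n] unfolding UB_def by blast
 define BB where "BB = {V:UB. ALL T:UB. ~ lt V T}"
 have BBfix: "act (a [^] M) V = V" if "V : BB" for V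
  using M(2) that UBD unfolding BB_def by (metis (no_types, lifting) diff_le_self mem_Collect_eq)
 have above: "EX U:BB. le V U" if V: "V : D" "T : UB" "le V T" for V T
 proof -
  define A where "A = {T:UB. le V T}"
  have "EX U. U : A & (ALL T. T : A --> lev T <= lev U)"
   by (rule ex_has_greatest_nat[of _ T _ "Suc n"]) (use V lev_le in "auto simp: A_def less_Suc_eq_le")
  then obtain U where U: "U : A" "!!T. T : A ==> lev T <= lev U" by blast
  have "U : BB" unfolding BB_def
  proof (intro CollectI conjI ballI notI)
   show "U : UB" using U A_def by auto
   fix T assume T: "T : UB" "lt U T"
   hence "T : A" using U V UBD le_trans[of V U T] unfolding A_def lt_def by auto
   thus False using U(2)[of T] lev_strict[of U T] T U(1) UBD unfolding A_def by auto
  qed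
  thus ?thesis using U A_def by auto
 qed
 have "ofam BB" unfolding ofam_def
 proof (intro conjI ballI impI)
  show "BB <= D" unfolding BB_def using UBD by auto
  fix V W assume VW: "V : BB" "W : BB" "V ~= W"
  hence D': "V : D" "W : D" "~ lt V W" "~ lt W V" using UBD unfolding BB_def by auto
  have "~ tr V W"
  proof
   assume tr: "tr V W"
   have "R V W x <= kp | R W V x <= kp" using consistency[OF D'(1,2) tr a(2)] .
   thus False
   using odiam_transverse[OF D'(1,2) tr a M(1)] odiam_transverse[OF D'(2,1) tr_sym[OF D'(1,2) tr] a M(1)]
   BBfix VW UBD unfolding BB_def by blast
  qed
  thus "orth V W" using trichotomy[of V W] D' VW by auto
 qed
 moreover have "odiam V a x C" if V: "V : D" "ALL U:BB. ~ le V U" for V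
 proof -
  have "~ le V T" if "T : UB" for T using above[OF V(1) that] V(2) by auto
  hence "V ~: UB" "ALL T:UB. ~ lt V T" using le_refl V unfolding lt_def by auto
  thus ?thesis using M(2) V by (meson diff_le_self)
 qed
 ultimately show ?thesis using M(1) BBfix unfolding BB_def UB_def by blast
qed

definition loxodromic :: "'s => 'g => bool" where
 "loxodromic W g \<longleftrightarrow> W : D & act g W = W & (EX \<eta>>0. EX C. ALL k::nat. P W \<one> (g [^] k) >= \<eta> * real k - C)"

lemma loxodromicI:
 assumes W: "W : D" "g : CG" "act g W = W" "x : CG"
  and growth: "P W x (g [^] (2::nat) ** x) > P W x (g ** x) + kp"
 shows "loxodromic W g"
proof -
 define \<eta> where "\<eta> = P W x (g [^] (2::nat) ** x) - P W x (g ** x) - kp"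
 have eta: "\<eta> > 0" using growth unfolding \<eta>_def by simp
 have lin: "P W x (g [^] (Suc k) ** x) >= \<eta> * k" for k
  using linear_growth[OF W _ eta] unfolding \<eta>_def by simp
 have "P W \<one> (g [^] k) >= \<eta> * real k - (2 * P W x \<one> + \<eta>)" for k :: nat
 proof -
  have c: "g [^] k : CG" "g [^] k ** x : CG" using W by auto
  have "P W (g [^] k) (g [^] k ** x) = P W \<one> x"
   using P_fix[OF c(1) W(1) act_pow[OF W(2,1,3)], of \<one> x] W by simp
  moreover have "P W x (g [^] k ** x) <= P W x \<one> + P W \<one> (g [^] k) + P W (g [^] k) (g [^] k ** x)"
   using P_tri[OF W(1,4) one_closed c(2)] P_tri[OF W(1) one_closed c] by linarith
  moreover have "P W x (g [^] k ** x) >= \<eta> * real k - \<eta>"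
  proof (cases k)
   case 0
   thus ?thesis using P_nonneg[OF W(1,4) c(2)] eta by simp
  next
   case (Suc m)
   thus ?thesis using lin[of m] by (simp add: algebra_simps)
  qed
  ultimately show ?thesis using P_sym[OF W(1,4) one_closed] by linarith
 qed
 thus ?thesis using W eta unfolding loxodromic_def by blast
qed

theorem loxodromic_power:
 assumes a: "a : CG" and inf: "!!k::nat. k >= 1 ==> a [^] k ~= \<one>"
 shows "EX j::nat. j >= 1 & (EX W. loxodromic W (a [^] j))"
proof (rule ccontr)
 assume no: "~ ?thesis"
 obtain M BB C where M: "M >= 1" "ofam BB" "ALL U:BB. act (a [^] (M::nat)) U = U & U : udoms a \<one>"
  "ALL V:D. (ALL U:BB. ~ le V U) --> odiam V a \<one> C"
  using big_domains[OF a one_closed] by blast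
 define b where "b = a [^] M"
 have b: "b : CG" unfolding b_def using a by auto
 have bpow: "b [^] k = a [^] (M * k)" for k :: nat unfolding b_def using a by (simp add: nat_pow_pow)
 have BBD: "BB <= D" "finite BB" using M(2) ofam_finite unfolding ofam_def by auto
 have nl: "non_loxodromic U b" if U: "U : BB" for U
  unfolding non_loxodromic_def
 proof (intro allI ballI impI)
  fix i :: nat and x assume i: "1 <= i" and x: "x : CG"
  have UD: "U : D" "act b U = U" using U BBD M(3) unfolding b_def by auto
  show "P U x (b [^] (2 * i) ** x) <= P U x (b [^] i ** x) + kp"
  proof (rule ccontr)
   assume "~ ?thesis"
   hence "loxodromic U (b [^] i)"
   using loxodromicI[of U "b [^] i" x] UD b x act_pow[OF b UD] by (simp add: nat_pow_pow mult.commute)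
   hence "loxodromic U (a [^] (M * i))" unfolding bpow .
   moreover have "M * i >= 1" using M(1) i by simp
   ultimately show False using no by blast
  qed
 qed
 have unb: "EX m::nat. P U \<one> (b [^] m ** \<one>) > B" if U: "U : BB" for U B
 proof (rule ccontr)
  have UD: "U : D" using U BBD by auto
  assume as: "~ (EX m::nat. P U \<one> (b [^] m ** \<one>) > B)"
  have bd: "P U \<one> (a [^] i ** \<one>) <= B + sbound a \<one> M" for i :: nat
  proof -
   have "P U (a [^] (M * (i div M)) ** \<one>) (a [^] i ** \<one>) <= sbound a \<one> M"
   using sbound[OF UD a one_closed, of "i mod M" M "M * (i div M)"] M(1) by (simp add: less_imp_le)
   moreover have "P U \<one> (a [^] (M * (i div M)) ** \<one>) <= B" using as bpow by (metis not_le)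
   ultimately show ?thesis
   using P_tri[OF UD one_closed, of "a [^] (M * (i div M)) ** \<one>" "a [^] i ** \<one>"] a by simp
  qed
  have "odiam U a \<one> (2 * (B + sbound a \<one> M))" unfolding odiam_def
  proof (intro allI)
   fix i j :: nat
   show "P U (a [^] i ** \<one>) (a [^] j ** \<one>) <= 2 * (B + sbound a \<one> M)"
   using P_tri[OF UD _ one_closed, of "a [^] i ** \<one>" "a [^] j ** \<one>"] bd[of i] bd[of j]
   P_sym[OF UD one_closed, of "a [^] i ** \<one>"] a by simp
  qed
  thus False using M(3) U unfolding udoms_def by auto
 qed
 have rec: "EX C>=0. ALL N. ALL x0:CG. EX z:CG. ALL V:D. ALL i<=(N::nat).
  P V z (b [^] i ** z) <= C + (if orth V U then P V x0 (b [^] i ** x0) else 0)" if U: "U : BB" for U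
  using recentre[OF _ b _ nl[OF U] one_closed unb[OF U]] U BBD M(3) unfolding b_def by blast
 \<comment> \<open>\<open>F\<close> collects the big domains at which the point has been recentred.
   Domains below a big domain outside \<open>F\<close> are still uncontrolled, and for
   \<open>F = BB\<close> none is left.\<close>
 have "finite F ==> F <= BB ==> EX C>=0. ALL N. EX z:CG. ALL V:D. (ALL U:BB - F. ~ le V U) -->
   (ALL i<=(N::nat). P V z (b [^] i ** z) <= C)" for F
 proof (induction F rule: finite_induct)
  case empty
  have "P V \<one> (b [^] i ** \<one>) <= max 0 C" if "V : D" "ALL U:BB. ~ le V U" for V and i :: nat
  proof -
   have "P V (a [^] (0::nat) ** \<one>) (a [^] (M * i) ** \<one>) <= C" using M(4) that unfolding odiam_def by blast
   thus ?thesis unfolding bpow using a by simp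
  qed
  thus ?case by (intro exI[of _ "max 0 C"] conjI allI bexI[of _ \<one>]) auto
 next
  case (insert U F)
  then obtain C1 where C1: "C1 >= 0" "ALL N. EX z:CG. ALL V:D. (ALL U:BB - F. ~ le V U) -->
   (ALL i<=(N::nat). P V z (b [^] i ** z) <= C1)" by auto
  obtain C2 where C2: "C2 >= 0" "ALL N. ALL x0:CG. EX z:CG. ALL V:D. ALL i<=(N::nat).
   P V z (b [^] i ** z) <= C2 + (if orth V U then P V x0 (b [^] i ** x0) else 0)"
   using rec[of U] insert.prems by auto
  show ?case
  proof (intro exI[of _ "C1 + C2"] conjI allI)
   show "0 <= C1 + C2" using C1 C2 by simp
   fix N
   obtain x0 where x0: "x0 : CG" "ALL V:D. (ALL U:BB - F. ~ le V U) -->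
   (ALL i<=(N::nat). P V x0 (b [^] i ** x0) <= C1)" using C1 by blast
   obtain z where z: "z : CG" "ALL V:D. ALL i<=(N::nat).
   P V z (b [^] i ** z) <= C2 + (if orth V U then P V x0 (b [^] i ** x0) else 0)" using C2(2) x0(1) by blast
   have "P V z (b [^] i ** z) <= C1 + C2" if V: "V : D" "ALL U':BB - insert U F. ~ le V U'" and i: "i <= N" for V i
   proof (cases "orth V U")
   case True
   hence "~ le V U" using orth_not_le[of V U] V insert.prems BBD by auto
   hence "ALL U':BB - F. ~ le V U'" using V by auto
   hence "P V x0 (b [^] i ** x0) <= C1" using x0 V i by blast
   thus ?thesis using z(2) V i True by fastforce
   next
   case False
   thus ?thesis using z(2) V i C1(1) by fastforce
   qed
   thus "EX z:CG. ALL V:D. (ALL U':BB - insert U F. ~ le V U') -->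
   (ALL i<=N. P V z (b [^] i ** z) <= C1 + C2)" using z(1) by blast
  qed
 qed
 then obtain C where C: "ALL N. EX z:CG. ALL V:D. ALL i<=(N::nat). P V z (b [^] i ** z) <= C"
  using BBD by (metis Diff_cancel empty_iff order_refl)
 obtain tht where th: "ALL x:CG. ALL y:CG. (ALL V:D. P V x y <= C) --> d x y <= tht" using uniqueness by blast
 define S where "S = {g : CG. d \<one> g <= tht}"
 have S: "finite S" unfolding S_def by (rule finite_balls)
 \<comment> \<open>The ball \<open>S\<close> depends on \<open>C\<close> alone, so \<open>N\<close>
   may now be taken to be its cardinality: the \<open>card S + 1\<close> distinct elements
   \<open>inv z ** (b [^] i ** z)\<close> cannot all lie in it.\<close>
 obtain z where z: "z : CG" "ALL V:D. ALL i<=card S. P V z (b [^] i ** z) <= C" using C by blast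
 let ?h = "%i::nat. inv z ** (b [^] i ** z)"
 have "?h ` {..card S} <= S"
 proof (rule image_subsetI)
  fix i assume "i : {..card S}"
  hence "d z (b [^] i ** z) <= tht" using th z b by auto
  moreover have "d (z ** \<one>) (z ** ?h i) = d \<one> (?h i)" using d_act[of z \<one> "?h i"] z b by blast
  moreover have "z ** ?h i = b [^] i ** z" using z b by (simp add: m_assoc[symmetric])
  ultimately show "?h i : S" unfolding S_def using z b by auto
 qed
 moreover have "inj_on ?h {..card S}"
 proof (rule inj_onI)
  fix i j assume "?h i = ?h j"
  hence e: "b [^] i = b [^] j" using z b by simp
  have *: "~ i < j" if "b [^] i = b [^] j" for i j :: nat
  proof
   assume ij: "i < j"
   have "b [^] (j - i) ** b [^] i = b [^] j" using b ij nat_pow_mult by simp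
   hence "b [^] (j - i) = \<one>" using that b by (metis l_one nat_pow_closed one_closed right_cancel)
   moreover have "M * (j - i) >= 1" using M(1) ij by simp
   ultimately show False using inf bpow by metis
  qed
  show "i = j" using *[OF e] *[OF e[symmetric]] by simp
 qed
 ultimately have "card {..card S} <= card S" using card_inj_on_le S by blast
 thus False by simp
qed

end

section \<open>Stable translation lengths\<close>

text \<open>Fekete's lemma. As \<open>u 0\<close> may be positive, the estimate for multiples
  carries an extra \<open>u 0\<close>, which disappears after division by \<open>k\<close>.\<close>

lemma subadditive_limit:
 fixes u :: "nat => real"
 assumes sub: "!!i j. u (i + j) <= u i + u j" and nonneg: "!!i. u i >= 0"
 shows "EX l. (%k. u k / k) \<longlonglongrightarrow> l"
proof -
 define l where "l = (INF k\<in>{1..}. u k / real k)"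
 have bdd: "bdd_below ((%k. u k / real k) ` {1..})" using nonneg by (intro bdd_belowI[of _ 0]) auto
 have mult: "u (m * q) <= q * u m + u 0" for m q
 proof (induction q)
  case (Suc q)
  thus ?case using sub[of m "m * q"] by (simp add: algebra_simps)
 qed simp
 show ?thesis
 proof (intro exI[of _ l] LIMSEQ_I)
  fix e :: real assume e: "e > 0"
  have "EX m:{1..}. u m / real m < l + e / 2"
   using e unfolding l_def by (subst cINF_less_iff[symmetric, OF _ bdd]) auto
  then obtain m where m: "m >= 1" "u m / real m < l + e / 2" by auto
  define M where "M = Max (u ` {..m})"
  have M: "u i <= M" if "i <= m" for i unfolding M_def using that by (intro Max_ge) auto
  have M0: "M >= 0" using M[of 0] nonneg[of 0] by auto
  obtain N :: nat where N: "real N > 2 * (2 * M) / e" using reals_Archimedean2 by blast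
  show "EX no. ALL k>=no. norm (u k / real k - l) < e"
  proof (intro exI[of _ "max N 1"] allI impI)
   fix k assume k: "max N 1 <= k"
   have lower: "l <= u k / real k" unfolding l_def using k by (intro cINF_lower[OF bdd]) auto
   have "u k <= u (m * (k div m)) + u (k mod m)" using sub[of "m * (k div m)" "k mod m"] by simp
   also have "... <= (k div m) * u m + u 0 + u (k mod m)" using mult[of m "k div m"] by simp
   also have "... <= (k div m) * u m + 2 * M" using M[of 0] M[of "k mod m"] m by (simp add: less_imp_le)
   also have "(k div m) * u m <= real k / real m * u m"
   using nonneg[of m] m by (intro mult_right_mono) (simp_all add: pos_le_divide_eq flip: of_nat_mult)
   finally have "u k / real k <= u m / real m + 2 * M / real k"
   using k by (simp add: field_simps)
   moreover have "2 * M / real k < e / 2"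
   proof -
   have "real k > 4 * M / e" using N k by auto
   thus ?thesis using e k by (simp add: field_simps)
   qed
   ultimately show "norm (u k / real k - l) < e" using lower m by auto
  qed
 qed
qed

lemma (in group) inv_cancel_left [simp]:
 "x : CG ==> y : CG ==> inv x ** (x ** y) = y"
 "x : CG ==> y : CG ==> x ** (inv x ** y) = y"
 by (simp_all add: m_assoc[symmetric])

lemma (in group) conj_pow:
 assumes "h : CG" "g : CG"
 shows "(h ** g ** inv h) [^] (k::nat) = h ** g [^] k ** inv h"
proof (induction k)
 case (Suc k)
 have "h ** g [^] k ** inv h ** (h ** g ** inv h) = h ** g [^] k ** (inv h ** h) ** g ** inv h"
  using assms by (simp add: m_assoc del: l_inv)
 thus ?case using Suc assms by (simp add: m_assoc)
qed (use assms in simp)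

context hhg_distances
begin

definition tl :: "'s => 'g => real" where
 "tl W g = lim (%k::nat. P W \<one> (g [^] k) / real k)"

definition fixd :: "'g => 's => bool" where
 "fixd g W \<longleftrightarrow> g : CG & W : D & act g W = W"

lemma fixdD: "fixd g W ==> g : CG" "fixd g W ==> W : D" "fixd g W ==> act g W = W"
 unfolding fixd_def by auto

lemma fixd_pow: "fixd g W ==> fixd (g [^] (k::nat)) W"
 unfolding fixd_def using act_pow by auto

lemma fixd_mult: "fixd g W ==> fixd h W ==> fixd (g ** h) W"
 unfolding fixd_def using act_mult by auto

lemma fixd_inv: "fixd g W ==> fixd (inv g) W"
 unfolding fixd_def using act_fix_inv by auto

lemma fixd_conj: assumes "fixd g W" "h : CG" shows "fixd (h ** g ** inv h) (act h W)"
 using assms act_closed unfolding fixd_def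
 by (simp add: act_mult[symmetric] m_assoc) (simp add: act_mult)

lemma tl_tendsto: assumes "fixd g W" shows "(%k::nat. P W \<one> (g [^] k) / real k) \<longlonglongrightarrow> tl W g"
proof -
 note g = fixdD[OF assms]
 have "EX l. (%k::nat. P W \<one> (g [^] k) / real k) \<longlonglongrightarrow> l"
 proof (rule subadditive_limit)
  fix i j :: nat
  have "P W (g [^] i) (g [^] (i + j)) = P W \<one> (g [^] j)"
   using P_fix[OF _ g(2) act_pow[OF g], of i \<one> "g [^] j"] g by (simp add: nat_pow_mult)
  thus "P W \<one> (g [^] (i + j)) <= P W \<one> (g [^] i) + P W \<one> (g [^] j)"
   using P_tri[OF g(2) one_closed, of "g [^] i" "g [^] (i + j)"] g by simp
  show "0 <= P W \<one> (g [^] i)" using P_nonneg g by auto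
 qed
 thus ?thesis unfolding tl_def using convergent_LIMSEQ_iff convergent_def by blast
qed

lemma tl_nonneg: assumes "fixd g W" shows "tl W g >= 0"
 by (rule LIMSEQ_le_const[OF tl_tendsto[OF assms]])
  (use P_nonneg fixdD[OF assms] in "auto intro!: exI[of _ 0] divide_nonneg_nonneg")

lemma tl_base: assumes "fixd g W" "x : CG"
 shows "(%k::nat. P W x (g [^] k ** x) / real k) \<longlonglongrightarrow> tl W g"
proof -
 note g = fixdD[OF assms(1)]
 have "(%k::nat. P W x (g [^] k ** x) / real k - P W \<one> (g [^] k) / real k) \<longlonglongrightarrow> 0"
 proof (rule tendsto_rabs_zero_cancel, rule tendsto_sandwich[OF _ _ tendsto_const])
  have "abs(P W x (g [^] k ** x) - P W \<one> (g [^] k)) <= 2 * P W x \<one>" for k :: nat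
  proof -
   have c: "g [^] k : CG" "g [^] k ** x : CG" using g assms by auto
   have "P W (g [^] k) (g [^] k ** x) = P W \<one> x"
   using P_fix[OF c(1) g(2) act_pow[OF g], of \<one> x] assms g by simp
   thus ?thesis
   using P_tri[OF g(2) assms(2) one_closed c(2)] P_tri[OF g(2) one_closed c(1,2)]
   P_tri[OF g(2) one_closed assms(2) c(1)] P_tri[OF g(2) assms(2) c(2,1)]
   P_sym[OF g(2) one_closed assms(2)] P_sym[OF g(2) c(1,2)] by linarith
  qed
  thus "\<forall>\<^sub>F k in sequentially. abs(P W x (g [^] k ** x) / real k - P W \<one> (g [^] k) / real k) <= 2 * P W x \<one> / real k"
   by (intro always_eventually allI) (simp add: diff_divide_distrib[symmetric] divide_right_mono)
  show "(%k. 2 * P W x \<one> / real k) \<longlonglongrightarrow> 0" by (rule lim_const_over_n)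
 qed auto
 from tendsto_add[OF this tl_tendsto[OF assms(1)]] show ?thesis by simp
qed

lemma tl_pow: assumes "fixd g W" shows "tl W (g [^] (j::nat)) = j * tl W g"
proof (cases "j = 0")
 case True
 have "(%k::nat. P W \<one> (\<one> [^] k) / real k) \<longlonglongrightarrow> 0"
  using lim_const_over_n[of "P W \<one> \<one>"] by simp
 thus ?thesis using True LIMSEQ_unique tl_tendsto[OF fixd_pow[OF assms, of 0]] by fastforce
next
 case False
 have "((%k::nat. P W \<one> (g [^] k) / real k) \<circ> (%k. j * k)) \<longlonglongrightarrow> tl W g"
  by (rule LIMSEQ_subseq_LIMSEQ[OF tl_tendsto[OF assms]]) (use False in "auto simp: strict_mono_def")
 hence "(%k. real j * (((%k::nat. P W \<one> (g [^] k) / real k) \<circ> (%k. j * k)) k)) \<longlonglongrightarrow> j * tl W g"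
  by (rule tendsto_mult_left)
 also have "(%k. real j * (((%k::nat. P W \<one> (g [^] k) / real k) \<circ> (%k. j * k)) k)) =
   (%k::nat. P W \<one> ((g [^] j) [^] k) / real k)"
  using False fixdD[OF assms] by (auto simp: fun_eq_iff nat_pow_pow)
 finally show ?thesis using LIMSEQ_unique tl_tendsto[OF fixd_pow[OF assms]] by blast
qed

lemma tl_inv: assumes "fixd g W" shows "tl W (inv g) = tl W g"
proof -
 note g = fixdD[OF assms]
 have "P W \<one> (inv g [^] k) = P W \<one> (g [^] k)" for k :: nat
 proof -
  have "P W (g [^] k ** \<one>) (g [^] k ** inv g [^] k) = P W \<one> (inv g [^] k)"
   using P_fix[OF _ g(2) act_pow[OF g], of k \<one> "inv g [^] k"] g by simp
  moreover have "g [^] k ** inv g [^] k = \<one>" using g by (simp add: nat_pow_inv)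
  ultimately show ?thesis using P_sym[OF g(2), of \<one> "g [^] k"] g by simp
 qed
 thus ?thesis unfolding tl_def by simp
qed

lemma tl_conj: assumes "fixd g W" "h : CG" shows "tl (act h W) (h ** g ** inv h) = tl W g"
proof -
 note g = fixdD[OF assms(1)]
 have "P (act h W) \<one> ((h ** g ** inv h) [^] k) = P W (inv h) (g [^] k ** inv h)" for k :: nat
  using P_act[OF assms(2) g(2), of "inv h" "g [^] k ** inv h"] conj_pow[OF assms(2) g(1)] g assms
  by (simp add: m_assoc[symmetric])
 hence "(%k::nat. P (act h W) \<one> ((h ** g ** inv h) [^] k) / real k) \<longlonglongrightarrow> tl W g"
  using tl_base[OF assms(1), of "inv h"] assms by simp
 thus ?thesis using LIMSEQ_unique tl_tendsto[OF fixd_conj[OF assms]] by blast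
qed

lemma commute_pow:
 assumes "g : CG" "h : CG" "g ** h = h ** g"
 shows "(g ** h) [^] (k::nat) = g [^] k ** h [^] k"
 using assms pow_mult_distrib by blast

lemma tl_mult_le:
 assumes "fixd g W" "fixd h W" "g ** h = h ** g"
 shows "tl W (g ** h) <= tl W g + tl W h"
proof (rule LIMSEQ_le[OF tl_tendsto[OF fixd_mult[OF assms(1,2)]] tendsto_add[OF tl_tendsto[OF assms(1)] tl_tendsto[OF assms(2)]]])
 note g = fixdD[OF assms(1)] and h = fixdD[OF assms(2)]
 have "P W \<one> ((g ** h) [^] k) <= P W \<one> (g [^] k) + P W \<one> (h [^] k)" for k :: nat
 proof -
  have c: "g [^] k : CG" "h [^] k : CG" "g [^] k ** h [^] k : CG" using g h by auto
  have "P W (g [^] k) (g [^] k ** h [^] k) = P W \<one> (h [^] k)"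
   using P_fix[OF c(1) g(2) act_pow[OF g] one_closed c(2)] c by simp
  thus ?thesis using P_tri[OF g(2) one_closed c(1,3)] commute_pow[OF g(1) h(1) assms(3)] by simp
 qed
 thus "EX N. ALL k>=N. P W \<one> ((g ** h) [^] k) / real k <= P W \<one> (g [^] k) / real k + P W \<one> (h [^] k) / real k"
  by (auto simp: add_divide_distrib[symmetric] divide_right_mono)
qed

text \<open>The four-point inequality for the neutral element, \<open>g [^] k ** h [^] k\<close>,
  \<open>g [^] k\<close> and \<open>h [^] k\<close>, divided by \<open>k\<close>; the additive
  constant vanishes in the limit.\<close>

lemma tl_four_point:
 assumes "fixd g W" "fixd h W" "g ** h = h ** g"
 shows "tl W (g ** h) + tl W (inv g ** h) <= max (2 * tl W g) (2 * tl W h)"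
proof -
 note g = fixdD[OF assms(1)] and h = fixdD[OF assms(2)]
 have comm: "inv g ** h = h ** inv g"
  using assms(3) g h by (metis inv_closed inv_solve_left inv_solve_right m_assoc m_closed)
 define s where "s k = P W \<one> ((g ** h) [^] k) / real k + P W \<one> ((inv g ** h) [^] k) / real k" for k :: nat
 define t where "t k = max (2 * (P W \<one> (g [^] k) / real k)) (2 * (P W \<one> (h [^] k) / real k)) + kp / real k" for k :: nat
 have "s \<longlonglongrightarrow> tl W (g ** h) + tl W (inv g ** h)" unfolding s_def
  by (intro tendsto_add tl_tendsto fixd_mult fixd_inv assms)
 moreover have "t \<longlonglongrightarrow> max (2 * tl W g) (2 * tl W h) + 0" unfolding t_def
  by (intro tendsto_add tendsto_max tendsto_mult_left tl_tendsto assms lim_const_over_n)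
 moreover have "s k <= t k" for k
 proof -
  have c: "g [^] k : CG" "h [^] k : CG" "g [^] k ** h [^] k : CG"
   "inv g [^] k : CG" "inv g [^] k ** h [^] k : CG" using g h by auto
  have gg: "g [^] k ** inv g [^] k = \<one>" using g by (simp add: nat_pow_inv)
  have hg: "h [^] k ** g [^] k = g [^] k ** h [^] k"
   using commute_pow[OF g(1) h(1) assms(3)] commute_pow[OF h(1) g(1) assms(3)[symmetric]] assms(3) by simp
  have e1: "P W \<one> ((g ** h) [^] k) = P W \<one> (g [^] k ** h [^] k)" using commute_pow[OF g(1) h(1) assms(3)] by simp
  have "P W (g [^] k ** \<one>) (g [^] k ** (inv g [^] k ** h [^] k)) = P W \<one> (inv g [^] k ** h [^] k)"
   by (rule P_fix[OF c(1) g(2) act_pow[OF g] one_closed c(5)])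
  moreover have "g [^] k ** (inv g [^] k ** h [^] k) = h [^] k" using c gg by (simp add: m_assoc[symmetric])
  ultimately have e2: "P W \<one> ((inv g ** h) [^] k) = P W (g [^] k) (h [^] k)"
   using commute_pow[of "inv g" h k] g h comm c by simp
  have e3: "P W (g [^] k) (g [^] k ** h [^] k) = P W \<one> (h [^] k)"
   using P_fix[OF c(1) g(2) act_pow[OF g] one_closed c(2)] c by simp
  have e4: "P W (h [^] k) (g [^] k ** h [^] k) = P W \<one> (g [^] k)"
   using P_fix[OF c(2) h(2) act_pow[OF h] one_closed c(1)] c hg by simp
  have "P W \<one> (g [^] k ** h [^] k) + P W (g [^] k) (h [^] k) <=
   max (P W \<one> (g [^] k) + P W (g [^] k ** h [^] k) (h [^] k)) (P W \<one> (h [^] k) + P W (g [^] k ** h [^] k) (g [^] k)) + kp"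
   by (rule four_point[OF g(2) one_closed c(3,1,2)])
  hence "P W \<one> ((g ** h) [^] k) + P W \<one> ((inv g ** h) [^] k) <= max (2 * P W \<one> (g [^] k)) (2 * P W \<one> (h [^] k)) + kp"
   unfolding e1 e2 using e3 e4 P_sym[OF g(2) c(3,1)] P_sym[OF g(2) c(3,2)] by simp
  hence "(P W \<one> ((g ** h) [^] k) + P W \<one> ((inv g ** h) [^] k)) / real k <=
   (max (2 * P W \<one> (g [^] k)) (2 * P W \<one> (h [^] k)) + kp) / real k" by (rule divide_right_mono) simp
  thus ?thesis unfolding s_def t_def by (simp add: add_divide_distrib max_divide_distrib_right)
 qed
 ultimately show ?thesis using LIMSEQ_le[of s _ t] by fastforce
qed

text \<open>Commuting isometries of a hyperbolic space with the same translation length differ, up to sign, by one of length zero.\<close>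
lemma tl_dichotomy:
 assumes "fixd g W" "fixd h W" "g ** h = h ** g" and eq: "tl W g = tl W h"
 shows "tl W (g ** h) = 0 | tl W (inv g ** h) = 0"
proof -
 note g = fixdD[OF assms(1)] and h = fixdD[OF assms(2)]
 have comm: "inv g ** h = h ** inv g"
  using assms(3) g h by (metis inv_closed inv_solve_left inv_solve_right m_assoc m_closed)
 have f: "fixd (g ** h) W" "fixd (inv g ** h) W"
  using fixd_mult fixd_inv assms by auto
 have 1: "tl W (g ** h) + tl W (inv g ** h) <= 2 * tl W h" using tl_four_point[OF assms(1-3)] eq by simp
 have uw: "(g ** h) ** (inv g ** h) = h [^] (2::nat)"
 proof -
  have "(g ** h) ** (inv g ** h) = (h ** g) ** (inv g ** h)" using assms(3) by simp
  also have "... = h ** ((g ** inv g) ** h)" using g h by (simp add: m_assoc del: r_inv)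
  also have "... = h [^] (2::nat)" using g h by (simp add: numeral_2_eq_2)
  finally show ?thesis .
 qed
 have wu: "inv (g ** h) ** (inv g ** h) = inv (g [^] (2::nat))"
 proof -
  have "inv (g ** h) ** (inv g ** h) = inv (g ** h) ** (h ** inv g)" using comm by simp
  also have "... = inv (h ** g) ** (h ** inv g)" using assms(3) by simp
  also have "... = inv g ** ((inv h ** h) ** inv g)" using g h by (simp add: inv_mult_group m_assoc del: l_inv)
  also have "... = inv (g [^] (2::nat))" using g h by (simp add: numeral_2_eq_2 inv_mult_group)
  finally show ?thesis .
 qed
 have "(g ** h) ** (inv g ** h) = (inv g ** h) ** (g ** h)"
 proof -
  have "(inv g ** h) ** (g ** h) = (h ** inv g) ** (g ** h)" using comm by simp
  also have "... = h ** ((inv g ** g) ** h)" using g h by (simp add: m_assoc del: l_inv)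
  also have "... = h [^] (2::nat)" using g h by (simp add: numeral_2_eq_2)
  finally show ?thesis using uw by simp
 qed
 \<comment> \<open>The inequality is used a second time, for \<open>g ** h\<close> and
   \<open>inv g ** h\<close>: their product is the square of \<open>h\<close>, and their quotient is
   the inverse square of \<open>g\<close>. So one of their two lengths is at least
   \<open>2 * tl W h\<close>, which by the first use leaves zero for the other.\<close>
 hence "tl W (h [^] (2::nat)) + tl W (inv (g [^] (2::nat))) <= max (2 * tl W (g ** h)) (2 * tl W (inv g ** h))"
  using tl_four_point[OF f] uw wu by simp
 hence "4 * tl W h <= max (2 * tl W (g ** h)) (2 * tl W (inv g ** h))"
  using tl_pow[OF assms(2), of 2] tl_pow[OF assms(1), of 2] tl_inv[OF fixd_pow[OF assms(1), of 2]] eq by simp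
 thus ?thesis using 1 tl_nonneg[OF f(1)] tl_nonneg[OF f(2)] by (auto simp: max_def split: if_splits)
qed

lemma tl_zero_of_rel:
 assumes "fixd g V" "fixd g W" "lt V W | tr V W"
 shows "tl W g = 0"
proof -
 note V = fixdD[OF assms(1)] and W = fixdD[OF assms(2)]
 obtain B where B: "ALL m::nat. P W \<one> (g [^] m ** \<one>) <= B"
  using fixed_rho_bounded[of V W g 1 \<one>] V W assms(3) by auto
 have "(%k::nat. P W \<one> (g [^] k) / real k) \<longlonglongrightarrow> 0"
 proof (rule tendsto_sandwich[OF _ _ tendsto_const lim_const_over_n])
  show "\<forall>\<^sub>F k in sequentially. 0 <= P W \<one> (g [^] k) / real k"
   by (intro always_eventually allI divide_nonneg_nonneg P_nonneg W) (use W in auto)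
  show "\<forall>\<^sub>F k in sequentially. P W \<one> (g [^] k) / real k <= B / real k"
   by (intro always_eventually allI divide_right_mono) (use B W in auto)
 qed
 thus ?thesis using LIMSEQ_unique tl_tendsto[OF assms(2)] by blast
qed

lemma tl_pos_orth:
 assumes "fixd g V" "fixd g W" "tl V g > 0" "tl W g > 0" "V ~= W"
 shows "orth V W"
 using tl_zero_of_rel[OF assms(1,2)] tl_zero_of_rel[OF assms(2,1)] assms trichotomy[of V W] fixdD
 by fastforce

lemma loxodromic_tl: assumes "g : CG" "loxodromic W g" shows "fixd g W & tl W g > 0"
proof -
 have f: "fixd g W" using assms unfolding loxodromic_def fixd_def by auto
 obtain \<eta> C where e: "\<eta> > 0" "ALL k::nat. P W \<one> (g [^] k) >= \<eta> * real k - C"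
  using assms unfolding loxodromic_def by blast
 have "(%k::nat. \<eta> - C / real k) \<longlonglongrightarrow> \<eta> - 0" by (intro tendsto_diff tendsto_const lim_const_over_n)
 hence "\<eta> - 0 <= tl W g"
 proof (rule LIMSEQ_le[OF _ tl_tendsto[OF f]], intro exI[of _ 1] allI impI)
  fix k :: nat assume k: "1 <= k"
  have "(\<eta> * real k - C) / real k <= P W \<one> (g [^] k) / real k" using e(2) by (intro divide_right_mono) auto
  thus "\<eta> - C / real k <= P W \<one> (g [^] k) / real k" using k by (simp add: diff_divide_distrib)
 qed
 thus ?thesis using f e by auto
qed

end

section \<open>Domains detected by an abelian subgroup\<close>

context hhg_distances
begin

definition ldoms :: "'g set => 's set" where
 "ldoms B = {W. EX h:B. fixd h W & tl W h > 0}"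

definition axd :: "'g => 's set" where
 "axd h = {W. EX j::nat. j >= 1 & fixd (h [^] j) W & tl W (h [^] j) > 0}"

lemma tl_pow_pos: "fixd g W ==> tl W g > 0 ==> k >= 1 ==> tl W (g [^] (k::nat)) > 0"
 by (simp add: tl_pow)

lemma axd_orth: assumes "h : CG" shows "ofam (axd h)"
 unfolding ofam_def
proof (intro conjI ballI impI)
 show "axd h <= D" unfolding axd_def fixd_def by auto
 fix V W assume VW: "V : axd h" "W : axd h" "V ~= W"
 obtain i :: nat where i: "i >= 1" "fixd (h [^] i) V" "tl V (h [^] i) > 0"
  using VW(1) unfolding axd_def by auto
 obtain j :: nat where j: "j >= 1" "fixd (h [^] j) W" "tl W (h [^] j) > 0"
  using VW(2) unfolding axd_def by auto
 have "fixd (h [^] (i * j)) V" "tl V (h [^] (i * j)) > 0"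
  using fixd_pow[OF i(2), of j] tl_pow_pos[OF i(2,3) j(1)] assms by (simp_all add: nat_pow_pow)
 moreover have "fixd (h [^] (i * j)) W" "tl W (h [^] (i * j)) > 0"
  using fixd_pow[OF j(2), of i] tl_pow_pos[OF j(2,3) i(1)] assms by (simp_all add: nat_pow_pow mult.commute)
 ultimately show "orth V W" using tl_pos_orth VW(3) by blast
qed

text \<open>\<open>k\<close> commutes with \<open>h\<close> and so permutes the domains on which
  \<open>h\<close> translates. These are pairwise orthogonal, hence at most \<open>n\<close> in
  number; some power of \<open>k\<close> with exponent at most \<open>n\<close> fixes
  \<open>W\<close>, and \<open>fact n\<close> is a multiple of all these exponents.\<close>

lemma length_domain_period:
 assumes B: "B <= CG" "!!g h. g : B ==> h : B ==> g ** h = h ** g"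
  and k: "k : B" and W: "W : ldoms B"
 shows "fixd (k [^] (fact n :: nat)) W"
proof -
 obtain h where h: "h : B" "fixd h W" "tl W h > 0" using W unfolding ldoms_def by auto
 have c: "h : CG" "k : CG" using B h k by auto
 have WD: "W : D" using fixdD[OF h(2)] by auto
 let ?W = "%i::nat. act (inv (k [^] i)) W"
 have mem: "?W i : axd h" for i
 proof -
  have ki: "inv (k [^] i) : CG" "k [^] i : CG" using c by auto
  have kh: "k [^] i ** h = h ** k [^] i" using group_commutes_pow[OF B(2)[OF k h(1)] c(2,1)] by simp
  hence "inv (k [^] i) ** h ** inv (inv (k [^] i)) = h" using c ki by (simp add: m_assoc kh[symmetric])
  hence "fixd h (?W i)" "tl (?W i) h > 0"
   using fixd_conj[OF h(2) ki(1)] tl_conj[OF h(2) ki(1)] h(3) by auto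
  thus ?thesis unfolding axd_def using c by (intro CollectI exI[of _ 1]) simp
 qed
 have "finite (axd h)" "card (axd h) <= n" using ofam_finite axd_orth c by auto
 hence "card (?W ` {..n}) <= n" using mem card_mono[of "axd h" "?W ` {..n}"] by (meson image_subsetI order_trans)
 hence "~ inj_on ?W {..n}" using card_image[of ?W "{..n}"] by auto
 then obtain i j where ij: "i <= n" "j <= n" "i ~= j" "?W i = ?W j" unfolding inj_on_def by auto
 have "EX i j. i < j & j <= n & ?W i = ?W j" using ij by (metis linorder_neqE_nat)
 then obtain i j where "i < j" "j <= n" "?W i = ?W j" by blast
 hence "act (k [^] (j - i)) W = W" "1 <= j - i" "j - i <= n"
  using act_inv_pow_eq[OF c(2) WD, of i j] by auto
 thus ?thesis using act_pow_fact[OF c(2) WD] WD c unfolding fixd_def by auto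
qed

text \<open>Two domains detected by different elements are also detected by a common one: of the
  three elements \<open>g\<close>, \<open>g ** h\<close> and \<open>g ** h [^] 2\<close>, at most
  one has length zero on each of the two domains. Then \<open>tl_pos_orth\<close> applies.\<close>

lemma ldoms_orth:
 assumes B: "subgroup B G" "!!g h. g : B ==> h : B ==> g ** h = h ** g"
 shows "ofam (ldoms B)"
 unfolding ofam_def
proof (intro conjI ballI impI)
 show "ldoms B <= D" unfolding ldoms_def fixd_def by auto
 fix V W assume VW: "V : ldoms B" "W : ldoms B" "V ~= W"
 have Bc: "B <= CG" using subgroup.subset[OF B(1)] .
 note per = length_domain_period[OF Bc B(2)]
 obtain g0 where g0: "g0 : B" "fixd g0 V" "tl V g0 > 0" using VW(1) unfolding ldoms_def by auto
 obtain h0 where h0: "h0 : B" "fixd h0 W" "tl W h0 > 0" using VW(2) unfolding ldoms_def by auto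
 define g h where "g = g0 [^] (fact n :: nat)" and "h = h0 [^] (fact n :: nat)"
 have f1: "fact n >= (1::nat)" by (simp add: fact_ge_1)
 have powB: "b [^] (k::nat) : B" if "b : B" for b k
  by (induction k) (use subgroup.one_closed[OF B(1)] subgroup.m_closed[OF B(1)] that in auto)
 have gB: "g : B" "h : B" unfolding g_def h_def using powB g0 h0 by auto
 have fx: "fixd g V" "fixd g W" "fixd h V" "fixd h W"
  unfolding g_def h_def using per VW g0 h0 by auto
 have pos: "tl V g > 0" "tl W h > 0" unfolding g_def h_def using tl_pow_pos g0 h0 f1 by auto
 have c: "g : CG" "h : CG" using gB Bc by auto
 have gh: "g ** h = h ** g" using B(2) gB by auto
 define e where "e k = g ** h [^] (k::nat)" for k
 have eB: "e k : B" for k unfolding e_def using subgroup.m_closed[OF B(1)] gB powB by auto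
 have fe: "fixd (e k) U" if "U : {V, W}" for k U
  unfolding e_def using that fx fixd_mult fixd_pow by auto
 have one: "tl U h = 0 & tl U g = 0" if U: "U : {V, W}" and kl: "k < l" and z: "tl U (e k) = 0" "tl U (e l) = 0" for U k l
 proof -
  have fU: "fixd g U" "fixd h U" using U fx by auto
  have iB: "inv (e k) : B" using subgroup.m_inv_closed[OF B(1) eB] .
  have "inv (e k) ** e l = h [^] (l - k)"
  proof -
   have "e k ** h [^] (l - k) = e l" unfolding e_def using c kl by (simp add: m_assoc nat_pow_mult)
   thus ?thesis using c eB Bc by (metis inv_cancel_left(1) nat_pow_closed subsetD)
  qed
  hence "tl U (h [^] (l - k)) <= 0"
   using tl_mult_le[OF fixd_inv[OF fe[OF U, of k]] fe[OF U, of l] B(2)[OF iB eB]] tl_inv[OF fe[OF U, of k]] z by simp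
  hence h: "tl U h = 0" using tl_pow[OF fU(2), of "l - k"] tl_nonneg[OF fU(2)] kl
   by (simp add: mult_le_0_iff)
  have iB: "inv (h [^] k) : B" using subgroup.m_inv_closed[OF B(1) powB] gB by auto
  have "e k ** inv (h [^] k) = g" unfolding e_def using c by (simp add: m_assoc)
  hence "tl U g <= tl U (e k) + tl U (h [^] k)"
   using tl_mult_le[OF fe[OF U, of k] fixd_inv[OF fixd_pow[OF fU(2), of k]] B(2)[OF eB iB]]
   tl_inv[OF fixd_pow[OF fU(2), of k]] by simp
  thus ?thesis using h z tl_pow[OF fU(2), of k] tl_nonneg[OF fU(1)] by simp
 qed
 have atmost: "~ (tl U (e k) = 0 & tl U (e l) = 0)" if "U : {V, W}" "k < l" for U k l
  using one[OF that] pos that by auto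
 have "EX k:{0,1,2}. tl V (e k) ~= 0 & tl W (e k) ~= 0"
  using atmost[of V 0 1] atmost[of V 0 2] atmost[of V 1 2] atmost[of W 0 1] atmost[of W 0 2] atmost[of W 1 2] by force
 then obtain k where "tl V (e k) ~= 0" "tl W (e k) ~= 0" by blast
 thus "orth V W" using tl_pos_orth[of "e k" V W] fe[of V k] fe[of W k] tl_nonneg[OF fe[of V k]] tl_nonneg[OF fe[of W k]] VW(3)
  by (simp add: order_less_le)
qed

text \<open>Some power of \<open>a\<close> is loxodromic, and homogeneity of the length transfers
  positivity to the uniform exponent \<open>fact n\<close>.\<close>

lemma length_pos:
 assumes B: "subgroup B G" "!!g h. g : B ==> h : B ==> g ** h = h ** g"
  and a: "a : B" "!!k::nat. k >= 1 ==> a [^] k ~= \<one>"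
 shows "EX W:ldoms B. tl W (a [^] (fact n :: nat)) > 0"
proof -
 have ac: "a : CG" using a B subgroup.subset by blast
 obtain j :: nat and W where j: "j >= 1" "loxodromic W (a [^] j)" using loxodromic_power[OF ac a(2)] by blast
 have f: "fixd (a [^] j) W" "tl W (a [^] j) > 0" using loxodromic_tl[OF _ j(2)] ac by auto
 have "a [^] j : B"
  by (induction j) (use subgroup.one_closed[OF B(1)] subgroup.m_closed[OF B(1)] a in auto)
 hence W: "W : ldoms B" using f unfolding ldoms_def by auto
 have fq: "fixd (a [^] (fact n :: nat)) W"
  using length_domain_period[OF subgroup.subset[OF B(1)] B(2) a(1) W] .
 have "real j * tl W (a [^] (fact n :: nat)) = fact n * tl W (a [^] j)"
  using tl_pow[OF fq, of j] tl_pow[OF f(1), of "fact n"] ac by (simp add: nat_pow_pow mult.commute)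
 hence "real j * tl W (a [^] (fact n :: nat)) > 0" using f(2) by simp
 thus ?thesis using W by (auto simp: zero_less_mult_iff)
qed

lemma ldoms_conj:
 assumes h: "h : CG" and B: "B <= CG" "!!b. b : B ==> EX m::nat>=1. h ** b [^] m ** inv h : B"
  and W: "W : ldoms B"
 shows "act h W : ldoms B"
proof -
 obtain b where b: "b : B" "fixd b W" "tl W b > 0" using W unfolding ldoms_def by auto
 obtain m :: nat where m: "m >= 1" "h ** b [^] m ** inv h : B" using B(2)[OF b(1)] by blast
 have "fixd (h ** b [^] m ** inv h) (act h W)" "tl (act h W) (h ** b [^] m ** inv h) > 0"
  using fixd_conj[OF fixd_pow[OF b(2), of m] h] tl_conj[OF fixd_pow[OF b(2), of m] h]
   tl_pow_pos[OF b(2,3) m(1)] by auto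
 thus ?thesis using m(2) unfolding ldoms_def by auto
qed

end

section \<open>Finitely many conjugation actions\<close>

lemma (in group) int_pow_in_subgroup:
 assumes "subgroup A G" "x : A" shows "x [^] (k::int) : A"
proof -
 have p: "x [^] (m::nat) : A" for m
  by (induction m) (use subgroup.one_closed[OF assms(1)] subgroup.m_closed[OF assms(1)] assms(2) in auto)
 show ?thesis
 proof (cases k)
  case (nonneg m)
  thus ?thesis using p by (simp add: int_pow_int)
 next
  case (neg m)
  have "x : CG" using subgroup.subset[OF assms(1)] assms(2) by auto
  hence "x [^] k = inv (x [^] Suc m)" unfolding neg by (simp del: nat_pow_Suc of_nat_Suc add: int_pow_neg int_pow_int)
  thus ?thesis using subgroup.m_inv_closed[OF assms(1) p[of "Suc m"]] by simp
 qed
qed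

text \<open>Two of the powers up to the index lie in the same coset, so a positive power with
  exponent at most the index lies in \<open>H\<close>; its factorial is divisible by all these
  exponents.\<close>

lemma (in group) finite_index_power:
 assumes H: "subgroup H G" "finite (rcosets H)"
 shows "EX k>=(1::nat). ALL g:CG. g [^] k : H"
proof -
 define N where "N = card (rcosets H)"
 have "g [^] (fact N :: nat) : H" if g: "g : CG" for g
 proof -
  have "(%i::nat. H #> g [^] i) ` {..N} <= rcosets H" using g by (auto simp: RCOSETS_def)
  hence "card ((%i::nat. H #> g [^] i) ` {..N}) <= N" unfolding N_def by (intro card_mono H)
  hence "~ inj_on (%i::nat. H #> g [^] i) {..N}" using card_image by fastforce
  then obtain i j :: nat where ij: "i < j" "j <= N" "H #> g [^] i = H #> g [^] j"
   unfolding inj_on_def by (metis atMost_iff linorder_neqE_nat)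
  have "g [^] j : H #> g [^] i" using ij(3) rcos_self[OF _ H(1), of "g [^] j"] g by simp
  then obtain h where h: "h : H" "g [^] j = h ** g [^] i" unfolding r_coset_def by auto
  have hc: "h : CG" using h subgroup.subset[OF H(1)] by auto
  have "g [^] (j - i) ** g [^] i = h ** g [^] i" using h(2) ij(1) g by (simp add: nat_pow_mult)
  hence m: "g [^] (j - i) : H" using h hc g by simp
  have "(j - i) dvd fact N" by (rule dvd_fact) (use ij in auto)
  then obtain q where q: "fact N = (j - i) * q" by blast
  show ?thesis using int_pow_in_subgroup[OF H(1) m, of "int q"] g unfolding q by (simp add: nat_pow_pow int_pow_int)
 qed
 thus ?thesis by (intro exI[of _ "fact N"]) auto
qed

text \<open>
  The translation lengths of \<open>g a g\<^sup>-\<^sup>1\<close> on the finitely many domains that detect \<open>A\<close> take finitely many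
  values as functions of \<open>a\<close>, and two conjugations with the same values differ on each domain by a sign.
\<close>
theorem (in group) finitely_many_conjugations:
 fixes d P R RR kp act n and D :: "'s set" and le orth :: "'s => 's => bool"
 assumes H: "subgroup H G" "finite (rcosets H)" and hh: "hhg_distances D le orth n (G(|carrier := H|)) d P R RR kp act"
  and A: "subgroup A G" "!!a b. a : A ==> b : A ==> a ** b = b ** a"
  and tf: "!!a k. a : A ==> a ~= \<one> ==> (k::nat) >= 1 ==> a [^] k ~= \<one>"
  and comm: "!!g. g : CG ==> EX m::nat>=1. ALL a:A. g ** a [^] m ** inv g : A"
 shows "EX T<=CG. finite T &
  (ALL g:CG. EX t:T. EX m::nat>=1. ALL a:A. g ** a [^] m ** inv g = t ** a [^] m ** inv t)"
proof -
 interpret hh: hhg_distances D le orth n "G(|carrier := H|)" d P R RR kp act by (rule hh)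
 note pw = nat_pow_consistent[of _ _ H, symmetric]
 have Hc: "H <= CG" and Ac: "A <= CG" using subgroup.subset H A by auto
 have Hinv: "inv\<^bsub>G(|carrier := H|)\<^esub> h = inv h" if "h : H" for h using m_inv_consistent[OF H(1) that] .
 have powA: "a [^] (k::nat) : A" if "a : A" for a k
  by (induction k) (use subgroup.one_closed[OF A(1)] subgroup.m_closed[OF A(1)] that in auto)
 have powH: "a [^] (k::nat) : H" if "a : H" for a k
  by (induction k) (use subgroup.one_closed[OF H(1)] subgroup.m_closed[OF H(1)] that in auto)
 define B where "B = A \<inter> H"
 have BG: "subgroup B (G(|carrier := H|))" unfolding B_def
  using subgroups_Inter_pair[OF A(1) H(1)] subgroup_incl H(1) by (metis inf_le2)
 have Bcomm: "g **\<^bsub>G(|carrier := H|)\<^esub> h = h **\<^bsub>G(|carrier := H|)\<^esub> g" if "g : B" "h : B" for g h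
  using A(2) that unfolding B_def by auto
 define LD where "LD = hh.ldoms B"
 have "hh.ofam LD" unfolding LD_def by (rule hh.ldoms_orth[OF BG Bcomm])
 hence finLD: "finite LD" and LDD: "LD <= D" using hh.ofam_finite unfolding hh.ofam_def by auto
 obtain q where q: "q >= (1::nat)" "!!g. g : CG ==> g [^] q : H" using finite_index_power[OF H] by blast
 define Q where "Q = q * fact n"
 have Q: "Q >= 1" unfolding Q_def using q by (simp add: fact_ge_1 Suc_leI)
 have aQ: "hh.fixd (a [^] Q) W" if "a : A" "W : LD" for a W
 proof -
  have "a [^] q : B" using that powA q(2) Ac unfolding B_def by auto
  hence "hh.fixd ((a [^] q) [^]\<^bsub>G(|carrier := H|)\<^esub> (fact n :: nat)) W"
   using hh.length_domain_period[of B "a [^] q" W] Bcomm that subgroup.subset[OF BG] unfolding LD_def by auto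
  thus ?thesis using that Ac unfolding Q_def pw by (auto simp: nat_pow_pow)
 qed
 \<comment> \<open>Elements of \<open>G\<close> need neither lie in \<open>H\<close> nor fix
   \<open>W\<close>. The length is defined through any exponent \<open>E\<close> whose power does
   both, and dividing by \<open>E\<close> makes it independent of the choice.\<close>
 define vf where "vf W x E \<longleftrightarrow> (E::nat) >= 1 & x : CG & hh.fixd (x [^] E) W" for W x E
 define gl where "gl W x = (let E = (SOME E. vf W x E) in hh.tl W (x [^] (E::nat)) / real E)" for W x
 have vf_mult: "vf W x (E * k)" if "vf W x E" "k >= 1" for W x E k
  using that hh.fixd_pow[of "x [^] E" W k] unfolding vf_def pw by (auto simp: nat_pow_pow)
 have tl_E: "hh.tl W (x [^] (E * k)) = k * hh.tl W (x [^] E)" if "vf W x E" for W x E and k :: nat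
  using hh.tl_pow[of "x [^] E" W k] that unfolding vf_def pw by (auto simp: nat_pow_pow)
 have gl: "gl W x = hh.tl W (x [^] E) / E" if E: "vf W x E" for W x E
 proof -
  define E' where "E' = (SOME E. vf W x E)"
  have E': "vf W x E'" unfolding E'_def using E by (rule someI)
  have "E * hh.tl W (x [^] E') = E' * hh.tl W (x [^] E)"
   using tl_E[OF E, of E'] tl_E[OF E', of E] by (simp add: mult.commute)
  thus ?thesis using E E' unfolding gl_def Let_def E'_def[symmetric] vf_def by (simp add: field_simps)
 qed
 have glA: "gl W a = hh.tl W (a [^] Q) / Q" "vf W a Q" if "a : A" "W : LD" for W a
 proof -
  show "vf W a Q" unfolding vf_def using Q aQ that Ac by auto
  thus "gl W a = hh.tl W (a [^] Q) / Q" by (rule gl)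
 qed
 have invA: "inv a : A" "a ** b : A" if "a : A" "b : A" for a b
  using subgroup.m_inv_closed[OF A(1)] subgroup.m_closed[OF A(1)] that by auto
 have powAm: "(a ** b) [^] k = a [^] k ** b [^] k" if "a : A" "b : A" for a b and k :: nat
  using pow_mult_distrib[of a b k] A(2) that Ac by auto
 have invH: "(inv a) [^] Q = inv\<^bsub>G(|carrier := H|)\<^esub> (a [^] Q)" if "a : A" "W : LD" for a W
  using aQ[OF that] Hinv[of "a [^] Q"] that Ac unfolding hh.fixd_def by (auto simp: nat_pow_inv)
 have gl_mult: "gl W (a ** b) <= gl W a + gl W b" if "a : A" "b : A" "W : LD" for a b W
 proof -
  have "hh.tl W (a [^] Q ** b [^] Q) <= hh.tl W (a [^] Q) + hh.tl W (b [^] Q)"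
   using hh.tl_mult_le[OF aQ[OF that(1,3)] aQ[OF that(2,3)]] A(2)[OF powA powA] that by auto
  thus ?thesis using glA that invA powAm Q by (simp add: add_divide_distrib[symmetric] divide_right_mono)
 qed
 have gl_inv: "gl W (inv a) = gl W a" if "a : A" "W : LD" for a W
  using glA[OF that] glA[OF invA(1)[OF that(1,1)] that(2)] invH[OF that] hh.tl_inv[OF aQ[OF that]] by simp
 have gl_nonneg: "gl W a >= 0" if "a : A" "W : LD" for a W
  using glA[OF that] hh.tl_nonneg[OF aQ[OF that]] by simp
 have gl_dich: "gl W (a ** b) = 0 | gl W (inv a ** b) = 0" if "a : A" "b : A" "W : LD" "gl W a = gl W b" for a b W
 proof -
  have "hh.tl W (a [^] Q) = hh.tl W (b [^] Q)" using that glA Q by simp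
  hence "hh.tl W (a [^] Q ** b [^] Q) = 0 | hh.tl W (inv\<^bsub>G(|carrier := H|)\<^esub> (a [^] Q) ** b [^] Q) = 0"
   using hh.tl_dichotomy[OF aQ[OF that(1,3)] aQ[OF that(2,3)]] A(2)[OF powA powA] that by auto
  thus ?thesis using glA[OF invA(2)[OF that(1,2)] that(3)] glA[OF invA(2)[OF invA(1)[OF that(1,1)] that(2)] that(3)]
   powAm that invA(1) invH[OF that(1,3)] by auto
 qed
 have gl_pos: "a = \<one>" if a: "a : A" and z: "!!W. W : LD ==> gl W a = 0" for a
 proof (rule ccontr)
  assume "a ~= \<one>"
  hence ne: "(a [^] q) [^] (k::nat) ~= \<one>" if "k >= 1" for k
   using tf[OF a, of "q * k"] that q a Ac by (auto simp: nat_pow_pow)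
  have "a [^] q : B" using a powA q(2) Ac unfolding B_def by auto
  then obtain W where W: "W : LD" "hh.tl W ((a [^] q) [^] (fact n :: nat)) > 0"
   using hh.length_pos[OF BG Bcomm, of "a [^] q"] ne unfolding LD_def pw by auto
  hence "hh.tl W (a [^] Q) > 0" using a Ac unfolding Q_def by (auto simp: nat_pow_pow)
  thus False using z[OF W(1)] glA[OF a W(1)] Q by simp
 qed
 have LDconj: "act h W : LD" if h: "h : H" and W: "W : LD" for h W
  unfolding LD_def
 proof (rule hh.ldoms_conj)
  show "h : carrier (G(|carrier := H|))" "B <= carrier (G(|carrier := H|))" "W : hh.ldoms B"
   using h W unfolding LD_def B_def by auto
  fix b assume b: "b : B"
  obtain m :: nat where m: "m >= 1" "ALL a:A. h ** a [^] m ** inv h : A" using comm[of h] h Hc by auto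
  have "h ** b [^] m ** inv h : B"
   using m b h powH subgroup.m_closed[OF H(1)] subgroup.m_inv_closed[OF H(1)] unfolding B_def by auto
  thus "EX m::nat>=1. h **\<^bsub>G(|carrier := H|)\<^esub> b [^]\<^bsub>G(|carrier := H|)\<^esub> m **\<^bsub>G(|carrier := H|)\<^esub> inv\<^bsub>G(|carrier := H|)\<^esub> h : B"
   using m(1) Hinv[OF h] unfolding pw by auto
 qed
 have vf_conj: "EX E. vf W (g ** a ** inv g) E" if g: "g : CG" and a: "a : A" and W: "W : LD" for g a W
 proof -
  obtain m :: nat where m: "m >= 1" "ALL a:A. g ** a [^] m ** inv g : A" using comm[OF g] by auto
  have "hh.fixd ((g ** a [^] m ** inv g) [^] Q) W" using aQ m a W by auto
  moreover have "(g ** a [^] m ** inv g) [^] Q = (g ** a ** inv g) [^] (m * Q)"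
   using g a Ac conj_pow[of g a m] by (auto simp: nat_pow_pow[symmetric])
  ultimately show ?thesis unfolding vf_def using g a Ac m Q by (intro exI[of _ "m * Q"]) auto
 qed
 have gl_act: "gl (act h W) (h ** x ** inv h) = gl W x" if h: "h : H" and E: "vf W x E" for h W x E
 proof -
  have hc: "h : CG" using h Hc by auto
  have f: "hh.fixd (x [^] E) W" "x : CG" "E >= 1" using E unfolding vf_def by auto
  have p: "(h ** x ** inv h) [^] E = h ** x [^] E ** inv h" using conj_pow hc f by auto
  have "hh.fixd (h ** x [^] E ** inv h) (act h W)" "hh.tl (act h W) (h ** x [^] E ** inv h) = hh.tl W (x [^] E)"
   using hh.fixd_conj[OF f(1), of h] hh.tl_conj[OF f(1), of h] h Hinv[OF h] by auto
  hence "vf (act h W) (h ** x ** inv h) E" "hh.tl (act h W) ((h ** x ** inv h) [^] E) = hh.tl W (x [^] E)"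
   unfolding vf_def p using f hc by auto
  thus ?thesis using gl gl[OF E] by simp
 qed
 have gl_pow: "gl W (x [^] k) = k * gl W x" if E: "vf W x E" and k: "k >= 1" for W x E and k :: nat
 proof -
  have x: "x : CG" "E >= 1" using E unfolding vf_def by auto
  have "vf W (x [^] k) E" using vf_mult[OF E k] x unfolding vf_def by (simp add: nat_pow_pow mult.commute)
  hence "gl W (x [^] k) = hh.tl W (x [^] (E * k)) / E" using gl x by (simp add: nat_pow_pow mult.commute)
  thus ?thesis using tl_E[OF E, of k] gl[OF E] by simp
 qed
 obtain R0 where R0: "finite R0" "R0 <= CG" "!!g. g : CG ==> EX t:R0. EX h:H. g = h ** t"
 proof -
  have "ALL C:rcosets H. EX t:CG. C = H #> t" by (auto simp: RCOSETS_def)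
  then obtain f where f: "ALL C:rcosets H. f C : CG & C = H #> f C" by metis
  have "EX t:f ` (rcosets H). EX h:H. g = h ** t" if g: "g : CG" for g
  proof -
   have C: "H #> g : rcosets H" using g by (auto simp: RCOSETS_def)
   have "g : H #> f (H #> g)" using f C rcos_self[OF g H(1)] by auto
   thus ?thesis using C unfolding r_coset_def by auto
  qed
  thus ?thesis using that[of "f ` (rcosets H)"] f H(2) by auto
 qed
 \<comment> \<open>Conjugation by \<open>h ** t\<close> with \<open>h\<close> in \<open>H\<close>
   shows on \<open>W\<close> the lengths that conjugation by \<open>t\<close> shows on the translate
   of \<open>W\<close> by \<open>inv h\<close>. So the finitely many coset representatives and
   domains of \<open>LD\<close> account for all these functions.\<close>
 define \<phi> where "\<phi> W g = (\<lambda>a\<in>A. gl W (g ** a ** inv g))" for W g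
 define \<Phi> where "\<Phi> = (%(W, t). \<phi> W t) ` (LD \<times> R0)"
 have phi: "\<phi> W g : \<Phi>" if W: "W : LD" and g: "g : CG" for W g
 proof -
  obtain t h where t: "t : R0" "h : H" "g = h ** t" using R0(3)[OF g] by blast
  have tc: "t : CG" "h : CG" "inv h : H" using t R0 Hc subgroup.m_inv_closed[OF H(1)] by auto
  define W' where "W' = act (inv h) W"
  have W': "W' : LD" unfolding W'_def using LDconj tc W by auto
  have WD: "W : D" using W LDD by auto
  have aW': "act h W' = W" unfolding W'_def using hh.act_act_inv[of h W] t Hinv[OF t(2)] WD by simp
  have "gl W (g ** a ** inv g) = gl W' (t ** a ** inv t)" if a: "a : A" for a
  proof -
   obtain E where E: "vf W' (t ** a ** inv t) E" using vf_conj[OF tc(1) a W'] by blast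
   have "g ** a ** inv g = h ** (t ** a ** inv t) ** inv h"
   using t(3) tc a Ac by (auto simp: inv_mult_group m_assoc)
   thus ?thesis using gl_act[OF t(2) E] aW' by simp
  qed
  hence "\<phi> W g = \<phi> W' t" unfolding \<phi>_def by (auto simp: fun_eq_iff)
  thus ?thesis unfolding \<Phi>_def using W' t by auto
 qed
 define \<Psi> where "\<Psi> g = (\<lambda>W\<in>LD. \<phi> W g)" for g
 have "\<Psi> ` CG <= (\<Pi>\<^sub>E W\<in>LD. \<Phi>)" unfolding \<Psi>_def using phi by auto
 moreover have "finite (\<Pi>\<^sub>E W\<in>LD. \<Phi>)" using finLD R0 unfolding \<Phi>_def by (intro finite_PiE) auto
 ultimately have finPsi: "finite (\<Psi> ` CG)" by (rule finite_subset)
 define ref where "ref g = inv_into (CG) \<Psi> (\<Psi> g)" for g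
 have ref: "ref g : CG" "\<Psi> (ref g) = \<Psi> g" if "g : CG" for g
  unfolding ref_def using that by (auto intro: inv_into_into f_inv_into_f)
 obtain mm where mm: "!!g. g : CG ==> (mm g :: nat) >= 1 & (ALL a:A. g ** a [^] mm g ** inv g : A)"
  using comm by metis
 define cj where "cj g m a = g ** a [^] (m::nat) ** inv g" for g m a
 have cj_mult: "cj g m (a ** b) = cj g m a ** cj g m b" if "g : CG" "a : A" "b : A" for g m a b
 proof -
  have "a : CG" "b : CG" using that Ac by auto
  thus ?thesis unfolding cj_def powAm[OF that(2,3)] using that(1) by (simp add: m_assoc)
 qed
 have cj_pow: "cj g m (a [^] k) = cj g (m * k) a" if "a : A" for g m a and k :: nat
  unfolding cj_def using that Ac by (auto simp: nat_pow_pow mult.commute)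
 have cjA: "cj g (mm g * k) a : A" if "g : CG" "a : A" for g k a
  using mm[OF that(1)] powA[OF that(2), of k] cj_pow[OF that(2), of g "mm g" k] unfolding cj_def by auto
 have cj_carrier: "cj g m a : CG" if "g : CG" "a : A" for g m a unfolding cj_def using that Ac by auto
 \<comment> \<open>The domains on which conjugation by \<open>g\<close> agrees with that by
   \<open>ref g\<close>, tested on a power of \<open>a\<close> for which both results lie in
   \<open>A\<close>; on the other domains of \<open>LD\<close> the two turn out to be
   opposite.\<close>
 define sg where "sg g = {W:LD. ALL a:A. gl W (inv (cj g (mm g * mm (ref g)) a) ** cj (ref g) (mm g * mm (ref g)) a) = 0}" for g
 define F where "F g = (\<Psi> g, sg g)" for g
 have "F ` CG <= (\<Psi> ` CG) \<times> Pow LD" unfolding F_def sg_def by auto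
 hence finF: "finite (F ` CG)" using finPsi finLD finite_subset by (metis finite_Pow_iff finite_cartesian_product)
 have other: "ALL a:A. gl W (cj g (mm g * mm (ref g)) a ** cj (ref g) (mm g * mm (ref g)) a) = 0"
  if g: "g : CG" and W: "W : LD" "W ~: sg g" for g W
 proof -
  define m g0 where "m = mm g * mm (ref g)" and "g0 = ref g"
  define u u0 where "u = cj g m" and "u0 = cj g0 m"
  have g0: "g0 : CG" "\<Psi> g0 = \<Psi> g" unfolding g0_def using ref g by auto
  have m1: "m >= 1" unfolding m_def using mm[OF g] mm[OF g0(1)] unfolding g0_def by (metis mult_le_mono nat_mult_1)
  have uA: "u a : A" "u0 a : A" if "a : A" for a
   using cjA[OF g that, of "mm g0"] cjA[OF g0(1) that, of "mm g"]
   unfolding u_def u0_def m_def g0_def[symmetric] by (simp_all add: mult.commute)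
  have hom: "u (a ** b) = u a ** u b" "u0 (a ** b) = u0 a ** u0 b" if "a : A" "b : A" for a b
   unfolding u_def u0_def using cj_mult g g0 that by auto
  have dich: "gl W (u a ** u0 a) = 0 | gl W (inv (u a) ** u0 a) = 0" if a: "a : A" for a
  proof (rule gl_dich[OF uA[OF a] W(1)])
   have "\<phi> W g0 = \<phi> W g" using fun_cong[OF g0(2), of W] W(1) unfolding \<Psi>_def by simp
   hence "\<phi> W g0 a = \<phi> W g a" by simp
   hence eq: "gl W (g0 ** a ** inv g0) = gl W (g ** a ** inv g)"
   using a unfolding \<phi>_def by simp
   obtain E where E: "vf W (g ** a ** inv g) E" using vf_conj[OF g a W(1)] by blast
   obtain E0 where E0: "vf W (g0 ** a ** inv g0) E0" using vf_conj[OF g0(1) a W(1)] by blast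
   have "u a = (g ** a ** inv g) [^] m" "u0 a = (g0 ** a ** inv g0) [^] m"
   unfolding u_def u0_def cj_def using conj_pow g g0 a Ac by auto
   thus "gl W (u a) = gl W (u0 a)" using gl_pow[OF E m1] gl_pow[OF E0 m1] eq by simp
  qed
  obtain a0 where a0: "a0 : A" "gl W (inv (u a0) ** u0 a0) ~= 0"
   using W unfolding sg_def u_def u0_def m_def g0_def by auto
  have z0: "gl W (u a0 ** u0 a0) = 0" using dich a0 by auto
  have split1: "gl W (x ** y) = 0" if "x : A" "y : A" "gl W x = 0" "gl W y = 0" for x y
   using gl_mult[OF that(1,2) W(1)] gl_nonneg[OF invA(2)[OF that(1,2)] W(1)] that by simp
  have reorder: "(w ** x) ** (y ** z) = (w ** y) ** (x ** z)" if "w : A" "x : A" "y : A" "z : A" for w x y z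
  proof -
   have "(w ** x) ** (y ** z) = w ** (x ** y) ** z" using that Ac by (auto simp: m_assoc subset_iff)
   also have "... = w ** (y ** x) ** z" using A(2) that by simp
   also have "... = (w ** y) ** (x ** z)" using that Ac by (auto simp: m_assoc subset_iff)
   finally show ?thesis .
  qed
  \<comment> \<open>For every element one of the two signs is right, and the elements for which a
    given sign is right form a subgroup. As \<open>a0\<close> violates agreement, an element
    \<open>b\<close> violating opposition would make \<open>a0 ** b\<close> violate both.\<close>
  have "gl W (u b ** u0 b) = 0" if b: "b : A" for b
  proof (rule ccontr)
   assume nb: "gl W (u b ** u0 b) ~= 0"
   hence zb: "gl W (inv (u b) ** u0 b) = 0" using dich b by auto
   have ab: "a0 ** b : A" using invA a0 b by auto
   note U = uA[OF a0(1)] uA[OF b]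
   from dich[OF ab] show False
   proof
   assume "gl W (u (a0 ** b) ** u0 (a0 ** b)) = 0"
   hence "gl W ((u a0 ** u0 a0) ** (u b ** u0 b)) = 0" using hom a0 b reorder U by simp
   moreover have "gl W (inv (u a0 ** u0 a0)) = 0" using gl_inv W(1) z0 invA U by auto
   ultimately have "gl W (inv (u a0 ** u0 a0) ** ((u a0 ** u0 a0) ** (u b ** u0 b))) = 0"
   using split1 invA U by auto
   thus False using nb U invA Ac by (simp add: subset_iff)
   next
   assume z: "gl W (inv (u (a0 ** b)) ** u0 (a0 ** b)) = 0"
   have iu: "inv (u (a0 ** b)) = inv (u a0) ** inv (u b)"
   using hom a0 b U Ac A(2)[OF U(1,3)] by (simp add: subset_iff inv_mult_group)
   have "gl W ((inv (u a0) ** u0 a0) ** (inv (u b) ** u0 b)) = 0"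
   using z hom a0 b reorder U invA unfolding iu by simp
   moreover have "gl W (inv (inv (u b) ** u0 b)) = 0" using gl_inv W(1) zb invA U by auto
   ultimately have "gl W (((inv (u a0) ** u0 a0) ** (inv (u b) ** u0 b)) ** inv (inv (u b) ** u0 b)) = 0"
   using split1 invA U by auto
   moreover have "(x ** y) ** inv y = x" if "x : A" "y : A" for x y
   using that Ac by (auto simp: m_assoc subset_iff)
   ultimately show False using a0(2) U invA by simp
   qed
  qed
  thus ?thesis unfolding u_def u0_def m_def g0_def by auto
 qed
 have key: "EX m::nat>=1. ALL a:A. cj g m a = cj g' m a" if g: "g : CG" "g' : CG" and FF: "F g = F g'" for g g'
 proof -
  define g0 where "g0 = ref g"
  have ref': "ref g' = g0" unfolding g0_def ref_def using FF unfolding F_def by simp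
  have g0: "g0 : CG" unfolding g0_def using ref g by auto
  define M where "M = mm g * mm g0 * mm g'"
  have M1: "M >= 1" unfolding M_def using mm[OF g(1)] mm[OF g(2)] mm[OF g0] by (metis mult_le_mono nat_mult_1)
  have "cj g M a = cj g' M a" if a: "a : A" for a
  proof -
   define x x' x0 where "x = cj g M a" and "x' = cj g' M a" and "x0 = cj g0 M a"
   have xA: "x : A" "x' : A" "x0 : A"
   using cjA[OF g(1) a, of "mm g0 * mm g'"] cjA[OF g(2) a, of "mm g * mm g0"] cjA[OF g0 a, of "mm g * mm g'"]
   unfolding x_def x'_def x0_def M_def by (simp_all add: ac_simps)
   have xc: "x : CG" "x' : CG" "x0 : CG" using xA Ac by auto
   have e: "cj g (mm g * mm g0) (a [^] mm g') = x" "cj g0 (mm g * mm g0) (a [^] mm g') = x0"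
   "cj g' (mm g' * mm g0) (a [^] mm g) = x'" "cj g0 (mm g' * mm g0) (a [^] mm g) = x0"
   unfolding x_def x'_def x0_def M_def using cj_pow[OF a] by (simp_all add: ac_simps)
   \<comment> \<open>Either both conjugations agree with the common reference on \<open>W\<close> or
     both are opposite to it; in both cases their quotient has length zero.\<close>
   have "gl W (inv x ** x') = 0" if W: "W : LD" for W
   proof (cases "W : sg g")
   case True
   hence "W : sg g'" using FF unfolding F_def by simp
   hence z': "gl W (inv x' ** x0) = 0" using powA[OF a, of "mm g"] e ref' unfolding sg_def by auto
   have z: "gl W (inv x ** x0) = 0" using True powA[OF a, of "mm g'"] e unfolding sg_def g0_def by auto
   have "inv x ** x' = (inv x ** x0) ** inv (inv x' ** x0)"
   using xc by (simp add: inv_mult_group m_assoc)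
   hence "gl W (inv x ** x') <= gl W (inv x ** x0) + gl W (inv (inv x' ** x0))"
   using gl_mult W xA invA by auto
   thus ?thesis using z z' gl_inv[of "inv x' ** x0" W] W xA invA gl_nonneg[of "inv x ** x'" W] by auto
   next
   case False
   hence "W ~: sg g'" using FF unfolding F_def by simp
   hence z': "gl W (x' ** x0) = 0" using other[OF g(2) W] powA[OF a, of "mm g"] e ref' by auto
   have z: "gl W (x ** x0) = 0" using other[OF g(1) W False] powA[OF a, of "mm g'"] e unfolding g0_def by auto
   have "inv x ** x' = inv (x ** x0) ** (x' ** x0)"
   proof -
   have "inv (x ** x0) ** (x' ** x0) = inv (x0 ** x) ** (x0 ** x')" using A(2) xA by simp
   thus ?thesis using xc by (simp add: inv_mult_group m_assoc)
   qed
   hence "gl W (inv x ** x') <= gl W (inv (x ** x0)) + gl W (x' ** x0)"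
   using gl_mult W xA invA by auto
   thus ?thesis using z z' gl_inv[of "x ** x0" W] W xA invA gl_nonneg[of "inv x ** x'" W] by auto
   qed
   hence "inv x ** x' = \<one>" using gl_pos invA xA by auto
   thus ?thesis unfolding x_def[symmetric] x'_def[symmetric] using xc by (metis inv_cancel_left(2) r_one)
  qed
  thus ?thesis using M1 by blast
 qed
 define T where "T = inv_into (CG) F ` (F ` CG)"
 have "T <= CG" unfolding T_def by (auto intro: inv_into_into)
 moreover have "finite T" unfolding T_def using finF by auto
 moreover have "EX t:T. EX m::nat>=1. ALL a:A. g ** a [^] m ** inv g = t ** a [^] m ** inv t" if g: "g : CG" for g
 proof -
  define t where "t = inv_into (CG) F (F g)"
  have "t : T" "t : CG" "F g = F t" unfolding T_def t_def using g by (auto intro: inv_into_into simp: f_inv_into_f)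
  thus ?thesis using key[OF g, of t] unfolding cj_def by blast
 qed
 ultimately show ?thesis by blast
qed

section \<open>Distances of bounded sets and the four-point inequality\<close>

definition supd :: "('p => 'p => real) => 'p set => 'p set => real" where
 "supd d A B = (SUP (a, b)\<in>A \<times> B. d a b)"

definition bdd_sub :: "'p set => ('p => 'p => real) => real => 'p set => bool" where
 "bdd_sub M d r A \<longleftrightarrow> A ~= {} & A <= M & diam_le d A r"

lemma hyperbolic_segment_ex:
 assumes "hyperbolic_space dl M d" "x : M" "y : M"
 shows "EX S. geodesic_segment M d x y S"
 using assms by (simp add: hyperbolic_space_def geodesic_space_def)

lemma hyperbolic_thin:
 assumes hyp: "hyperbolic_space dl M d" and S: "geodesic_segment M d x y S1" "geodesic_segment M d y z S2"
  "geodesic_segment M d x z S3" "p : S1"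
 shows "EX q:S2 \<union> S3. d p q <= dl"
proof -
 from hyp have "ALL x y z S1 S2 S3. geodesic_segment M d x y S1 & geodesic_segment M d y z S2 &
  geodesic_segment M d x z S3 --> (ALL p:S1. EX q:S2 \<union> S3. d p q <= dl)"
  unfolding hyperbolic_space_def by (rule conjunct2)
 from this[rule_format, OF conjI[OF S(1) conjI[OF S(2,3)]] S(4)] show ?thesis .
qed

lemma geoseg_ends: "geodesic_segment M d x y S ==> x : S" "geodesic_segment M d x y S ==> y : S"
 unfolding geodesic_segment_def by force+

context Metric_space
begin

lemma dist_le_sup_distance:
 assumes "bdd_sub M d r A" "bdd_sub M d s B" "a : A" "b : B"
 shows "d a b <= supd d A B"
proof -
 obtain a0 b0 where ab: "a0 : A" "b0 : B" using assms by blast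
 have AM: "A <= M" "B <= M" "ALL x:A. ALL y:A. d x y <= r" "ALL x:B. ALL y:B. d x y <= s"
  using assms unfolding bdd_sub_def diam_le_def by auto
 have "bdd_above ((%(a, b). d a b) ` (A \<times> B))"
 proof (intro bdd_aboveI[of _ "r + d a0 b0 + s"], clarify)
  fix x y assume xy: "x : A" "y : B"
  have "d x y <= d x a0 + d a0 b0 + d b0 y"
   using triangle[of x a0 y] triangle[of a0 b0 y] xy ab AM by (smt (verit) subsetD)
  thus "d x y <= r + d a0 b0 + s" using AM xy ab by (smt (verit))
 qed
 thus ?thesis unfolding supd_def using assms(3,4) by (intro cSUP_upper2[where x = "(a, b)"]) auto
qed

lemma supd_le:
 assumes "A ~= {}" "B ~= {}" "!!a b. a : A ==> b : B ==> d a b <= c"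
 shows "supd d A B <= c"
 unfolding supd_def using assms by (intro cSUP_least) auto

lemma supd_sym: "supd d A B = supd d B A"
proof -
 have "(%(a, b). d a b) ` (A \<times> B) = (%(a, b). d a b) ` (B \<times> A)"
  using commute by (auto simp: image_iff) metis+
 thus ?thesis unfolding supd_def by simp
qed

lemma supd_nonneg:
 assumes "bdd_sub M d r A" "bdd_sub M d s B"
 shows "supd d A B >= 0"
proof -
 obtain a b where "a : A" "b : B" using assms unfolding bdd_sub_def by blast
 thus ?thesis using dist_le_sup_distance[OF assms] nonneg[of a b] by (meson order_trans)
qed

lemma supd_self: "bdd_sub M d r A ==> supd d A A <= r"
 unfolding bdd_sub_def diam_le_def by (intro supd_le) auto

lemma supd_triangle:
 assumes "bdd_sub M d r A" "bdd_sub M d s B" "bdd_sub M d t C"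
 shows "supd d A C <= supd d A B + supd d B C"
proof -
 obtain b where b: "b : B" using assms unfolding bdd_sub_def by blast
 show ?thesis
 proof (rule supd_le)
  show "A ~= {}" "C ~= {}" using assms unfolding bdd_sub_def by auto
  fix a c assume ac: "a : A" "c : C"
  have "d a c <= d a b + d b c" using triangle ac b assms unfolding bdd_sub_def by (meson subsetD)
  thus "d a c <= supd d A B + supd d B C"
   using dist_le_sup_distance[OF assms(1,2) ac(1) b] dist_le_sup_distance[OF assms(2,3) b ac(2)] by linarith
 qed
qed

lemma sup_le_set_distance:
 assumes A: "bdd_sub M d r A" and B: "bdd_sub M d s B"
 shows "supd d A B <= set_distance d A B + r + s"
proof -
 have "supd d A B - r - s <= set_distance d A B" unfolding set_distance_def
 proof (rule cINF_greatest)
  show "A \<times> B ~= {}" using assms unfolding bdd_sub_def by auto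
  fix p assume "p : A \<times> B"
  then obtain a b where p: "p = (a, b)" "a : A" "b : B" by auto
  have "supd d A B <= r + d a b + s"
  proof (rule supd_le)
   show "A ~= {}" "B ~= {}" using assms unfolding bdd_sub_def by auto
   fix x y assume xy: "x : A" "y : B"
   have "d x y <= d x a + d a b + d b y"
   using triangle[of x a y] triangle[of a b y] xy p A B unfolding bdd_sub_def by (smt (verit) subsetD)
   moreover have "d x a <= r" "d b y <= s" using xy p A B unfolding bdd_sub_def diam_le_def by auto
   ultimately show "d x y <= r + d a b + s" by linarith
  qed
  thus "supd d A B - r - s <= (case p of (a, b) => d a b)" using p by simp
 qed
 thus ?thesis by linarith
qed

lemma set_distance_le_sup:
 assumes A: "bdd_sub M d r A" and B: "bdd_sub M d s B"
 shows "set_distance d A B <= supd d A B"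
proof -
 obtain a b where ab: "a : A" "b : B" using assms unfolding bdd_sub_def by blast
 have "set_distance d A B <= d a b" unfolding set_distance_def
  by (rule cINF_lower2[of _ _ "(a, b)"]) (use ab in "auto intro!: bdd_belowI[of _ 0]")
 thus ?thesis using dist_le_sup_distance[OF A B ab] by linarith
qed

lemma bounded_singleton: "p : M ==> bdd_sub M d 0 {p}"
 unfolding bdd_sub_def diam_le_def by auto

lemma geoseg_between:
 assumes "geodesic_segment M d x y S" "q : S"
 shows "d x q + d q y = d x y" "q : M"
proof -
 obtain L c where c: "L >= 0" "c : {0..L} \<rightarrow> M" "c 0 = x" "c L = y" "S = c ` {0..L}"
  "ALL s:{0..L}. ALL t:{0..L}. d (c s) (c t) = abs(s - t)" using assms unfolding geodesic_segment_def by auto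
 obtain t where t: "t : {0..L}" "q = c t" using assms c by auto
 have "d (c 0) (c t) = abs(0 - t)" "d (c t) (c L) = abs(t - L)" "d (c 0) (c L) = abs(0 - L)" using c t by auto
 thus "d x q + d q y = d x y" using c t by auto
 show "q : M" using c t by auto
qed

text \<open>The parameters at which the side from \<open>x\<close> to \<open>y\<close> is close to
  \<open>S3\<close> include \<open>0\<close>. Near their supremum the side is close to both
  \<open>S2\<close> and \<open>S3\<close>, so the distance from there to \<open>w\<close> is about
  the Gromov product of \<open>x\<close> and \<open>y\<close>. Approximating the supremum costs the
  additive \<open>2\<close>.\<close>

lemma hyperbolic_projection:
 assumes hyp: "hyperbolic_space dl M d" and delta: "dl >= 0" and S: "geodesic_segment M d x y S"
  and M: "x : M" "y : M" "w : M"
 shows "EX q:S. 2 * d w q <= d w x + d w y - d x y + 4 * dl + 2"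
proof -
 obtain L c where c: "L >= 0" "c : {0..L} \<rightarrow> M" "c 0 = x" "c L = y" "S = c ` {0..L}"
  "ALL s:{0..L}. ALL t:{0..L}. d (c s) (c t) = abs(s - t)" using S unfolding geodesic_segment_def by auto
 obtain S2 S3 where S23: "geodesic_segment M d y w S2" "geodesic_segment M d x w S3"
  using hyperbolic_segment_ex[OF hyp] M by metis
 have thin: "EX r:S2 \<union> S3. d q r <= dl" if "q : S" for q
  by (rule hyperbolic_thin[OF hyp S S23 that])
 define I where "I = {t:{0..L}. EX r:S3. d (c t) r <= dl}"
 have x3: "x : S3" "y : S2"
  using geoseg_ends S23 by metis+
 have I0: "0 : I" unfolding I_def using c x3 M delta by (auto intro!: bexI[of _ x])
 have bdd: "bdd_above I" unfolding I_def by (intro bdd_aboveI[of _ L]) auto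
 define t where "t = Sup I"
 have t: "0 <= t" "t <= L" unfolding t_def using I0 bdd by (auto intro: cSup_upper cSup_least simp: I_def)
 have "EX t1:I. t - 1 / 2 < t1" unfolding t_def using I0 by (intro less_cSupD) auto
 then obtain t1 where t1: "t1 : I" "t - 1 / 2 < t1" "t1 <= t" using cSup_upper[OF _ bdd] unfolding t_def by blast
 define t2 where "t2 = min L (t + 1 / 2)"
 have t2: "t2 : {0..L}" "abs(t1 - t2) <= 1" unfolding t2_def using t t1 c(1) by (auto simp: min_def)
 have "EX r:S2. d (c t2) r <= dl"
 proof (cases "t2 = L")
  case True
  thus ?thesis using c(4) x3 M delta by (auto intro!: bexI[of _ y])
 next
  case False
  hence "t2 > t" unfolding t2_def by (auto simp: min_def split: if_splits)
  hence "t2 ~: I" using cSup_upper[OF _ bdd, of t2] unfolding t_def by auto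
  thus ?thesis using thin[of "c t2"] t2 c(5) unfolding I_def by auto
 qed
 then obtain r2 where r2: "r2 : S2" "d (c t2) r2 <= dl" by blast
 obtain r3 where r3: "r3 : S3" "d (c t1) r3 <= dl" "t1 : {0..L}" using t1 unfolding I_def by auto
 define q where "q = c t1"
 have q: "q : S" "q : M" "c t2 : M" unfolding q_def using c r3 t2 by auto
 have b: "d x q + d q y = d x y" using geoseg_between[OF S q(1)] by auto
 have b2: "d y r2 + d r2 w = d y w" "r2 : M" using geoseg_between[OF S23(1) r2(1)] by auto
 have b3: "d x r3 + d r3 w = d x w" "r3 : M" using geoseg_between[OF S23(2) r3(1)] by auto
 have "d q (c t2) <= 1" unfolding q_def using c(6) r3(3) t2 by auto
 hence qr2: "d q r2 <= dl + 1" using triangle[OF q(2,3) b2(2)] r2 by linarith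
 have qr3: "d q r3 <= dl" using r3 unfolding q_def by simp
 have "d x q <= d x r3 + d r3 q" "d q w <= d q r3 + d r3 w" "d y q <= d y r2 + d r2 q" "d q w <= d q r2 + d r2 w"
  using triangle[OF M(1) b3(2) q(2)] triangle[OF q(2) b3(2) M(3)] triangle[OF M(2) b2(2) q(2)] triangle[OF q(2) b2(2) M(3)]
  by simp_all
 hence "2 * d w q <= d w x + d w y - d x y + 4 * dl + 2"
  using b b2(1) b3(1) qr2 qr3 commute[of r3 q] commute[of r2 q] commute[of y q] commute[of w x] commute[of w y] commute[of w q]
  by linarith
 thus ?thesis using q(1) by blast
qed

text \<open>The projection of \<open>w\<close> to the side from \<open>x\<close> to \<open>y\<close>
  is within \<open>dl\<close> of one of the other two sides of the triangle \<open>x\<close>,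
  \<open>y\<close>, \<open>z\<close>; which side it is decides which term of the maximum is
  large.\<close>

lemma hyperbolic_four_point:
 assumes hyp: "hyperbolic_space dl M d" and delta: "dl >= 0"
  and M: "x : M" "y : M" "z : M" "w : M"
 shows "d x y + d z w <= max (d x z + d y w) (d x w + d y z) + (6 * dl + 2)"
proof -
 obtain S1 S2 S3 where S: "geodesic_segment M d x y S1" "geodesic_segment M d y z S2" "geodesic_segment M d x z S3"
  using hyperbolic_segment_ex[OF hyp] M by metis
 obtain q where q: "q : S1" "2 * d w q <= d w x + d w y - d x y + 4 * dl + 2"
  using hyperbolic_projection[OF hyp delta S(1) M(1,2,4)] by blast
 have qM: "q : M" using geoseg_between[OF S(1) q(1)] by auto
 have "EX r:S2 \<union> S3. d q r <= dl" by (rule hyperbolic_thin[OF hyp S q(1)])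
 then obtain r where r: "r : S2 \<union> S3" "d q r <= dl" by blast
 have rM: "r : M" using r geoseg_between(2)[OF S(2)] geoseg_between(2)[OF S(3)] by blast
 have wr: "d w r <= d w q + dl" using triangle[OF M(4) qM rM] r by linarith
 have tr: "d u w + d v w - d u v <= 2 * d w r" if "d u r + d r v = d u v" "u : M" "v : M" for u v
  using that triangle[OF that(2) rM M(4)] triangle[OF M(4) rM that(3)] commute[of r w] commute[of v w] by linarith
 show ?thesis
 proof (cases "r : S2")
  case True
  hence "d y w + d z w - d y z <= 2 * d w r" using tr M geoseg_between[OF S(2)] by auto
  hence "d x y + d z w <= d x w + d y z + (6 * dl + 2)"
   using q(2) wr commute[of w x] commute[of w y] by linarith
  thus ?thesis by linarith
 next
  case False
  hence "d x w + d z w - d x z <= 2 * d w r" using r tr M geoseg_between[OF S(3)] by auto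
  hence "d x y + d z w <= d x z + d y w + (6 * dl + 2)"
   using q(2) wr commute[of w x] commute[of w y] by linarith
  thus ?thesis by linarith
 qed
qed

lemma supd_four_point:
 assumes fp: "!!x y z w. x : M ==> y : M ==> z : M ==> w : M ==>
   d x y + d z w <= max (d x z + d y w) (d x w + d y z) + c"
  and A: "bdd_sub M d r A1" "bdd_sub M d r A2" "bdd_sub M d r A3" "bdd_sub M d r A4"
 shows "supd d A1 A2 + supd d A3 A4 <=
  max (supd d A1 A3 + supd d A2 A4) (supd d A1 A4 + supd d A2 A3) + c" (is "_ <= ?R")
proof -
 have ne: "A1 ~= {}" "A2 ~= {}" "A3 ~= {}" "A4 ~= {}" and sub: "A1 <= M" "A2 <= M" "A3 <= M" "A4 <= M"
  using A unfolding bdd_sub_def by simp_all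
 have pt: "d a b + d e f <= ?R" if "a : A1" "b : A2" "e : A3" "f : A4" for a b e f
 proof -
  have "d a b + d e f <= max (d a e + d b f) (d a f + d b e) + c" using fp that sub by blast
  moreover have "d a e <= supd d A1 A3" "d b f <= supd d A2 A4"
   "d a f <= supd d A1 A4" "d b e <= supd d A2 A3"
   using dist_le_sup_distance A that by blast+
  ultimately show ?thesis by linarith
 qed
 have "supd d A1 A2 <= ?R - d e f" if "e : A3" "f : A4" for e f
  by (rule supd_le[OF ne(1,2)]) (use pt that in "simp add: algebra_simps")
 hence "supd d A3 A4 <= ?R - supd d A1 A2"
  by (intro supd_le[OF ne(3,4)]) (simp add: algebra_simps)
 thus ?thesis by linarith
qed

text \<open>A geodesic between the projections is sampled at integer parameters, and quasiconvexity
  moves each sample to the projection of a point of \<open>X\<close>. Rounding the length down costs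
  \<open>1\<close> at the far end.\<close>

lemma quasiconvex_coarse_geodesic:
 assumes geo: "geodesic_space M d" and qc: "quasiconvex K M d (\<Union>x\<in>X. p x)" and r: "r >= 0"
  and p: "!!x. x : X ==> bdd_sub M d r (p x)" and xy: "x : X" "y : X"
 shows "EX (c :: nat => 'x) l. (ALL i<=l. c i : X) & supd d (p (c 0)) (p x) <= K + 2 * r &
  supd d (p (c l)) (p y) <= K + 1 + 2 * r &
  (ALL i<=l. ALL j<=l. abs(supd d (p (c i)) (p (c j)) - abs(real i - real j)) <= 2 * K + 2 * r)"
proof -
 have pM: "p x <= M" "p x ~= {}" if "x : X" for x using p[OF that] unfolding bdd_sub_def by auto
 obtain a b where ab: "a : p x" "b : p y" using pM(2)[OF xy(1)] pM(2)[OF xy(2)] by blast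
 have abM: "a : M" "b : M" using ab pM(1) xy by auto
 obtain S where S: "geodesic_segment M d a b S" using geo abM unfolding geodesic_space_def by blast
 then obtain L g where g: "L >= 0" "g : {0..L} \<rightarrow> M" "g 0 = a" "g L = b" "S = g ` {0..L}"
  "ALL s:{0..L}. ALL t:{0..L}. d (g s) (g t) = abs(s - t)" unfolding geodesic_segment_def by auto
 have "ALL s:S. EX q:(\<Union>x\<in>X. p x). d s q <= K" using qc S ab xy unfolding quasiconvex_def by blast
 hence "ALL s:S. EX u q. u : X & q : p u & d s q <= K" by blast
 then obtain u q where uq: "!!s. s : S ==> u s : X & q s : p (u s) & d s (q s) <= K" by metis
 define l where "l = nat \<lfloor>L\<rfloor>"
 have l: "real l <= L" "L < real l + 1" unfolding l_def using g(1) by linarith+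
 define c where "c i = u (g (real i))" for i
 define e where "e i = q (g (real i))" for i
 have gS: "g (real i) : S" "g (real i) : M" "real i : {0..L}" if "i <= l" for i using g that l by auto
 have ce: "c i : X" "e i : p (c i)" "d (g (real i)) (e i) <= K" "e i : M" if "i <= l" for i
  using uq[OF gS(1)[OF that]] pM(1) unfolding c_def e_def by auto
 have close: "supd d (p u) (p v) <= d s t + 2 * r" "d s t <= supd d (p u) (p v)"
  if "u : X" "v : X" "s : p u" "t : p v" for u v s t
 proof -
  show "d s t <= supd d (p u) (p v)" using dist_le_sup_distance p that by blast
  show "supd d (p u) (p v) <= d s t + 2 * r"
  proof (rule supd_le)
   show "p u ~= {}" "p v ~= {}" using that by auto
   fix s' t' assume st: "s' : p u" "t' : p v"
   have "p u <= M" "p v <= M" "ALL a:p u. ALL b:p u. d a b <= r" "ALL a:p v. ALL b:p v. d a b <= r"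
   using p[OF that(1)] p[OF that(2)] unfolding bdd_sub_def diam_le_def by auto
   hence "d s' s <= r" "d t t' <= r" "s : M" "t : M" "s' : M" "t' : M"
   using that(3,4) st by auto
   thus "d s' t' <= d s t + 2 * r" using triangle[of s' s t'] triangle[of s t t'] by linarith
  qed
 qed
 have 1: "supd d (p (c 0)) (p x) <= K + 2 * r"
  using close(1)[OF ce(1)[OF le0] xy(1) ce(2)[OF le0] ab(1)] ce(3)[OF le0] g(3) commute[of a "e 0"] by simp
 have "d (e l) b <= d (e l) (g l) + d (g l) (g L)"
  using triangle[OF ce(4)[OF order_refl] gS(2)[OF order_refl] abM(2)] g(4) by simp
 also have "d (g l) (g L) <= 1" using g(1,6) gS(3)[of l] l by auto
 finally have 2: "supd d (p (c l)) (p y) <= K + 1 + 2 * r"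
  using close(1)[OF ce(1)[OF order_refl] xy(2) ce(2)[OF order_refl] ab(2)] ce(3)[OF order_refl] commute[of "g l" "e l"] by simp
 have 3: "abs(supd d (p (c i)) (p (c j)) - abs(real i - real j)) <= 2 * K + 2 * r" if ij: "i <= l" "j <= l" for i j
 proof -
  have dg: "d (g i) (g j) = abs(real i - real j)" using g(6) gS(3)[OF ij(1)] gS(3)[OF ij(2)] by blast
  have "d (g i) (g j) <= d (g i) (e i) + d (e i) (e j) + d (e j) (g j)"
   "d (e i) (e j) <= d (e i) (g i) + d (g i) (g j) + d (g j) (e j)"
   using triangle[OF gS(2) ce(4) gS(2), OF ij(1) ij(1) ij(2)] triangle[OF ce(4) ce(4) gS(2), OF ij(1) ij(2) ij(2)]
   triangle[OF ce(4) gS(2) ce(4), OF ij(1) ij(1) ij(2)] triangle[OF gS(2) gS(2) ce(4), OF ij(1) ij(2) ij(2)] by linarith+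
  hence "abs(d (e i) (e j) - abs(real i - real j)) <= 2 * K"
   using dg ce(3)[OF ij(1)] ce(3)[OF ij(2)] commute[of "e i" "g i"] commute[of "e j" "g j"] by linarith
  thus ?thesis
   using close[OF ce(1)[OF ij(1)] ce(1)[OF ij(2)] ce(2)[OF ij(1)] ce(2)[OF ij(2)]] r by linarith
 qed
 show ?thesis by (rule exI[of _ c], rule exI[of _ l]) (use ce(1) 1 2 3 in auto)
qed

end

lemma supd_image:
 assumes "!!p q. p : M ==> q : M ==> d' (f p) (f q) = d p q" "A <= M" "B <= M"
 shows "supd d' (f ` A) (f ` B) = supd d A B"
proof -
 have "(%(a, b). d' a b) ` (f ` A \<times> f ` B) = (%(a, b). d a b) ` (A \<times> B)"
 proof (intro subset_antisym subsetI)
  fix r assume "r : (%(a, b). d' a b) ` (f ` A \<times> f ` B)"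
  then obtain a b where "a : A" "b : B" "r = d' (f a) (f b)" by auto
  thus "r : (%(a, b). d a b) ` (A \<times> B)" using assms by (intro image_eqI[of _ _ "(a, b)"]) (auto simp: subset_iff)
 next
  fix r assume "r : (%(a, b). d a b) ` (A \<times> B)"
  then obtain a b where "a : A" "b : B" "r = d a b" by auto
  thus "r : (%(a, b). d' a b) ` (f ` A \<times> f ` B)" using assms by (intro image_eqI[of _ _ "(f a, f b)"]) (auto simp: subset_iff)
 qed
 thus ?thesis unfolding supd_def by simp
qed

section \<open>Words and word metrics\<close>

context group
begin

lemma list_product_simps [simp]: "list_product G [] = \<one>" "list_product G (x # xs) = x ** list_product G xs"
 unfolding list_product_def by auto

lemma lp_closed: "set xs <= CG ==> list_product G xs : CG"
 by (induction xs) auto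

lemma lp_append:
 "set xs <= CG ==> set ys <= CG ==> list_product G (xs @ ys) = list_product G xs ** list_product G ys"
 by (induction xs) (auto simp: m_assoc lp_closed)

definition letters :: "'a set => 'a set" where "letters S = S \<union> (%s. inv s) ` S"

lemma letters_carr: "S <= CG ==> letters S <= CG"
 unfolding letters_def by auto

lemma generate_word:
 assumes "S <= CG" "g : generate G S"
 shows "EX xs. set xs <= letters S & list_product G xs = g"
 using assms(2)
proof (induction rule: generate.induct)
 case one
 show ?case by (rule exI[of _ "[]"]) auto
next
 case (incl h)
 thus ?case using assms by (intro exI[of _ "[h]"]) (auto simp: letters_def)
next
 case (inv h)
 thus ?case using assms by (intro exI[of _ "[inv h]"]) (auto simp: letters_def)
next
 case (eng h1 h2)
 then obtain xs ys where "set xs <= letters S" "list_product G xs = h1" "set ys <= letters S" "list_product G ys = h2" by auto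
 thus ?case using lp_append[of xs ys] letters_carr[OF assms(1)] by (intro exI[of _ "xs @ ys"]) auto
qed

lemma word_length_le: "set xs <= letters S ==> list_product G xs = g ==> word_length G S g <= length xs"
 unfolding word_length_def letters_def by (rule Least_le) blast

lemma wl_att:
 assumes "S <= CG" "generate G S = CG" "g : CG"
 shows "EX xs. length xs = word_length G S g & set xs <= letters S & list_product G xs = g"
proof -
 obtain xs where "set xs <= letters S" "list_product G xs = g" using generate_word assms by metis
 hence "EX k xs. length xs = k & set xs <= S \<union> (%s. inv s) ` S & list_product G xs = g"
  unfolding letters_def by metis
 thus ?thesis unfolding word_length_def letters_def by (rule LeastI_ex)
qed

lemma word_metric_finite_balls:
 assumes "finite S" "S <= CG" "generate G S = CG"
 shows "finite {g : CG. word_metric G S \<one> g <= r}"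
proof (rule finite_subset)
 show "finite (list_product G ` {xs. set xs <= letters S & length xs <= nat \<lfloor>r\<rfloor>})"
  by (intro finite_imageI finite_lists_length_le) (use assms in "simp add: letters_def")
 show "{g : CG. word_metric G S \<one> g <= r} <= list_product G ` {xs. set xs <= letters S & length xs <= nat \<lfloor>r\<rfloor>}"
 proof clarify
  fix g assume g: "g : CG" "word_metric G S \<one> g <= r"
  obtain xs where xs: "length xs = word_length G S g" "set xs <= letters S" "list_product G xs = g"
   using wl_att[OF assms(2,3) g(1)] by blast
  have "real (word_length G S g) <= r" using g unfolding word_metric_def by simp
  hence "word_length G S g <= nat \<lfloor>r\<rfloor>" by linarith
  thus "g : list_product G ` {xs. set xs <= letters S & length xs <= nat \<lfloor>r\<rfloor>}" using xs by force
 qed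
qed

lemma wm_inv:
 assumes "g : CG" "x : CG" "y : CG"
 shows "word_metric G S (g ** x) (g ** y) = word_metric G S x y"
 using assms unfolding word_metric_def by (simp add: inv_mult_group m_assoc)

end

section \<open>Extracting the coarse distances from an HHG structure\<close>

text \<open>The structure provides a unique maximal domain, and what is needed is a largest one. A
  domain not nested in the maximal one could be enlarged forever without becoming nested in it, and
  the resulting infinite chain contradicts finite complexity.\<close>

lemma hhs_domain_order:
 assumes nest: "hhs_nesting H xi" and orth: "hhs_orthogonality H" and fc: "hhs_finite_complexity H"
 shows "EX N. domain_order (domains H) (nested H) (orth H) N"
proof -
 let ?D = "domains H"
 obtain N :: nat where N0: "ALL C<=?D. (ALL V:C. ALL W:C. nested H V W | nested H W V) --> finite C & card C <= N"
  using fc unfolding hhs_finite_complexity_def by blast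
 have N: "finite C & card C <= N" if "C <= ?D" "!!V W. V : C ==> W : C ==> nested H V W | nested H W V" for C
  using N0 that by simp
 have refl: "!!V. V : ?D ==> nested H V V"
  and trans: "!!U V W. U : ?D ==> V : ?D ==> W : ?D ==> nested H U V ==> nested H V W ==> nested H U W"
  and antisym: "!!V W. V : ?D ==> W : ?D ==> nested H V W ==> nested H W V ==> V = W"
 proof -
  have "reflp_on ?D (nested H)" "transp_on ?D (nested H)" "antisymp_on ?D (nested H)"
   using nest unfolding hhs_nesting_def by simp_all
  thus "!!V. V : ?D ==> nested H V V"
   "!!U V W. U : ?D ==> V : ?D ==> W : ?D ==> nested H U V ==> nested H V W ==> nested H U W"
   "!!V W. V : ?D ==> W : ?D ==> nested H V W ==> nested H W V ==> V = W"
   by (metis reflp_onD, metis transp_onD, metis antisymp_onD)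
 qed
 have top: "EX S:?D. ALL V:?D. nested H V S" if ne: "?D ~= {}"
 proof -
  obtain S where S: "S : ?D" "!!S'. S' : ?D ==> (ALL W:?D. nested H S' W --> W = S') ==> S' = S"
  proof -
   have "EX! S. S : ?D & (ALL W:?D. nested H S W --> W = S)" using nest ne unfolding hhs_nesting_def by simp
   thus ?thesis using that by blast
  qed
  have "nested H V S" if V: "V : ?D" for V
  proof (rule ccontr)
   assume nV: "~ nested H V S"
   define A where "A = {V:?D. ~ nested H V S}"
   have "ALL V:A. EX W:A. nested H V W & W ~= V"
   proof
   fix V assume V: "V : A"
   hence "V : ?D" "V ~= S" using refl unfolding A_def by auto
   then obtain W where W: "W : ?D" "nested H V W" "W ~= V" using S(2) by blast
   hence "~ nested H W S" using V trans[of V W S] S(1) unfolding A_def by auto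
   thus "EX W:A. nested H V W & W ~= V" using W unfolding A_def by auto
   qed
   then obtain s where s: "!!V. V : A ==> s V : A & nested H V (s V) & s V ~= V" by metis
   define f where "f i = (s ^^ i) V" for i :: nat
   have fA: "f i : A" for i unfolding f_def by (induction i) (use V nV s in "auto simp: A_def")
   hence fD: "f i : ?D" for i unfolding A_def by auto
   have fs: "f (Suc i) = s (f i)" for i unfolding f_def by simp
   have le: "nested H (f i) (f (i + k))" for i k
   proof (induction k)
   case (Suc k)
   thus ?case using trans[OF fD[of i] fD[of "i + k"] fD[of "Suc (i + k)"]] s[OF fA[of "i + k"]] fs[of "i + k"] by simp
   qed (use refl fD in simp)
   have "inj f"
   proof (rule injI)
   fix i j assume e: "f i = f j"
   have *: "~ i < j" if "f i = f j" for i j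
   proof
   assume "i < j"
   then obtain k where "j = Suc i + k" using less_iff_Suc_add by auto
   hence "nested H (f (Suc i)) (f i)" using le[of "Suc i" k] that by simp
   thus False using antisym[OF fD[of i] fD[of "Suc i"]] s[OF fA[of i]] fs[of i] by simp
   qed
   show "i = j" using *[OF e] *[OF e[symmetric]] by simp
   qed
   moreover have "nested H (f i) (f j) | nested H (f j) (f i)" for i j
   using le[of i "j - i"] le[of j "i - j"] by (cases "i <= j") auto
   ultimately show False using N[of "range f"] fD finite_imageD by blast
  qed
  thus ?thesis using S(1) by blast
 qed
 note o2 = conjunct2[OF conjunct2[OF orth[unfolded hhs_orthogonality_def]]]
 note o3 = conjunct1[OF o2] and o4 = conjunct1[OF conjunct2[OF o2]] and o5 = conjunct2[OF conjunct2[OF o2]]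
 have osym: "!!V W. V : ?D ==> W : ?D ==> orth H V W ==> orth H W V"
  and oirr: "!!V. V : ?D ==> ~ orth H V V"
 proof -
  have "symp_on ?D (orth H)" "irreflp_on ?D (orth H)" using orth unfolding hhs_orthogonality_def by simp_all
  thus "!!V W. V : ?D ==> W : ?D ==> orth H V W ==> orth H W V" "!!V. V : ?D ==> ~ orth H V V"
   by (metis symp_onD, metis irreflp_onD)
 qed
 have ole: "!!U V W. U : ?D ==> V : ?D ==> W : ?D ==> nested H V W ==> orth H W U ==> orth H V U"
  and onl: "!!V W. V : ?D ==> W : ?D ==> orth H V W ==> ~ nested H V W"
 proof -
  have "ALL U:?D. ALL V:?D. ALL W:?D. nested H V W & orth H W U --> orth H V U"
   "ALL V:?D. ALL W:?D. orth H V W --> ~ nested H V W & ~ nested H W V"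
   by (rule o3, rule o5)
  thus "!!U V W. U : ?D ==> V : ?D ==> W : ?D ==> nested H V W ==> orth H W U ==> orth H V U"
   "!!V W. V : ?D ==> W : ?D ==> orth H V W ==> ~ nested H V W" by blast+
 qed
 have cont: "EX W:?D. nested H W T & W ~= T & (ALL V:?D. nested H V T & orth H V U --> nested H V W)"
  if "T : ?D" "U : ?D" "nested H U T" "V : ?D" "nested H V T" "orth H V U" for T U V
 proof -
  have "ALL T:?D. ALL U:below H T. {V : below H T. orth H V U} ~= {} -->
   (EX W:below H T - {T}. ALL V:below H T. orth H V U --> nested H V W)"
   by (rule o4)
  moreover have "V : {V : below H T. orth H V U}" using that by simp
  ultimately have "EX W:below H T - {T}. ALL V:below H T. orth H V U --> nested H V W"
   using that(1-3) by (metis (no_types, lifting) empty_iff mem_Collect_eq)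
  thus ?thesis by auto
 qed
 show ?thesis
  by (intro exI[of _ N] domain_order.intro) (fact refl trans antisym top N osym oirr ole onl cont)+
qed

theorem hhg_structure_distances:
 fixes Gm :: "('g, 'm) monoid_scheme" and H :: "('g, 's, 'p) hhs"
 assumes "group Gm" and S: "finite S" "S <= carrier Gm" "generate Gm S = carrier Gm"
  and hhg: "hhg_structure Gm S H act isom"
 shows "EX n P R RR kp. hhg_distances (domains H) (nested H) (orth H) n Gm (word_metric Gm S) P R RR kp act"
proof -
 interpret group Gm by fact
 let ?D = "domains H" and ?d = "word_metric Gm S"
 have hhs: "hhs_structure (carrier Gm) ?d H" and ga: "group_action Gm ?D act"
  using hhg unfolding hhg_structure_def by auto
 obtain dl where delta: "dl >= 0" "!!W. W : ?D ==> hyperbolic_space dl (space H W) (sdist H W)"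
  using hhs unfolding hhs_structure_def by blast
 obtain xi kp0 K lam E where xi: "xi >= 0" "kp0 >= 0" and proj: "hhs_projections (carrier Gm) ?d H xi K"
  and nest: "hhs_nesting H xi" and cons: "hhs_consistency (carrier Gm) H xi kp0"
  and lam: "lam >= 1" "E >= max xi kp0" and ll: "hhs_large_links (carrier Gm) H lam E"
  using hhs unfolding hhs_structure_def by blast
 obtain al where pr: "hhs_partial_realization (carrier Gm) H al" using hhs unfolding hhs_structure_def by blast
 have uniq: "hhs_uniqueness (carrier Gm) ?d H" and orth: "hhs_orthogonality H" and fc: "hhs_finite_complexity H"
  using hhs unfolding hhs_structure_def by blast+
 obtain N where N: "domain_order ?D (nested H) (orth H) N" using hhs_domain_order[OF nest orth fc] by blast
 interpret O: domain_order ?D "nested H" "orth H" N by (rule N)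
 have lt: "O.lt V W \<longleftrightarrow> pnested H V W" and tr: "O.tr V W \<longleftrightarrow> transverse H V W" for V W
  unfolding O.lt_def O.tr_def pnested_def transverse_def by auto
 \<comment> \<open>Replacing infima by suprema costs the diameter bound \<open>xi\<close> for each
   of the two sets, and \<open>6 * dl + 2\<close> is the error of the four-point inequality.\<close>
 define kp where "kp = 3 + 3 * abs(K) + 4 * xi + kp0 + lam + abs(E) + abs(al) + 6 * dl"
 have kap: "kp >= 1" "kp >= xi" "kp >= K" "kp >= K + 2 * xi" "kp >= kp0 + 2 * xi" "kp >= lam" "kp >= lam + 2 * xi" "kp >= E + 2 * xi"
  "kp >= al + 2 * xi" "kp >= 6 * dl + 2" "kp >= K + 1 + 2 * xi" "kp >= 2 * K + 2 * xi"
  unfolding kp_def using xi lam delta by linarith+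
 have met: "Metric_space (space H W) (sdist H W)" if "W : ?D" for W
  using delta(2)[OF that] unfolding hyperbolic_space_def geodesic_space_def by simp
 have bp: "bdd_sub (space H W) (sdist H W) xi (proj H W x)" if "W : ?D" "x : carrier Gm" for W x
  using proj that unfolding hhs_projections_def bdd_sub_def by auto
 have br: "bdd_sub (space H W) (sdist H W) xi (rho H V W)" if "V : ?D" "W : ?D" "pnested H V W | transverse H V W" for V W
  using nest cons that unfolding hhs_nesting_def hhs_consistency_def bdd_sub_def by blast
 define P where "P W x y = supd (sdist H W) (proj H W x) (proj H W y)" for W x y
 define R where "R V W x = supd (sdist H W) (rho H V W) (proj H W x)" for V W x
 define RR where "RR U V W = supd (sdist H W) (rho H U W) (rho H V W)" for U V W
 note symd = Metric_space.supd_sym[OF met] and tri = Metric_space.supd_triangle[OF met]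
  and slei = Metric_space.sup_le_set_distance[OF met] and iles = Metric_space.set_distance_le_sup[OF met]
  and nonn = Metric_space.supd_nonneg[OF met]
 have P_inf: "P W x y <= dst H W (proj H W x) (proj H W y) + 2 * xi" "dst H W (proj H W x) (proj H W y) <= P W x y"
  if "W : ?D" "x : carrier Gm" "y : carrier Gm" for W x y
  unfolding P_def using slei[OF that(1) bp[OF that(1,2)] bp[OF that(1,3)]] iles[OF that(1) bp[OF that(1,2)] bp[OF that(1,3)]] by simp_all
 have R_inf: "R V W x <= dst H W (proj H W x) (rho H V W) + 2 * xi"
  if "V : ?D" "W : ?D" "pnested H V W | transverse H V W" "x : carrier Gm" for V W x
  unfolding R_def using slei[OF that(2) bp[OF that(2,4)] br[OF that(1-3)]] symd[OF that(2), of "rho H V W"] by simp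
 have trs: "transverse H W V" if "V : ?D" "W : ?D" "transverse H V W" for V W
  using O.tr_sym[OF that(1,2)] that tr by simp
 have P_sym: "P W x y = P W y x" if "W : ?D" "x : carrier Gm" "y : carrier Gm" for W x y
  unfolding P_def by (rule symd[OF that(1)])
 have P_nonneg: "0 <= P W x y" if "W : ?D" "x : carrier Gm" "y : carrier Gm" for W x y
  unfolding P_def by (rule nonn[OF that(1) bp bp]) (use that in auto)
 have P_refl: "P W x x <= kp" if "W : ?D" "x : carrier Gm" for W x
  unfolding P_def using Metric_space.supd_self[OF met bp] that kap(2) by force
 have P_tri: "P W x z <= P W x y + P W y z" if "W : ?D" "x : carrier Gm" "y : carrier Gm" "z : carrier Gm" for W x y z
  unfolding P_def by (rule tri[OF that(1) bp bp bp]) (use that in auto)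
 have d_nonneg: "0 <= ?d x y" for x y unfolding word_metric_def by auto
 have P_lip: "P W x y <= kp * ?d x y + kp" if "W : ?D" "x : carrier Gm" "y : carrier Gm" for W x y
 proof -
  have "dst H W (proj H W x) (proj H W y) <= K * ?d x y + K" using proj that unfolding hhs_projections_def by blast
  moreover have "K * ?d x y <= kp * ?d x y" using kap(3) d_nonneg by (intro mult_right_mono) auto
  ultimately show ?thesis using P_inf(1)[OF that] kap(4) by linarith
 qed
 have R_nonneg: "0 <= R V W x" if "V : ?D" "W : ?D" "O.lt V W | O.tr V W" "x : carrier Gm" for V W x
  unfolding R_def by (rule nonn[OF that(2) br bp]) (use that lt tr in auto)
 have R_le: "R V W x <= R V W y + P W y x"
  if "V : ?D" "W : ?D" "O.lt V W | O.tr V W" "x : carrier Gm" "y : carrier Gm" for V W x y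
  unfolding R_def P_def by (rule tri[OF that(2) br bp bp]) (use that lt tr in auto)
 have P_le_R: "P W x y <= R V W x + R V W y"
  if "V : ?D" "W : ?D" "O.lt V W | O.tr V W" "x : carrier Gm" "y : carrier Gm" for V W x y
  using tri[OF that(2) bp[OF that(2,4)] br[OF that(1,2)] bp[OF that(2,5)]] symd[OF that(2), of "rho H V W" "proj H W x"] that(3) lt tr
  unfolding R_def P_def by simp
 have R_RR: "R U W x <= R V W x + RR U V W"
  if "U : ?D" "V : ?D" "W : ?D" "O.lt U W | O.tr U W" "O.lt V W | O.tr V W" "x : carrier Gm" for U V W x
  using tri[OF that(3) br[OF that(1,3)] br[OF that(2,3)] bp[OF that(3,6)]] that(4,5) lt tr
  unfolding R_def RR_def by simp
 have RR_le: "RR U V W <= R U W x + R V W x"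
  if "U : ?D" "V : ?D" "W : ?D" "O.lt U W | O.tr U W" "O.lt V W | O.tr V W" "x : carrier Gm" for U V W x
  using tri[OF that(3) br[OF that(1,3)] bp[OF that(3,6)] br[OF that(2,3)]] that(4,5) lt tr symd[OF that(3), of "rho H V W" "proj H W x"]
  unfolding R_def RR_def by simp
 have RR_sym: "RR U V W = RR V U W"
  if "U : ?D" "V : ?D" "W : ?D" "O.lt U W | O.tr U W" "O.lt V W | O.tr V W" for U V W
  unfolding RR_def by (rule symd[OF that(3)])
 have RR_nested: "RR U V W <= kp"
  if h: "U : ?D" "V : ?D" "W : ?D" "nested H U V" "O.lt V W | O.tr V W & ~ orth H W U" for U V W
 proof -
  have 1: "pnested H V W | transverse H V W & ~ orth H W U" using h(5) lt tr by simp
  have "U ~= W" using h O.le_antisym unfolding O.lt_def O.tr_def by auto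
  moreover have "~ nested H W U" using h O.le_trans[of W U V] O.le_antisym[of V W] O.le_antisym[of U W] calculation O.le_trans[of U V W]
   unfolding O.lt_def O.tr_def by blast
  moreover have "nested H U W | ~ orth H U W"
   using h O.le_trans[of U V W] O.orth_sym[of U W] unfolding O.lt_def O.tr_def by blast
  ultimately have 2: "pnested H U W | transverse H U W" unfolding pnested_def transverse_def by blast
  have "dst H W (rho H U W) (rho H V W) <= kp0" using cons h(1-4) 1 unfolding hhs_consistency_def by blast
  thus ?thesis unfolding RR_def using slei[OF h(3) br[OF h(1,3) 2] br[OF h(2,3)]] 1 kap(5) by auto
 qed
 have consistency: "R V W x <= kp | R W V x <= kp" if h: "V : ?D" "W : ?D" "O.tr V W" "x : carrier Gm" for V W x
 proof -
  have t: "transverse H V W" "transverse H W V" using h tr trs by auto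
  have "min (dst H W (proj H W x) (rho H V W)) (dst H V (proj H V x) (rho H W V)) <= kp0"
   using cons h(1,2,4) t(1) unfolding hhs_consistency_def by blast
  thus ?thesis using R_inf[OF h(1,2) _ h(4)] R_inf[OF h(2,1) _ h(4)] t kap(5) by (auto simp: min_def split: if_splits)
 qed
 have large_links: "EX F. finite F & F <= ?D & real (card F) <= kp * P W x y + kp &
   (ALL T:F. O.lt T W & R T W x <= kp * P W x y + kp) &
   (ALL V:?D. O.lt V W --> (EX T:F. nested H V T) | P V x y <= kp)"
  if h: "W : ?D" "x : carrier Gm" "y : carrier Gm" for W x y
 proof (cases "below H W - {W} = {}")
  case True
  hence "~ O.lt V W" if "V : ?D" for V using that unfolding O.lt_def by auto
  thus ?thesis using P_nonneg[OF h] kap(1) by (intro exI[of _ "{}"]) auto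
 next
  case False
  define N where "N = lam * dst H W (proj H W x) (proj H W y) + lam"
  obtain T where T: "ALL i:{1..nat \<lfloor>N\<rfloor>}. T i : below H W - {W} & dst H W (proj H W x) (rho H (T i) W) <= N"
   "ALL V:below H W - {W}. (EX i:{1..nat \<lfloor>N\<rfloor>}. V : below H (T i)) | dst H V (proj H V x) (proj H V y) < E"
   using ll False h unfolding hhs_large_links_def Let_def N_def by blast
  have "lam * dst H W (proj H W x) (proj H W y) <= lam * P W x y" using P_inf(2)[OF h] lam by simp
  also have "... <= kp * P W x y" using kap(6) P_nonneg[OF h] by (rule mult_right_mono)
  finally have Nk: "N + 2 * xi <= kp * P W x y + kp" unfolding N_def using kap(7) by linarith
  let ?F = "T ` {1..nat \<lfloor>N\<rfloor>}"
  have "card ?F <= nat \<lfloor>N\<rfloor>" using card_image_le[of "{1..nat \<lfloor>N\<rfloor>}" T] by simp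
  moreover have "kp * P W x y + kp >= 0" using kap(1) P_nonneg[OF h] by simp
  ultimately have c: "real (card ?F) <= kp * P W x y + kp" using Nk xi by linarith
  have "O.lt U W & R U W x <= kp * P W x y + kp" if U: "U : ?F" for U
  proof -
   have 1: "U : below H W - {W}" "dst H W (proj H W x) (rho H U W) <= N" using T(1) U by auto
   hence 2: "U : ?D" "pnested H U W" unfolding pnested_def by auto
   thus ?thesis using R_inf[OF 2(1) h(1) _ h(2)] 1(2) Nk lt by auto
  qed
  moreover have "(EX T:?F. nested H V T) | P V x y <= kp" if V: "V : ?D" "O.lt V W" for V
  proof -
   have "V : below H W - {W}" using V unfolding O.lt_def by auto
   hence "(EX i:{1..nat \<lfloor>N\<rfloor>}. V : below H (T i)) | dst H V (proj H V x) (proj H V y) < E" using T(2) by blast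
   thus ?thesis using P_inf(1)[OF V(1) h(2,3)] kap(8) by auto
  qed
  ultimately show ?thesis using c T(1) by (intro exI[of _ ?F]) auto
 qed
 have realization: "EX z:carrier Gm. ALL V:F. P V z (b V) <= kp & (ALL W:?D. O.lt V W | O.tr V W --> R V W z <= kp)"
  if F: "O.ofam F" and b: "!!V. V : F ==> b V : carrier Gm" for F b
 proof -
  have FD: "F <= ?D" "ALL V:F. ALL W:F. V ~= W --> orth H V W" using F unfolding O.ofam_def by auto
  have ne: "proj H V (b V) ~= {}" if "V : F" for V using bp[of V "b V"] FD b that unfolding bdd_sub_def by auto
  define p where "p V = (SOME q. q : proj H V (b V))" for V
  have p: "p V : proj H V (b V)" if "V : F" for V unfolding p_def using ne[OF that] by (rule some_in_eq[THEN iffD2])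
  have "ALL V:F. p V : (\<Union>x\<in>carrier Gm. proj H V x)" using p b by blast
  then obtain z where z: "z : carrier Gm" "ALL V:F. dst H V (proj H V z) {p V} <= al &
   (ALL W:?D. pnested H V W | transverse H W V --> dst H W (proj H W z) (rho H V W) <= al)"
   using pr[unfolded hhs_partial_realization_def, rule_format, of F p, OF conjI[OF FD(1) conjI[OF FD(2)]]] by blast
  have "P V z (b V) <= kp" if V: "V : F" for V
  proof -
   have VD: "V : ?D" using V FD by auto
   interpret MV: Metric_space "space H V" "sdist H V" by (rule met[OF VD])
   have pV: "bdd_sub (space H V) (sdist H V) 0 {p V}"
   by (rule MV.bounded_singleton) (use p[OF V] bp[OF VD b[OF V]] in "auto simp: bdd_sub_def")
   have "supd (sdist H V) (proj H V z) {p V} <= al + xi"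
   using slei[OF VD bp[OF VD z(1)] pV] z(2) V by force
   moreover have "supd (sdist H V) {p V} (proj H V (b V)) <= xi"
   by (rule MV.supd_le) (use p[OF V] bp[OF VD b[OF V]] in "auto simp: bdd_sub_def diam_le_def")
   ultimately show ?thesis using tri[OF VD bp[OF VD z(1)] pV bp[OF VD b[OF V]]] kap(9) unfolding P_def by linarith
  qed
  moreover have "R V W z <= kp" if V: "V : F" "W : ?D" "O.lt V W | O.tr V W" for V W
  proof -
   have VD: "V : ?D" using V FD by auto
   have r: "pnested H V W | transverse H V W" "pnested H V W | transverse H W V" using V(3) lt tr trs[OF VD V(2)] by auto
   hence "dst H W (proj H W z) (rho H V W) <= al" using z(2) V by blast
   thus ?thesis using R_inf[OF VD V(2) r(1) z(1)] kap(9) by linarith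
  qed
  ultimately show ?thesis using z(1) by blast
 qed
 have uniqueness: "EX tht. ALL x:carrier Gm. ALL y:carrier Gm. (ALL V:?D. P V x y <= c) --> ?d x y <= tht" for c
 proof -
  obtain tht where th: "ALL x:carrier Gm. ALL y:carrier Gm. ?d x y >= tht -->
   (EX V:?D. dst H V (proj H V x) (proj H V y) >= max 0 c + 1)"
  proof -
   have "max 0 c + 1 >= 0" by simp
   thus ?thesis using spec[OF uniq[unfolded hhs_uniqueness_def], of "max 0 c + 1"] that by blast
  qed
  have "?d x y <= tht" if "x : carrier Gm" "y : carrier Gm" "ALL V:?D. P V x y <= c" for x y
  proof (rule ccontr)
   assume "~ ?d x y <= tht"
   hence "tht <= ?d x y" by linarith
   hence "EX V:?D. dst H V (proj H V x) (proj H V y) >= max 0 c + 1"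
   using bspec[OF bspec[OF th that(1)] that(2)] by blast
   then obtain V where V: "V : ?D" "dst H V (proj H V x) (proj H V y) >= max 0 c + 1" by blast
   have "P V x y <= c" using that(3) V(1) by blast
   thus False using P_inf(2)[OF V(1) that(1,2)] V(2) by linarith
  qed
  thus ?thesis by blast
 qed
 have four: "P W x y + P W z w <= max (P W x z + P W y w) (P W x w + P W y z) + kp"
  if h: "W : ?D" "x : carrier Gm" "y : carrier Gm" "z : carrier Gm" "w : carrier Gm" for W x y z w
  using Metric_space.supd_four_point[OF met[OF h(1)]
   Metric_space.hyperbolic_four_point[OF met[OF h(1)] delta(2)[OF h(1)] delta(1)]
   bp[OF h(1,2)] bp[OF h(1,3)] bp[OF h(1,4)] bp[OF h(1,5)]] kap(10)
  unfolding P_def by linarith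
 have geo: "EX (c :: nat => 'g) l. (ALL i<=l. c i : carrier Gm) & P W (c 0) x <= kp & P W (c l) y <= kp &
   (ALL i<=l. ALL j<=l. abs(P W (c i) (c j) - abs(real i - real j)) <= kp)"
  if h: "W : ?D" "x : carrier Gm" "y : carrier Gm" for W x y
 proof -
  have g: "geodesic_space (space H W) (sdist H W)" using delta(2)[OF h(1)] unfolding hyperbolic_space_def by simp
  have q: "quasiconvex K (space H W) (sdist H W) (\<Union>x\<in>carrier Gm. proj H W x)"
   using proj h(1) unfolding hhs_projections_def by blast
  obtain c :: "nat => 'g" and l where c: "ALL i<=l. c i : carrier Gm" "P W (c 0) x <= K + 2 * xi" "P W (c l) y <= K + 1 + 2 * xi"
   "ALL i<=l. ALL j<=l. abs(P W (c i) (c j) - abs(real i - real j)) <= 2 * K + 2 * xi"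
   using Metric_space.quasiconvex_coarse_geodesic[OF met[OF h(1)] g q xi(1) bp[OF h(1)] h(2,3)] unfolding P_def by blast
  show ?thesis
   by (rule exI[of _ c], rule exI[of _ l]) (use c kap(4,11,12) in force)
 qed
 interpret ga: group_action Gm ?D act by (rule ga)
 have a_closed: "act g V : ?D" if "g : carrier Gm" "V : ?D" for g V using ga.element_image[OF that] by simp
 have a_mult: "act (g **\<^bsub>Gm\<^esub> h) V = act g (act h V)" if "g : carrier Gm" "h : carrier Gm" "V : ?D" for g h V
  using ga.composition_rule that by blast
 have a_one: "act \<one>\<^bsub>Gm\<^esub> V = V" if "V : ?D" for V using ga.id_eq_one[symmetric] that by auto
 note h3 = conjunct2[OF conjunct2[OF conjunct2[OF hhg[unfolded hhg_structure_def]]]]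
 note h4 = conjunct1[OF h3] and h5 = conjunct1[OF conjunct2[OF h3]]
  and h7 = conjunct1[OF conjunct2[OF conjunct2[OF conjunct2[OF h3]]]]
  and h8 = conjunct2[OF conjunct2[OF conjunct2[OF conjunct2[OF h3]]]]
 have pres: "(nested H (act g U) (act g V) \<longleftrightarrow> nested H U V) & (orth H (act g U) (act g V) \<longleftrightarrow> orth H U V)"
  if "g : carrier Gm" "U : ?D" "V : ?D" for g U V
  using bspec[OF bspec[OF bspec[OF h4 that(1)] that(2)] that(3)] by simp
 have iso: "sdist H (act g U) (isom g U p) (isom g U q) = sdist H U p q"
  if "g : carrier Gm" "U : ?D" "p : space H U" "q : space H U" for g U p q
  using bspec[OF bspec[OF conjunct2[OF bspec[OF bspec[OF h5 that(1)] that(2)]] that(3)] that(4)] .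
 have pim: "proj H (act g U) (g **\<^bsub>Gm\<^esub> x) = isom g U ` proj H U x"
  if "g : carrier Gm" "x : carrier Gm" "U : ?D" for g x U
  using bspec[OF bspec[OF bspec[OF h7 that(1)] that(2)] that(3)] by simp
 have rim: "rho H (act g U) (act g V) = isom g V ` rho H U V"
  if "g : carrier Gm" "U : ?D" "V : ?D" "transverse H U V | pnested H U V" for g U V
  using mp[OF bspec[OF bspec[OF bspec[OF h8 that(1)] that(2)] that(3)] that(4)] by simp
 have P_act: "P (act g W) (g **\<^bsub>Gm\<^esub> x) (g **\<^bsub>Gm\<^esub> y) = P W x y"
  if h: "g : carrier Gm" "W : ?D" "x : carrier Gm" "y : carrier Gm" for g W x y
  unfolding P_def pim[OF h(1,3,2)] pim[OF h(1,4,2)]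
  by (rule supd_image[where M = "space H W"])
   (use iso[OF h(1,2)] bp[OF h(2,3)] bp[OF h(2,4)] in "auto simp: bdd_sub_def")
 have R_act: "R (act g V) (act g W) (g **\<^bsub>Gm\<^esub> x) = R V W x"
  if h: "g : carrier Gm" "V : ?D" "W : ?D" "x : carrier Gm" "O.lt V W | O.tr V W" for g V W x
 proof -
  have r: "transverse H V W | pnested H V W" "pnested H V W | transverse H V W" using h(5) lt tr by auto
  show ?thesis unfolding R_def pim[OF h(1,4,3)] rim[OF h(1-3) r(1)]
   by (rule supd_image[where M = "space H W"])
   (use iso[OF h(1,3)] bp[OF h(3,4)] br[OF h(2,3) r(2)] in "auto simp: bdd_sub_def")
 qed
 have carr: "carrier Gm ~= {}" by auto
 have 1: "hhs_distances ?D (nested H) (orth H) N (carrier Gm) ?d P R RR kp"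
  by (intro hhs_distances.intro N hhs_distances_axioms.intro)
   (fact kap carr P_sym P_nonneg P_refl P_tri P_lip R_nonneg R_le P_le_R R_RR RR_le RR_sym RR_nested consistency
   large_links realization uniqueness)+
 note dact = wm_inv[of _ _ _ S] and fb = word_metric_finite_balls[OF S]
 have a_le: "nested H (act g V) (act g W) = nested H V W" if "g : carrier Gm" "V : ?D" "W : ?D" for g V W
  using pres[OF that] by blast
 have a_orth: "orth H (act g V) (act g W) = orth H V W" if "g : carrier Gm" "V : ?D" "W : ?D" for g V W
  using pres[OF that] by blast
 have "hhg_distances ?D (nested H) (orth H) N Gm ?d P R RR kp act"
  by (intro hhg_distances.intro 1 hhg_distances_axioms.intro)
   (fact group_axioms four geo a_closed a_mult a_one a_le a_orth P_act R_act dact d_nonneg fb)+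
 thus ?thesis by blast
qed

section \<open>Integer matrices\<close>

text \<open>Multiplying by the adjugate shows that an injective endomorphism of \<open>\<int>\<^sup>n\<close> has image of finite index, and conversely.\<close>

lemma int_matrix_injective_cofinal:
 fixes M :: "nat => nat => int"
 assumes inj: "!!x. (ALL i<n. (\<Sum>j<n. M i j * x j) = 0) ==> ALL j<n. x j = 0"
 shows "EX m>0. ALL y. EX x. ALL i<n. (\<Sum>j<n. M i j * x j) = m * y i"
proof -
 define A where "A = mat n n (%(i, j). M i j)"
 have A: "A : carrier_mat n n" unfolding A_def by auto
 have mv: "(A *\<^sub>v v) $ i = (\<Sum>j<n. M i j * v $ j)" if "v : carrier_vec n" "i < n" for v i
  using that unfolding A_def by (auto simp: mult_mat_vec_def scalar_prod_def atLeast0LessThan intro!: sum.cong)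
 have "det A ~= 0"
 proof
  assume "det A = 0"
  then obtain v where v: "v : carrier_vec n" "v ~= 0\<^sub>v n" "A *\<^sub>v v = 0\<^sub>v n"
   using det_0_iff_vec_prod_zero[OF A] by auto
  have "ALL i<n. (\<Sum>j<n. M i j * v $ j) = 0" using mv[OF v(1)] v(3) by (metis index_zero_vec(1))
  hence "ALL j<n. v $ j = 0" using inj by blast
  thus False using v(1,2) by (metis carrier_vecD eq_vecI index_zero_vec(1,2))
 qed
 define s where "s = sgn (det A)"
 have sd: "s * det A = abs(det A)" unfolding s_def by (simp add: mult.commute abs_sgn)
 have B: "adj_mat A : carrier_mat n n" "A * adj_mat A = det A \<cdot>\<^sub>m 1\<^sub>m n" using adj_mat[OF A] by auto
 have "EX x. ALL i<n. (\<Sum>j<n. M i j * x j) = abs(det A) * y i" for y :: "nat => int"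
 proof -
  define w where "w = vec n (%i. s * y i)"
  define v where "v = adj_mat A *\<^sub>v w"
  have w: "w : carrier_vec n" unfolding w_def by auto
  have v: "v : carrier_vec n" unfolding v_def using B w by auto
  have "A *\<^sub>v v = (A * adj_mat A) *\<^sub>v w" unfolding v_def by (rule assoc_mult_mat_vec[OF A B(1) w, symmetric])
  also have "... = det A \<cdot>\<^sub>v w" unfolding B(2)
  proof (rule eq_vecI)
   fix i assume "i < dim_vec (det A \<cdot>\<^sub>v w)"
   hence i: "i < n" using w by simp
   have "(det A \<cdot>\<^sub>m 1\<^sub>m n *\<^sub>v w) $ i = (\<Sum>j<n. det A * (if j = i then 1 else 0) * w $ j)"
   using i w by (simp add: mult_mat_vec_def scalar_prod_def atLeast0LessThan)
   also have "... = (\<Sum>j<n. if j = i then det A * w $ j else 0)" by (rule sum.cong) auto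
   also have "... = (det A \<cdot>\<^sub>v w) $ i" using i w by simp
   finally show "(det A \<cdot>\<^sub>m 1\<^sub>m n *\<^sub>v w) $ i = (det A \<cdot>\<^sub>v w) $ i" .
  qed (use w in simp)
  finally have e: "A *\<^sub>v v = det A \<cdot>\<^sub>v w" .
  have "(\<Sum>j<n. M i j * v $ j) = abs(det A) * y i" if i: "i < n" for i
  proof -
   have "(\<Sum>j<n. M i j * v $ j) = (det A \<cdot>\<^sub>v w) $ i" using mv[OF v i] e by simp
   also have "... = det A * (s * y i)" using i unfolding w_def by simp
   finally show ?thesis using sd by (simp add: algebra_simps)
  qed
  thus ?thesis by (intro exI[of _ "%j. v $ j"]) simp
 qed
 thus ?thesis using \<open>det A ~= 0\<close> by (intro exI[of _ "abs(det A)"]) auto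
qed

lemma int_matrix_cofinal_injective:
 fixes M :: "nat => nat => int"
 assumes m: "m ~= 0" and surj: "!!y. EX x. ALL i<n. (\<Sum>j<n. M i j * x j) = m * y i"
  and x: "ALL i<n. (\<Sum>j<n. M i j * x j) = 0"
 shows "ALL j<n. x j = 0"
proof -
 define A where "A = mat n n (%(i, j). M i j)"
 have A: "A : carrier_mat n n" unfolding A_def by auto
 have mv: "(A *\<^sub>v v) $ i = (\<Sum>j<n. M i j * v $ j)" if "v : carrier_vec n" "i < n" for v i
  using that unfolding A_def by (auto simp: mult_mat_vec_def scalar_prod_def atLeast0LessThan intro!: sum.cong)
 have "ALL k. EX x. ALL i<n. (\<Sum>j<n. M i j * x j) = m * (if i = k then 1 else 0)" by (intro allI surj)
 from choice[OF this] obtain X where X: "ALL k. ALL i<n. (\<Sum>j<n. M i j * X k j) = m * (if i = k then 1 else 0)" by blast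
 define B where "B = mat n n (%(j, k). X k j)"
 have B: "B : carrier_mat n n" unfolding B_def by auto
 have "A * B = m \<cdot>\<^sub>m 1\<^sub>m n"
 proof (rule eq_matI)
  fix i k assume "i < dim_row (m \<cdot>\<^sub>m 1\<^sub>m n)" "k < dim_col (m \<cdot>\<^sub>m 1\<^sub>m n)"
  hence ik: "i < n" "k < n" by auto
  have "(A * B) $$ (i, k) = (\<Sum>j<n. M i j * X k j)"
   using ik unfolding A_def B_def by (auto simp: scalar_prod_def atLeast0LessThan intro!: sum.cong)
  thus "(A * B) $$ (i, k) = (m \<cdot>\<^sub>m 1\<^sub>m n) $$ (i, k)" using X[rule_format, of i k] ik by simp
 qed (use A B in auto)
 hence "det A * det B = m ^ n" using det_mult[OF A B] by simp
 hence "det A ~= 0" using m by auto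
 hence no: "~ (EX v. v : carrier_vec n & v ~= 0\<^sub>v n & A *\<^sub>v v = 0\<^sub>v n)"
  using det_0_iff_vec_prod_zero[OF A] by simp
 define v where "v = vec n x"
 have v: "v : carrier_vec n" unfolding v_def by auto
 have "A *\<^sub>v v = 0\<^sub>v n"
 proof (rule eq_vecI)
  fix i assume "i < dim_vec (0\<^sub>v n :: int vec)"
  hence i: "i < n" by simp
  have "(A *\<^sub>v v) $ i = (\<Sum>j<n. M i j * v $ j)" by (rule mv[OF v i])
  also have "... = (\<Sum>j<n. M i j * x j)" unfolding v_def by (auto intro!: sum.cong)
  finally have "(A *\<^sub>v v) $ i = (\<Sum>j<n. M i j * x j)" .
  thus "(A *\<^sub>v v) $ i = 0\<^sub>v n $ i" using x i by simp
 qed (use A in auto)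
 hence "v = 0\<^sub>v n" using no v by auto
 thus ?thesis unfolding v_def by (metis index_vec index_zero_vec(1))
qed

section \<open>Coordinates on a based abelian subgroup and the modular homomorphism\<close>

context group
begin

lemma conj_mult:
 assumes "g : CG" "x : CG" "y : CG"
 shows "g ** (x ** y) ** inv g = (g ** x ** inv g) ** (g ** y ** inv g)"
 using assms by (simp add: m_assoc)

lemma conj_inv: "g : CG ==> x : CG ==> g ** inv x ** inv g = inv (g ** x ** inv g)"
 by (simp add: inv_mult_group m_assoc)

lemma monomial_0 [simp]: "monomial 0 G a k = \<one>"
 unfolding monomial_def by simp

lemma monomial_Suc:
 assumes "!!i. i <= n ==> a i : CG"
 shows "monomial (Suc n) G a k = monomial n G a k ** a n [^] k n"
proof -
 have "set (map (%i. a i [^] k i) [0..<n]) <= CG" using assms by auto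
 thus ?thesis unfolding monomial_def using assms[of n] by (simp add: lp_append)
qed

lemma monomial_cong:
 "(!!i. i < n ==> a i = a' i) ==> (!!i. i < n ==> k i = k' i) ==> monomial n G a k = monomial n G a' k'"
 unfolding monomial_def by (intro arg_cong[where f = "list_product G"]) simp

end

locale comm_sub = group G for G (structure) +
 fixes A :: "'a set"
 assumes sub: "subgroup A G" and comm: "x : A ==> y : A ==> x ** y = y ** x"
begin

lemma A_carr: "x : A ==> x : CG" using subgroup.subset[OF sub] by auto
lemma A_closed [simp]: "x : A ==> y : A ==> x ** y : A" "x : A ==> inv x : A" "\<one> : A"
 using subgroup.m_closed[OF sub] subgroup.m_inv_closed[OF sub] subgroup.one_closed[OF sub] by auto
lemma A_pow [simp]: "x : A ==> x [^] (k::int) : A" "x : A ==> x [^] (m::nat) : A"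
 using int_pow_in_subgroup[OF sub, of x k] int_pow_in_subgroup[OF sub, of x "int m"] by (auto simp: int_pow_int)

lemma A_reorder:
 assumes "w : A" "x : A" "y : A" "z : A"
 shows "(w ** x) ** (y ** z) = (w ** y) ** (x ** z)"
proof -
 have "(w ** x) ** (y ** z) = w ** (x ** y) ** z" using assms A_carr by (simp add: m_assoc)
 also have "... = w ** (y ** x) ** z" using comm assms by simp
 finally show ?thesis using assms A_carr by (simp add: m_assoc)
qed

lemma pow_mult_A: "x : A ==> y : A ==> (x ** y) [^] (k::nat) = x [^] k ** y [^] k"
 using pow_mult_distrib[of x y k] comm A_carr by auto

lemma int_pow_mult_A: "x : A ==> y : A ==> (x ** y) [^] (k::int) = x [^] k ** y [^] k"
 using int_pow_mult_distrib[of x y k] comm A_carr by auto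

lemma monomial_in: "(!!i. i < n ==> a i : A) ==> monomial n G a k : A"
proof (induction n)
 case (Suc n)
 have c: "!!i. i <= n ==> a i : CG" using Suc.prems A_carr by auto
 have ms: "monomial (Suc n) G a k = monomial n G a k ** a n [^] k n" for k by (rule monomial_Suc) (rule c)
 show ?case unfolding ms using Suc by simp
qed simp

lemma monomial_add:
 "(!!i. i < n ==> a i : A) ==> monomial n G a (%i. k i + l i) = monomial n G a k ** monomial n G a l"
proof (induction n)
 case (Suc n)
 have c: "!!i. i <= n ==> a i : CG" using Suc.prems A_carr by auto
 have ms: "monomial (Suc n) G a k = monomial n G a k ** a n [^] k n" for k by (rule monomial_Suc) (rule c)
 have "a n [^] (k n + l n) = a n [^] k n ** a n [^] l n" using c[of n] by (simp add: int_pow_mult)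
 thus ?case unfolding ms
  using Suc A_reorder[of "monomial n G a k" "monomial n G a l" "a n [^] k n" "a n [^] l n"] monomial_in[of n a] by simp
qed simp

lemma monomial_pow:
 "(!!i. i < n ==> a i : A) ==> monomial n G a (%i. m * k i) = monomial n G a k [^] (m::int)"
proof (induction n)
 case (Suc n)
 have c: "!!i. i <= n ==> a i : CG" using Suc.prems A_carr by auto
 have ms: "monomial (Suc n) G a k = monomial n G a k ** a n [^] k n" for k by (rule monomial_Suc) (rule c)
 have "a n [^] (m * k n) = (a n [^] k n) [^] m" using c[of n] by (simp add: int_pow_pow mult.commute)
 thus ?case unfolding ms
  using Suc int_pow_mult_A[of "monomial n G a k" "a n [^] k n" m] monomial_in[of n a] by simp
qed simp

lemma monomial_pow_left:
 assumes "!!i. i < n ==> a i : A"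
 shows "monomial n G (%i. a i [^] (m::nat)) k = monomial n G a (%i. int m * k i)"
 unfolding monomial_def
 by (intro arg_cong[where f = "list_product G"]) (use assms A_carr in "auto simp: int_pow_pow int_pow_int[symmetric]")

end

locale based_subgroup = comm_sub G A for G (structure) and A +
 fixes n :: nat and a :: "nat => 'a"
 assumes basis: "ordered_basis n G A a"
begin

lemma a_in: "i < n ==> a i : A" using basis unfolding ordered_basis_def by auto
lemma a_carrier: "i < n ==> a i : CG" using a_in A_carr by auto
lemma mono_in [simp]: "monomial n G a k : A" by (rule monomial_in) (rule a_in)
lemma mono_add: "monomial n G a (%i. k i + l i) = monomial n G a k ** monomial n G a l" by (rule monomial_add) (rule a_in)
lemma mono_pow: "monomial n G a (%i. m * k i) = monomial n G a k [^] (m::int)" by (rule monomial_pow) (rule a_in)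

definition crd :: "'a => nat => int" where
 "crd x = (THE k. k : {..<n} \<rightarrow>\<^sub>E UNIV & x = monomial n G a k)"

lemma crd_ex1: "x : A ==> EX! k. k : {..<n} \<rightarrow>\<^sub>E UNIV & x = monomial n G a k"
 using basis unfolding ordered_basis_def by auto

lemma crd: "x : A ==> monomial n G a (crd x) = x"
 unfolding crd_def using theI'[OF crd_ex1] by metis

lemma crd_unique: assumes "monomial n G a k = x" "i < n" shows "crd x i = k i"
proof -
 have x: "x : A" using assms(1) mono_in by metis
 have "restrict k {..<n} : {..<n} \<rightarrow>\<^sub>E UNIV & x = monomial n G a (restrict k {..<n})"
  using assms(1) monomial_cong[of n a a k "restrict k {..<n}"] by auto
 hence "crd x = restrict k {..<n}" unfolding crd_def by (intro the1_equality[OF crd_ex1[OF x]])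
 thus ?thesis using assms by simp
qed

lemma crd_mult: assumes "x : A" "y : A" "i < n" shows "crd (x ** y) i = crd x i + crd y i"
 by (rule crd_unique[OF _ assms(3)]) (use mono_add crd assms in simp)

lemma crd_int_pow: assumes "x : A" "i < n" shows "crd (x [^] (m::int)) i = m * crd x i"
 by (rule crd_unique[OF _ assms(2)]) (use mono_pow crd assms in simp)

lemma crd_pow: assumes "x : A" "i < n" shows "crd (x [^] (m::nat)) i = int m * crd x i"
 using crd_int_pow[OF assms, of "int m"] by (simp add: int_pow_int)

lemma crd_one: "i < n ==> crd \<one> i = 0"
 using crd_mult[of \<one> \<one> i] by simp

lemma crd_inj: assumes "x : A" "y : A" "!!i. i < n ==> crd x i = crd y i" shows "x = y"
 using monomial_cong[of n a a "crd x" "crd y"] crd assms by auto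

lemma torsion_free: assumes "x : A" "x [^] (k::nat) = \<one>" "k >= 1" shows "x = \<one>"
proof (rule crd_inj)
 fix i assume "i < n"
 thus "crd x i = crd \<one> i" using crd_pow[OF assms(1), of i k] crd_one[of i] assms by simp
qed (use assms in auto)

lemma crd_basis: assumes "i < n" "j < n" shows "crd (a j) i = (if i = j then 1 else 0)"
proof (rule crd_unique[OF _ assms(1)])
 have "(!!i. i < m ==> a i : A) ==> monomial m G a (%i. if i = j then 1 else 0) = (if j < m then a j else \<one>)" for m
 proof (induction m)
  case (Suc m)
  have c: "!!i. i <= m ==> a i : CG" using Suc.prems A_carr by auto
 have ms: "monomial (Suc m) G a k = monomial m G a k ** a m [^] k m" for k by (rule monomial_Suc) (rule c)
  have cj: "!!i. i < Suc m ==> a i : CG" using Suc.prems A_carr by auto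
  show ?case unfolding ms using Suc c[of m] cj[of j] by (auto simp: less_Suc_eq)
 qed simp
 thus "monomial n G a (%i. if i = j then 1 else 0) = a j" using a_in assms by simp
qed

lemma generate_pow_eq: "generate G {a j [^] m | j. j < n} = {monomial n G a (%i. int m * k i) | k. True}" for m :: nat
proof (intro equalityI subsetI)
 let ?S = "{a j [^] m | j. j < n}" and ?M = "{monomial n G a (%i. int m * k i) | k. True}"
 have Sc: "?S <= CG" using a_carrier by auto
 fix x assume "x : generate G ?S"
 thus "x : ?M"
 proof (induction rule: generate.induct)
  case one
  have "monomial n G a (%i. int m * 0) = monomial n G a (%i. 0) [^] int m" by (rule monomial_pow) (use a_in in auto)
  moreover have "monomial n G a (%i. 0 * 0) = monomial n G a (%i. 0) [^] (0::int)" by (rule monomial_pow) (use a_in in auto)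
  ultimately have "\<one> = monomial n G a (%i. int m * 0)" by simp
  thus ?case by (intro CollectI exI[of _ "%i. 0"]) simp
 next
  case (incl h)
  then obtain j where j: "j < n" "h = a j [^] m" by auto
  hence "h = monomial n G a (%i. int m * crd (a j) i)"
   using mono_pow[of "int m" "crd (a j)"] crd[OF a_in[OF j(1)]] by (simp add: int_pow_int)
  thus ?case by blast
 next
  case (inv h)
  then obtain j where j: "j < n" "h = a j [^] m" by auto
  hence "inv h = (a j [^] int m) [^] (-1::int)" using a_carrier by (simp add: int_pow_int int_pow_neg)
  also have "... = monomial n G a (%i. int m * crd (a j) i) [^] (-1::int)"
   using mono_pow[of "int m" "crd (a j)"] crd[OF a_in[OF j(1)]] by simp
  also have "... = monomial n G a (%i. -1 * (int m * crd (a j) i))" by (rule monomial_pow[symmetric]) (use a_in in auto)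
  also have "... = monomial n G a (%i. int m * (- crd (a j) i))" by (simp add: algebra_simps)
  finally show ?case by (intro CollectI exI[of _ "%i. - crd (a j) i"]) simp
 next
  case (eng h1 h2)
  then obtain k l where "h1 = monomial n G a (%i. int m * k i)" "h2 = monomial n G a (%i. int m * l i)" by auto
  hence "h1 ** h2 = monomial n G a (%i. int m * k i + int m * l i)" using mono_add by simp
  also have "... = monomial n G a (%i. int m * (k i + l i))" by (simp add: algebra_simps)
  finally show ?case by (intro CollectI exI[of _ "%i. k i + l i"]) simp
 qed
next
 let ?S = "{a j [^] m | j. j < n}" and ?M = "{monomial n G a (%i. int m * k i) | k. True}"
 have Sc: "?S <= CG" using a_carrier by auto
 have "subgroup (generate G ?S \<inter> A) G" by (rule subgroups_Inter_pair[OF generate_is_subgroup[OF Sc] sub])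
 then interpret S: comm_sub G "generate G ?S \<inter> A"
  by (intro comm_sub.intro comm_sub_axioms.intro is_group) (use comm in auto)
 fix x assume "x : ?M"
 moreover have "monomial n G (%i. a i [^] m) k = monomial n G a (%i. int m * k i)" for k
  by (rule monomial_pow_left) (rule a_in)
 ultimately obtain k where "x = monomial n G (%i. a i [^] m) k" by auto
 moreover have "monomial n G (%i. a i [^] m) k : generate G ?S \<inter> A"
  by (rule S.monomial_in) (use a_in in "auto intro: generate.incl")
 ultimately show "x : generate G ?S" by auto
qed

text \<open>Reducing the coordinates modulo \<open>m\<close> leaves finitely many cosets. The
  reduced monomials need not lie in \<open>K\<close>; only the cosets they represent matter.\<close>

lemma generate_pow_finite_index:
 assumes m: "m > 0" and K: "subgroup K G" "K <= A" "!!j. j < n ==> a j [^] m : K"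
 shows "finite_index_subgroup (generate G {a j [^] (m::nat) | j. j < n}) K G"
proof -
 let ?S = "{a j [^] m | j. j < n}" and ?B = "generate G {a j [^] (m::nat) | j. j < n}"
 have Sc: "?S <= CG" using a_carrier by auto
 have B: "subgroup ?B G" by (rule generate_is_subgroup[OF Sc])
 have BK: "?B <= K" by (rule generate_subgroup_incl[OF _ K(1)]) (use K(3) in auto)
 have 1: "subgroup ?B (G(|carrier := K|))" by (rule subgroup_incl[OF B K(1) BK])
 have "rcosets\<^bsub>G(|carrier := K|)\<^esub> ?B <= (%k. ?B #> monomial n G a k) ` ({..<n} \<rightarrow>\<^sub>E {0..<int m})"
 proof
  fix C assume "C : rcosets\<^bsub>G(|carrier := K|)\<^esub> ?B"
  then obtain x where x: "x : K" "C = ?B #> x" unfolding RCOSETS_def r_coset_def by auto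
  have xA: "x : A" using x K by auto
  define r where "r = (\<lambda>i\<in>{..<n}. crd x i mod int m)"
  have r: "r : {..<n} \<rightarrow>\<^sub>E {0..<int m}" unfolding r_def using m by auto
  have "x = monomial n G a (%i. int m * (crd x i div int m) + r i)"
   using crd[OF xA] monomial_cong[of n a a "crd x" "%i. int m * (crd x i div int m) + r i"] unfolding r_def by auto
  also have "... = monomial n G a (%i. int m * (crd x i div int m)) ** monomial n G a r" by (rule mono_add)
  finally have e: "x = monomial n G a (%i. int m * (crd x i div int m)) ** monomial n G a r" .
  have b: "monomial n G a (%i. int m * (crd x i div int m)) : ?B" unfolding generate_pow_eq by (intro CollectI exI[of _ "%i. crd x i div int m"]) simp
  have mr: "monomial n G a r : CG" using A_carr by simp
  have "x : ?B #> monomial n G a r" unfolding r_coset_def using e b by blast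
  hence "?B #> monomial n G a r = ?B #> x" by (rule repr_independence[OF _ mr B])
  thus "C : (%k. ?B #> monomial n G a k) ` ({..<n} \<rightarrow>\<^sub>E {0..<int m})" using x r by blast
 qed
 moreover have "finite ((%k. ?B #> monomial n G a k) ` ({..<n} \<rightarrow>\<^sub>E {0..<int m}))" by (intro finite_imageI finite_PiE) auto
 ultimately show ?thesis unfolding finite_index_subgroup_def using 1 finite_subset by blast
qed

lemma conj_set_mem:
 assumes "g : CG" "x : CG"
 shows "x : inv g <# A #> g \<longleftrightarrow> g ** x ** inv g : A"
proof
 assume "x : inv g <# A #> g"
 then obtain y where y: "y : A" "x = inv g ** y ** g" unfolding l_coset_def r_coset_def by auto
 thus "g ** x ** inv g : A" using assms A_carr by (simp add: m_assoc)
next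
 assume y: "g ** x ** inv g : A"
 have "x = inv g ** (g ** x ** inv g) ** g" using assms by (simp add: m_assoc)
 thus "x : inv g <# A #> g" using y unfolding l_coset_def r_coset_def by blast
qed

lemma conj_inter_subgroup: assumes g: "g : CG" shows "subgroup (A \<inter> (inv g <# A #> g)) G"
proof
 have mem: "x : A \<inter> (inv g <# A #> g) \<longleftrightarrow> x : A & g ** x ** inv g : A" for x
  using conj_set_mem[OF g] A_carr by auto
 show "A \<inter> (inv g <# A #> g) <= CG" using A_carr by auto
 show "\<one> : A \<inter> (inv g <# A #> g)" unfolding mem using g by simp
 fix x assume x: "x : A \<inter> (inv g <# A #> g)"
 thus "inv x : A \<inter> (inv g <# A #> g)" unfolding mem using conj_inv[OF g] A_carr by auto
 fix y assume "y : A \<inter> (inv g <# A #> g)"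
 thus "x ** y : A \<inter> (inv g <# A #> g)" using x unfolding mem using conj_mult[OF g] A_carr by auto
qed

text \<open>Two exponents give the same matrix because the \<open>m * m'\<close>-th powers can be
  computed from either. The finite index clause comes from
  \<open>generate_pow_finite_index\<close>.\<close>

lemma modular_hom_eq:
 assumes g: "g : CG" and m: "(m::nat) > 0"
  and c: "!!j. j < n ==> g ** a j [^] m ** inv g = monomial n G a (%i. c i j)"
 shows "modular_hom n G A a g = Matrix.mat n n (%(i, j). rat_of_int (c i j) / rat_of_nat m)"
 unfolding modular_hom_def
proof (rule the_equality)
 have sub': "subgroup (A \<inter> (inv g <# A #> g)) G" by (rule conj_inter_subgroup[OF g])
 have "finite_index_subgroup (generate G {a j [^] m |j. j < n}) (A \<inter> (inv g <# A #> g)) G"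
 proof (rule generate_pow_finite_index[OF m sub'])
  fix j assume j: "j < n"
  hence "a j [^] m : A" "a j [^] m : CG" using a_in A_carr by auto
  thus "a j [^] m : A \<inter> (inv g <# A #> g)" using conj_set_mem[OF g] c[OF j] by auto
 qed auto
 thus "EX (m'::nat) c'. m' > 0 & finite_index_subgroup (generate G {a j [^] m' |j. j < n}) (A \<inter> (inv g <# A #> g)) G &
  (ALL j<n. g ** a j [^] m' ** inv g = monomial n G a (%i. c' i j)) &
  Matrix.mat n n (%(i, j). rat_of_int (c i j) / rat_of_nat m) = Matrix.mat n n (%(i, j). rat_of_int (c' i j) / rat_of_nat m')"
  using m c by blast
next
 fix M assume "EX (m'::nat) c'. m' > 0 & finite_index_subgroup (generate G {a j [^] m' |j. j < n}) (A \<inter> (inv g <# A #> g)) G &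
  (ALL j<n. g ** a j [^] m' ** inv g = monomial n G a (%i. c' i j)) &
  M = Matrix.mat n n (%(i, j). rat_of_int (c' i j) / rat_of_nat m')"
 then obtain m' :: nat and c' where m': "m' > 0" "ALL j<n. g ** a j [^] m' ** inv g = monomial n G a (%i. c' i j)"
  "M = Matrix.mat n n (%(i, j). rat_of_int (c' i j) / rat_of_nat m')" by blast
 have "rat_of_int (c' i j) / rat_of_nat m' = rat_of_int (c i j) / rat_of_nat m" if ij: "i < n" "j < n" for i j
 proof -
  let ?x = "g ** a j [^] m ** inv g" and ?y = "g ** a j [^] m' ** inv g"
  have xy: "?x : A" "?y : A" using c[OF ij(2)] m'(2) ij(2) mono_in by auto
  have aj: "a j : CG" using a_carrier ij by auto
  have "?x [^] m' = g ** a j [^] (m * m') ** inv g" "?y [^] m = g ** a j [^] (m * m') ** inv g"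
   using conj_pow[OF g, of "a j [^] m" m'] conj_pow[OF g, of "a j [^] m'" m] aj by (simp_all add: nat_pow_pow mult.commute)
  hence "int m' * crd ?x i = int m * crd ?y i" using crd_pow[OF xy(1) ij(1), of m'] crd_pow[OF xy(2) ij(1), of m] by simp
  moreover have "crd ?x i = c i j" by (rule crd_unique) (use c ij in auto)
  moreover have "crd ?y i = c' i j" by (rule crd_unique) (use m' ij in auto)
  ultimately have "int m' * c i j = int m * c' i j" by simp
  hence "rat_of_int (int m' * c i j) = rat_of_int (int m * c' i j)" by simp
  hence "rat_of_nat m' * rat_of_int (c i j) = rat_of_nat m * rat_of_int (c' i j)" by simp
  thus ?thesis using m m' by (simp add: field_simps)
 qed
 thus "M = Matrix.mat n n (%(i, j). rat_of_int (c i j) / rat_of_nat m)" unfolding m'(3) by (intro eq_matI) auto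
qed

text \<open>Turns agreement of two conjugations on \<open>m\<close>-th powers into equality of the
  matrices; the additional exponent \<open>k\<close> brings the conjugates into \<open>A\<close>,
  where they have coordinates.\<close>

lemma modular_hom_cong:
 assumes g: "g : CG" "h : CG" and m: "(m::nat) >= 1"
  and eq: "!!x. x : A ==> g ** x [^] m ** inv g = h ** x [^] m ** inv h"
  and k: "(k::nat) >= 1" "!!x. x : A ==> g ** x [^] k ** inv g : A"
 shows "modular_hom n G A a g = modular_hom n G A a h"
proof -
 define c where "c i j = crd (g ** a j [^] (k * m) ** inv g) i" for i j
 have p: "a j [^] (k * m) = (a j [^] k) [^] m" "a j [^] (k * m) = (a j [^] m) [^] k" if "j < n" for j
  using a_carrier[OF that] by (simp_all add: nat_pow_pow mult.commute)
 have 1: "g ** a j [^] (k * m) ** inv g = monomial n G a (%i. c i j)" if j: "j < n" for j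
  using crd[of "g ** a j [^] (k * m) ** inv g"] k(2)[of "a j [^] m"] a_in[OF j] p[OF j] unfolding c_def by simp
 have 2: "h ** a j [^] (k * m) ** inv h = monomial n G a (%i. c i j)" if j: "j < n" for j
  using 1[OF j] eq[of "a j [^] k"] a_in[OF j] p[OF j] by simp
 have km: "k * m > 0" using k m by simp
 show ?thesis using modular_hom_eq[OF g(1) km 1] modular_hom_eq[OF g(2) km 2] by simp
qed

end

section \<open>Path groups of graphs of groups\<close>

lemma gog_eq_append:
 assumes "gog_eq \<G> p p'" "gog_eq \<G> q q'" shows "gog_eq \<G> (p @ q) (p' @ q')"
proof -
 have "gog_eq \<G> ([] @ p @ q) ([] @ p' @ q)" "gog_eq \<G> (p' @ q @ []) (p' @ q' @ [])"
  by (rule eq_cong[OF assms(1)], rule eq_cong[OF assms(2)])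
 thus ?thesis using eq_trans by fastforce
qed

lemma gog_class_eq_iff: "gog_class \<G> p = gog_class \<G> q \<longleftrightarrow> gog_eq \<G> p q"
proof
 assume "gog_class \<G> p = gog_class \<G> q"
 hence "q : gog_class \<G> p" unfolding gog_class_def using eq_refl by auto
 thus "gog_eq \<G> p q" unfolding gog_class_def by simp
next
 assume "gog_eq \<G> p q"
 thus "gog_class \<G> p = gog_class \<G> q"
  unfolding gog_class_def using eq_trans[of \<G> p q] eq_trans[OF eq_sym[of \<G> p q]] by auto
qed

lemma gog_mult_class: "gog_mult \<G> (gog_class \<G> p) (gog_class \<G> q) = gog_class \<G> (p @ q)"
proof -
 have "gog_class \<G> (p' @ q') = gog_class \<G> (p @ q)" if "gog_eq \<G> p p'" "gog_eq \<G> q q'" for p' q'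
  unfolding gog_class_eq_iff by (rule eq_sym, rule gog_eq_append[OF that])
 thus ?thesis unfolding gog_mult_def using eq_refl[of \<G> p] eq_refl[of \<G> q] unfolding gog_class_def[of \<G> p] gog_class_def[of \<G> q] by blast
qed

locale gog_paths =
 fixes \<G> :: "('v, 'e, 'a, 'b) graph_of_groups"
 assumes gog: "is_graph_of_groups \<G>"
begin

sublocale bidirected_digraph "graph \<G>" "erev \<G>"
 using gog unfolding is_graph_of_groups_def by blast

abbreviation "src == tail (graph \<G>)"
abbreviation "tgt == head (graph \<G>)"
abbreviation "vg == vgrp \<G>"
abbreviation "vs e == vg (src e)"
abbreviation "Vs == verts (graph \<G>)"
abbreviation "Es == arcs (graph \<G>)"
abbreviation "gpa == gog_path \<G>"
abbreviation "geq == gog_eq \<G>"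
abbreviation "cls == gog_class \<G>"
abbreviation "em == emb \<G>"
abbreviation "eg == egrp \<G>"
abbreviation "rv == erev \<G>"

lemma vgg: "u : Vs ==> group (vg u)"
 using gog unfolding is_graph_of_groups_def by blast
lemma egrp_group: "e : Es ==> group (eg e)"
 using gog unfolding is_graph_of_groups_def by blast
lemma egrp_erev: "e : Es ==> eg (rv e) = eg e"
 using gog unfolding is_graph_of_groups_def by blast
lemma emb_mon: "e : Es ==> em e : mon (eg e) (vg (tgt e))"
 using gog unfolding is_graph_of_groups_def by blast
lemma emb_rev_mon: "e : Es ==> em (rv e) : mon (eg e) (vs e)"
 using emb_mon[of "rv e"] egrp_erev[of e] by simp
lemma emb_closed:
 "e : Es ==> c : carrier (eg e) ==> em e c : carrier (vg (tgt e))"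
 "e : Es ==> c : carrier (eg e) ==> em (rv e) c : carrier (vs e)"
 using emb_mon[of e] emb_rev_mon[of e] unfolding mon_def hom_def by auto

lemma path_verts: "gpa u p w ==> u : Vs & w : Vs"
 by (induction rule: gog_path.induct) auto

lemma path_app: "gpa u p x ==> gpa x q w ==> gpa u (p @ q) w"
 by (induction rule: gog_path.induct) (auto intro: gog_path.intros)

lemma pathl:
 "u : Vs ==> b : carrier (vg u) ==> gpa u [Elt u b] u"
 "e : Es ==> gpa (src e) [Edge e] (tgt e)"
 by (intro path_Elt path_Nil path_Edge | simp)+

primrec linv :: "('v, 'e, 'a) gog_letter => ('v, 'e, 'a) gog_letter" where
 "linv (Elt u b) = Elt u (inv\<^bsub>vg u\<^esub> b)"
| "linv (Edge e) = Edge (rv e)"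

definition winv :: "('v, 'e, 'a) gog_letter list => ('v, 'e, 'a) gog_letter list" where
 "winv p = rev (map linv p)"

lemma winv_simps [simp]: "winv [] = []" "winv (l # p) = winv p @ [linv l]"
 unfolding winv_def by auto

lemma winv_path: "gpa u p w ==> gpa w (winv p) u"
proof (induction rule: gog_path.induct)
 case (path_Nil u)
 thus ?case by (simp add: gog_path.path_Nil)
next
 case (path_Elt u b p w)
 thus ?case using path_app[OF path_Elt.IH pathl(1)[of u "inv\<^bsub>vg u\<^esub> b"]] group.inv_closed[OF vgg] by simp
next
 case (path_Edge e p w)
 thus ?case using path_app[OF path_Edge.IH] pathl(2)[of "rv e"] by simp
qed

lemma winv_winv: "gpa u p w ==> winv (winv p) = p"
proof (induction rule: gog_path.induct)
 case (path_Elt u b p w)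
 thus ?case using group.inv_inv[OF vgg, of u b] unfolding winv_def by (simp add: rev_map[symmetric])
qed (auto simp: winv_def rev_map[symmetric])

lemma elt_inv:
 assumes "u : Vs" "b : carrier (vg u)"
 shows "geq [Elt u b, Elt u (inv\<^bsub>vg u\<^esub> b)] []"
 using vertex_mult[of u \<G> b "inv\<^bsub>vg u\<^esub> b"] vertex_one[of u \<G>] eq_trans assms
  group.inv_closed[OF vgg] group.r_inv[OF vgg] by metis

lemma winv_right: "gpa u p w ==> geq (p @ winv p) []"
proof (induction rule: gog_path.induct)
 case (path_Nil u)
 thus ?case by (simp add: eq_refl)
next
 case (path_Elt u b p w)
 have "geq ([Elt u b] @ (p @ winv p) @ [linv (Elt u b)]) ([Elt u b] @ [] @ [linv (Elt u b)])"
  by (rule eq_cong[OF path_Elt.IH])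
 moreover have "geq ([Elt u b] @ [] @ [linv (Elt u b)]) []" using elt_inv path_Elt by simp
 ultimately show ?case using eq_trans by fastforce
next
 case (path_Edge e p w)
 have "geq ([Edge e] @ (p @ winv p) @ [linv (Edge e)]) ([Edge e] @ [] @ [linv (Edge e)])"
  by (rule eq_cong[OF path_Edge.IH])
 moreover have "geq ([Edge e] @ [] @ [linv (Edge e)]) []" using edge_inv path_Edge by simp
 ultimately show ?case using eq_trans by fastforce
qed

lemma winv_left: "gpa u p w ==> geq (winv p @ p) []"
 using winv_right[OF winv_path] winv_winv by metis

lemma winv_mid: "gpa u p w ==> geq (l @ winv p @ p @ r) (l @ r)"
 using eq_cong[OF winv_left, of u p w l r] by simp

lemma connected_path:
 assumes "Digraph_Component.connected (graph \<G>)" "v : Vs" "u : Vs"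
 shows "EX p. gpa v p u"
proof -
 have "(v, u) : rtrancl_on (Vs) (\<Union>e\<in>Es. {(src e, tgt e), (tgt e, src e)})"
 proof -
  let ?S = "with_proj (mk_symmetric (graph \<G>))"
  have V: "verts ?S = Vs" and E: "arcs_ends ?S = (\<Union>e\<in>Es. {(src e, tgt e), (tgt e, src e)})"
   by (simp, simp only: with_proj_simps parcs_mk_symmetric)
  have "ALL x:verts ?S. ALL y:verts ?S. x \<rightarrow>\<^sup>*\<^bsub>?S\<^esub> y"
   using assms(1) unfolding Digraph_Component.connected_def strongly_connected_def by (rule conjunct2)
  hence "v \<rightarrow>\<^sup>*\<^bsub>?S\<^esub> u" unfolding V using assms(2,3) by blast
  thus ?thesis unfolding reachable_def V E .
 qed
 thus ?thesis
 proof (induction rule: rtrancl_on_induct)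
  case base
  hence "gpa v [] v" by (rule gog_path.path_Nil)
  thus ?case ..
 next
  case (step y z)
  then obtain p e where p: "gpa v p y" and e: "e : Es" "(y, z) = (src e, tgt e) | (y, z) = (tgt e, src e)" by blast
  have "gpa y [Edge e] z | gpa y [Edge (rv e)] z"
   using e pathl(2)[of e] pathl(2)[of "rv e"] by auto
  thus ?case using path_app[OF p] by blast
 qed
qed

end

section \<open>The fundamental group and its vertex groups\<close>

locale gog_group = group G + gog_paths \<G>
 for G :: "('g, 'm) monoid_scheme" (structure) and \<G> :: "('v, 'e, 'a, 'b) graph_of_groups" +
 fixes v :: 'v and \<phi> :: "'g => ('v, 'e, 'a) gog_letter list set"
 assumes conn: "Digraph_Component.connected (graph \<G>)" and v: "v : verts (graph \<G>)"
  and iso: "\<phi> : iso G (gog_pi1 \<G> v)"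
begin

text \<open>The elements of the path group are moved into \<open>G\<close> along chosen paths from the base vertex.\<close>

definition pth :: "'v => ('v, 'e, 'a) gog_letter list" where
 "pth u = (if u = v then [] else SOME p. gpa v p u)"

lemma pth: "u : Vs ==> gpa v (pth u) u"
 unfolding pth_def using v path_Nil someI_ex[OF connected_path[OF conn v]] by auto

lemma pth_v [simp]: "pth v = []" unfolding pth_def by simp

definition elem :: "'v => ('v, 'e, 'a) gog_letter list => 'v => 'g" where
 "elem u p w = inv_into (CG) \<phi> (cls (pth u @ p @ winv (pth w)))"

lemma phi_bij: "bij_betw \<phi> (CG) (cls ` {p. gpa v p v})"
 using iso unfolding iso_def gog_pi1_def by simp

lemma elem_loop: "gpa u p w ==> gpa v (pth u @ p @ winv (pth w)) v"
 using path_app[OF pth path_app[OF _ winv_path[OF pth]]] path_verts by blast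

lemma elem:
 assumes "gpa u p w"
 shows "elem u p w : CG" "\<phi> (elem u p w) = cls (pth u @ p @ winv (pth w))"
proof -
 have "cls (pth u @ p @ winv (pth w)) : \<phi> ` CG"
  unfolding bij_betw_imp_surj_on[OF phi_bij] by (rule imageI, rule CollectI, rule elem_loop[OF assms])
 thus "elem u p w : CG" "\<phi> (elem u p w) = cls (pth u @ p @ winv (pth w))"
  unfolding elem_def by (rule inv_into_into, rule f_inv_into_f)
qed

lemma elem_unique: "g : CG ==> \<phi> g = cls (pth u @ p @ winv (pth w)) ==> g = elem u p w"
 unfolding elem_def using inv_into_f_f[OF bij_betw_imp_inj_on[OF phi_bij], of g] by simp

lemma phi_mult: "g : CG ==> h : CG ==> \<phi> (g ** h) = gog_mult \<G> (\<phi> g) (\<phi> h)"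
 using iso unfolding iso_def hom_def gog_pi1_def by simp

lemma elem_cong:
 assumes "geq p q" shows "elem u p w = elem u q w"
 unfolding elem_def using eq_cong[OF assms] gog_class_eq_iff by metis

lemma elem_append:
 assumes "gpa u p x" "gpa x q w"
 shows "elem u (p @ q) w = elem u p x ** elem x q w"
proof (rule elem_unique[symmetric])
 have x: "x : Vs" using path_verts assms by blast
 have "\<phi> (elem u p x ** elem x q w) = cls ((pth u @ p @ winv (pth x)) @ (pth x @ q @ winv (pth w)))"
  unfolding phi_mult[OF elem(1)[OF assms(1)] elem(1)[OF assms(2)]] elem(2)[OF assms(1)] elem(2)[OF assms(2)] by (rule gog_mult_class)
 also have "... = cls (pth u @ (p @ q) @ winv (pth w))"
  unfolding gog_class_eq_iff using winv_mid[OF pth[OF x], of "pth u @ p" "q @ winv (pth w)"] by simp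
 finally show "\<phi> (elem u p x ** elem x q w) = cls (pth u @ (p @ q) @ winv (pth w))" .
qed (use elem assms in auto)

lemma elem_Nil: assumes "u : Vs" shows "elem u [] u = \<one>"
proof -
 have "elem u ([] @ []) u = elem u [] u ** elem u [] u" by (rule elem_append; rule gog_path.path_Nil[OF assms])
 thus ?thesis using elem(1)[OF gog_path.path_Nil[OF assms]] by simp
qed

lemma elem_winv: assumes "gpa u p w" shows "elem w (winv p) u = inv (elem u p w)"
proof -
 have "elem w (winv p) u ** elem u p w = elem w (winv p @ p) w" using elem_append[OF winv_path[OF assms] assms] by simp
 also have "... = \<one>" using elem_cong[OF winv_left[OF assms]] elem_Nil path_verts[OF assms] by simp
 finally show ?thesis using inv_equality elem(1)[OF assms] elem(1)[OF winv_path[OF assms]] by simp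
qed

lemma elem_surj: assumes "g : CG" shows "EX p. gpa v p v & \<phi> g = cls p & g = elem v p v"
proof -
 have "\<phi> g : cls ` {p. gpa v p v}" using bij_betw_imp_surj_on[OF phi_bij] assms by blast
 then obtain p where p: "gpa v p v" "\<phi> g = cls p" by blast
 hence "g = elem v p v" using elem_unique[OF assms, of v p v] by simp
 thus ?thesis using p by blast
qed

lemma elem_pth: assumes "u : Vs" shows "elem v (pth u) u = \<one>"
proof -
 have "\<phi> (elem v (pth u) u) = cls (pth u @ winv (pth u))" using elem(2)[OF pth[OF assms]] by simp
 also have "... = cls (pth v @ [] @ winv (pth v))" unfolding gog_class_eq_iff using winv_right[OF pth[OF assms]] by simp
 finally have "elem v (pth u) u = elem v [] v" by (rule elem_unique[OF elem(1)[OF pth[OF assms]]])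
 thus ?thesis using elem_Nil[OF v] by simp
qed

definition ve :: "'v => 'a => 'g" where "ve u b = elem u [Elt u b] u"
definition ee :: "'e => 'g" where "ee e = elem (src e) [Edge e] (tgt e)"
definition VG :: "'v => 'g set" where "VG u = ve u ` carrier (vg u)"

lemma ve_closed: "u : Vs ==> b : carrier (vg u) ==> ve u b : CG"
 unfolding ve_def using elem(1) pathl by blast

lemma ee_closed: "e : Es ==> ee e : CG"
 unfolding ee_def using elem(1) pathl by blast

lemma ve_mult:
 assumes "u : Vs" "b : carrier (vg u)" "c : carrier (vg u)"
 shows "ve u (b **\<^bsub>vg u\<^esub> c) = ve u b ** ve u c"
 unfolding ve_def using elem_append[of u "[Elt u b]" u "[Elt u c]" u] pathl assms elem_cong[OF vertex_mult[OF assms]] by simp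

lemma ve_hom: "u : Vs ==> group_hom (vg u) G (ve u)"
 by (intro group_hom.intro vgg is_group group_hom_axioms.intro homI) (auto simp: ve_closed ve_mult)

lemma VG_sub: "u : Vs ==> subgroup (VG u) G"
 unfolding VG_def using group_hom.img_is_subgroup[OF ve_hom] by blast

lemma ee_rev: assumes "e : Es" shows "ee (rv e) = inv (ee e)"
 using elem_winv[OF pathl(2)[OF assms]] assms unfolding ee_def by simp

lemma ee_conj:
 assumes "e : Es" "c : carrier (eg e)"
 shows "ee e ** ve (tgt e) (em e c) ** inv (ee e) = ve (src e) (em (rv e) c)"
proof -
 have 1: "gpa (tgt e) [Elt (tgt e) (em e c)] (tgt e)" using pathl emb_closed assms by simp
 have 2: "gpa (tgt e) [Edge (rv e)] (src e)" using pathl(2)[of "rv e"] assms by simp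
 have "ve (src e) (em (rv e) c) = elem (src e) ([Edge e] @ [Elt (tgt e) (em e c)] @ [Edge (rv e)]) (src e)"
  unfolding ve_def using elem_cong[OF edge_conj[OF assms]] by simp
 also have "... = ee e ** (ve (tgt e) (em e c) ** ee (rv e))"
  using elem_append[OF pathl(2)[OF assms(1)] path_app[OF 1 2]] elem_append[OF 1 2] assms unfolding ve_def ee_def by simp
 finally show ?thesis using ee_rev assms ee_closed ve_closed emb_closed by (simp add: m_assoc)
qed

text \<open>A vertex of the Bass--Serre tree over \<open>u\<close> has as stabiliser a conjugate of the vertex group at \<open>u\<close>.\<close>

lemma stabilizer_eq:
 assumes p: "gpa v p u" and x: "x = (u, \<Union>b\<in>carrier (vg u). cls (p @ [Elt u b]))"
 defines "h == elem v p u"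
 shows "stabilizer G (%g. bass_serre_act \<G> (\<phi> g)) x = (%y. h ** y ** inv h) ` VG u"
proof -
 have u: "u : Vs" using path_verts[OF p] by simp
 interpret U: group "vg u" by (rule vgg[OF u])
 have h: "h : CG" unfolding h_def by (rule elem(1)[OF p])
 have conj: "h ** ve u b ** inv h = elem v (p @ [Elt u b] @ winv p) v" if b: "b : carrier (vg u)" for b
  using elem_append[OF p path_app[OF pathl(1)[OF u b] winv_path[OF p]]]
   elem_append[OF pathl(1)[OF u b] winv_path[OF p]] elem_winv[OF p] ve_closed[OF u b] h
  unfolding h_def ve_def by (simp add: m_assoc)
 have act: "gog_mult \<G> (cls q) (snd x) = (\<Union>b\<in>carrier (vg u). cls (q @ p @ [Elt u b]))" for q
 proof -
  have "gog_mult \<G> (cls q) (snd x) = (\<Union>b\<in>carrier (vg u). gog_mult \<G> (cls q) (cls (p @ [Elt u b])))"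
   unfolding x gog_mult_def by auto
  thus ?thesis unfolding gog_mult_class .
 qed
 have one: "geq (r @ [Elt u \<one>\<^bsub>vg u\<^esub>]) r" for r
  using eq_cong[OF vertex_one[OF u], of r "[]"] by simp
 show ?thesis
 proof (intro equalityI subsetI)
  fix g assume "g : stabilizer G (%g. bass_serre_act \<G> (\<phi> g)) x"
  hence g: "g : CG" and gx: "bass_serre_act \<G> (\<phi> g) x = x" unfolding stabilizer_def by auto
  obtain q where q: "gpa v q v" "\<phi> g = cls q" "g = elem v q v" using elem_surj[OF g] by blast
  have "gog_mult \<G> (cls q) (snd x) = snd x" using gx q unfolding bass_serre_act_def by (metis snd_conv)
  moreover have "q @ p @ [Elt u \<one>\<^bsub>vg u\<^esub>] : gog_mult \<G> (cls q) (snd x)"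
   unfolding act by (rule UN_I[OF U.one_closed]) (simp add: gog_class_def eq_refl)
  ultimately have "q @ p @ [Elt u \<one>\<^bsub>vg u\<^esub>] : snd x" by simp
  then obtain b where "b : carrier (vg u)" "q @ p @ [Elt u \<one>\<^bsub>vg u\<^esub>] : cls (p @ [Elt u b])"
   unfolding x snd_conv by (rule UN_E)
  hence b: "b : carrier (vg u)" "geq (p @ [Elt u b]) (q @ p @ [Elt u \<one>\<^bsub>vg u\<^esub>])"
   unfolding gog_class_def by simp_all
  have "geq (p @ [Elt u b]) (q @ p)" using eq_trans[OF b(2)] one[of "q @ p"] by simp
  hence "geq ([] @ (p @ [Elt u b]) @ winv p) ([] @ (q @ p) @ winv p)" by (rule eq_cong)
  moreover have "geq (q @ (p @ winv p) @ []) (q @ [] @ [])" by (rule eq_cong[OF winv_right[OF p]])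
  ultimately have "geq (p @ [Elt u b] @ winv p) q" using eq_trans by fastforce
  hence "g = h ** ve u b ** inv h" using elem_cong q(3) conj[OF b(1)] by metis
  thus "g : (%y. h ** y ** inv h) ` VG u" unfolding VG_def using b by blast
 next
  fix g assume "g : (%y. h ** y ** inv h) ` VG u"
  then obtain c where c: "c : carrier (vg u)" "g = h ** ve u c ** inv h" unfolding VG_def by auto
  have path: "gpa v (p @ [Elt u c] @ winv p) v"
   by (intro path_app[OF p] path_app[OF pathl(1)] winv_path[OF p] u c)
  have ph: "\<phi> g = cls (p @ [Elt u c] @ winv p)" using elem(2)[OF path] conj c by simp
  have eq: "cls ((p @ [Elt u c] @ winv p) @ p @ [Elt u b]) = cls (p @ [Elt u (c **\<^bsub>vg u\<^esub> b)])" if b: "b : carrier (vg u)" for b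
  proof -
   have "geq ((p @ [Elt u c]) @ (winv p @ p) @ [Elt u b]) ((p @ [Elt u c]) @ [] @ [Elt u b])"
   by (rule eq_cong[OF winv_left[OF p]])
   moreover have "geq (p @ [Elt u c, Elt u b] @ []) (p @ [Elt u (c **\<^bsub>vg u\<^esub> b)] @ [])"
   by (rule eq_cong[OF vertex_mult[OF u c(1) b]])
   ultimately show ?thesis unfolding gog_class_eq_iff using eq_trans by fastforce
  qed
  have "gog_mult \<G> (\<phi> g) (snd x) = (\<Union>b\<in>carrier (vg u). cls (p @ [Elt u (c **\<^bsub>vg u\<^esub> b)]))"
   unfolding ph act using eq by (intro SUP_cong) auto
  also have "... = (\<Union>b\<in>(%b. c **\<^bsub>vg u\<^esub> b) ` carrier (vg u). cls (p @ [Elt u b]))" by auto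
  also have "(%b. c **\<^bsub>vg u\<^esub> b) ` carrier (vg u) = carrier (vg u)" by (rule U.surj_const_mult[OF c(1)])
  finally have "bass_serre_act \<G> (\<phi> g) x = x" unfolding bass_serre_act_def x by simp
  thus "g : stabilizer G (%g. bass_serre_act \<G> (\<phi> g)) x" unfolding stabilizer_def using c h ve_closed[OF u] by auto
 qed
qed

end

section \<open>Commensurability of the vertex groups\<close>

lemma Z_power_pow:
 assumes "c : carrier (Z_power n)" "i < n"
 shows "(c [^]\<^bsub>Z_power n\<^esub> (m::nat)) i = int m * c i"
 by (induction m) (use assms in "auto simp: algebra_simps")

lemma int_additive:
 fixes f :: "int => int" assumes "!!x y. f (x + y) = f x + f y" shows "f x = x * f 1"
proof (induction x rule: int_induct[of _ 0])
 case base
 show ?case using assms[of 0 0] by simp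
next
 case (step1 i)
 thus ?case using assms[of i 1] by (simp add: algebra_simps)
next
 case (step2 i)
 thus ?case using assms[of "i - 1" 1] by (simp add: algebra_simps)
qed

lemma int_vector_additive:
 fixes f :: "(nat => int) => int"
 assumes add: "!!x y. f (%i. x i + y i) = f x + f y" and ext: "!!x y. (!!i. i < n ==> x i = y i) ==> f x = f y"
 shows "f x = (\<Sum>j<n. x j * f (%i. if i = j then 1 else 0))"
proof -
 have one: "f (%i. if i = j then c else 0) = c * f (%i. if i = j then 1 else 0)" for j c
 proof (rule int_additive[of "%c. f (%i. if i = j then c else 0)"])
  fix x y :: int
  have "(%i. if i = j then x + y else 0) = (%i. (if i = j then x else 0) + (if i = j then y else 0))" by auto
  thus "f (%i. if i = j then x + y else 0) = f (%i. if i = j then x else 0) + f (%i. if i = j then y else 0)"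
   using add by simp
 qed
 have "f (%i. if i < k then x i else 0) = (\<Sum>j<k. x j * f (%i. if i = j then 1 else 0))" for k
 proof (induction k)
  case 0
  show ?case using add[of "%_. 0" "%_. 0"] by simp
 next
  case (Suc k)
  have "(%i. if i < Suc k then x i else 0) = (%i. (if i < k then x i else 0) + (if i = k then x k else 0))" by auto
  thus ?case using add Suc one[of k "x k"] by simp
 qed
 from this[of n] show ?thesis using ext[of x "%i. if i < n then x i else 0"] by simp
qed

text \<open>Read in coordinates, an injective homomorphism is an integer matrix with trivial kernel,
  so \<open>int_matrix_injective_cofinal\<close> makes a fixed multiple of every vector one of its
  values.\<close>

lemma Z_power_mon_cofinal:
 assumes B: "group B" "B \<cong> Z_power n" and C: "group C" "C \<cong> Z_power n" and f: "f : mon B C"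
 shows "EX m>=(1::nat). ALL c:carrier C. EX b:carrier B. c [^]\<^bsub>C\<^esub> m = f b"
proof -
 interpret Z: group "Z_power n" by simp
 obtain h where h: "h : iso (Z_power n) B" using group.iso_sym[OF B] unfolding is_iso_def by blast
 obtain k where k: "k : iso C (Z_power n)" using C(2) unfolding is_iso_def by blast
 have kh: "group_hom C (Z_power n) k"
  using k C(1) Z.is_group unfolding iso_def group_hom_def group_hom_axioms_def by auto
 define g where "g x = k (f (h (\<lambda>i\<in>{..<n}. x i)))" for x
 have r: "(\<lambda>i\<in>{..<n}. x i) : carrier (Z_power n)" for x :: "nat => int" by auto
 have hB: "h y : carrier B" if "y : carrier (Z_power n)" for y using h that unfolding iso_def hom_def by auto
 have fC: "f y : carrier C" if "y : carrier B" for y using f that unfolding mon_def hom_def by auto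
 have kZ: "k y : carrier (Z_power n)" if "y : carrier C" for y using k that unfolding iso_def hom_def by auto
 have add: "g (%i. x i + y i) i = g x i + g y i" if i: "i < n" for x y i
 proof -
  have e: "(\<lambda>i\<in>{..<n}. x i + y i) = (\<lambda>i\<in>{..<n}. x i) **\<^bsub>Z_power n\<^esub> (\<lambda>i\<in>{..<n}. y i)" by auto
  have "h : hom (Z_power n) B" using h unfolding iso_def by blast
  hence "h (\<lambda>i\<in>{..<n}. x i + y i) = h (\<lambda>i\<in>{..<n}. x i) **\<^bsub>B\<^esub> h (\<lambda>i\<in>{..<n}. y i)"
   unfolding e by (rule hom_mult[OF _ r r])
  hence "f (h (\<lambda>i\<in>{..<n}. x i + y i)) = f (h (\<lambda>i\<in>{..<n}. x i)) **\<^bsub>C\<^esub> f (h (\<lambda>i\<in>{..<n}. y i))"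
   using f hB[OF r] unfolding mon_def hom_def by auto
  hence "g (%i. x i + y i) = g x **\<^bsub>Z_power n\<^esub> g y"
   unfolding g_def using k fC[OF hB[OF r]] unfolding iso_def hom_def by auto
  thus ?thesis using i by simp
 qed
 define M where "M i j = g (%i. if i = j then 1 else 0) i" for i j
 have lin: "g x i = (\<Sum>j<n. M i j * x j)" if i: "i < n" for x i
 proof -
  have "g x i = (\<Sum>j<n. x j * g (%i. if i = j then 1 else 0) i)"
  proof (rule int_vector_additive[of "%x. g x i"])
   show "g x i = g y i" if "!!i. i < n ==> x i = y i" for x y
   unfolding g_def using restrict_ext[of "{..<n}" x y] that by auto
  qed (use add i in auto)
  thus ?thesis unfolding M_def by (simp add: mult.commute)
 qed
 have "ALL j<n. x j = 0" if "ALL i<n. (\<Sum>j<n. M i j * x j) = 0" for x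
 proof -
  have z: "g x i = 0" "g (%_. 0) i = 0" if "i < n" for i
   using \<open>ALL i<n. (\<Sum>j<n. M i j * x j) = 0\<close> lin[of i] that by auto
  have "g y : {..<n} \<rightarrow>\<^sub>E UNIV" for y using kZ[OF fC[OF hB[OF r]]] unfolding g_def by simp
  hence "g x = g (%_. 0)" using z PiE_ext[of "g x" "{..<n}" "%_. UNIV" "g (%_. 0)"] by simp
  hence "f (h (\<lambda>i\<in>{..<n}. x i)) = f (h (\<lambda>i\<in>{..<n}. 0))"
   unfolding g_def using k fC[OF hB[OF r]] unfolding iso_def bij_betw_def inj_on_def by blast
  hence "h (\<lambda>i\<in>{..<n}. x i) = h (\<lambda>i\<in>{..<n}. 0)"
   using f hB[OF r] unfolding mon_def inj_on_def by blast
  hence "(\<lambda>i\<in>{..<n}. x i) = (\<lambda>i\<in>{..<n}. 0)"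
   using h r unfolding iso_def bij_betw_def inj_on_def by blast
  thus ?thesis by (metis lessThan_iff restrict_apply')
 qed
 then obtain m where m: "m > 0" "!!y. EX x. ALL i<n. (\<Sum>j<n. M i j * x j) = m * y i"
  using int_matrix_injective_cofinal[of n M] by blast
 have "EX b:carrier B. c [^]\<^bsub>C\<^esub> nat m = f b" if c: "c : carrier C" for c
 proof -
  obtain x where x: "ALL i<n. (\<Sum>j<n. M i j * x j) = m * k c i" using m(2) by blast
  have kc: "k (c [^]\<^bsub>C\<^esub> nat m) = k c [^]\<^bsub>Z_power n\<^esub> nat m" using group_hom.hom_nat_pow[OF kh c] .
  have cm: "c [^]\<^bsub>C\<^esub> nat m : carrier C" using C(1) c by (simp add: group.is_monoid monoid.nat_pow_closed)
  have "k (c [^]\<^bsub>C\<^esub> nat m) = g x"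
  proof (rule PiE_ext)
   show "k (c [^]\<^bsub>C\<^esub> nat m) : {..<n} \<rightarrow>\<^sub>E UNIV" using kZ[OF cm] by simp
   show "g x : {..<n} \<rightarrow>\<^sub>E UNIV" using kZ[OF fC[OF hB[OF r]]] unfolding g_def by simp
   show "k (c [^]\<^bsub>C\<^esub> nat m) i = g x i" if "i : {..<n}" for i
   unfolding kc using Z_power_pow[OF kZ[OF c], of i "nat m"] x lin[of i x] that m(1) by simp
  qed
  hence "c [^]\<^bsub>C\<^esub> nat m = f (h (\<lambda>i\<in>{..<n}. x i))"
   unfolding g_def using k cm fC[OF hB[OF r]] unfolding iso_def bij_betw_def inj_on_def by blast
  thus ?thesis using hB[OF r] by blast
 qed
 moreover have "nat m >= 1" using m(1) by simp
 ultimately show ?thesis by blast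
qed

lemma Z_power_comm: "comm_group (Z_power n)"
 by (rule group.group_comm_groupI) (auto simp: add.commute)

locale gbs_group = gog_group G \<G> v \<phi>
 for G :: "('g, 'm) monoid_scheme" (structure) and \<G> :: "('v, 'e, 'a, 'b) graph_of_groups" and v \<phi> +
 fixes n :: nat
 assumes vgrp_iso: "u : verts (graph \<G>) ==> vgrp \<G> u \<cong> Z_power n"
  and egrp_iso: "e : arcs (graph \<G>) ==> egrp \<G> e \<cong> Z_power n"
  and fin: "fin_digraph (graph \<G>)"
begin

lemma vgrp_comm: "u : Vs ==> comm_group (vg u)"
 by (rule comm_group.iso_imp_comm_group[OF Z_power_comm group.iso_sym[OF vgg vgrp_iso]]) (use vgg group.is_monoid in auto)

lemma VG_comm:
 assumes "u : Vs" "x : VG u" "y : VG u" shows "x ** y = y ** x"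
proof -
 obtain b c where "b : carrier (vg u)" "c : carrier (vg u)" "x = ve u b" "y = ve u c" using assms unfolding VG_def by auto
 thus ?thesis using ve_mult[OF assms(1)] comm_groupE(4)[OF vgrp_comm[OF assms(1)]] by metis
qed

lemma emb_cofinal:
 assumes "e : Es"
 shows "EX m>=(1::nat). ALL c:carrier (vg (tgt e)). EX b:carrier (eg e). c [^]\<^bsub>vg (tgt e)\<^esub> m = em e b"
 by (rule Z_power_mon_cofinal[OF egrp_group egrp_iso vgg vgrp_iso emb_mon]) (use assms in auto)

text \<open>Each arc of the path costs a power: the one that takes the vertex group at its head into
  the image of the edge group, from where conjugation by the arc leads into the vertex group at its
  tail.\<close>

lemma VG_commensurable:
 assumes "gpa u p w"
 shows "EX m>=(1::nat). ALL y:VG w. elem u p w ** y [^] m ** inv (elem u p w) : VG u"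
 using assms
proof (induction rule: gog_path.induct)
 case (path_Nil u)
 have "\<one> ** y [^] (1::nat) ** inv \<one> : VG u" if "y : VG u" for y
  using that subgroup.mem_carrier[OF VG_sub[OF path_Nil] that] by simp
 thus ?case unfolding elem_Nil[OF path_Nil] by blast
next
 case (path_Elt u b p w)
 then obtain m :: nat where m: "m >= 1" "!!y. y : VG w ==> elem u p w ** y [^] m ** inv (elem u p w) : VG u" by blast
 interpret V: subgroup "VG u" G by (rule VG_sub[OF path_Elt(1)])
 have b: "ve u b : VG u" unfolding VG_def using path_Elt by blast
 have e: "elem u (Elt u b # p) w = ve u b ** elem u p w" unfolding ve_def
  using elem_append[OF pathl(1)[OF path_Elt(1,2)] path_Elt(3)] by simp
 have c: "elem u p w : CG" by (rule elem(1)[OF path_Elt(3)])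
 have "elem u (Elt u b # p) w ** y [^] m ** inv (elem u (Elt u b # p) w) : VG u" if y: "y : VG w" for y
 proof -
  have yc: "y : CG" using y subgroup.subset[OF VG_sub] path_verts[OF path_Elt(3)] by auto
  have "elem u (Elt u b # p) w ** y [^] m ** inv (elem u (Elt u b # p) w) = ve u b ** (elem u p w ** y [^] m ** inv (elem u p w)) ** inv (ve u b)"
   unfolding e using c yc b V.mem_carrier[OF b] by (simp add: m_assoc inv_mult_group)
  thus ?thesis using m(2)[OF y] b V.m_closed V.m_inv_closed by simp
 qed
 thus ?case using m(1) by blast
next
 case (path_Edge e p w)
 then obtain m :: nat where m: "m >= 1" "!!y. y : VG w ==> elem (tgt e) p w ** y [^] m ** inv (elem (tgt e) p w) : VG (tgt e)" by blast
 obtain k :: nat where k: "k >= 1" "!!c. c : carrier (vg (tgt e)) ==> EX b:carrier (eg e). c [^]\<^bsub>vg (tgt e)\<^esub> k = em e b"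
  using emb_cofinal[OF path_Edge(1)] by blast
 have t: "tgt e : Vs" and s: "src e : Vs" using path_Edge(1) by auto
 have el: "elem (src e) (Edge e # p) w = ee e ** elem (tgt e) p w" unfolding ee_def
  using elem_append[OF pathl(2)[OF path_Edge(1)] path_Edge(2)] by simp
 have c: "elem (tgt e) p w : CG" "ee e : CG" using elem(1)[OF path_Edge(2)] ee_closed[OF path_Edge(1)] by auto
 have "elem (src e) (Edge e # p) w ** y [^] (m * k) ** inv (elem (src e) (Edge e # p) w) : VG (src e)" if y: "y : VG w" for y
 proof -
  have yc: "y : CG" using y subgroup.subset[OF VG_sub] path_verts[OF path_Edge(2)] by auto
  obtain d where d: "d : carrier (vg (tgt e))" "elem (tgt e) p w ** y [^] m ** inv (elem (tgt e) p w) = ve (tgt e) d"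
   using m(2)[OF y] unfolding VG_def by auto
  obtain b where b: "b : carrier (eg e)" "d [^]\<^bsub>vg (tgt e)\<^esub> k = em e b" using k(2)[OF d(1)] by blast
  have "ve (tgt e) (em e b) = ve (tgt e) d [^] k" unfolding b(2)[symmetric] by (rule group_hom.hom_nat_pow[OF ve_hom[OF t] d(1)])
  also have "... = elem (tgt e) p w ** y [^] (m * k) ** inv (elem (tgt e) p w)"
   unfolding d(2)[symmetric] using conj_pow[OF c(1), of "y [^] m" k] yc by (simp add: nat_pow_pow)
  finally have "elem (src e) (Edge e # p) w ** y [^] (m * k) ** inv (elem (src e) (Edge e # p) w) = ee e ** ve (tgt e) (em e b) ** inv (ee e)"
   unfolding el using c yc by (simp add: m_assoc inv_mult_group)
  also have "... = ve (src e) (em (rv e) b)" by (rule ee_conj[OF path_Edge(1) b(1)])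
  finally show ?thesis using emb_closed(2)[OF path_Edge(1) b(1)] unfolding VG_def by simp
 qed
 moreover have "m * k >= 1" using m(1) k(1) by simp
 ultimately show ?case by blast
qed

end

locale gbs_base = gbs_group G \<G> v \<phi> n
 for G :: "('g, 'm) monoid_scheme" (structure) and \<G> :: "('v, 'e, 'a, 'b) graph_of_groups" and v \<phi> n +
 fixes x :: "'v \<times> ('v, 'e, 'a) gog_letter list set" and A :: "'g set" and a :: "nat => 'g"
 assumes x: "x : bass_serre_verts \<G> v"
  and fi: "finite_index_subgroup A (stabilizer G (%g. bass_serre_act \<G> (\<phi> g)) x) G"
  and ob: "ordered_basis n G A a"
begin

lemma base_conjugate:
 obtains u h where "u : Vs" "h : CG" "A <= (%y. h ** y ** inv h) ` VG u" "subgroup A G"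
  "EX k>=(1::nat). ALL y:VG u. h ** y [^] k ** inv h : A" "EX p. gpa v p u & h = elem v p u"
proof -
 obtain u p where up: "gpa v p u" "x = (u, \<Union>b\<in>carrier (vg u). cls (p @ [Elt u b]))"
  using x unfolding bass_serre_verts_def by blast
 have u: "u : Vs" using path_verts[OF up(1)] by simp
 define h where "h = elem v p u"
 have h: "h : CG" unfolding h_def by (rule elem(1)[OF up(1)])
 define S where "S = (%y. h ** y ** inv h) ` VG u"
 have st: "stabilizer G (%g. bass_serre_act \<G> (\<phi> g)) x = S" unfolding S_def h_def by (rule stabilizer_eq[OF up])
 interpret V: subgroup "VG u" G by (rule VG_sub[OF u])
 have "(%y. h ** y ** inv h) : hom (G(|carrier := VG u|)) G"
  using h V.mem_carrier conj_mult by (auto intro!: homI)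
 hence "subgroup ((%y. h ** y ** inv h) ` carrier (G(|carrier := VG u|))) G"
  by (intro group_hom.img_is_subgroup group_hom.intro group_hom_axioms.intro subgroup_imp_group V.subgroup_axioms is_group)
 hence S: "subgroup S G" unfolding S_def by simp
 interpret S: group "G(|carrier := S|)" by (rule subgroup_imp_group[OF S])
 have A: "subgroup A (G(|carrier := S|))" "finite (rcosets\<^bsub>G(|carrier := S|)\<^esub> A)"
  using fi unfolding finite_index_subgroup_def st by auto
 obtain k :: nat where k: "k >= 1" "!!g. g : S ==> g [^]\<^bsub>G(|carrier := S|)\<^esub> k : A" using S.finite_index_power[OF A] by auto
 have "h ** y [^] k ** inv h : A" if y: "y : VG u" for y
  using k(2)[of "h ** y ** inv h"] conj_pow[OF h V.mem_carrier[OF y], of k] y nat_pow_consistent[of "h ** y ** inv h" k S]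
  unfolding S_def by simp
 moreover have "subgroup A G" by (rule incl_subgroup[OF S A(1)])
 moreover have "A <= S" using subgroup.subset[OF A(1)] by simp
 ultimately show ?thesis using that[OF u h] k(1) up(1) unfolding S_def h_def by blast
qed

sublocale based_subgroup G A n a
proof -
 obtain u h where uh: "u : Vs" "h : CG" "A <= (%y. h ** y ** inv h) ` VG u" "subgroup A G"
  by (rule base_conjugate)
 interpret V: subgroup "VG u" G by (rule VG_sub[OF uh(1)])
 have "b ** c = c ** b" if bc: "b : A" "c : A" for b c
 proof -
  obtain y z where yz: "y : VG u" "z : VG u" "b = h ** y ** inv h" "c = h ** z ** inv h" using uh(3) bc by blast
  thus ?thesis using conj_mult[OF uh(2), of y z] conj_mult[OF uh(2), of z y] VG_comm[OF uh(1) yz(1,2)] V.mem_carrier by simp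
 qed
 thus "based_subgroup G A n a"
  by (intro based_subgroup.intro comm_sub.intro comm_sub_axioms.intro based_subgroup_axioms.intro is_group uh(4) ob)
qed

lemma VG_commensurable_A:
 assumes u: "gpa v p u"
 shows "EX m>=(1::nat). ALL y:VG u. elem v p u ** y [^] m ** inv (elem v p u) : A"
  "EX m>=(1::nat). ALL y:A. inv (elem v p u) ** y [^] m ** elem v p u : VG u"
proof -
 obtain w h where wh: "w : Vs" "h : CG" "A <= (%y. h ** y ** inv h) ` VG w"
  and ex: "EX k>=(1::nat). ALL y:VG w. h ** y [^] k ** inv h : A" "EX q. gpa v q w & h = elem v q w"
  by (rule base_conjugate)
 obtain q where q: "gpa v q w" "h = elem v q w" using ex(2) by blast
 obtain k :: nat where k: "k >= 1" "!!y. y : VG w ==> h ** y [^] k ** inv h : A" using ex(1) by blast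
 let ?g = "elem v p u"
 have g: "?g : CG" by (rule elem(1)[OF u])
 have Vc: "VG u <= CG" "VG w <= CG" using subgroup.subset[OF VG_sub] path_verts[OF u] wh(1) by auto
 have e1: "elem w (winv q @ p) u = inv h ** ?g" using elem_append[OF winv_path[OF q(1)] u] elem_winv[OF q(1)] q(2) by simp
 have e2: "elem u (winv p @ q) w = inv ?g ** h" using elem_append[OF winv_path[OF u] q(1)] elem_winv[OF u] q(2) by simp
 obtain m :: nat where m: "m >= 1" "!!y. y : VG u ==> inv h ** ?g ** y [^] m ** inv (inv h ** ?g) : VG w"
  using VG_commensurable[OF path_app[OF winv_path[OF q(1)] u]] unfolding e1 by blast
 have "?g ** y [^] (m * k) ** inv ?g : A" if y: "y : VG u" for y
 proof -
  have yc: "y : CG" using y Vc by auto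
  have "h ** (inv h ** ?g ** y [^] m ** inv (inv h ** ?g)) [^] k ** inv h = ?g ** y [^] (m * k) ** inv ?g"
   using conj_pow[of "inv h ** ?g" "y [^] m" k] g wh(2) yc by (simp add: m_assoc inv_mult_group nat_pow_pow)
  thus ?thesis using k(2)[OF m(2)[OF y]] by simp
 qed
 moreover have "m * k >= 1" using m(1) k(1) by simp
 ultimately show "EX m>=(1::nat). ALL y:VG u. ?g ** y [^] m ** inv ?g : A" by blast
 obtain m :: nat where m: "m >= 1" "!!y. y : VG w ==> inv ?g ** h ** y [^] m ** inv (inv ?g ** h) : VG u"
  using VG_commensurable[OF path_app[OF winv_path[OF u] q(1)]] unfolding e2 by blast
 have "inv ?g ** b [^] m ** ?g : VG u" if b: "b : A" for b
 proof -
  obtain y where y: "y : VG w" "b = h ** y ** inv h" using b wh(3) by blast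
  have yc: "y : CG" using y Vc by auto
  have "inv ?g ** b [^] m ** ?g = inv ?g ** h ** y [^] m ** inv (inv ?g ** h)"
   unfolding y(2) using conj_pow[OF wh(2) yc, of m] g wh(2) yc by (simp add: m_assoc inv_mult_group)
  thus ?thesis using m(2)[OF y(1)] by simp
 qed
 thus "EX m>=(1::nat). ALL y:A. inv ?g ** y [^] m ** ?g : VG u" using m(1) by blast
qed

lemma VG_pow_in_A: assumes "u : Vs" shows "EX m>=(1::nat). ALL y:VG u. y [^] m : A"
proof -
 have "y : VG u ==> y : CG" for y using subgroup.subset[OF VG_sub[OF assms]] by auto
 thus ?thesis using VG_commensurable_A(1)[OF pth[OF assms]] unfolding elem_pth[OF assms] by simp
qed

lemma A_pow_in_VG: "EX m>=(1::nat). ALL y:A. y [^] m : VG v"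
 using VG_commensurable_A(2)[OF gog_path.path_Nil[OF v]] A_carr unfolding elem_Nil[OF v] by simp

lemma A_commensurated:
 assumes g: "g : CG" shows "EX m>=(1::nat). ALL y:A. g ** y [^] m ** inv g : A"
proof -
 obtain p where p: "gpa v p v" "g = elem v p v" using elem_surj[OF g] by blast
 obtain m :: nat where m: "m >= 1" "!!y. y : A ==> y [^] m : VG v" using A_pow_in_VG by blast
 obtain k :: nat where k: "k >= 1" "!!y. y : VG v ==> g ** y [^] k ** inv g : A" using VG_commensurable_A(1)[OF p(1)] p(2) by blast
 have "g ** y [^] (m * k) ** inv g : A" if "y : A" for y
  using k(2)[OF m(2)[OF that]] A_carr[OF that] by (simp add: nat_pow_pow)
 moreover have "m * k >= 1" using m(1) k(1) by simp
 ultimately show ?thesis by blast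
qed

end

section \<open>Rational coordinates and the affine action\<close>

context gbs_base
begin

definition virt :: "'g => bool" where "virt h \<longleftrightarrow> h : CG & (EX m>=(1::nat). h [^] m : A)"

text \<open>The coordinates of \<open>A\<close> extended to all elements with a power in
  \<open>A\<close>, on dividing by the exponent. The default \<open>0\<close> beyond
  \<open>n\<close> lets vectors be compared as functions.\<close>

definition vec :: "'g => nat => real" where
 "vec h i = (if i < n then let m = SOME m::nat. m >= 1 & h [^] m : A in of_int (crd (h [^] (m::nat)) i) / real m else 0)"

lemma vec_ge [simp]: "i >= n ==> vec h i = 0" unfolding vec_def by simp

lemma vec_eq:
 assumes "h : CG" "m >= (1::nat)" "h [^] m : A" "i < n"
 shows "vec h i = of_int (crd (h [^] m) i) / m"
proof -
 define k where "k = (SOME m::nat. m >= 1 & h [^] m : A)"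
 have k: "k >= 1" "h [^] k : A" using someI[of "%m::nat. m >= 1 & h [^] m : A" m] assms unfolding k_def by auto
 have "(h [^] m) [^] k = (h [^] k) [^] m" using assms(1) by (simp add: nat_pow_pow mult.commute)
 hence "int k * crd (h [^] m) i = int m * crd (h [^] k) i" using crd_pow assms k by metis
 hence "real k * of_int (crd (h [^] m) i) = real m * of_int (crd (h [^] k) i)"
  by (metis of_int_mult of_int_of_nat_eq)
 thus ?thesis unfolding vec_def Let_def k_def[symmetric] using assms k by (simp add: field_simps)
qed

lemma virt_A: "h : A ==> virt h" unfolding virt_def using A_carr by (auto intro!: exI[of _ 1])

lemma virt_VG: "u : Vs ==> h : VG u ==> virt h"
 unfolding virt_def using VG_pow_in_A[of u] subgroup.mem_carrier[OF VG_sub] by blast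

lemma vec_A: "h : A ==> i < n ==> vec h i = of_int (crd h i)"
 using vec_eq[of h 1 i] A_carr by simp

lemma virt_mult:
 assumes "virt y" "virt z" "y ** z = z ** y"
 shows "virt (y ** z)" "vec (y ** z) i = vec y i + vec z i"
proof -
 obtain k l :: nat where kl: "k >= 1" "y [^] k : A" "l >= 1" "z [^] l : A" and c: "y : CG" "z : CG"
  using assms unfolding virt_def by blast
 have p: "y [^] (k * l) : A" "z [^] (k * l) : A"
  using A_pow(2)[OF kl(2), of l] A_pow(2)[OF kl(4), of k] c by (simp_all add: nat_pow_pow mult.commute)
 have e: "(y ** z) [^] (k * l) = y [^] (k * l) ** z [^] (k * l)" using pow_mult_distrib[OF assms(3) c] .
 have kl1: "k * l >= 1" using kl by simp
 have yz: "y ** z : CG" "(y ** z) [^] (k * l) : A" using c e p by auto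
 thus "virt (y ** z)" unfolding virt_def using kl1 by blast
 show "vec (y ** z) i = vec y i + vec z i"
 proof (cases "i < n")
  case True
  thus ?thesis using vec_eq[OF yz(1) kl1 yz(2) True] vec_eq[OF c(1) kl1 p(1) True] vec_eq[OF c(2) kl1 p(2) True] crd_mult[OF p True]
   unfolding e by (simp add: add_divide_distrib)
 qed simp
qed

lemma vec_one [simp]: "vec \<one> i = 0"
 using vec_A[of \<one> i] crd_one by (cases "i < n") auto

lemma virt_conj:
 assumes "virt h" "g : CG" shows "virt (g ** h ** inv g)"
proof -
 obtain m :: nat where m: "m >= 1" "h [^] m : A" and h: "h : CG" using assms(1) unfolding virt_def by blast
 obtain k :: nat where k: "k >= 1" "!!y. y : A ==> g ** y [^] k ** inv g : A" using A_commensurated[OF assms(2)] by blast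
 have "(g ** h ** inv g) [^] (m * k) : A"
  using k(2)[OF m(2)] conj_pow[OF assms(2) h, of "m * k"] h by (simp add: nat_pow_pow)
 moreover have "m * k >= 1" using m k by simp
 ultimately show ?thesis unfolding virt_def using h assms(2) by blast
qed

lemma monomial_unit: "j < n ==> monomial n G a (%i. if i = j then 1 else 0) = a j"
 using monomial_cong[of n a a "crd (a j)" "%i. if i = j then 1 else 0"] crd_basis[of _ j] crd[OF a_in] by simp

lemma crd_hom:
 assumes c: "!!y. y : A ==> f y : A" and m: "!!y z. y : A ==> z : A ==> f (y ** z) = f y ** f z" and y: "y : A" and i: "i < n"
 shows "crd (f y) i = (\<Sum>j<n. crd y j * crd (f (a j)) i)"
proof -
 have "crd (f (monomial n G a k)) i = (\<Sum>j<n. k j * crd (f (monomial n G a (%i. if i = j then 1 else 0))) i)" for k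
 proof (rule int_vector_additive)
  show "crd (f (monomial n G a (%i. x i + y i))) i = crd (f (monomial n G a x)) i + crd (f (monomial n G a y)) i" for x y
   unfolding mono_add using m[OF mono_in mono_in] crd_mult[OF c[OF mono_in] c[OF mono_in] i] by simp
  show "crd (f (monomial n G a x)) i = crd (f (monomial n G a y)) i" if "!!i. i < n ==> x i = y i" for x y
   using monomial_cong[of n a a x y] that by simp
 qed
 from this[of "crd y"] show ?thesis using monomial_unit crd[OF y] by simp
qed

text \<open>The modular matrix of \<open>g\<close> applied to a real vector: its columns are the
  coordinates of the conjugated basis elements, as \<open>modular_hom_vec\<close> shows.\<close>

definition lin :: "'g => (nat => real) => nat => real" where
 "lin g w i = (\<Sum>j<n. w j * vec (g ** a j ** inv g) i)"

lemma lin_vec: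
 assumes g: "g : CG" and h: "virt h" shows "lin g (vec h) = vec (g ** h ** inv g)"
proof
 fix i
 obtain m :: nat where m: "m >= 1" "h [^] m : A" and hc: "h : CG" using h unfolding virt_def by blast
 obtain k :: nat where k: "k >= 1" "!!y. y : A ==> g ** y [^] k ** inv g : A" using A_commensurated[OF g] by blast
 define f where "f y = g ** y [^] k ** inv g" for y
 have fm: "f (y ** z) = f y ** f z" if "y : A" "z : A" for y z
  unfolding f_def using pow_mult_A[OF that] conj_mult[OF g] A_carr that by simp
 have km: "m * k >= 1" using m k by simp
 have z: "(g ** h ** inv g) [^] (m * k) = f (h [^] m)"
  unfolding f_def using conj_pow[OF g hc, of "m * k"] hc by (simp add: nat_pow_pow)
 have fA: "f y : A" if "y : A" for y unfolding f_def using k(2) that by simp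
 show "lin g (vec h) i = vec (g ** h ** inv g) i"
 proof (cases "i < n")
  case True
  have "vec (g ** h ** inv g) i = of_int (crd (f (h [^] m)) i) / (m * k)"
   using vec_eq[of "g ** h ** inv g" "m * k" i] km True fA[OF m(2)] g hc unfolding z by simp
  also have "crd (f (h [^] m)) i = (\<Sum>j<n. crd (h [^] m) j * crd (f (a j)) i)" by (rule crd_hom[OF fA fm m(2) True])
  also have "of_int (\<Sum>j<n. crd (h [^] m) j * crd (f (a j)) i) / real (m * k) = (\<Sum>j<n. vec h j * vec (g ** a j ** inv g) i)"
   unfolding of_int_sum sum_divide_distrib
  proof (rule sum.cong)
   fix j assume "j : {..<n}"
   hence j: "j < n" by simp
   have "vec (g ** a j ** inv g) i = of_int (crd (f (a j)) i) / k"
   using vec_eq[of "g ** a j ** inv g" k i] conj_pow[OF g a_carrier[OF j], of k] fA[OF a_in[OF j]] k(1) True g a_carrier[OF j] unfolding f_def by simp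
   thus "of_int (crd (h [^] m) j * crd (f (a j)) i) / real (m * k) = vec h j * vec (g ** a j ** inv g) i"
   using vec_eq[OF hc m j] by simp
  qed simp
  finally show ?thesis unfolding lin_def by simp
 qed (simp add: lin_def)
qed

lemma virt_basis: "g : CG ==> j < n ==> virt (g ** a j ** inv g)"
 using virt_conj[OF virt_A[OF a_in]] by blast

lemma lin_mult:
 assumes g: "g : CG" "h : CG" shows "lin g (lin h w) = lin (g ** h) w"
proof
 fix i
 have "lin g (lin h w) i = (\<Sum>k<n. \<Sum>j<n. w j * vec (h ** a j ** inv h) k * vec (g ** a k ** inv g) i)"
  unfolding lin_def by (simp add: sum_distrib_right)
 also have "... = (\<Sum>j<n. \<Sum>k<n. w j * vec (h ** a j ** inv h) k * vec (g ** a k ** inv g) i)" by (rule sum.swap)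
 also have "... = (\<Sum>j<n. w j * lin g (vec (h ** a j ** inv h)) i)"
  unfolding lin_def by (simp add: sum_distrib_left mult.assoc)
 also have "... = lin (g ** h) w i" unfolding lin_def[of "g ** h"]
 proof (rule sum.cong)
  fix j assume "j : {..<n}"
  hence j: "j < n" by simp
  have "g ** (h ** a j ** inv h) ** inv g = (g ** h) ** a j ** inv (g ** h)"
   using g a_carrier[OF j] by (simp add: m_assoc inv_mult_group)
  thus "w j * lin g (vec (h ** a j ** inv h)) i = w j * vec ((g ** h) ** a j ** inv (g ** h)) i"
   using lin_vec[OF g(1) virt_basis[OF g(2) j]] by simp
 qed simp
 finally show "lin g (lin h w) i = lin (g ** h) w i" .
qed

definition RV :: "(nat => real) set" where "RV = {w. ALL i>=n. w i = 0}"

lemma lin_id: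
 assumes "!!j. j < n ==> vec (g ** a j ** inv g) = vec (a j)" "w : RV" shows "lin g w = w"
proof
 fix i
 have "lin g w i = (\<Sum>j<n. w j * vec (a j) i)" unfolding lin_def using assms by simp
 also have "... = (\<Sum>j<n. if j = i then w j else 0)"
 proof (rule sum.cong)
  fix j assume "j : {..<n}"
  thus "w j * vec (a j) i = (if j = i then w j else 0)"
   using vec_A[OF a_in, of j i] crd_basis[of i j] by (cases "i < n") auto
 qed simp
 also have "... = w i" using assms(2) unfolding RV_def by (simp add: not_less)
 finally show "lin g w i = w i" .
qed

lemma lin_one: "w : RV ==> lin \<one> w = w" by (rule lin_id) (use a_carrier in auto)

lemma lin_add: "lin g (%i. w i + z i) i = lin g w i + lin g z i"
 unfolding lin_def by (simp add: sum.distrib distrib_right)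

lemma lin_RV: "lin g w : RV" unfolding RV_def lin_def by simp

text \<open>The action of the path group by affine maps of \<open>\<rat>\<^sup>n\<close>: the vertex groups act by translations and
  the arcs by their conjugation action. On a subgroup acting trivially by conjugation its translation part extends the
  coordinates of \<open>A\<close>.\<close>

primrec aff :: "('v, 'e, 'a) gog_letter => (nat => real) => nat => real" where
 "aff (Elt u b) w = (%i. vec (ve u b) i + w i)"
| "aff (Edge e) w = lin (ee e) w"

definition affs :: "('v, 'e, 'a) gog_letter list => (nat => real) => nat => real" where
 "affs p w = foldr aff p w"

lemma affs_simps [simp]: "affs [] w = w" "affs (l # p) w = aff l (affs p w)" "affs (p @ q) w = affs p (affs q w)"
 unfolding affs_def by auto

lemma aff_RV: "w : RV ==> aff l w : RV"
 by (cases l) (auto simp: lin_RV, simp add: RV_def)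

lemma affs_RV: "w : RV ==> affs p w : RV"
 by (induction p) (auto simp: aff_RV)

text \<open>The affine maps satisfy the relations of the path group: the vertex groups are abelian
  and act by translations, and conjugation by an arc carries the translation vector at its head to
  that at its tail.\<close>

lemma affs_gog_eq: "geq p q ==> w : RV ==> affs p w = affs q w"
proof (induction arbitrary: w rule: gog_eq.induct)
 case (eq_cong p q l r)
 thus ?case using affs_RV by simp
next
 case (vertex_mult u b c)
 have "ve u b : VG u" "ve u c : VG u" using vertex_mult unfolding VG_def by auto
 hence "vec (ve u b ** ve u c) i = vec (ve u b) i + vec (ve u c) i" for i
  using virt_mult(2) virt_VG VG_comm vertex_mult(1) by blast
 thus ?case using ve_mult[OF vertex_mult(1-3)] by (simp add: add.assoc)
next
 case (vertex_one u)
 have "ve u \<one>\<^bsub>vg u\<^esub> = \<one>" using group_hom.hom_one[OF ve_hom[OF vertex_one(1)]] .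
 thus ?case by simp
next
 case (edge_inv e)
 thus ?case using lin_mult ee_rev ee_closed lin_one by simp
next
 case (edge_conj e c)
 have s: "tgt e : Vs" using edge_conj(1) by simp
 have m: "ve (tgt e) (em e c) : VG (tgt e)" using emb_closed(1)[OF edge_conj(1,2)] unfolding VG_def by simp
 have "lin (ee e) (%i. vec (ve (tgt e) (em e c)) i + lin (ee (rv e)) w i) =
  (%i. lin (ee e) (vec (ve (tgt e) (em e c))) i + lin (ee e) (lin (ee (rv e)) w) i)" using lin_add by blast
 also have "lin (ee e) (vec (ve (tgt e) (em e c))) = vec (ve (src e) (em (rv e) c))"
  using lin_vec[OF ee_closed[OF edge_conj(1)] virt_VG[OF s m]] ee_conj[OF edge_conj(1,2)] by simp
 also have "lin (ee e) (lin (ee (rv e)) w) = w" using lin_mult ee_rev ee_closed edge_conj lin_one by simp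
 finally show ?case by simp
qed auto

abbreviation zv :: "nat => real" where "zv == %_. 0"
lemma zv: "zv : RV" unfolding RV_def by simp

lemma lin_virt_commuting:
 assumes g: "g : CG" "m >= (1::nat)" "!!y. y : A ==> g ** y [^] m ** inv g = y [^] m" and w: "w : RV"
 shows "lin g w = w"
proof (rule lin_id[OF _ w])
 fix j assume j: "j < n"
 show "vec (g ** a j ** inv g) = vec (a j)"
 proof
  fix i
  have "(g ** a j ** inv g) [^] m = a j [^] m" using conj_pow[OF g(1) a_carrier[OF j], of m] g(3)[OF a_in[OF j]] by simp
  thus "vec (g ** a j ** inv g) i = vec (a j) i"
   using vec_eq[of "g ** a j ** inv g" m i] vec_eq[of "a j" m i] g(1,2) a_carrier[OF j] a_in[OF j] by (cases "i < n") auto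
 qed
qed

lemma A_VG_commuting:
 assumes u: "u : Vs" and y: "y : VG u"
 shows "EX m>=(1::nat). ALL b:A. y ** b [^] m ** inv y = b [^] m"
proof -
 obtain m :: nat where m: "m >= 1" "!!b. b : A ==> b [^] m : VG u"
  using VG_commensurable_A(2)[OF pth[OF u]] A_carr unfolding elem_pth[OF u] by auto
 have yc: "y : CG" using y subgroup.mem_carrier[OF VG_sub[OF u]] by blast
 have "y ** b [^] m ** inv y = b [^] m" if b: "b : A" for b
 proof -
  have "y ** b [^] m = b [^] m ** y" by (rule VG_comm[OF u y m(2)[OF b]])
  thus ?thesis using yc A_carr[OF b] by (simp add: m_assoc)
 qed
 thus ?thesis using m(1) by blast
qed

text \<open>The linear part of the map of a path is the conjugation action of its element. Letters
  of vertex groups contribute nothing to it, as they commute with suitable powers of the elements of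
  \<open>A\<close>.\<close>

lemma affs_path:
 assumes "gpa u p w" "z : RV" shows "affs p z = (%i. lin (elem u p w) z i + affs p zv i)"
 using assms
proof (induction rule: gog_path.induct)
 case (path_Nil u)
 thus ?case using elem_Nil lin_one by simp
next
 case (path_Elt u b p w)
 have e: "elem u (Elt u b # p) w = ve u b ** elem u p w" unfolding ve_def
  using elem_append[OF pathl(1)[OF path_Elt(1,2)] path_Elt(3)] by simp
 have b: "ve u b : VG u" unfolding VG_def using path_Elt by blast
 have bc: "ve u b : CG" by (rule ve_closed[OF path_Elt(1,2)])
 obtain m :: nat where "m >= 1" "!!y. y : A ==> ve u b ** y [^] m ** inv (ve u b) = y [^] m"
  using A_VG_commuting[OF path_Elt(1) b] by blast
 hence "lin (ve u b) (lin (elem u p w) z) = lin (elem u p w) z" by (rule lin_virt_commuting[OF bc _ _ lin_RV])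
 hence "lin (elem u (Elt u b # p) w) z = lin (elem u p w) z"
  unfolding e using lin_mult[OF bc elem(1)[OF path_Elt(3)]] by simp
 thus ?case using path_Elt by (simp add: algebra_simps)
next
 case (path_Edge e p w)
 have el: "elem (src e) (Edge e # p) w = ee e ** elem (tgt e) p w" unfolding ee_def
  using elem_append[OF pathl(2)[OF path_Edge(1)] path_Edge(2)] by simp
 have "affs (Edge e # p) z = lin (ee e) (%i. lin (elem (tgt e) p w) z i + affs p zv i)" using path_Edge by simp
 also have "... = (%i. lin (ee e) (lin (elem (tgt e) p w) z) i + lin (ee e) (affs p zv) i)" using lin_add by blast
 finally show ?case unfolding el using lin_mult[OF ee_closed[OF path_Edge(1)] elem(1)[OF path_Edge(2)]] by simp
qed

definition tr :: "'g => nat => real" where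
 "tr g = affs (SOME p. gpa v p v & \<phi> g = cls p) zv"

lemma tr_eq:
 assumes "gpa v p v" "\<phi> g = cls p" shows "tr g = affs p zv"
proof -
 let ?q = "SOME p. gpa v p v & \<phi> g = cls p"
 have "gpa v ?q v & \<phi> g = cls ?q" by (rule someI[of _ p]) (use assms in auto)
 hence "geq ?q p" using assms(2) gog_class_eq_iff by metis
 thus ?thesis unfolding tr_def using affs_gog_eq zv by blast
qed

lemma tr_mult:
 assumes "g : CG" "h : CG" shows "tr (g ** h) i = tr g i + lin g (tr h) i"
proof -
 obtain p where p: "gpa v p v" "\<phi> g = cls p" "g = elem v p v" using elem_surj[OF assms(1)] by blast
 obtain q where q: "gpa v q v" "\<phi> h = cls q" using elem_surj[OF assms(2)] by blast
 have "\<phi> (g ** h) = cls (p @ q)" using phi_mult[OF assms] p q gog_mult_class by simp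
 hence "tr (g ** h) = affs (p @ q) zv" by (rule tr_eq[OF path_app[OF p(1) q(1)]])
 also have "... = (%i. lin g (affs q zv) i + affs p zv i)" using affs_path[OF p(1) affs_RV[OF zv]] p(3) by simp
 finally show ?thesis using tr_eq[OF p(1,2)] tr_eq[OF q] by simp
qed

lemma tr_VG: assumes "y : VG v" shows "tr y = vec y"
proof -
 obtain b where b: "b : carrier (vg v)" "y = ve v b" using assms unfolding VG_def by auto
 have "\<phi> y = cls [Elt v b]" using elem(2)[OF pathl(1)[OF v b(1)]] b(2) unfolding ve_def by simp
 thus ?thesis using tr_eq[OF pathl(1)[OF v b(1)]] b(2) by simp
qed

text \<open>The kernel of the modular homomorphism. On it the cocycle \<open>tr\<close> is a
  homomorphism, and its index is finite when the monodromy is.\<close>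

definition cen :: "'g set" where
 "cen = {g : CG. EX m>=(1::nat). ALL y:A. g ** y [^] m ** inv g = y [^] m}"

lemma cen_common:
 assumes "g : CG" "m >= (1::nat)" "ALL y:A. g ** y [^] m ** inv g = y [^] m" "y : A"
 shows "g ** y [^] (m * k) ** inv g = y [^] (m * k)"
 using assms(3,4) A_pow(2)[OF assms(4), of k] A_carr[OF assms(4)] by (metis mult.commute nat_pow_pow)

lemma cen_subgroup: "subgroup cen G"
proof
 show "cen <= CG" unfolding cen_def by auto
 have "ALL y:A. \<one> ** y [^] (1::nat) ** inv \<one> = y [^] (1::nat)" using A_carr by simp
 thus "\<one> : cen" unfolding cen_def by blast
 fix g assume g: "g : cen"
 then obtain m :: nat where m: "m >= 1" "ALL y:A. g ** y [^] m ** inv g = y [^] m" and gc: "g : CG" unfolding cen_def by blast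
 have "inv g ** y [^] m ** inv (inv g) = y [^] m" if y: "y : A" for y
 proof -
  have "inv g ** (g ** y [^] m ** inv g) ** inv (inv g) = y [^] m" using gc A_carr[OF y] by (simp add: m_assoc)
  thus ?thesis using m(2) y by simp
 qed
 thus "inv g : cen" unfolding cen_def using gc m(1) by blast
 fix h assume h: "h : cen"
 then obtain k :: nat where k: "k >= 1" "ALL y:A. h ** y [^] k ** inv h = y [^] k" and hc: "h : CG" unfolding cen_def by blast
 have "(g ** h) ** y [^] (m * k) ** inv (g ** h) = y [^] (m * k)" if y: "y : A" for y
 proof -
  have "(g ** h) ** y [^] (m * k) ** inv (g ** h) = g ** (h ** y [^] (m * k) ** inv h) ** inv g"
   using gc hc A_carr[OF y] by (simp add: m_assoc inv_mult_group)
  also have "... = y [^] (m * k)"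
   using cen_common[OF hc k y, of m] cen_common[OF gc m y, of k] by (simp add: mult.commute)
  finally show ?thesis .
 qed
 moreover have "m * k >= 1" using m k by simp
 ultimately show "g ** h : cen" unfolding cen_def using gc hc by blast
qed

lemma VG_cen: "VG v <= cen"
 using A_VG_commuting[OF v] subgroup.mem_carrier[OF VG_sub[OF v]] unfolding cen_def by blast

lemma tr_RV: "g : CG ==> tr g : RV"
 using elem_surj[of g] tr_eq affs_RV[OF zv] by metis

lemma tr_cen_mult: assumes "g : cen" "h : CG" shows "tr (g ** h) i = tr g i + tr h i"
proof -
 obtain m :: nat where m: "m >= 1" "!!y. y : A ==> g ** y [^] m ** inv g = y [^] m" and gc: "g : CG"
  using assms unfolding cen_def by blast
 show ?thesis using tr_mult[OF gc assms(2)] lin_virt_commuting[OF gc m tr_RV[OF assms(2)]] by simp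
qed

lemma modular_hom_vec:
 assumes g: "g : CG" and ij: "i < n" "j < n"
 shows "vec (g ** a j ** inv g) i = of_rat (modular_hom n G A a g $$ (i, j))"
proof -
 obtain k :: nat where k: "k >= 1" "!!y. y : A ==> g ** y [^] k ** inv g : A" using A_commensurated[OF g] by blast
 define c where "c i j = crd (g ** a j [^] k ** inv g) i" for i j
 have "modular_hom n G A a g = Matrix.mat n n (%(i, j). rat_of_int (c i j) / rat_of_nat k)"
 proof (rule modular_hom_eq[OF g])
  show "g ** a j [^] k ** inv g = monomial n G a (%i. c i j)" if "j < n" for j
   unfolding c_def using crd[OF k(2)[OF a_in[OF that]]] by simp
 qed (use k in simp)
 moreover have "vec (g ** a j ** inv g) i = of_int (c i j) / k"
  using vec_eq[of "g ** a j ** inv g" k i] conj_pow[OF g a_carrier[OF ij(2)], of k] k(1) k(2)[OF a_in[OF ij(2)]] ij(1) g a_carrier[OF ij(2)]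
  unfolding c_def by simp
 ultimately show ?thesis using ij by (simp add: of_rat_divide)
qed

lemma modular_hom_eq_cen:
 assumes g: "g : CG" "h : CG" and eq: "modular_hom n G A a g = modular_hom n G A a h"
 shows "inv h ** g : cen"
proof -
 have l: "lin g w i = lin h w i" if "i < n" for w i
  unfolding lin_def using modular_hom_vec[OF g(1) that] modular_hom_vec[OF g(2) that] eq by (intro sum.cong) auto
 obtain k :: nat where k: "k >= 1" "!!y. y : A ==> g ** y [^] k ** inv g : A" using A_commensurated[OF g(1)] by blast
 obtain m :: nat where m: "m >= 1" "!!y. y : A ==> h ** y [^] m ** inv h : A" using A_commensurated[OF g(2)] by blast
 have "inv h ** g ** y [^] (k * m) ** inv (inv h ** g) = y [^] (k * m)" if y: "y : A" for y
 proof -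
  have yA: "y [^] (k * m) : A" using y by simp
  have 1: "g ** y [^] (k * m) ** inv g : A" "h ** y [^] (k * m) ** inv h : A"
   using k(2)[OF A_pow(2)[OF y, of m]] m(2)[OF A_pow(2)[OF y, of k]] A_carr[OF y] by (simp_all add: nat_pow_pow mult.commute)
  have "g ** y [^] (k * m) ** inv g = h ** y [^] (k * m) ** inv h"
  proof (rule crd_inj[OF 1])
   fix i assume i: "i < n"
   have "vec (g ** y [^] (k * m) ** inv g) i = vec (h ** y [^] (k * m) ** inv h) i"
   using lin_vec[OF g(1) virt_A[OF yA]] lin_vec[OF g(2) virt_A[OF yA]] l[OF i, of "vec (y [^] (k * m))"] by simp
   thus "crd (g ** y [^] (k * m) ** inv g) i = crd (h ** y [^] (k * m) ** inv h) i" using vec_A 1 i by simp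
  qed
  hence "inv h ** (g ** y [^] (k * m) ** inv g) ** h = y [^] (k * m)" using g A_carr[OF yA] by (simp add: m_assoc)
  thus ?thesis using g A_carr[OF yA] by (simp add: m_assoc inv_mult_group)
 qed
 moreover have "k * m >= 1" using k m by simp
 ultimately show ?thesis unfolding cen_def using g by blast
qed

lemma cen_finite_index: assumes "finite (monodromy n G A a)" shows "finite (rcosets cen)"
proof -
 \<comment> \<open>Right cosets of \<open>cen\<close> are compared through
   \<open>h ** inv g\<close>; hence the matrices of the inverses.\<close>
 let ?s = "%M. SOME g. g : CG & modular_hom n G A a (inv g) = M"
 have "rcosets cen <= (%M. cen #> ?s M) ` monodromy n G A a"
 proof
  fix C assume "C : rcosets cen"
  then obtain g where g: "g : CG" "C = cen #> g" unfolding RCOSETS_def by auto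
  let ?h = "?s (modular_hom n G A a (inv g))"
  have h: "?h : CG & modular_hom n G A a (inv ?h) = modular_hom n G A a (inv g)" by (rule someI[of _ g]) (use g in simp)
  hence "inv (inv ?h) ** inv g : cen" using g by (intro modular_hom_eq_cen) auto
  hence m: "?h ** inv g : cen" using h by simp
  have "?h = (?h ** inv g) ** g" using h g by (simp add: m_assoc)
  hence "?h : cen #> g" unfolding r_coset_def using m by blast
  hence "C = cen #> ?h" unfolding g(2) by (rule repr_independence[OF _ g(1) cen_subgroup])
  thus "C : (%M. cen #> ?s M) ` monodromy n G A a" unfolding monodromy_def using g by blast
 qed
 thus ?thesis using assms finite_subset by blast
qed

text \<open>The vertex groups embed: since \<open>A\<close> has rank \<open>n\<close>, the map \<open>\<int>\<^sup>n \<cong> G\<^sub>v \<rightarrow> A\<close>, \<open>y \<mapsto> y\<^sup>m\<close>, has image of finite index.\<close>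

lemma VG_pow_inj:
 assumes m: "m >= (1::nat)" "!!y. y : VG v ==> y [^] m : A" and yz: "y : VG v" "z : VG v" "y [^] m = z [^] m"
 shows "y = z"
proof -
 obtain h where h: "h : iso (Z_power n) (vg v)" using group.iso_sym[OF vgg[OF v] vgrp_iso[OF v]] unfolding is_iso_def by blast
 have hc: "h x : carrier (vg v)" if "x : carrier (Z_power n)" for x using h that unfolding iso_def hom_def by auto
 have r: "(\<lambda>i\<in>{..<n}. x i) : carrier (Z_power n)" for x :: "nat => int" by auto
 define f where "f x = ve v (h (\<lambda>i\<in>{..<n}. x i))" for x
 have fV: "f x : VG v" for x unfolding f_def VG_def using hc[OF r] by blast
 have fc: "f x : CG" for x using fV subgroup.mem_carrier[OF VG_sub[OF v]] by blast
 have fA: "f x [^] m : A" for x using m(2) fV by simp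
 have f_surj: "EX x. b = f x" if b: "b : VG v" for b
 proof -
  obtain c where c: "c : carrier (vg v)" "b = ve v c" using b unfolding VG_def by auto
  have "c : h ` carrier (Z_power n)" using h c(1) unfolding iso_def bij_betw_def by blast
  then obtain x where x: "x : {..<n} \<rightarrow>\<^sub>E UNIV" "c = h x" by auto
  hence "f x = b" unfolding f_def c(2) by (simp add: PiE_restrict)
  thus ?thesis by blast
 qed
 have f_add: "f (%i. x i + y i) = f x ** f y" for x y
 proof -
  have e: "(\<lambda>i\<in>{..<n}. x i + y i) = (\<lambda>i\<in>{..<n}. x i) **\<^bsub>Z_power n\<^esub> (\<lambda>i\<in>{..<n}. y i)" by auto
  have "h : hom (Z_power n) (vg v)" using h unfolding iso_def by blast
  hence "h (\<lambda>i\<in>{..<n}. x i + y i) = h (\<lambda>i\<in>{..<n}. x i) **\<^bsub>vg v\<^esub> h (\<lambda>i\<in>{..<n}. y i)"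
   unfolding e by (rule hom_mult[OF _ r r])
  thus ?thesis unfolding f_def using ve_mult[OF v hc[OF r] hc[OF r]] by simp
 qed
 define M where "M i j = crd (f (%i. if i = j then 1 else 0) [^] m) i" for i j
 have lin: "crd (f x [^] m) i = (\<Sum>j<n. M i j * x j)" if i: "i < n" for x i
 proof -
  have "crd (f x [^] m) i = (\<Sum>j<n. x j * crd (f (%i. if i = j then 1 else 0) [^] m) i)"
  proof (rule int_vector_additive[of "%x. crd (f x [^] m) i"])
   show "crd (f (%i. x i + y i) [^] m) i = crd (f x [^] m) i + crd (f y [^] m) i" for x y
   unfolding f_add using pow_mult_distrib[OF VG_comm[OF v fV fV] fc fc] crd_mult[OF fA fA i] by simp
   show "crd (f x [^] m) i = crd (f y [^] m) i" if "!!i. i < n ==> x i = y i" for x y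
   unfolding f_def using restrict_ext[of "{..<n}" x y] that by simp
  qed
  thus ?thesis unfolding M_def by (simp add: mult.commute)
 qed
 obtain k :: nat where k: "k >= 1" "!!b. b : A ==> b [^] k : VG v" using A_pow_in_VG by blast
 \<comment> \<open>The \<open>k\<close>-th power of an element of \<open>A\<close> lies in
   \<open>VG v\<close>, and its \<open>m\<close>-th power returns to \<open>A\<close>. So the matrix
   of the \<open>m\<close>-th power map attains \<open>k * m\<close> times every vector, and
   \<open>int_matrix_cofinal_injective\<close> applies.\<close>
 have surj: "EX x. ALL i<n. (\<Sum>j<n. M i j * x j) = int (k * m) * y i" for y
 proof -
  obtain x where x: "monomial n G a y [^] k = f x" using f_surj[OF k(2)[OF mono_in]] by blast
  have "f x [^] m = monomial n G a y [^] (k * m)" unfolding x[symmetric] using A_carr[OF mono_in] by (simp add: nat_pow_pow)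
  hence "crd (f x [^] m) i = int (k * m) * y i" if "i < n" for i
   using crd_pow[OF mono_in that, of y "k * m"] crd_unique[OF refl that, of y] by simp
  thus ?thesis using lin by auto
 qed
 obtain x1 x2 where x: "y = f x1" "z = f x2" using f_surj yz(1,2) by metis
 have "(\<Sum>j<n. M i j * (x1 j - x2 j)) = 0" if i: "i < n" for i
  using lin[OF i, of x1] lin[OF i, of x2] yz(3) x by (simp add: right_diff_distrib sum_subtractf)
 moreover have "int (k * m) ~= 0" using k(1) m(1) by simp
 ultimately have "ALL j<n. x1 j - x2 j = 0" using int_matrix_cofinal_injective[of "int (k * m)" n M "%j. x1 j - x2 j"] surj by blast
 thus ?thesis unfolding x f_def using restrict_ext[of "{..<n}" x1 x2] by simp
qed

text \<open>The coordinates of \<open>m\<close>-th powers are integers in a bounded range, and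
  \<open>VG_pow_inj\<close> recovers the element from its \<open>m\<close>-th power.\<close>

lemma VG_vec_finite: "finite {y : VG v. ALL i<n. abs(vec y i) <= C}"
proof -
 obtain m :: nat where m: "m >= 1" "!!y. y : VG v ==> y [^] m : A" using VG_pow_in_A[OF v] by blast
 let ?B = "{y : VG v. ALL i<n. abs(vec y i) <= C}" and ?f = "%y. \<lambda>i\<in>{..<n}. crd (y [^] m) i"
 have Vc: "y : VG v ==> y : CG" for y using subgroup.mem_carrier[OF VG_sub[OF v]] by blast
 have "?f ` ?B <= {..<n} \<rightarrow>\<^sub>E {\<lfloor>- (m * C)\<rfloor>..\<lceil>m * C\<rceil>}"
 proof (intro image_subsetI PiE_I)
  fix y i assume y: "y : ?B" and i: "i : {..<n}"
  have "real_of_int (crd (y [^] m) i) = m * vec y i" using vec_eq[OF Vc m(1) m(2), of y i] y i m(1) by simp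
  moreover have "abs(m * vec y i) <= m * C" using y i by (auto simp: abs_mult intro!: mult_left_mono)
  ultimately have "real_of_int (crd (y [^] m) i) <= m * C" "- (m * C) <= real_of_int (crd (y [^] m) i)" by linarith+
  thus "?f y i : {\<lfloor>- (m * C)\<rfloor>..\<lceil>m * C\<rceil>}" using i by (simp add: le_ceiling_iff floor_le_iff)
 qed auto
 hence "finite (?f ` ?B)" by (rule finite_subset) (simp add: finite_PiE)
 moreover have "inj_on ?f ?B"
 proof (rule inj_onI)
  fix y z assume yz: "y : ?B" "z : ?B" "?f y = ?f z"
  have "y [^] m = z [^] m"
  proof (rule crd_inj)
   fix i assume "i < n"
   thus "crd (y [^] m) i = crd (z [^] m) i" using fun_cong[OF yz(3), of i] by simp
  qed (use m yz in auto)
  thus "y = z" using VG_pow_inj[OF m] yz by auto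
 qed
 ultimately show ?thesis using finite_imageD by blast
qed

end

section \<open>Common prefixes and the tree metric on lists\<close>

fun lcp :: "'q list => 'q list => nat" where
 "lcp (x # xs) (y # ys) = (if x = y then Suc (lcp xs ys) else 0)"
| "lcp [] ys = 0"
| "lcp xs [] = 0"

lemma lcp_Nil2 [simp]: "lcp xs [] = 0" by (cases xs) auto

lemma lcp_sym: "lcp xs ys = lcp ys xs"
 by (induction xs ys rule: lcp.induct) auto

lemma lcp_le: "lcp xs ys <= length xs" "lcp xs ys <= length ys"
 by (induction xs ys rule: lcp.induct) auto

lemma lcp_self [simp]: "lcp xs xs = length xs" by (induction xs) auto

lemma lcp_ultra: "min (lcp xs ys) (lcp ys zs) <= lcp xs zs"
proof (induction xs ys arbitrary: zs rule: lcp.induct)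
 case (1 x xs y ys)
 show ?case
 proof (cases zs)
  case (Cons z zs')
  thus ?thesis using 1[of zs'] by auto
 qed simp
qed auto

lemma lcp_take: "lcp (take k xs) ys = min k (lcp xs ys)"
proof (induction xs ys arbitrary: k rule: lcp.induct)
 case (1 x xs y ys)
 show ?case by (cases k) (use 1 in auto)
qed auto

lemma lcp_full: "lcp xs ys = length xs ==> length xs = length ys ==> xs = ys"
 by (induction xs ys rule: lcp.induct) (auto split: if_splits)

text \<open>The path metric of the tree in which every nonempty list is joined to the list without
  its last entry.\<close>

definition tdist :: "'q list => 'q list => nat" where
 "tdist xs ys = length xs + length ys - 2 * lcp xs ys"

lemma tdist_int: "int (tdist xs ys) = int (length xs) + int (length ys) - 2 * int (lcp xs ys)"
 unfolding tdist_def using lcp_le[of xs ys] by linarith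

lemma tdist_Nil [simp]: "tdist [] xs = length xs" unfolding tdist_def by simp

section \<open>Normal forms for the vertices of the Bass-Serre tree\<close>

context gog_paths
begin

definition img :: "'e => 'a set" where "img e = em (rv e) ` carrier (eg e)"

lemma img_subgroup: "e : Es ==> subgroup (img e) (vs e)"
 unfolding img_def using emb_rev_mon[of e] vgg[of "src e"] egrp_group[of e]
 by (intro group_hom.img_is_subgroup group_hom.intro group_hom_axioms.intro) (auto simp: mon_def)

lemma img_rev: "e : Es ==> img (rv e) = em e ` carrier (eg e)"
 unfolding img_def by (simp add: egrp_erev)

text \<open>Coset representatives; the trivial coset is represented by the neutral element.\<close>

definition rep :: "'e => 'a => 'a" where
 "rep e b = (if b : img e then \<one>\<^bsub>vs e\<^esub>
   else SOME c. c : carrier (vs e) & inv\<^bsub>vs e\<^esub> b **\<^bsub>vs e\<^esub> c : img e)"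

definition res :: "'e => 'a => 'b" where
 "res e b = inv_into (carrier (eg e)) (em (rv e)) (inv\<^bsub>vs e\<^esub> (rep e b) **\<^bsub>vs e\<^esub> b)"

context
 fixes e assumes e: "e : Es"
begin

interpretation U: group "vs e" using vgg e by simp
interpretation I: subgroup "img e" "vs e" by (rule img_subgroup[OF e])

lemma rep_basic:
 assumes b: "b : carrier (vs e)"
 shows "rep e b : carrier (vs e)" "inv\<^bsub>vs e\<^esub> (rep e b) **\<^bsub>vs e\<^esub> b : img e"
proof -
 have "rep e b : carrier (vs e) & inv\<^bsub>vs e\<^esub> b **\<^bsub>vs e\<^esub> rep e b : img e"
 proof (cases "b : img e")
  case True
  thus ?thesis unfolding rep_def using b I.m_inv_closed by simp
 next
  case False
  have "EX c. c : carrier (vs e) & inv\<^bsub>vs e\<^esub> b **\<^bsub>vs e\<^esub> c : img e" using b I.one_closed by (intro exI[of _ b]) simp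
  thus ?thesis unfolding rep_def using False someI_ex by simp
 qed
 hence r: "rep e b : carrier (vs e)" and m: "inv\<^bsub>vs e\<^esub> b **\<^bsub>vs e\<^esub> rep e b : img e" by auto
 show "rep e b : carrier (vs e)" by (rule r)
 show "inv\<^bsub>vs e\<^esub> (rep e b) **\<^bsub>vs e\<^esub> b : img e"
  using I.m_inv_closed[OF m] b r by (simp add: U.inv_mult_group)
qed

lemma rep_res:
 assumes b: "b : carrier (vs e)"
 shows "res e b : carrier (eg e)" "b = rep e b **\<^bsub>vs e\<^esub> em (rv e) (res e b)"
proof -
 let ?d = "inv\<^bsub>vs e\<^esub> (rep e b) **\<^bsub>vs e\<^esub> b"
 have "?d : em (rv e) ` carrier (eg e)" using rep_basic(2)[OF b] unfolding img_def .
 hence "res e b : carrier (eg e)" "em (rv e) (res e b) = ?d" unfolding res_def by (auto simp: inv_into_into f_inv_into_f)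
 thus "res e b : carrier (eg e)" "b = rep e b **\<^bsub>vs e\<^esub> em (rv e) (res e b)"
  using b rep_basic(1)[OF b] by (simp_all add: U.m_assoc[symmetric])
qed

lemma rep_coset:
 assumes b: "b : carrier (vs e)" and c: "c : img e"
 shows "rep e (b **\<^bsub>vs e\<^esub> c) = rep e b"
proof -
 have cc: "c : carrier (vs e)" using c by simp
 have 1: "b **\<^bsub>vs e\<^esub> c : img e \<longleftrightarrow> b : img e"
 proof
  assume "b **\<^bsub>vs e\<^esub> c : img e"
  hence "(b **\<^bsub>vs e\<^esub> c) **\<^bsub>vs e\<^esub> inv\<^bsub>vs e\<^esub> c : img e" using c I.m_inv_closed I.m_closed by simp
  thus "b : img e" using b cc by (simp add: U.m_assoc)
 qed (use c in simp)
 have 2: "inv\<^bsub>vs e\<^esub> (b **\<^bsub>vs e\<^esub> c) **\<^bsub>vs e\<^esub> d : img e \<longleftrightarrow> inv\<^bsub>vs e\<^esub> b **\<^bsub>vs e\<^esub> d : img e"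
  if d: "d : carrier (vs e)" for d
 proof -
  have e1: "inv\<^bsub>vs e\<^esub> (b **\<^bsub>vs e\<^esub> c) **\<^bsub>vs e\<^esub> d = inv\<^bsub>vs e\<^esub> c **\<^bsub>vs e\<^esub> (inv\<^bsub>vs e\<^esub> b **\<^bsub>vs e\<^esub> d)"
   using b cc d by (simp add: U.inv_mult_group U.m_assoc)
  have e2: "inv\<^bsub>vs e\<^esub> b **\<^bsub>vs e\<^esub> d = c **\<^bsub>vs e\<^esub> (inv\<^bsub>vs e\<^esub> (b **\<^bsub>vs e\<^esub> c) **\<^bsub>vs e\<^esub> d)"
   unfolding e1 using b cc d by (simp add: U.m_assoc[symmetric])
  show ?thesis unfolding e1 using e2 I.m_closed[OF c] I.m_closed[OF I.m_inv_closed[OF c]] e1 by metis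
 qed
 show ?thesis unfolding rep_def using 1 2 by (simp cong: conj_cong)
qed

lemma rep_one_iff: assumes "b : carrier (vs e)" shows "rep e b = \<one>\<^bsub>vs e\<^esub> \<longleftrightarrow> b : img e"
 using rep_basic(2)[OF assms] assms unfolding rep_def by auto

lemma rep_rep: assumes b: "b : carrier (vs e)" shows "rep e (rep e b) = rep e b"
proof -
 have "rep e (rep e b **\<^bsub>vs e\<^esub> em (rv e) (res e b)) = rep e (rep e b)"
  by (rule rep_coset[OF rep_basic(1)[OF b]]) (use rep_res[OF b] in "auto simp: img_def")
 thus ?thesis using rep_res(2)[OF b] by simp
qed

lemma res_unique:
 assumes b: "b : carrier (vs e)" and y: "y : carrier (eg e)" "b = rep e b **\<^bsub>vs e\<^esub> em (rv e) y"
 shows "res e b = y"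
proof -
 have r: "rep e b : carrier (vs e)" by (rule rep_basic(1)[OF b])
 have e2: "em (rv e) z = inv\<^bsub>vs e\<^esub> (rep e b) **\<^bsub>vs e\<^esub> b"
  if "z : carrier (eg e)" "b = rep e b **\<^bsub>vs e\<^esub> em (rv e) z" for z
  by (rule U.inv_solve_left[THEN iffD2, OF emb_closed(2)[OF e that(1)] r b that(2)])
 have "em (rv e) (res e b) = em (rv e) y" unfolding e2[OF y] by (rule e2[OF rep_res[OF b]])
 moreover have "inj_on (em (rv e)) (carrier (eg e))" using emb_rev_mon[OF e] unfolding mon_def by blast
 ultimately show ?thesis using rep_res(1)[OF b] y(1) unfolding inj_on_def by blast
qed

text \<open>The two identities behind the action \<open>ae\<close>: the representatives carry a left
  action of the vertex group, and \<open>res\<close> is its cocycle with values in the edge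
  group.\<close>

lemma rep_mult:
 assumes b: "b : carrier (vs e)" and c: "c : carrier (vs e)"
 shows "rep e (b **\<^bsub>vs e\<^esub> rep e c) = rep e (b **\<^bsub>vs e\<^esub> c)"
  "res e (b **\<^bsub>vs e\<^esub> c) = res e (b **\<^bsub>vs e\<^esub> rep e c) **\<^bsub>eg e\<^esub> res e c"
proof -
 interpret E: group "eg e" by (rule egrp_group[OF e])
 let ?r = "rep e c" and ?i = "em (rv e) (res e c)"
 have r: "?r : carrier (vs e)" "?i : carrier (vs e)" "res e c : carrier (eg e)" "c = ?r **\<^bsub>vs e\<^esub> ?i"
  using rep_basic[OF c] rep_res[OF c] emb_closed(2)[OF e] by auto
 have bc: "b **\<^bsub>vs e\<^esub> c = (b **\<^bsub>vs e\<^esub> ?r) **\<^bsub>vs e\<^esub> ?i" using r b by (metis U.m_assoc)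
 have im: "?i : img e" using r(3) unfolding img_def by blast
 have br: "b **\<^bsub>vs e\<^esub> ?r : carrier (vs e)" using b r by simp
 show 1: "rep e (b **\<^bsub>vs e\<^esub> ?r) = rep e (b **\<^bsub>vs e\<^esub> c)" unfolding bc using rep_coset[OF br im] by simp
 let ?y = "res e (b **\<^bsub>vs e\<^esub> ?r)"
 have y: "?y : carrier (eg e)" "b **\<^bsub>vs e\<^esub> ?r = rep e (b **\<^bsub>vs e\<^esub> ?r) **\<^bsub>vs e\<^esub> em (rv e) ?y"
  using rep_res[OF br] by auto
 have h: "em (rv e) (?y **\<^bsub>eg e\<^esub> res e c) = em (rv e) ?y **\<^bsub>vs e\<^esub> ?i"
  using emb_rev_mon[OF e] y(1) r(3) unfolding mon_def hom_def by auto
 have "b **\<^bsub>vs e\<^esub> c = rep e (b **\<^bsub>vs e\<^esub> c) **\<^bsub>vs e\<^esub> (em (rv e) ?y **\<^bsub>vs e\<^esub> ?i)"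
  using bc y 1 r br rep_basic(1)[OF br] emb_closed(2)[OF e y(1)] by (metis U.m_assoc)
 thus "res e (b **\<^bsub>vs e\<^esub> c) = ?y **\<^bsub>eg e\<^esub> res e c"
  by (intro res_unique) (use b c y(1) r(3) h in auto)
qed

lemma rep_fixed_res:
 assumes "c : carrier (vs e)" "rep e c = c" shows "res e c = \<one>\<^bsub>eg e\<^esub>"
proof (rule res_unique)
 interpret E: group "eg e" by (rule egrp_group[OF e])
 show "\<one>\<^bsub>eg e\<^esub> : carrier (eg e)" by simp
 have "em (rv e) \<one>\<^bsub>eg e\<^esub> = \<one>\<^bsub>vs e\<^esub>"
  using emb_rev_mon[OF e] hom_one[of "em (rv e)" "eg e" "vs e"] U.is_group E.is_group unfolding mon_def by auto
 thus "c = rep e c **\<^bsub>vs e\<^esub> em (rv e) \<one>\<^bsub>eg e\<^esub>" using assms by simp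
qed (rule assms(1))

lemma emb_one: "em e \<one>\<^bsub>eg e\<^esub> = \<one>\<^bsub>vg (tgt e)\<^esub>"
 using emb_mon[OF e] hom_one[of "em e" "eg e" "vg (tgt e)"] vgg[of "tgt e"] egrp_group[OF e] e unfolding mon_def by auto

lemma emb_mult: "x : carrier (eg e) ==> y : carrier (eg e) ==> em e (x **\<^bsub>eg e\<^esub> y) = em e x **\<^bsub>vg (tgt e)\<^esub> em e y"
 using emb_mon[OF e] unfolding mon_def hom_def by auto

lemma rep_inj:
 assumes b: "b : carrier (vs e)" and c: "c : carrier (vs e)" "d : carrier (vs e)" "rep e c = c" "rep e d = d"
  and eq: "rep e (b **\<^bsub>vs e\<^esub> c) = rep e (b **\<^bsub>vs e\<^esub> d)"
 shows "c = d"
proof -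
 have *: "rep e (inv\<^bsub>vs e\<^esub> b **\<^bsub>vs e\<^esub> rep e (b **\<^bsub>vs e\<^esub> f)) = f" if f: "f : carrier (vs e)" "rep e f = f" for f
 proof -
  have "rep e (inv\<^bsub>vs e\<^esub> b **\<^bsub>vs e\<^esub> rep e (b **\<^bsub>vs e\<^esub> f)) = rep e (inv\<^bsub>vs e\<^esub> b **\<^bsub>vs e\<^esub> (b **\<^bsub>vs e\<^esub> f))"
   by (rule rep_mult(1)[OF U.inv_closed[OF b] U.m_closed[OF b f(1)]])
  also have "... = f" unfolding U.inv_cancel_left(1)[OF b f(1)] by (rule f(2))
  finally show ?thesis .
 qed
 show ?thesis using *[OF c(1,3)] *[OF c(2,4)] unfolding eq by (rule trans[OF sym])
qed

end

text \<open>A list \<open>[(c\<^sub>1, e\<^sub>1), \<dots>, (c\<^sub>k, e\<^sub>k)]\<close> stands for the coset of \<open>c\<^sub>1 e\<^sub>1 \<cdots> c\<^sub>k e\<^sub>k\<close>, a vertex of the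
  Bass--Serre tree; the reduced lists are the normal forms of these vertices.\<close>

definition starts :: "'e => ('a \<times> 'e) list => bool" where
 "starts e L \<longleftrightarrow> (EX L'. L = (\<one>\<^bsub>vs e\<^esub>, e) # L')"

fun red :: "'v => ('a \<times> 'e) list => bool" where
 "red u [] \<longleftrightarrow> u : Vs"
| "red u ((c, e) # L) \<longleftrightarrow> e : Es & src e = u & c : carrier (vg u) & rep e c = c & red (tgt e) L & ~ starts (rv e) L"

fun endv :: "'v => ('a \<times> 'e) list => 'v" where
 "endv u [] = u"
| "endv u ((c, e) # L) = endv (tgt e) L"

text \<open>Multiplication by \<open>b\<close> from the left: the first entry becomes a coset
  representative, and the remaining factor in the edge group is pushed through the arc into the next
  vertex group.\<close>

fun ae :: "'a => ('a \<times> 'e) list => ('a \<times> 'e) list" where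
 "ae b [] = []"
| "ae b ((c, e) # L) = (rep e (b **\<^bsub>vs e\<^esub> c), e) # ae (em e (res e (b **\<^bsub>vs e\<^esub> c))) L"

text \<open>Multiplication by the arc \<open>e\<close> from the left. It cancels against an initial
  \<open>rv e\<close> whose representative is trivial, as this is the only way in which the result
  can fail to be reduced.\<close>

definition aa :: "'e => ('a \<times> 'e) list => ('a \<times> 'e) list" where
 "aa e L = (if starts (rv e) L then tl L else (\<one>\<^bsub>vs e\<^esub>, e) # L)"

fun wrd :: "('a \<times> 'e) list => ('v, 'e, 'a) gog_letter list" where
 "wrd [] = []"
| "wrd ((c, e) # L) = [Elt (src e) c, Edge e] @ wrd L"

lemma red_verts: "red u L ==> u : Vs"
 by (cases "(u, L)" rule: red.cases) auto

lemma vg_mult: "u : Vs ==> b : carrier (vg u) ==> c : carrier (vg u) ==> b **\<^bsub>vg u\<^esub> c : carrier (vg u)"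
 using group.is_monoid[OF vgg] monoid.m_closed by metis

lemma ae_length [simp]: "length (ae b L) = length L" by (induction b L rule: ae.induct) auto
lemma ae_endv [simp]: "endv u (ae b L) = endv u L"
 by (induction b L arbitrary: u rule: ae.induct) auto

lemma starts_ae:
 assumes "red u L" "e : Es" "src e = u" "b : img e" shows "starts e (ae b L) \<longleftrightarrow> starts e L"
proof (cases L)
 case (Cons ce L')
 obtain c e' where ce: "ce = (c, e')" by (cases ce)
 interpret I: subgroup "img e" "vs e" by (rule img_subgroup[OF assms(2)])
 show ?thesis
 proof (cases "e' = e")
  case True
  hence c: "c : carrier (vs e)" "rep e c = c" using assms Cons ce by auto
  have "rep e (b **\<^bsub>vs e\<^esub> c) = \<one>\<^bsub>vs e\<^esub> \<longleftrightarrow> b **\<^bsub>vs e\<^esub> c : img e"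
   by (rule rep_one_iff[OF assms(2)]) (use vg_mult[of "src e"] assms(2) c(1) I.mem_carrier[OF assms(4)] in auto)
  also have "... \<longleftrightarrow> c : img e"
  proof
   assume "b **\<^bsub>vs e\<^esub> c : img e"
   hence "inv\<^bsub>vs e\<^esub> b **\<^bsub>vs e\<^esub> (b **\<^bsub>vs e\<^esub> c) : img e" using assms(4) I.m_inv_closed I.m_closed by simp
   thus "c : img e" using c(1) I.mem_carrier[OF assms(4)] group.inv_solve_left[OF vgg[of "src e"]] assms(2)
   by (simp add: group.inv_cancel_left[OF vgg])
  qed (use assms(4) in simp)
  also have "... \<longleftrightarrow> c = \<one>\<^bsub>vs e\<^esub>" using rep_one_iff[OF assms(2) c(1)] c(2) by simp
  finally show ?thesis using True unfolding Cons ce starts_def by simp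
 qed (use Cons ce in "auto simp: starts_def")
qed (simp add: starts_def)

lemma img_emb: "e : Es ==> y : carrier (eg e) ==> em e y : img (rv e)"
 unfolding img_rev by blast

lemma ae_step:
 assumes "e : Es" "b : carrier (vs e)" "c : carrier (vs e)"
 shows "b **\<^bsub>vs e\<^esub> c : carrier (vs e)" "res e (b **\<^bsub>vs e\<^esub> c) : carrier (eg e)"
  "em e (res e (b **\<^bsub>vs e\<^esub> c)) : carrier (vg (tgt e))"
  "rep e (b **\<^bsub>vs e\<^esub> c) : carrier (vs e)"
proof -
 show 1: "b **\<^bsub>vs e\<^esub> c : carrier (vs e)" using vg_mult assms by simp
 show 2: "res e (b **\<^bsub>vs e\<^esub> c) : carrier (eg e)" by (rule rep_res[OF assms(1) 1])
 show "em e (res e (b **\<^bsub>vs e\<^esub> c)) : carrier (vg (tgt e))" by (rule emb_closed[OF assms(1) 2])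
 show "rep e (b **\<^bsub>vs e\<^esub> c) : carrier (vs e)" by (rule rep_basic[OF assms(1) 1])
qed

lemma ae_red: "red u L ==> b : carrier (vg u) ==> red u (ae b L)"
proof (induction b L arbitrary: u rule: ae.induct)
 case (2 b c e L)
 hence e: "e : Es" "src e = u" and c: "c : carrier (vg u)" and L: "red (tgt e) L" "~ starts (rv e) L" by auto
 note st = ae_step[OF e(1), unfolded e(2), OF 2(3) c]
 have "red (tgt e) (ae (em e (res e (b **\<^bsub>vg u\<^esub> c))) L)" using 2(1)[of "tgt e"] L(1) st(3) e(2) by simp
 moreover have "~ starts (rv e) (ae (em e (res e (b **\<^bsub>vg u\<^esub> c))) L)"
  using starts_ae[OF L(1), of "rv e"] img_emb[OF e(1) st(2)] L(2) e by simp
 moreover have "rep e (rep e (b **\<^bsub>vg u\<^esub> c)) = rep e (b **\<^bsub>vg u\<^esub> c)" using rep_rep[OF e(1)] st(1) e(2) by simp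
 ultimately show ?case using e st by simp
qed simp

lemma ae_mult: "red u L ==> b : carrier (vg u) ==> d : carrier (vg u) ==> ae d (ae b L) = ae (d **\<^bsub>vg u\<^esub> b) L"
proof (induction b L arbitrary: u d rule: ae.induct)
 case (2 b c e L)
 hence e: "e : Es" "src e = u" and c: "c : carrier (vg u)" and L: "red (tgt e) L" by auto
 interpret U: group "vg u" by (rule vgg) (use e in auto)
 note st = ae_step[OF e(1), unfolded e(2), OF 2(3) c]
 note st2 = ae_step[OF e(1), unfolded e(2), OF 2(4) st(4)]
 note rm = rep_mult[OF e(1), unfolded e(2), OF 2(4) st(1)]
 have as: "(d **\<^bsub>vg u\<^esub> b) **\<^bsub>vg u\<^esub> c = d **\<^bsub>vg u\<^esub> (b **\<^bsub>vg u\<^esub> c)" by (rule U.m_assoc[OF 2(4,3) c])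
 have "ae (em e (res e (d **\<^bsub>vg u\<^esub> rep e (b **\<^bsub>vg u\<^esub> c)))) (ae (em e (res e (b **\<^bsub>vg u\<^esub> c))) L) =
  ae (em e (res e (d **\<^bsub>vg u\<^esub> (b **\<^bsub>vg u\<^esub> c)))) L"
  using 2(1)[OF _ _ st2(3), unfolded e(2)] L st(3) emb_mult[OF e(1) st2(2) st(2)] rm(2) by simp
 thus ?case using e(2) rm(1) as by simp
qed simp

lemma ae_one: "red u L ==> ae \<one>\<^bsub>vg u\<^esub> L = L"
proof (induction u L rule: red.induct)
 case (2 u c e L)
 hence e: "e : Es" "src e = u" and c: "c : carrier (vg u)" "rep e c = c" and L: "red (tgt e) L" by auto
 interpret U: group "vg u" by (rule vgg) (use e in auto)
 have "res e c = \<one>\<^bsub>eg e\<^esub>" using rep_fixed_res[OF e(1)] c e(2) by simp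
 thus ?case using 2(1)[OF L] e c emb_one[OF e(1)] by simp
qed simp

text \<open>Equal first entries pass the same factor on to the rest, and distinct ones stay distinct
  by \<open>rep_inj\<close>. Thus vertex groups act by isometries.\<close>

lemma ae_lcp:
 "red u L ==> red u M ==> b : carrier (vg u) ==> lcp (ae b L) (ae b M) = lcp L M"
proof (induction b L arbitrary: u M rule: ae.induct)
 case (2 b c e L)
 hence e: "e : Es" "src e = u" and c: "c : carrier (vg u)" "rep e c = c" and L: "red (tgt e) L" by auto
 note st = ae_step[OF e(1), unfolded e(2), OF 2(4) c(1)]
 show ?case
 proof (cases M)
  case (Cons dm M')
  obtain d e' where dm: "dm = (d, e')" by (cases dm)
  show ?thesis
  proof (cases "(c, e) = (d, e')")
   case True
   thus ?thesis using 2(1)[of "tgt e" M'] 2(3) L st(3) e unfolding Cons dm by simp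
  next
   case False
   have "rep e (b **\<^bsub>vg u\<^esub> c) ~= rep e (b **\<^bsub>vg u\<^esub> d)" if "e = e'"
   using rep_inj[OF e(1), of b c d] 2(3,4) c e False that unfolding Cons dm by auto
   thus ?thesis using False e 2(3) unfolding Cons dm by auto
  qed
 qed simp
qed simp

lemma aa_red:
 assumes "e : Es" "red (tgt e) L"
 shows "red (src e) (aa e L)" "endv (src e) (aa e L) = endv (tgt e) L"
proof -
 interpret U: group "vs e" using vgg[of "src e"] assms by simp
 interpret I: subgroup "img e" "vs e" by (rule img_subgroup[OF assms(1)])
 have "rep e \<one>\<^bsub>vs e\<^esub> = \<one>\<^bsub>vs e\<^esub>" unfolding rep_def by (rule if_P[OF I.one_closed])
 thus "red (src e) (aa e L)" "endv (src e) (aa e L) = endv (tgt e) L"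
  using assms unfolding aa_def by (auto simp: starts_def)
qed

lemma aa_rev:
 assumes "e : Es" "red (tgt e) L" shows "aa (rv e) (aa e L) = L"
proof (cases "starts (rv e) L")
 case True
 then obtain L' where L': "L = (\<one>\<^bsub>vg (src (rv e))\<^esub>, rv e) # L'" unfolding starts_def by blast
 hence "~ starts e L'" using assms by simp
 thus ?thesis using True L' assms(1) unfolding aa_def by simp
next
 case False
 thus ?thesis using assms(1) unfolding aa_def by (simp add: starts_def)
qed

text \<open>An arc puts its own entry in front or removes that of its reverse. If this is the same
  for both lists, the common prefix changes accordingly; if one list grows and the other shrinks,
  there is no common prefix before or after.\<close>

lemma aa_tdist:
 assumes "e : Es" "red (tgt e) L" "red (tgt e) M" shows "tdist (aa e L) (aa e M) = tdist L M"
proof -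
 let ?o = "(\<one>\<^bsub>vg (src (rv e))\<^esub>, rv e)" and ?o' = "(\<one>\<^bsub>vs e\<^esub>, e)"
 have d: "lcp L' (?o' # M) = 0" if "red (tgt e) (?o # L')" for L' M :: "('a \<times> 'e) list"
 proof -
  have "~ starts e L'" using that assms(1) by simp
  thus ?thesis unfolding starts_def by (cases L') auto
 qed
 have d2: "lcp (?o # L') M = 0" if "~ starts (rv e) M" for L' M
  using that unfolding starts_def by (cases M) auto
 have "int (tdist (aa e L) (aa e M)) = int (tdist L M)"
 proof (cases "starts (rv e) L"; cases "starts (rv e) M")
  assume a: "starts (rv e) L" "starts (rv e) M"
  then obtain L' M' where "L = ?o # L'" "M = ?o # M'" unfolding starts_def by blast
  thus ?thesis using a unfolding aa_def tdist_int by simp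
 next
  assume a: "starts (rv e) L" "~ starts (rv e) M"
  then obtain L' where L: "L = ?o # L'" unfolding starts_def by blast
  thus ?thesis using a d[OF assms(2)[unfolded L], of M] d2[OF a(2), of L'] assms(1) unfolding aa_def tdist_int by simp
 next
  assume a: "~ starts (rv e) L" "starts (rv e) M"
  then obtain M' where M: "M = ?o # M'" unfolding starts_def by blast
  thus ?thesis using a d[OF assms(3)[unfolded M], of L] d2[OF a(1), of M'] lcp_sym[of M' "?o' # L"] lcp_sym[of "?o # M'" L] assms(1)
   unfolding aa_def tdist_int by simp
 next
  assume a: "~ starts (rv e) L" "~ starts (rv e) M"
  thus ?thesis unfolding aa_def tdist_int by simp
 qed
 thus ?thesis by simp
qed

lemma aa_conj:
 assumes "e : Es" "y : carrier (eg e)" "red (src e) L"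
 shows "aa e (ae (em e y) (aa (rv e) L)) = ae (em (rv e) y) L"
proof -
 interpret U: group "vs e" using vgg[of "src e"] assms by simp
 interpret W: group "vg (tgt e)" using vgg[of "tgt e"] assms by simp
 have c: "em e y : carrier (vg (tgt e))" "em (rv e) y : carrier (vs e)" using emb_closed assms by auto
 have i: "em (rv e) y : img e" "em e y : img (rv e)" using assms img_emb unfolding img_def by auto
 have r1: "rep e (em (rv e) y) = \<one>\<^bsub>vs e\<^esub>" using rep_one_iff[OF assms(1) c(2)] i by simp
 have s1: "res e (em (rv e) y) = y" by (rule res_unique[OF assms(1) c(2) assms(2)]) (use r1 c in simp)
 show ?thesis
 proof (cases "starts e L")
  case True
  then obtain L' where L: "L = (\<one>\<^bsub>vs e\<^esub>, e) # L'" unfolding starts_def by blast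
  have L': "red (tgt e) L'" "~ starts (rv e) L'" using assms(3) L by auto
  have "aa (rv e) L = L'" using True L assms(1) unfolding aa_def by simp
  moreover have "~ starts (rv e) (ae (em e y) L')" using starts_ae[OF L'(1), of "rv e"] i(2) L'(2) assms(1) by simp
  ultimately show ?thesis unfolding L using r1 s1 c by (simp add: aa_def)
 next
  case False
  have e': "rv e : Es" using assms(1) by simp
  have r2: "rep (rv e) (em e y) = \<one>\<^bsub>vg (tgt e)\<^esub>" using rep_one_iff[OF e'] i(2) c(1) assms(1) by simp
  have s2: "res (rv e) (em e y) = y" by (rule res_unique[OF e']) (use r2 c assms egrp_erev in auto)
  have "aa (rv e) L = (\<one>\<^bsub>vg (tgt e)\<^esub>, rv e) # L" using False assms(1) unfolding aa_def by simp
  thus ?thesis using r2 s2 c assms(1) unfolding aa_def by (simp add: starts_def)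
 qed
qed

primrec valid :: "('v, 'e, 'a) gog_letter => bool" where
 "valid (Elt u b) \<longleftrightarrow> u : Vs & b : carrier (vg u)"
| "valid (Edge e) \<longleftrightarrow> e : Es"

text \<open>Letters act by permutations on the disjoint union of the trees of normal forms starting at the various vertices:
  a vertex group acts trivially on the trees starting elsewhere, and an arc swaps the trees at its two ends if these differ.\<close>

fun lact :: "('v, 'e, 'a) gog_letter => 'v \<times> ('a \<times> 'e) list => 'v \<times> ('a \<times> 'e) list" where
 "lact (Elt u b) (w, L) = (w, if w = u & valid (Elt u b) then ae b L else L)"
| "lact (Edge e) (w, L) = (if e ~: Es then (w, L) else if w = tgt e then (src e, aa e L)
   else if w = src e then (tgt e, aa (rv e) L) else (w, L))"

definition wact :: "('v, 'e, 'a) gog_letter list => 'v \<times> ('a \<times> 'e) list => 'v \<times> ('a \<times> 'e) list" where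
 "wact p z = foldr lact p z"

lemma wact_simps [simp]: "wact [] z = z" "wact (l # p) z = lact l (wact p z)" "wact (p @ q) z = wact p (wact q z)"
 unfolding wact_def by auto

lemma lact_red: "red (fst z) (snd z) ==> red (fst (lact l z)) (snd (lact l z))"
 using aa_red[of _ "snd z"] aa_red[of "rv _" "snd z"] ae_red[of "fst z" "snd z"]
 by (cases z; cases l) (auto split: if_splits, (metis head_arev tail_arev arev_in_arcs aa_red(1))+)

lemma wact_red: "red (fst z) (snd z) ==> red (fst (wact p z)) (snd (wact p z))"
 by (induction p) (auto intro: lact_red)

text \<open>The path group is given by relations, so that two of its elements differ can be seen
  only through an action. This one makes the normal forms distinguishable.\<close>

lemma wact_gog_eq: "geq p q ==> red (fst z) (snd z) ==> wact p z = wact q z"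
proof (induction arbitrary: z rule: gog_eq.induct)
 case (eq_cong p q l r)
 thus ?case using wact_red by simp
next
 case (vertex_mult u b c)
 thus ?case using ae_mult[of u "snd z" c b] vg_mult[of u b c] by (cases z) auto
next
 case (vertex_one u)
 have "\<one>\<^bsub>vg u\<^esub> : carrier (vg u)" using group.is_monoid[OF vgg[OF vertex_one(1)]] monoid.one_closed by blast
 thus ?case using ae_one[of u "snd z"] vertex_one by (cases z) auto
next
 case (edge_inv e)
 obtain w L where z: "z = (w, L)" by (cases z)
 thus ?case using edge_inv aa_rev[of e L] aa_rev[of "rv e" L] by auto
next
 case (edge_conj e c)
 obtain w L where z: "z = (w, L)" by (cases z)
 have c: "em e c : carrier (vg (tgt e))" "em (rv e) c : carrier (vs e)" using emb_closed edge_conj by auto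
 show ?case
 proof (cases "w = src e")
  case True
  thus ?thesis using aa_conj[OF edge_conj(1,2), of L] edge_conj c unfolding z by simp
 next
  case False
  thus ?thesis using aa_rev[of e L] edge_conj c unfolding z by auto
 qed
qed auto

lemma wact_path_fst: "gpa u p w ==> fst (wact p (w, L)) = u"
proof (induction rule: gog_path.induct)
 case (path_Elt u b p w)
 thus ?case by (cases "wact p (w, L)") auto
next
 case (path_Edge e p w)
 thus ?case by (cases "wact p (w, L)") auto
qed auto

lemma wact_path_tdist:
 "gpa u p w ==> red w L ==> red w M ==> tdist (snd (wact p (w, L))) (snd (wact p (w, M))) = tdist L M"
proof (induction rule: gog_path.induct)
 case (path_Elt u b p w)
 obtain L' M' where LM: "wact p (w, L) = (u, L')" "wact p (w, M) = (u, M')"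
  using wact_path_fst[OF path_Elt(3)] by (metis prod.collapse)
 have "red u L'" "red u M'" using wact_red[of "(w, L)" p] wact_red[of "(w, M)" p] LM path_Elt by auto
 thus ?case using path_Elt LM ae_lcp[of u L' M' b] by (simp add: tdist_def)
next
 case (path_Edge e p w)
 obtain L' M' where LM: "wact p (w, L) = (tgt e, L')" "wact p (w, M) = (tgt e, M')"
  using wact_path_fst[OF path_Edge(2)] by (metis prod.collapse)
 have "red (tgt e) L'" "red (tgt e) M'" using wact_red[of "(w, L)" p] wact_red[of "(w, M)" p] LM path_Edge by auto
 thus ?case using path_Edge LM aa_tdist[of e L' M'] by simp
qed auto

lemma wrd_path: "red u L ==> gpa u (wrd L) (endv u L)"
proof (induction u L rule: red.induct)
 case (1 u)
 thus ?case by (simp add: gog_path.path_Nil)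
next
 case (2 u c e L)
 hence "gpa (src e) (Elt (src e) c # Edge e # wrd L) (endv (tgt e) L)"
  by (intro gog_path.path_Elt gog_path.path_Edge) auto
 thus ?case using 2 by simp
qed

lemma wrd_wact: "red u L ==> wact (wrd L) (endv u L, []) = (u, L)"
proof (induction u L rule: red.induct)
 case (2 u c e L)
 hence e: "e : Es" "src e = u" and c: "c : carrier (vg u)" "rep e c = c" and L: "red (tgt e) L" "~ starts (rv e) L" by auto
 interpret U: group "vg u" by (rule vgg) (use e in auto)
 have "res e c = \<one>\<^bsub>eg e\<^esub>" using rep_fixed_res[OF e(1)] c e(2) by simp
 hence "ae c ((\<one>\<^bsub>vg u\<^esub>, e) # L) = (c, e) # L" using e c ae_one[OF L(1)] emb_one[OF e(1)] by simp
 thus ?case using 2(1)[OF L(1)] e c L(2) by (simp add: aa_def) (use e in auto)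
qed simp

lemma edge_swap:
 assumes "e : Es" "y : carrier (eg e)"
 shows "geq [Elt (src e) (em (rv e) y), Edge e] [Edge e, Elt (tgt e) (em e y)]"
proof -
 have 1: "geq ([] @ [Edge e, Elt (tgt e) (em e y), Edge (rv e)] @ [Edge e]) ([] @ [Elt (src e) (em (rv e) y)] @ [Edge e])"
  by (rule eq_cong[OF edge_conj[OF assms]])
 have "geq [Edge (rv e), Edge (rv (rv e))] []" by (rule edge_inv) (use assms in simp)
 hence "geq ([Edge e, Elt (tgt e) (em e y)] @ [Edge (rv e), Edge (rv (rv e))] @ []) ([Edge e, Elt (tgt e) (em e y)] @ [] @ [])"
  by (rule eq_cong)
 thus ?thesis using eq_trans[OF eq_sym[OF 1]] by simp
qed

lemma ae_normal_form:
 "red u L ==> b : carrier (vg u) ==>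
  EX d:carrier (vg (endv u L)). geq (Elt u b # wrd L) (wrd (ae b L) @ [Elt (endv u L) d])"
proof (induction b L arbitrary: u rule: ae.induct)
 case (1 b)
 thus ?case using eq_refl by auto
next
 case (2 b c e L)
 hence e: "e : Es" "src e = u" and c: "c : carrier (vg u)" and L: "red (tgt e) L" by auto
 have u: "u : Vs" using e by auto
 note st = ae_step[OF e(1), unfolded e(2), OF 2(3) c]
 let ?bc = "b **\<^bsub>vg u\<^esub> c"
 let ?r = "rep e ?bc" and ?y = "res e ?bc"
 obtain d where d: "d : carrier (vg (endv (tgt e) L))"
  "geq (Elt (tgt e) (em e ?y) # wrd L) (wrd (ae (em e ?y) L) @ [Elt (endv (tgt e) L) d])"
  using 2(1)[OF L] st(3) e(2) by auto
 have bc: "?bc = ?r **\<^bsub>vg u\<^esub> em (rv e) ?y" using rep_res(2)[OF e(1)] st(1) e(2) by simp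
 have "geq ([] @ [Elt u b, Elt u c] @ (Edge e # wrd L)) ([] @ [Elt u ?bc] @ (Edge e # wrd L))"
  by (rule eq_cong[OF vertex_mult[OF u 2(3) c]])
 moreover have "geq ([] @ [Elt u ?r, Elt u (em (rv e) ?y)] @ (Edge e # wrd L)) ([] @ [Elt u (?r **\<^bsub>vg u\<^esub> em (rv e) ?y)] @ (Edge e # wrd L))"
  by (rule eq_cong[OF vertex_mult[OF u st(4)]]) (use emb_closed(2)[OF e(1) st(2)] e(2) in simp)
 moreover have "geq ([Elt u ?r] @ [Elt u (em (rv e) ?y), Edge e] @ wrd L) ([Elt u ?r] @ [Edge e, Elt (tgt e) (em e ?y)] @ wrd L)"
  using eq_cong[OF edge_swap[OF e(1) st(2)]] e(2) by blast
 moreover have "geq ([Elt u ?r, Edge e] @ (Elt (tgt e) (em e ?y) # wrd L) @ []) ([Elt u ?r, Edge e] @ (wrd (ae (em e ?y) L) @ [Elt (endv (tgt e) L) d]) @ [])"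
  by (rule eq_cong[OF d(2)])
 ultimately have "geq (Elt u b # Elt u c # Edge e # wrd L) (Elt u ?r # Edge e # wrd (ae (em e ?y) L) @ [Elt (endv (tgt e) L) d])"
  unfolding bc[symmetric] append_Cons append_Nil append_Nil2 using eq_trans eq_sym by meson
 thus ?case using d(1) e(2) by auto
qed

lemma aa_normal_form:
 assumes "e : Es" "red (tgt e) L"
 shows "geq (Edge e # wrd L) (wrd (aa e L))"
proof (cases "starts (rv e) L")
 case True
 then obtain L' where L: "L = (\<one>\<^bsub>vg (src (rv e))\<^esub>, rv e) # L'" unfolding starts_def by blast
 have "geq ([Edge e] @ [Elt (tgt e) \<one>\<^bsub>vg (tgt e)\<^esub>] @ (Edge (rv e) # wrd L')) ([Edge e] @ [] @ (Edge (rv e) # wrd L'))"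
  by (rule eq_cong[OF vertex_one]) (use assms in simp)
 moreover have "geq ([] @ [Edge e, Edge (rv e)] @ wrd L') ([] @ [] @ wrd L')" by (rule eq_cong[OF edge_inv[OF assms(1)]])
 ultimately show ?thesis using True assms(1) eq_trans unfolding L aa_def by fastforce
next
 case False
 have "geq ([] @ [Elt (src e) \<one>\<^bsub>vs e\<^esub>] @ (Edge e # wrd L)) ([] @ [] @ (Edge e # wrd L))"
  by (rule eq_cong[OF vertex_one]) (use assms in simp)
 thus ?thesis using False eq_sym unfolding aa_def by simp
qed

text \<open>A path agrees with the word of its normal form up to an element of the last vertex
  group. For a loop that fixes the root only this element remains, which identifies the stabilizer
  of the root.\<close>

lemma path_normal_form:
 "gpa u p w ==>
  EX d:carrier (vg w). endv u (snd (wact p (w, []))) = w & geq p (wrd (snd (wact p (w, []))) @ [Elt w d])"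
proof (induction rule: gog_path.induct)
 case (path_Nil u)
 hence "\<one>\<^bsub>vg u\<^esub> : carrier (vg u)" using group.is_monoid[OF vgg] monoid.one_closed by metis
 thus ?case using eq_sym[OF vertex_one[OF path_Nil]] by auto
next
 case (path_Elt u b p w)
 obtain L where L: "wact p (w, []) = (u, L)" using wact_path_fst[OF path_Elt(3)] by (metis prod.collapse)
 have rL: "red u L" using wact_red[of "(w, [])" p] L path_verts[OF path_Elt(3)] by simp
 obtain d where d: "d : carrier (vg w)" "endv u L = w" "geq p (wrd L @ [Elt w d])" using path_Elt.IH L by auto
 obtain d' where d': "d' : carrier (vg w)" "geq (Elt u b # wrd L) (wrd (ae b L) @ [Elt w d'])"
  using ae_normal_form[OF rL path_Elt(2)] d(2) by auto
 have w: "w : Vs" using path_verts[OF path_Elt(3)] by simp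
 have "geq ([Elt u b] @ p @ []) ([Elt u b] @ (wrd L @ [Elt w d]) @ [])" by (rule eq_cong[OF d(3)])
 moreover have "geq ([] @ (Elt u b # wrd L) @ [Elt w d]) ([] @ (wrd (ae b L) @ [Elt w d']) @ [Elt w d])" by (rule eq_cong[OF d'(2)])
 moreover have "geq (wrd (ae b L) @ [Elt w d', Elt w d] @ []) (wrd (ae b L) @ [Elt w (d' **\<^bsub>vg w\<^esub> d)] @ [])"
  by (rule eq_cong[OF vertex_mult[OF w d'(1) d(1)]])
 ultimately have "geq (Elt u b # p) (wrd (ae b L) @ [Elt w (d' **\<^bsub>vg w\<^esub> d)])"
  unfolding append_Cons append_Nil append_Nil2 append_assoc using eq_trans by meson
 thus ?case using vg_mult[OF w d'(1) d(1)] L path_Elt(1,2) d(2) by auto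
next
 case (path_Edge e p w)
 obtain L where L: "wact p (w, []) = (tgt e, L)" using wact_path_fst[OF path_Edge(2)] by (metis prod.collapse)
 have rL: "red (tgt e) L" using wact_red[of "(w, [])" p] L path_verts[OF path_Edge(2)] by simp
 obtain d where d: "d : carrier (vg w)" "endv (tgt e) L = w" "geq p (wrd L @ [Elt w d])" using path_Edge.IH L by auto
 have "geq ([Edge e] @ p @ []) ([Edge e] @ (wrd L @ [Elt w d]) @ [])" by (rule eq_cong[OF d(3)])
 moreover have "geq ([] @ (Edge e # wrd L) @ [Elt w d]) ([] @ wrd (aa e L) @ [Elt w d])"
  by (rule eq_cong[OF aa_normal_form[OF path_Edge(1) rL]])
 ultimately have "geq (Edge e # p) (wrd (aa e L) @ [Elt w d])"
  unfolding append_Cons append_Nil append_Nil2 append_assoc using eq_trans by meson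
 thus ?case using d(1,2) L path_Edge(1) aa_red(2)[OF path_Edge(1) rL] by auto
qed

end

section \<open>Geodesic spaces with the exact four-point inequality\<close>

definition four_point :: "'p set => ('p => 'p => real) => bool" where
 "four_point M d \<longleftrightarrow> (ALL x:M. ALL y:M. ALL z:M. ALL w:M. d x y + d z w <= max (d x z + d y w) (d x w + d y z))"

text \<open>Triangles are tripods: two points on two sides, at equal distance from the common vertex
  and not beyond the Gromov product, coincide (\<open>half\<close>). Each point of a side is in this
  range for one of the two ends of the side.\<close>

lemma four_point_hyperbolic:
 assumes geo: "geodesic_space M d" and four: "four_point M d"
 shows "hyperbolic_space 0 M d"
proof -
 interpret Metric_space M d using geo unfolding geodesic_space_def by blast
 have half: "d p q <= 0" if M: "x : M" "y : M" "z : M" "p : M" "q : M" and p: "d x p = s" "d p y = d x y - s" and q: "d x q = s" "d q z = d x z - s"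
  and s: "2 * s <= d x y + d x z - d y z" for x y z p q s
 proof -
  have f: "d x' y' + d z' w <= max (d x' z' + d y' w) (d x' w + d y' z')" if "x' : M" "y' : M" "z' : M" "w : M" for x' y' z' w
   using four that unfolding four_point_def by blast
  show ?thesis using f[of p q x y] f[of q y x z] M p q s commute[of p x] commute[of q x] commute[of y x] commute[of q y] commute[of y z] by linarith
 qed
 have "EX q:S2 \<union> S3. d p q <= 0"
  if S: "geodesic_segment M d x y S1" "geodesic_segment M d y z S2" "geodesic_segment M d x z S3" and p: "p : S1" for x y z S1 S2 S3 p
 proof -
  obtain L1 c1 where c1: "L1 >= 0" "c1 : {0..L1} \<rightarrow> M" "c1 0 = x" "c1 L1 = y" "S1 = c1 ` {0..L1}" "!!s t. s : {0..L1} ==> t : {0..L1} ==> d (c1 s) (c1 t) = abs(s - t)"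
   using S(1) unfolding geodesic_segment_def by blast
  obtain L2 c2 where c2: "L2 >= 0" "c2 : {0..L2} \<rightarrow> M" "c2 0 = y" "c2 L2 = z" "S2 = c2 ` {0..L2}" "!!s t. s : {0..L2} ==> t : {0..L2} ==> d (c2 s) (c2 t) = abs(s - t)"
   using S(2) unfolding geodesic_segment_def by blast
  obtain L3 c3 where c3: "L3 >= 0" "c3 : {0..L3} \<rightarrow> M" "c3 0 = x" "c3 L3 = z" "S3 = c3 ` {0..L3}" "!!s t. s : {0..L3} ==> t : {0..L3} ==> d (c3 s) (c3 t) = abs(s - t)"
   using S(3) unfolding geodesic_segment_def by blast
  have L: "d x y = L1" "d y z = L2" "d x z = L3" using c1(6)[of 0 L1] c2(6)[of 0 L2] c3(6)[of 0 L3] c1 c2 c3 by auto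
  have M: "x : M" "y : M" "z : M" using c1(1,2,3) c2(1-4) by (auto simp: Pi_iff)
  obtain s where s: "0 <= s" "s <= L1" "p = c1 s" using p c1(5) by auto
  have pM: "p : M" using s c1(2) by auto
  have dp: "d x p = s" "d p y = L1 - s" using c1(6)[of 0 s] c1(6)[of s L1] s c1(3,4) by auto
  have tri: "L3 <= L1 + L2" "L2 <= L1 + L3" "L1 <= L2 + L3"
   using triangle[OF M] triangle[OF M(2,1,3)] triangle[OF M(1,3,2)] L commute[of y x] commute[of z y] by linarith+
  show ?thesis
  proof (cases "2 * s <= L1 + L3 - L2")
   case True
   hence s3: "s : {0..L3}" using s tri by auto
   have q: "c3 s : M" "d x (c3 s) = s" "d (c3 s) z = L3 - s" using c3(2) s3 c3(6)[of 0 s] c3(6)[of s L3] c3(1,3,4) by auto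
   have "d p (c3 s) <= 0" by (rule half[OF M pM q(1) dp(1)]) (use dp q L True in auto)
   thus ?thesis using c3(5) s3 by blast
  next
   case False
   let ?s = "L1 - s"
   have s2: "?s : {0..L2}" using s tri False by auto
   have q: "c2 ?s : M" "d y (c2 ?s) = ?s" "d (c2 ?s) z = L2 - ?s" using c2(2) s2 c2(6)[of 0 ?s] c2(6)[of ?s L2] c2(1,3,4) by auto
   have "d p (c2 ?s) <= 0"
   by (rule half[OF M(2,1,3) pM q(1), of ?s]) (use dp q L False commute[of y x] commute[of y p] commute[of p x] in auto)
   thus ?thesis using c2(5) s2 by blast
  qed
 qed
 thus ?thesis unfolding hyperbolic_space_def using geo by blast
qed

text \<open>Moves a space along an injection; in this way the tree and the lines come to lie in one
  type of points.\<close>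

lemma geodesic_transport:
 assumes i: "!!x. x : M ==> h (f x) = x" and geo: "geodesic_space M d"
 shows "geodesic_space (f ` M) (%p q. d (h p) (h q))"
proof -
 interpret Metric_space M d using geo unfolding geodesic_space_def by blast
 have "Metric_space (f ` M) (%p q. d (h p) (h q))"
 proof
  fix x y z assume "x : f ` M" "y : f ` M"
  thus "d (h x) (h y) = 0 \<longleftrightarrow> x = y" using i by auto
  assume "z : f ` M"
  with \<open>x : f ` M\<close> \<open>y : f ` M\<close>
  show "d (h x) (h z) <= d (h x) (h y) + d (h y) (h z)"
   using i triangle by auto
 qed (simp_all add: commute)
 moreover have "EX S. geodesic_segment (f ` M) (%p q. d (h p) (h q)) (f x) (f y) S" if xy: "x : M" "y : M" for x y
 proof -
  obtain L c where c: "L >= 0" "c : {0..L} \<rightarrow> M" "c 0 = x" "c L = y" "ALL s:{0..L}. ALL t:{0..L}. d (c s) (c t) = abs(s - t)"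
   using geo xy unfolding geodesic_space_def geodesic_segment_def by blast
  thus ?thesis unfolding geodesic_segment_def
   by (intro exI[of _ "(%s. f (c s)) ` {0..L}"] exI[of _ L] conjI exI[of _ "%s. f (c s)"]) (auto simp: Pi_iff i)
 qed
 ultimately show ?thesis unfolding geodesic_space_def by auto
qed

lemma hyperbolic_transport:
 assumes i: "!!x. x : M ==> h (f x) = x" and geo: "geodesic_space M d" and four: "four_point M d"
 shows "hyperbolic_space 0 (f ` M) (%p q. d (h p) (h q))"
proof (rule four_point_hyperbolic)
 show "geodesic_space (f ` M) (%p q. d (h p) (h q))" by (rule geodesic_transport[OF _ geo]) (rule i)
 show "four_point (f ` M) (%p q. d (h p) (h q))"
  using four i unfolding four_point_def by auto
qed

lemma line_geodesic: "geodesic_space (UNIV :: real set) (%x y. abs(x - y))"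
proof -
 have "EX S. geodesic_segment UNIV (%x y. abs(x - y)) x y S" for x y :: real
  unfolding geodesic_segment_def
  by (rule exI[of _ "(%t. if x <= y then x + t else x - t) ` {0..\<bar>x - y\<bar>}"], rule exI[of _ "abs(x - y)"], intro conjI,
   simp, rule exI[of _ "%t. if x <= y then x + t else x - t"]) auto
 thus ?thesis unfolding geodesic_space_def by (auto intro!: Metric_space.intro)
qed

lemma line_four_point: "four_point M (%x y::real. abs(x - y))"
 unfolding four_point_def max_def by (auto simp: abs_if)

lemma point_geodesic: "geodesic_space {c} (%x y::real. abs(x - y))"
proof -
 have "geodesic_segment {c} (%x y. abs(x - y)) c c {c}"
  unfolding geodesic_segment_def by (rule exI[of _ 0], simp, rule exI[of _ "%_. c"]) auto
 thus ?thesis unfolding geodesic_space_def by (auto intro!: Metric_space.intro)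
qed

section \<open>The real tree spanned by a set of lists\<close>

text \<open>The real tree spanned by a prefix-closed set of lists. The pair \<open>(w, t)\<close> is the point at distance \<open>t\<close> below \<open>w\<close>,
  hence of height \<open>|w| - t\<close>; the Gromov product at the root of two points is the minimum of their heights and
  of the length of their common prefix.\<close>

type_synonym 'q tpoint = "'q list \<times> real"

definition ht :: "'q tpoint => real" where "ht p = real (length (fst p)) - snd p"
definition gp :: "'q tpoint => 'q tpoint => real" where "gp p q = min (real (lcp (fst p) (fst q))) (min (ht p) (ht q))"
definition td :: "'q tpoint => 'q tpoint => real" where "td p q = ht p + ht q - 2 * gp p q"

locale vertex_tree =
 fixes Om :: "'q list set"
 assumes nil: "[] : Om" and take_closed: "w : Om ==> take k w : Om"
begin

text \<open>The condition \<open>t < 1\<close> and the exception at the root make the representation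
  of a point unique.\<close>

definition pts :: "'q tpoint set" where "pts = {(w, t). w : Om & 0 <= t & t < 1 & (w = [] --> t = 0)}"

lemma gp_sym: "gp p q = gp q p" unfolding gp_def using lcp_sym[of "fst p"] by auto

lemma ht_nonneg: assumes "p : pts" shows "0 <= ht p"
proof (cases "fst p = []")
 case False
 hence "1 <= real (length (fst p))" by (cases "fst p") auto
 thus ?thesis using assms unfolding ht_def pts_def by auto
qed (use assms in "auto simp: ht_def pts_def")

lemma gp_self: "p : pts ==> gp p p = ht p" unfolding gp_def ht_def pts_def by auto

lemma gp_ultra: "min (gp x y) (gp y z) <= gp x z"
 using lcp_ultra[of "fst x" "fst y" "fst z"] unfolding gp_def by (auto simp: min_def split: if_splits)

lemma gp_le: "gp p q <= ht p" "gp p q <= ht q" unfolding gp_def by auto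

lemma td_nonneg: "0 <= td p q" unfolding td_def using gp_le[of p q] by linarith
lemma td_sym: "td p q = td q p" unfolding td_def using gp_sym[of p q] by simp

lemma td_triangle: "td x z <= td x y + td y z"
 unfolding td_def using gp_ultra[of x y z] gp_le[of x y] gp_le[of y z] unfolding min_le_iff_disj by linarith

lemma td_zero: assumes "p : pts" "q : pts" "td p q = 0" shows "p = q"
proof -
 let ?l = "real (lcp (fst p) (fst q))"
 have e: "ht p = gp p q" "ht q = gp p q" using assms(3) gp_le[of p q] unfolding td_def by linarith+
 have "gp p q <= ?l" unfolding gp_def by simp
 hence "ht p <= ?l" "ht q <= ?l" using e by linarith+
 moreover have "snd p < 1" "snd q < 1" using assms(1,2) unfolding pts_def by auto
 ultimately have "real (length (fst p)) < ?l + 1" "real (length (fst q)) < ?l + 1" unfolding ht_def by linarith+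
 hence "length (fst p) = lcp (fst p) (fst q)" "length (fst q) = lcp (fst p) (fst q)" using lcp_le[of "fst p" "fst q"] by linarith+
 hence w: "fst p = fst q" by (intro lcp_full) simp_all
 have "ht p = ht q" using e by linarith
 hence "snd p = snd q" using w unfolding ht_def by simp
 thus ?thesis using w by (simp add: prod_eq_iff)
qed

lemma td_metric: "Metric_space pts td"
proof (rule Metric_space.intro)
 fix x y assume "x : pts" "y : pts"
 moreover have "td x x = 0" if "x : pts" unfolding td_def gp_self[OF that] by simp
 ultimately show "td x y = 0 \<longleftrightarrow> x = y" using td_zero by blast
qed (rule td_nonneg td_sym td_triangle)+

lemma td_four_point: "four_point pts td"
proof -
 have r: "a + b >= c + e | a + b >= f + g"
  if "c <= a | g <= a" "f <= a | e <= a" "c <= b | f <= b" "g <= b | e <= b" for a b c e f g :: real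
  using that by linarith
 have "td x y + td z w <= max (td x z + td y w) (td x w + td y z)" for x y z w
 proof -
  have "gp x z <= gp x y | gp y z <= gp x y" "gp x w <= gp x y | gp y w <= gp x y"
   "gp x z <= gp z w | gp x w <= gp z w" "gp y z <= gp z w | gp y w <= gp z w"
   using gp_ultra[of x z y] gp_ultra[of x w y] gp_ultra[of z x w] gp_ultra[of z y w]
   unfolding min_le_iff_disj gp_sym[of z y] gp_sym[of w y] gp_sym[of z x] by blast+
  hence "gp x y + gp z w >= gp x z + gp y w | gp x y + gp z w >= gp x w + gp y z" by (rule r)
  thus ?thesis unfolding td_def le_max_iff_disj by linarith
 qed
 thus ?thesis unfolding four_point_def by blast
qed

text \<open>The point at height \<open>s\<close> on the geodesic from the root to
  \<open>p\<close>.\<close>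

definition anc :: "'q tpoint => real => 'q tpoint" where
 "anc p s = (take (nat \<lceil>s\<rceil>) (fst p), of_int \<lceil>s\<rceil> - s)"

lemma anc:
 assumes p: "p : pts" and s: "0 <= s" "s <= ht p"
 shows "anc p s : pts" "ht (anc p s) = s" "gp (anc p s) r = min s (gp p r)"
proof -
 obtain w t where wt: "p = (w, t)" by (cases p)
 have "s <= real (length w)" using p s(2) unfolding wt ht_def pts_def by auto
 hence k: "nat \<lceil>s\<rceil> <= length w" by (simp add: ceiling_le_iff)
 have c: "real (nat \<lceil>s\<rceil>) = of_int \<lceil>s\<rceil>" using s(1) by simp
 have "of_int \<lceil>s\<rceil> - s < 1" "0 <= of_int \<lceil>s\<rceil> - s" by linarith+
 moreover have "of_int \<lceil>s\<rceil> - s = 0" if "take (nat \<lceil>s\<rceil>) w = []"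
 proof -
  have "nat \<lceil>s\<rceil> = 0" using that k by auto
  hence "s = 0" using s(1) by simp
  thus ?thesis by simp
 qed
 ultimately show "anc p s : pts" using p take_closed[of w] unfolding wt anc_def pts_def by auto
 show h: "ht (anc p s) = s" unfolding anc_def ht_def wt using k c by simp
 have "s <= real (nat \<lceil>s\<rceil>)" unfolding c by linarith
 thus "gp (anc p s) r = min s (gp p r)"
  unfolding gp_def h using s(2) unfolding anc_def by (auto simp: lcp_take min_def)
qed

lemma td_geodesic: "geodesic_space pts td"
proof -
 have "EX S. geodesic_segment pts td p q S" if p: "p : pts" and q: "q : pts" for p q
 proof -
  define m where "m = gp p q"
  define L where "L = td p q"
  \<comment> \<open>The geodesic descends from \<open>p\<close> to the branching height
    \<open>m\<close> and then climbs to \<open>q\<close>.\<close>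
  define c where "c t = (if t <= ht p - m then anc p (ht p - t) else anc q (t - (ht p - 2 * m)))" for t
  have m: "m <= ht p" "m <= ht q" "0 <= m" unfolding m_def using gp_le[of p q] p q
   ht_nonneg[OF p] ht_nonneg[OF q] by (auto simp: gp_def)
  have L: "L = ht p + ht q - 2 * m" unfolding L_def td_def m_def ..
  have A: "anc p s : pts" "ht (anc p s) = s" "gp (anc p s) r = min s (gp p r)" if "0 <= s" "s <= ht p" for s r using anc[OF p that] by auto
  have B: "anc q s : pts" "ht (anc q s) = s" "gp (anc q s) r = min s (gp q r)" if "0 <= s" "s <= ht q" for s r using anc[OF q that] by auto
  have cM: "c t : pts" if "0 <= t" "t <= L" for t unfolding c_def using A(1)[of "ht p - t"] B(1)[of "t - (ht p - 2 * m)"] that m L by auto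
  have d: "td (c s) (c t) = t - s" if st: "0 <= s" "s <= t" "t <= L" for s t
  proof -
   consider "t <= ht p - m" | "s <= ht p - m" "t > ht p - m" | "s > ht p - m" using st by linarith
   thus ?thesis
   proof cases
   case 1
   let ?a = "ht p - s" and ?b = "ht p - t"
   have r: "0 <= ?a" "?a <= ht p" "0 <= ?b" "?b <= ht p" using 1 st m by auto
   have "gp (anc p ?a) (anc p ?b) = min ?a (min ?b (ht p))"
   using A(3)[OF r(1,2), of "anc p ?b"] A(3)[OF r(3,4), of p] gp_sym[of p "anc p ?b"] gp_self[OF p] by simp
   thus ?thesis unfolding c_def td_def using 1 st A(2)[OF r(1,2)] A(2)[OF r(3,4)] by simp
   next
   case 2
   let ?a = "ht p - s" and ?b = "t - (ht p - 2 * m)"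
   have r: "0 <= ?a" "?a <= ht p" "0 <= ?b" "?b <= ht q" using 2 st m L by auto
   have "gp (anc p ?a) (anc q ?b) = min ?a (min ?b m)"
   using A(3)[OF r(1,2), of "anc q ?b"] B(3)[OF r(3,4), of p] gp_sym[of p "anc q ?b"] gp_sym[of q p] unfolding m_def by simp
   thus ?thesis unfolding c_def td_def using 2 st A(2)[OF r(1,2)] B(2)[OF r(3,4)] by simp
   next
   case 3
   let ?a = "s - (ht p - 2 * m)" and ?b = "t - (ht p - 2 * m)"
   have r: "0 <= ?a" "?a <= ht q" "0 <= ?b" "?b <= ht q" using 3 st m L by auto
   have "gp (anc q ?a) (anc q ?b) = min ?a (min ?b (ht q))"
   using B(3)[OF r(1,2), of "anc q ?b"] B(3)[OF r(3,4), of q] gp_sym[of q "anc q ?b"] gp_self[OF q] by simp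
   thus ?thesis unfolding c_def td_def using 3 st r B(2)[OF r(1,2)] B(2)[OF r(3,4)] by simp
   qed
  qed
  have d': "td (c s) (c t) = abs(s - t)" if "s : {0..L}" "t : {0..L}" for s t
   using d[of s t] d[of t s] td_sym[of "c s" "c t"] that by (cases "s <= t") auto
  have L0: "0 <= L" unfolding L_def by (rule td_nonneg)
  have "c 0 = p"
   by (rule td_zero) (use cM[of 0] L0 p A(2)[of "ht p"] A(3)[of "ht p" p] gp_self[OF p] m in "auto simp: c_def td_def")
  moreover have "c L = q"
  proof (rule td_zero)
   have "td (c L) q = 0"
   proof (cases "L <= ht p - m")
   case True
   hence "ht q = m" "ht p - L = m" using m L by linarith+
   thus ?thesis unfolding c_def td_def using True A(2)[of m] A(3)[of m q] m unfolding m_def by simp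
   next
   case False
   have "L - (ht p - 2 * m) = ht q" unfolding L by simp
   thus ?thesis unfolding c_def td_def using False B(2)[of "ht q"] B(3)[of "ht q" q] gp_self[OF q] m by simp
   qed
   thus "td (c L) q = 0" .
  qed (use cM[of L] L0 q in auto)
  ultimately show ?thesis unfolding geodesic_segment_def
   by (intro exI[of _ "c ` {0..L}"] exI[of _ L] conjI exI[of _ c] L0) (use cM d' in auto)
 qed
 thus ?thesis unfolding geodesic_space_def using td_metric by blast
qed

text \<open>The distances to the vertices determine a point, and by \<open>td_attained\<close> also
  the metric. So isometries of the vertex set extend to the tree in a unique way.\<close>

definition vdist :: "'q tpoint => 'q list => real" where "vdist p z = td p (z, 0)"

lemma vertex_pt: "z : Om ==> (z, 0) : pts" unfolding pts_def by simp

lemma vdist_vertex: "vdist (w, 0) z = real (tdist w z)"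
proof -
 have "real (tdist w z) = real_of_int (int (tdist w z))" by simp
 also have "... = real (length w) + real (length z) - 2 * real (lcp w z)" unfolding tdist_int by simp
 finally show ?thesis unfolding vdist_def td_def gp_def ht_def using lcp_le[of w z] by simp
qed

lemma vdist_le: "abs(vdist p z - vdist q z) <= td p q"
 unfolding vdist_def using td_triangle[of p "(z, 0)" q] td_triangle[of q "(z, 0)" p] td_sym[of p q] by linarith

text \<open>If \<open>p\<close> is not higher than \<open>q\<close> then the vertex just below \<open>q\<close> lies on the far side of \<open>q\<close> as seen from \<open>p\<close>.\<close>

lemma td_attained: assumes "p : pts" "q : pts" shows "EX z:Om. td p q = abs(vdist p z - vdist q z)"
proof -
 have *: "EX z:Om. td p q = vdist p z - vdist q z" if pq: "p : pts" "q : pts" "ht p <= ht q" for p q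
 proof -
  obtain w t where q: "q = (w, t)" by (cases q)
  have w: "w : Om" "0 <= t" using pq(2) unfolding q pts_def by auto
  have "vdist q w = t" unfolding vdist_def td_def gp_def ht_def q using w by simp
  moreover have "gp p (w, 0) = gp p q" unfolding gp_def q using pq(3) w unfolding ht_def q by (auto simp: min_def)
  ultimately show ?thesis using w(1) unfolding vdist_def td_def q ht_def by (intro bexI[of _ w]) auto
 qed
 show ?thesis
 proof (cases "ht p <= ht q")
  case True
  thus ?thesis using *[OF assms] td_nonneg[of p q] by (metis abs_of_nonneg)
 next
  case False
  thus ?thesis using *[OF assms(2,1)] td_nonneg[of p q] td_sym[of p q] by (metis abs_minus_commute abs_of_nonneg linorder_le_cases)
 qed
qed

lemma vdist_inj: assumes "p : pts" "q : pts" "!!z. z : Om ==> vdist p z = vdist q z" shows "p = q"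
 using td_zero[OF assms(1,2)] td_attained[OF assms(1,2)] assms(3) by force

text \<open>A geodesic from a point of an edge to a vertex leaves the edge through one of its two
  ends.\<close>

lemma vdist_edge:
 assumes w: "w ~= []" and t: "0 <= t" "t <= 1"
 shows "vdist (w, t) z = min (real (tdist w z) + t) (real (tdist (butlast w) z) + 1 - t)"
proof -
 have l: "lcp (butlast w) z = min (length w - 1) (lcp w z)" unfolding butlast_conv_take by (rule lcp_take)
 have lw: "real (length w - 1) = real (length w) - 1" using w by (simp add: of_nat_diff Suc_leI)
 have r: "real (tdist x y) = real (length x) + real (length y) - 2 * real (lcp x y)" for x y :: "'q list"
  using arg_cong[OF tdist_int[of x y], of real_of_int] by simp
 have z: "real (lcp w z) <= real (length z)" using lcp_le(2)[of w z] by simp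
 show ?thesis
 proof (cases "lcp w z = length w")
  case True
  thus ?thesis unfolding vdist_def td_def gp_def ht_def r l using t z lw by (simp add: min_def)
 next
  case False
  hence "lcp w z <= length w - 1" using lcp_le(1)[of w z] by linarith
  hence "real (lcp w z) <= real (length w) - 1" using lw by linarith
  thus ?thesis unfolding vdist_def td_def gp_def ht_def r l using t z lw \<open>lcp w z <= length w - 1\<close> by (simp add: min_def)
 qed
qed

lemma tdist_one: assumes "tdist u w = 1" shows "u = butlast w & w ~= [] | w = butlast u & u ~= []"
proof -
 have i: "int (length u) + int (length w) - 2 * int (lcp u w) = 1" using tdist_int[of u w] assms by simp
 have "lcp u w = length u & length w = Suc (length u) | lcp u w = length w & length u = Suc (length w)"
 proof -
  have "length u + length w = Suc (2 * lcp u w)" using i by linarith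
  thus ?thesis using lcp_le[of u w] by presburger
 qed
 thus ?thesis
 proof
  assume a: "lcp u w = length u & length w = Suc (length u)"
  have "lcp (take (length u) w) u = length u" using a lcp_take[of "length u" w u] lcp_sym[of w u] by simp
  hence "take (length u) w = u" by (intro lcp_full) (use a in auto)
  thus ?thesis using a by (auto simp: butlast_conv_take)
 next
  assume a: "lcp u w = length w & length u = Suc (length w)"
  have "lcp (take (length w) u) w = length w" using a lcp_take[of "length w" u w] by simp
  hence "take (length w) u = w" by (intro lcp_full) (use a in auto)
  thus ?thesis using a by (auto simp: butlast_conv_take)
 qed
qed

text \<open>An isometry of the vertices maps edges to edges. By \<open>tdist_one\<close> it may
  reverse an edge with respect to the root, in which case \<open>t\<close> turns into
  \<open>1 - t\<close>.\<close>

lemma isometry_extend: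
 assumes b: "bij_betw f Om Om" and iso: "!!x y. x : Om ==> y : Om ==> tdist (f x) (f y) = tdist x y" and p: "p : pts"
 shows "EX q:pts. ALL z:Om. vdist q (f z) = vdist p z"
proof -
 obtain w t where wt: "p = (w, t)" by (cases p)
 have w: "w : Om" "0 <= t" "t < 1" "w = [] ==> t = 0" using p unfolding wt pts_def by auto
 have fO: "f x : Om" if "x : Om" for x using b that unfolding bij_betw_def by blast
 show ?thesis
 proof (cases "t = 0")
  case True
  thus ?thesis using iso[OF w(1)] vertex_pt[OF fO[OF w(1)]] unfolding wt by (intro bexI[of _ "(f w, 0)"]) (auto simp: vdist_vertex)
 next
  case False
  hence wn: "w ~= []" using w by auto
  define u where "u = butlast w"
  have u: "u : Om" unfolding u_def butlast_conv_take by (rule take_closed[OF w(1)])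
  have "lcp u w = length w - 1" unfolding u_def butlast_conv_take lcp_take by simp
  moreover have "int (length w - 1) = int (length w) - 1" "length u = length w - 1" using wn unfolding u_def by (cases w; simp)+
  ultimately have "int (tdist u w) = 1" unfolding tdist_int by simp
  hence "tdist (f u) (f w) = 1" using iso[OF u w(1)] by simp
  then consider "f u = butlast (f w)" "f w ~= []" | "f w = butlast (f u)" "f u ~= []" using tdist_one by blast
  thus ?thesis
  proof cases
   case 1
   have "(f w, t) : pts" using 1 w fO unfolding pts_def by auto
   moreover have "vdist (f w, t) (f z) = vdist p z" if "z : Om" for z
   unfolding wt vdist_edge[OF 1(2) w(2) less_imp_le[OF w(3)]] vdist_edge[OF wn w(2) less_imp_le[OF w(3)]]
   1(1)[symmetric] u_def[symmetric] iso[OF w(1) that] iso[OF u that] ..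
   ultimately show ?thesis by blast
  next
   case 2
   have t': "0 <= 1 - t" "1 - t <= 1" using w by auto
   have "(f u, 1 - t) : pts" using 2 w u fO False unfolding pts_def by auto
   moreover have "vdist (f u, 1 - t) (f z) = vdist p z" if "z : Om" for z
   unfolding wt vdist_edge[OF 2(2) t'] vdist_edge[OF wn w(2) less_imp_le[OF w(3)]]
   2(1)[symmetric] u_def[symmetric] iso[OF w(1) that] iso[OF u that] by (simp add: min.commute)
   ultimately show ?thesis by blast
  qed
 qed
qed

definition ext :: "('q list => 'q list) => 'q tpoint => 'q tpoint" where
 "ext f p = (SOME q. q : pts & (ALL z:Om. vdist q (f z) = vdist p z))"

definition visom :: "('q list => 'q list) => bool" where
 "visom f \<longleftrightarrow> bij_betw f Om Om & (ALL x:Om. ALL y:Om. tdist (f x) (f y) = tdist x y)"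

lemma ext:
 assumes "visom f" "p : pts"
 shows "ext f p : pts" "!!z. z : Om ==> vdist (ext f p) (f z) = vdist p z"
proof -
 have "EX q. q : pts & (ALL z:Om. vdist q (f z) = vdist p z)"
  using isometry_extend[of f p] assms unfolding visom_def by blast
 hence "ext f p : pts & (ALL z:Om. vdist (ext f p) (f z) = vdist p z)" unfolding ext_def by (rule someI_ex)
 thus "ext f p : pts" "!!z. z : Om ==> vdist (ext f p) (f z) = vdist p z" by auto
qed

lemma ext_unique:
 assumes f: "visom f" and p: "p : pts" and q: "q : pts" "!!z. z : Om ==> vdist q (f z) = vdist p z" shows "ext f p = q"
proof (rule vdist_inj[OF ext(1)[OF f p] q(1)])
 fix z assume "z : Om"
 then obtain y where "y : Om" "z = f y" using f unfolding visom_def bij_betw_def by blast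
 thus "vdist (ext f p) z = vdist q z" using ext(2)[OF f p] q(2) by simp
qed

lemma ext_td: assumes f: "visom f" and p: "p : pts" and q: "q : pts" shows "td (ext f p) (ext f q) = td p q"
proof (rule antisym)
 obtain z where z: "z : Om" "td (ext f p) (ext f q) = abs(vdist (ext f p) z - vdist (ext f q) z)"
  using td_attained[OF ext(1)[OF f p] ext(1)[OF f q]] by blast
 obtain y where "y : Om" "z = f y" using f z(1) unfolding visom_def bij_betw_def by blast
 thus "td (ext f p) (ext f q) <= td p q" using ext(2)[OF f p] ext(2)[OF f q] z(2) vdist_le[of p y q] by simp
 obtain z where z: "z : Om" "td p q = abs(vdist p z - vdist q z)" using td_attained[OF p q] by blast
 thus "td p q <= td (ext f p) (ext f q)" using ext(2)[OF f p] ext(2)[OF f q] vdist_le[of "ext f p" "f z" "ext f q"] by simp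
qed

lemma ext_vertex: assumes "visom f" "w : Om" shows "ext f (w, 0) = (f w, 0)"
proof (rule ext_unique[OF assms(1) vertex_pt[OF assms(2)]])
 have "f w : Om" using assms unfolding visom_def bij_betw_def by blast
 thus "(f w, 0) : pts" by (rule vertex_pt)
 show "vdist (f w, 0) (f z) = vdist (w, 0) z" if "z : Om" for z
  using assms that unfolding visom_def vdist_vertex by auto
qed

lemma ext_comp: assumes "visom f" "visom g" "p : pts" "visom h" "!!z. z : Om ==> h z = f (g z)" shows "ext h p = ext f (ext g p)"
proof (rule ext_unique[OF assms(4,3) ext(1)[OF assms(1) ext(1)[OF assms(2,3)]]])
 fix z assume z: "z : Om"
 have "g z : Om" using assms(2) z unfolding visom_def bij_betw_def by blast
 thus "vdist (ext f (ext g p)) (h z) = vdist p z"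
  using ext(2)[OF assms(1) ext(1)[OF assms(2,3)]] ext(2)[OF assms(2,3) z] assms(5)[OF z] by simp
qed

lemma ext_id: assumes "visom f" "p : pts" "!!z. z : Om ==> f z = z" shows "ext f p = p"
 by (rule ext_unique[OF assms(1,2,2)]) (use assms(3) in simp)

end

section \<open>Quasigeodesics and Lipschitz bounds for word metrics\<close>

context group
begin

lemma letters_inv: "S <= CG ==> x : letters S ==> inv x : letters S"
 unfolding letters_def by auto

lemma list_product_inv:
 assumes "set xs <= CG" shows "inv (list_product G xs) = list_product G (rev (map (%x. inv x) xs))"
 using assms
proof (induction xs)
 case (Cons x xs)
 hence "set (rev (map (%x. inv x) xs)) <= CG" by auto
 thus ?case using Cons lp_closed[of xs] lp_append[of "rev (map (%x. inv x) xs)" "[inv x]"]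
  by (simp add: inv_mult_group)
qed simp

context
 fixes S assumes S: "S <= CG" "generate G S = CG"
begin

lemma word_length_mult:
 assumes "g : CG" "h : CG" shows "word_length G S (g ** h) <= word_length G S g + word_length G S h"
proof -
 obtain xs ys where "length xs = word_length G S g" "set xs <= letters S" "list_product G xs = g"
  "length ys = word_length G S h" "set ys <= letters S" "list_product G ys = h"
  using wl_att[OF S assms(1)] wl_att[OF S assms(2)] by blast
 thus ?thesis using word_length_le[of "xs @ ys" S "g ** h"] lp_append[of xs ys] letters_carr[OF S(1)] by auto
qed

lemma word_length_inv_le: assumes "g : CG" shows "word_length G S (inv g) <= word_length G S g"
proof -
 obtain xs where xs: "length xs = word_length G S g" "set xs <= letters S" "list_product G xs = g"
  using wl_att[OF S assms] by blast
 hence "list_product G (rev (map (%x. inv x) xs)) = inv g" using list_product_inv letters_carr[OF S(1)] by auto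
 moreover have "set (rev (map (%x. inv x) xs)) <= letters S" using xs(2) letters_inv[OF S(1)] by auto
 ultimately show ?thesis using word_length_le[of "rev (map (%x. inv x) xs)" S "inv g"] xs(1) by simp
qed

lemma word_length_inv: "g : CG ==> word_length G S (inv g) = word_length G S g"
 using word_length_inv_le[of g] word_length_inv_le[of "inv g"] by simp

lemma word_length_zero: assumes "g : CG" shows "word_length G S g = 0 \<longleftrightarrow> g = \<one>"
 using wl_att[OF S assms] word_length_le[of "[]" S \<one>] by auto

lemma word_metric_Metric_space: "Metric_space (CG) (word_metric G S)"
proof (rule Metric_space.intro)
 show "word_metric G S x y = word_metric G S y x" for x y
  unfolding word_metric_def using word_length_inv[of "inv x ** y"] by (auto simp: inv_mult_group)
 fix x y z assume xy: "x : CG" "y : CG"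
 show "word_metric G S x y = 0 \<longleftrightarrow> x = y"
 proof -
  have "inv x ** y = \<one> \<longleftrightarrow> x = y" using xy by (metis inv_closed inv_equality inv_inv l_inv)
  thus ?thesis unfolding word_metric_def using xy word_length_zero[of "inv x ** y"] by simp
 qed
 assume z: "z : CG"
 have "inv x ** z = (inv x ** y) ** (inv y ** z)" using xy z by (simp add: m_assoc)
 thus "word_metric G S x z <= word_metric G S x y + word_metric G S y z"
  unfolding word_metric_def using xy z word_length_mult[of "inv x ** y" "inv y ** z"] by simp
qed (simp add: word_metric_def)

text \<open>The prefixes of a shortest word form a discrete geodesic; rounding the real parameter
  down costs the additive constant \<open>1\<close>.\<close>

lemma word_metric_quasigeodesic: "quasigeodesic_space (CG) (word_metric G S)"
proof -
 interpret M: Metric_space "CG" "word_metric G S" by (rule word_metric_Metric_space)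
 have path: "EX L>=0. EX c. c : {0..L} \<rightarrow> CG & c 0 = x & c L = y &
   (ALL s:{0..L}. ALL t:{0..L}. abs(s - t) / 1 - 1 <= word_metric G S (c s) (c t) & word_metric G S (c s) (c t) <= 1 * abs(s - t) + 1)"
  if xy: "x : CG" "y : CG" for x y
 proof -
  obtain xs where xs: "length xs = word_length G S (inv x ** y)" "set xs <= letters S" "list_product G xs = inv x ** y"
   using wl_att[OF S, of "inv x ** y"] xy by auto
  define p where "p i = list_product G (take i xs)" for i
  define c where "c s = x ** p (nat \<lfloor>s\<rfloor>)" for s :: real
  have sub: "set (take i xs) <= CG" "set (drop i xs) <= CG" for i
   using xs(2) letters_carr[OF S(1)] set_take_subset[of i xs] set_drop_subset[of i xs] by blast+
  have pc: "p i : CG" for i unfolding p_def by (rule lp_closed[OF sub(1)])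
  have d: "word_metric G S (x ** p i) (x ** p j) = real (j - i)" if ij: "i <= j" "j <= length xs" for i j
  proof -
   let ?m = "drop i (take j xs)"
   have mc: "set ?m <= letters S" using xs(2) by (meson order_trans set_drop_subset set_take_subset)
   have mc': "set ?m <= CG" using mc letters_carr[OF S(1)] by blast
   have "take j xs = take i xs @ ?m" using ij(1) by (metis append_take_drop_id min.absorb1 take_take)
   hence pj: "p j = p i ** list_product G ?m" unfolding p_def using lp_append[OF sub(1)[of i] mc'] by metis
   hence e: "inv (p i) ** p j = list_product G ?m" using pc lp_closed[OF mc'] by simp
   have 1: "word_length G S (inv (p i) ** p j) <= j - i" using word_length_le[OF mc e[symmetric]] ij by simp
   have "xs = take i xs @ ?m @ drop j xs" using ij by (metis append_assoc append_take_drop_id min.absorb1 take_take)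
   hence dec: "inv x ** y = p i ** (list_product G ?m ** list_product G (drop j xs))"
   using lp_append[OF sub(1)[of i], of "?m @ drop j xs"] lp_append[OF mc' sub(2)[of j]] mc' sub(2)[of j] xs(3)
   unfolding p_def by (metis Un_subset_iff set_append)
   have Mc: "list_product G ?m : CG" "list_product G (drop j xs) : CG"
   by (rule lp_closed[OF mc'], rule lp_closed[OF sub(2)])
   have "length xs <= word_length G S (p i) + word_length G S (list_product G ?m ** list_product G (drop j xs))"
   unfolding xs(1) dec by (rule word_length_mult[OF pc[of i] m_closed[OF Mc]])
   moreover have "word_length G S (list_product G ?m ** list_product G (drop j xs)) <= word_length G S (list_product G ?m) + word_length G S (list_product G (drop j xs))"
   by (rule word_length_mult[OF Mc])
   moreover have "set (take i xs) <= letters S" "set (drop j xs) <= letters S"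
   by (rule order_trans[OF set_take_subset xs(2)], rule order_trans[OF set_drop_subset xs(2)])
   hence "word_length G S (p i) <= i" "word_length G S (list_product G (drop j xs)) <= length xs - j"
   using word_length_le[of "take i xs" S "p i"] word_length_le[of "drop j xs" S "list_product G (drop j xs)"] p_def ij by simp_all
   ultimately have "word_length G S (inv (p i) ** p j) = j - i" using 1 ij unfolding e by linarith
   thus ?thesis using wm_inv[OF xy(1) pc pc] pc unfolding word_metric_def by simp
  qed
  have d': "abs(s - t) - 1 <= word_metric G S (c s) (c t) & word_metric G S (c s) (c t) <= abs(s - t) + 1"
   if st: "0 <= s" "s <= t" "t <= real (length xs)" for s t
  proof -
   have m: "nat \<lfloor>s\<rfloor> <= nat \<lfloor>t\<rfloor>" by (rule nat_mono[OF floor_mono[OF st(2)]])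
   have "nat \<lfloor>t\<rfloor> <= nat \<lfloor>real (length xs)\<rfloor>" by (rule nat_mono[OF floor_mono[OF st(3)]])
   hence "nat \<lfloor>t\<rfloor> <= length xs" by simp
   with m have "word_metric G S (c s) (c t) = real (nat \<lfloor>t\<rfloor> - nat \<lfloor>s\<rfloor>)" unfolding c_def by (rule d)
   also have "... = real (nat \<lfloor>t\<rfloor>) - real (nat \<lfloor>s\<rfloor>)" by (rule of_nat_diff[OF m])
   also have "... = of_int \<lfloor>t\<rfloor> - of_int \<lfloor>s\<rfloor>" using st by simp
   finally show ?thesis using st by linarith
  qed
  have "abs(s - t) / 1 - 1 <= word_metric G S (c s) (c t) & word_metric G S (c s) (c t) <= 1 * abs(s - t) + 1"
   if "s : {0..real (length xs)}" "t : {0..real (length xs)}" for s t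
  proof (cases "s <= t")
   case True
   thus ?thesis using d'[of s t] that by simp
  next
   case False
   hence "abs(t - s) - 1 <= word_metric G S (c t) (c s) & word_metric G S (c t) (c s) <= abs(t - s) + 1" using d'[of t s] that by simp
   thus ?thesis unfolding M.commute[of "c s" "c t"] abs_minus_commute[of s t] by simp
  qed
  moreover have "c (real (length xs)) = y" "c 0 = x" unfolding c_def p_def using xs(3) xy by simp_all
  moreover have "c : {0..real (length xs)} \<rightarrow> CG" unfolding c_def using pc xy by auto
  ultimately have "c : {0..real (length xs)} \<rightarrow> CG & c 0 = x & c (real (length xs)) = y &
   (ALL s:{0..real (length xs)}. ALL t:{0..real (length xs)}. abs(s - t) / 1 - 1 <= word_metric G S (c s) (c t) & word_metric G S (c s) (c t) <= 1 * abs(s - t) + 1)"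
   by blast
  thus ?thesis using of_nat_0_le_iff[of "length xs"] by blast
 qed
 have "EX k>=1. EX C>=0. ALL x:CG. ALL y:CG. EX L>=0. EX c. c : {0..L} \<rightarrow> CG & c 0 = x & c L = y &
   (ALL s:{0..L}. ALL t:{0..L}. abs(s - t) / k - C <= word_metric G S (c s) (c t) & word_metric G S (c s) (c t) <= k * abs(s - t) + C)"
  by (rule exI[of _ "1::real"], rule conjI[OF order_refl], rule exI[of _ "1::real"], rule conjI[OF zero_le_one], intro ballI path)
 thus ?thesis unfolding quasigeodesic_space_def using word_metric_Metric_space by blast
qed

lemma word_metric_lipschitz:
 assumes rho: "!!x y z. x : CG ==> y : CG ==> z : CG ==> \<rho> x z <= \<rho> x y + \<rho> y (z::'a)"
  "!!x. x : CG ==> \<rho> x x = (0::real)"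
  "!!g x y. g : CG ==> x : CG ==> y : CG ==> \<rho> (g ** x) (g ** y) = \<rho> x y"
  and K: "!!s. s : letters S ==> \<rho> \<one> s <= K" and xy: "x : CG" "y : CG"
 shows "\<rho> x y <= K * word_metric G S x y"
proof -
 have "\<rho> \<one> (list_product G xs) <= K * length xs" if "set xs <= letters S" for xs
  using that
 proof (induction xs)
  case (Cons s xs)
  have c: "s : CG" "list_product G xs : CG" using Cons.prems letters_carr[OF S(1)] by (auto intro!: lp_closed)
  have "\<rho> \<one> (s ** list_product G xs) <= \<rho> \<one> s + \<rho> (s ** \<one>) (s ** list_product G xs)" using rho(1)[of \<one> s "s ** list_product G xs"] c by simp
  also have "\<rho> (s ** \<one>) (s ** list_product G xs) = \<rho> \<one> (list_product G xs)" by (rule rho(3)) (use c in auto)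
  finally show ?case using Cons K[of s] by (simp add: algebra_simps)
 qed (simp add: rho(2))
 moreover obtain xs where "length xs = word_length G S (inv x ** y)" "set xs <= letters S" "list_product G xs = inv x ** y"
  using wl_att[OF S, of "inv x ** y"] xy by auto
 ultimately have "\<rho> \<one> (inv x ** y) <= K * word_metric G S x y" unfolding word_metric_def using xy by metis
 thus ?thesis using rho(3)[of x \<one> "inv x ** y"] xy by (simp add: m_assoc[symmetric])
qed

end

end

section \<open>The hierarchical structure of a product\<close>

lemma set_distance_singleton [simp]: "set_distance d {a} {b} = d a b"
 unfolding set_distance_def by simp

text \<open>The HHS structure of a product: the domains are the nonempty subsets of the set \<open>{0, \<dots>, n}\<close> of factors, with inclusion
  as nesting and disjointness as orthogonality; only the singletons carry unbounded spaces.\<close>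

definition fctrs :: "nat => nat set set" where "fctrs n = {B. B <= {..n} & B ~= {}}"

locale product_family = group G for G :: "('g, 'm) monoid_scheme" (structure) +
 fixes S :: "'g set" and n :: nat and Sp :: "nat set => real set" and dd :: "nat set => real => real => real"
  and pr :: "nat set => 'g => real" and im :: "'g => nat set => real => real"
  and j :: "real => 'p" and io :: "nat set => 's"
 assumes S: "finite S" "S <= CG" "generate G S = CG"
  and j: "inj j" and io: "inj_on io (fctrs n)"
  and geo: "B : fctrs n ==> geodesic_space (Sp B) (dd B)" and four: "B : fctrs n ==> four_point (Sp B) (dd B)"
  and big: "B : fctrs n ==> \<nexists>i. B = {i} ==> Sp B = {0}"
  and pr: "B : fctrs n ==> g : CG ==> pr B g : Sp B"
  and lip: "EX K>=0. ALL B:fctrs n. ALL g:CG. ALL h:CG. dd B (pr B g) (pr B h) <= K * word_metric G S g h"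
  and real: "EX al>=0. ALL q. (ALL B:fctrs n. q B : Sp B) --> (EX g:CG. ALL B:fctrs n. dd B (pr B g) (q B) <= al)"
  and uniq: "ALL kp>=0. EX tht. ALL g:CG. ALL h:CG. tht <= word_metric G S g h --> (EX B:fctrs n. kp <= dd B (pr B g) (pr B h))"
  and im_bij: "B : fctrs n ==> g : CG ==> bij_betw (im g B) (Sp B) (Sp B)"
  and im_dd: "B : fctrs n ==> g : CG ==> p : Sp B ==> q : Sp B ==> dd B (im g B p) (im g B q) = dd B p q"
  and im_mult: "B : fctrs n ==> g : CG ==> h : CG ==> p : Sp B ==> im (g ** h) B p = im g B (im h B p)"
  and im_pr: "B : fctrs n ==> g : CG ==> h : CG ==> im g B (pr B h) = pr B (g ** h)"
begin

definition dl :: "'s => nat set" where "dl = inv_into (fctrs n) io"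

text \<open>If \<open>V\<close> is properly nested in or transverse to \<open>W\<close>, then
  \<open>W\<close> is not a singleton and its space is the point \<open>0\<close>. So this point
  serves as \<open>rho\<close>, and the empty set as value of \<open>rho_map\<close>.\<close>

definition PH :: "('g, 's, 'p) hhs" where
 "PH = (|domains = io ` fctrs n, space = (%U. j ` Sp (dl U)), sdist = (%U p q. dd (dl U) (inv_into UNIV j p) (inv_into UNIV j q)),
   proj = (%U g. {j (pr (dl U) g)}), nested = (%U V. dl U <= dl V), orth = (%U V. dl U \<inter> dl V = {}),
   rho = (%_ _. {j 0}), rho_map = (%_ _ _. {})|)"

lemma prod_sel [simp]: "domains PH = io ` fctrs n" "space PH U = j ` Sp (dl U)"
 "sdist PH U p q = dd (dl U) (inv_into UNIV j p) (inv_into UNIV j q)" "proj PH U g = {j (pr (dl U) g)}"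
 "nested PH U V \<longleftrightarrow> dl U <= dl V" "orth PH U V \<longleftrightarrow> dl U \<inter> dl V = {}"
 "rho PH U V = {j 0}" "rho_map PH U V p = {}"
 unfolding PH_def by simp_all

lemma inv_j [simp]: "inv_into UNIV j (j a) = a" using j by simp

lemma dl_code [simp]: "B : fctrs n ==> dl (io B) = B" unfolding dl_def using io by simp
lemma dl_in: "U : io ` fctrs n ==> dl U : fctrs n" by auto
lemma dl_inj: "U : io ` fctrs n ==> V : io ` fctrs n ==> dl U = dl V ==> U = V" by auto

lemma fctrs_finite: "finite (fctrs n)" unfolding fctrs_def by simp

lemma dd_refl: assumes "B : fctrs n" "a : Sp B" shows "dd B a a = 0"
proof -
 have "Metric_space (Sp B) (dd B)" using geo[OF assms(1)] unfolding geodesic_space_def by blast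
 thus ?thesis using assms(2) Metric_space.zero by metis
qed

lemma big_space: assumes "W : io ` fctrs n" "\<nexists>i. dl W = {i}"
 shows "Sp (dl W) = {0}" "dd (dl W) 0 0 = 0" "g : CG ==> pr (dl W) g = 0"
 using big[OF dl_in[OF assms(1)] assms(2)] dd_refl[OF dl_in[OF assms(1)], of 0] pr[OF dl_in[OF assms(1)], of g] by auto

lemma pnested_big: assumes "V : io ` fctrs n" "W : io ` fctrs n" "pnested PH V W" shows "\<nexists>i. dl W = {i}"
proof
 assume "EX i. dl W = {i}"
 moreover have "dl V <= dl W" "V ~= W" using assms(3) unfolding pnested_def by auto
 moreover have "dl V ~= {}" using dl_in[OF assms(1)] unfolding fctrs_def by auto
 ultimately have "dl V = dl W" by auto
 thus False using dl_inj[OF assms(1,2)] \<open>V ~= W\<close> by blast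
qed

lemma transverse_big: assumes "transverse PH V W" shows "\<nexists>i. dl W = {i}" "\<nexists>i. dl V = {i}"
proof -
 have *: "dl V \<inter> dl W ~= {}" "~ dl V <= dl W" "~ dl W <= dl V" using assms unfolding transverse_def prod_sel by blast+
 show "\<nexists>i. dl W = {i}"
 proof
  assume "EX i. dl W = {i}"
  then obtain i where i: "dl W = {i}" ..
  show False using *(1,3) unfolding i by blast
 qed
 show "\<nexists>i. dl V = {i}"
 proof
  assume "EX i. dl V = {i}"
  then obtain i where i: "dl V = {i}" ..
  show False using *(1,2) unfolding i by blast
 qed
qed

lemma prod_hyperbolic: assumes "W : io ` fctrs n" shows "hyperbolic_space 0 (space PH W) (sdist PH W)"
proof -
 have "hyperbolic_space 0 (j ` Sp (dl W)) (%p q. dd (dl W) (inv_into UNIV j p) (inv_into UNIV j q))"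
  by (rule hyperbolic_transport[OF _ geo[OF dl_in[OF assms]] four[OF dl_in[OF assms]], where f = j and h = "inv_into UNIV j"]) simp
 moreover have "sdist PH W = (%p q. dd (dl W) (inv_into UNIV j p) (inv_into UNIV j q))" by (intro ext) simp
 ultimately show ?thesis by simp
qed

lemma prod_projections: "EX K. hhs_projections (CG) (word_metric G S) PH 0 K"
proof -
 obtain K where K: "K >= 0" "!!B g h. B : fctrs n ==> g : CG ==> h : CG ==> dd B (pr B g) (pr B h) <= K * word_metric G S g h"
  using lip by blast
 obtain al where al: "al >= 0" "!!q. (ALL B:fctrs n. q B : Sp B) ==> EX g:CG. ALL B:fctrs n. dd B (pr B g) (q B) <= al"
  using real by blast
 define K' where "K' = max K al"
 have wm: "0 <= word_metric G S g h" for g h unfolding word_metric_def by simp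
 have "hhs_projections (CG) (word_metric G S) PH 0 K'"
  unfolding hhs_projections_def
 proof (intro ballI conjI)
  fix W g h assume W: "W : domains PH" and g: "g : CG"
  hence B: "dl W : fctrs n" by auto
  show "proj PH W g ~= {}" "proj PH W g <= space PH W" using pr[OF B g] by auto
  show "diam_le (sdist PH W) (proj PH W g) 0" unfolding diam_le_def using dd_refl[OF B pr[OF B g]] by simp
  assume h: "h : CG"
  have "K * word_metric G S g h <= K' * word_metric G S g h" by (rule mult_right_mono[OF _ wm]) (simp add: K'_def)
  moreover have "0 <= K'" unfolding K'_def using K(1) by simp
  ultimately show "dst PH W (proj PH W g) (proj PH W h) <= K' * word_metric G S g h + K'"
   using K(2)[OF B g h] by simp
 next
  fix W assume W: "W : domains PH"
  hence B: "dl W : fctrs n" by auto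
  have geoM: "Metric_space (Sp (dl W)) (dd (dl W))" using geo[OF B] unfolding geodesic_space_def by blast
  show "quasiconvex K' (space PH W) (sdist PH W) (\<Union>g\<in>CG. proj PH W g)"
   unfolding quasiconvex_def
  proof (intro ballI allI impI)
   fix x y T p assume T: "geodesic_segment (space PH W) (sdist PH W) x y T" and p: "p : T"
   have "T <= space PH W" using T unfolding geodesic_segment_def by blast
   then obtain a where a: "a : Sp (dl W)" "p = j a" using p by auto
   have "ALL B:fctrs n. (if B = dl W then a else pr B \<one>) : Sp B" using a pr by auto
   then obtain g where g: "g : CG" "ALL B:fctrs n. dd B (pr B g) (if B = dl W then a else pr B \<one>) <= al"
   using al(2)[of "%B. if B = dl W then a else pr B \<one>"] by blast
   hence "dd (dl W) (pr (dl W) g) a <= K'" using bspec[OF g(2) B] unfolding K'_def by simp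
   hence "dd (dl W) a (pr (dl W) g) <= K'" using Metric_space.commute[OF geoM] by metis
   thus "EX q:\<Union>g\<in>CG. proj PH W g. sdist PH W p q <= K'"
   using g(1) a(2) by (intro bexI[of _ "j (pr (dl W) g)"]) auto
  qed
 qed
 thus ?thesis by blast
qed

lemma prod_nesting: "hhs_nesting PH 0"
proof -
 have top: "{..n} : fctrs n" unfolding fctrs_def by auto
 have le_top: "dl W <= {..n}" if "W : io ` fctrs n" for W using dl_in[OF that] unfolding fctrs_def by auto
 have "EX! T. T : io ` fctrs n & (ALL W:io ` fctrs n. dl T <= dl W --> W = T)"
 proof (rule ex1I[of _ "io {..n}"])
  have *: "W = io {..n}" if W: "W : io ` fctrs n" "dl (io {..n}) <= dl W" for W
  proof (rule dl_inj[OF W(1) imageI[OF top]])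
   show "dl W = dl (io {..n})" using W(2) le_top[OF W(1)] unfolding dl_code[OF top] by (rule subset_antisym[rotated])
  qed
  show "io {..n} : io ` fctrs n & (ALL W:io ` fctrs n. dl (io {..n}) <= dl W --> W = io {..n})"
   by (intro conjI ballI impI imageI top) (rule *)
  fix T assume T: "T : io ` fctrs n & (ALL W:io ` fctrs n. dl T <= dl W --> W = T)"
  have "dl T <= dl (io {..n})" unfolding dl_code[OF top] by (rule le_top[OF conjunct1[OF T]])
  hence "io {..n} = T" by (rule mp[OF bspec[OF conjunct2[OF T] imageI[OF top]]])
  thus "T = io {..n}" by (rule sym)
 qed
 hence e: "EX! S. S : domains PH & (ALL W:domains PH. nested PH S W --> W = S)" unfolding prod_sel(1,5) .
 have r: "reflp_on (domains PH) (nested PH)" unfolding reflp_on_def prod_sel(5) by blast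
 have t: "transp_on (domains PH) (nested PH)" unfolding transp_on_def prod_sel(5) by blast
 have as: "antisymp_on (domains PH) (nested PH)"
  unfolding antisymp_on_def prod_sel(1,5)
 proof (intro ballI impI)
  fix U V assume "U : io ` fctrs n" "V : io ` fctrs n" "dl U <= dl V" "dl V <= dl U"
  thus "U = V" using dl_inj[of U V] by blast
 qed
 have p: "rho PH V W ~= {}" "rho PH V W <= space PH W" "diam_le (sdist PH W) (rho PH V W) 0"
  "rho_map PH W V : space PH W \<rightarrow> Pow (space PH V)"
  if "V : domains PH" "W : domains PH" "pnested PH V W" for V W
 proof -
  have "V : io ` fctrs n" "W : io ` fctrs n" using that(1,2) unfolding prod_sel(1) .
  note b = big_space(1,2)[OF this(2) pnested_big[OF this that(3)]]
  show "rho PH V W ~= {}" "rho PH V W <= space PH W" "diam_le (sdist PH W) (rho PH V W) 0"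
   "rho_map PH W V : space PH W \<rightarrow> Pow (space PH V)"
   unfolding diam_le_def by (simp, simp add: b(1), simp add: b(2), simp)
 qed
 show ?thesis unfolding hhs_nesting_def by (intro conjI ballI impI r t as disjI2[OF e] p)
qed

text \<open>The container for the domains below \<open>T\<close> that are orthogonal to
  \<open>U\<close> is the difference of the two sets of factors; this is why all nonempty subsets
  are domains.\<close>

lemma prod_orthogonality: "hhs_orthogonality PH"
proof -
 have ne: "dl W ~= {}" if "W : io ` fctrs n" for W using dl_in[OF that] unfolding fctrs_def by simp
 have sy: "symp_on (domains PH) (orth PH)" by (rule symp_onI) (simp add: Int_commute)
 have ir: "irreflp_on (domains PH) (orth PH)" by (rule irreflp_onI) (use ne in simp)
 have mono: "orth PH V U" if "nested PH V W & orth PH W U" for U V W using that unfolding prod_sel by blast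
 have incomp: "~ nested PH V W" "~ nested PH W V" if "V : domains PH" "W : domains PH" "orth PH V W" for V W
  using that(3) ne[of V] ne[of W] that(1,2) unfolding prod_sel by blast+
 have cont: "EX W:below PH T - {T}. ALL V:below PH T. orth PH V U --> nested PH V W"
  if T': "T : domains PH" and U': "U : below PH T" and ne': "{V : below PH T. orth PH V U} ~= {}" for T U
 proof -
 have T: "T : io ` fctrs n" and U: "U : {V : io ` fctrs n. dl V <= dl T}"
  and nonempty: "{V : {V : io ` fctrs n. dl V <= dl T}. dl V \<inter> dl U = {}} ~= {}"
  using T' U' ne' unfolding prod_sel .
 let ?B = "dl T - dl U"
 obtain V where V: "V : io ` fctrs n" "dl V <= dl T" "dl V \<inter> dl U = {}" using nonempty by blast
 have "?B ~= {}" using V ne[OF V(1)] by blast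
 moreover have "dl T <= {..n}" using dl_in[OF T] unfolding fctrs_def by blast
 ultimately have B: "?B : fctrs n" unfolding fctrs_def by blast
 have "?B ~= dl T" using U ne[of U] by blast
 hence "io ?B ~= T" using dl_code[OF B] by metis
 moreover have "ALL V:{V : io ` fctrs n. dl V <= dl T}. dl V \<inter> dl U = {} --> dl V <= dl (io ?B)" unfolding dl_code[OF B] by blast
 moreover have "dl (io ?B) <= dl T" unfolding dl_code[OF B] by blast
 ultimately show ?thesis unfolding prod_sel
  using B by (intro bexI[of _ "io ?B"]) auto
 qed
 show ?thesis unfolding hhs_orthogonality_def
 proof (intro conjI ballI impI sy ir)
  show "orth PH V U" if "nested PH V W & orth PH W U" for U V W by (rule mono[OF that])
  show "EX W:below PH T - {T}. ALL V:below PH T. orth PH V U --> nested PH V W"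
   if "T : domains PH" "U : below PH T" "{V : below PH T. orth PH V U} ~= {}" for T U
   by (rule cont[OF that])
  show "~ nested PH V W" "~ nested PH W V" if "V : domains PH" "W : domains PH" "orth PH V W" for V W
   by (rule incomp(1)[OF that], rule incomp(2)[OF that])
 qed
qed

lemma prod_consistency: "hhs_consistency (CG) PH 0 0"
 unfolding hhs_consistency_def
proof (intro conjI ballI impI)
 fix V W assume VW: "V : domains PH" "W : domains PH" "transverse PH V W"
 note b = big_space[OF _ transverse_big(1)[OF VW(3)]] big_space[OF _ transverse_big(2)[OF VW(3)]]
 show "rho PH V W ~= {}" "rho PH V W <= space PH W" "diam_le (sdist PH W) (rho PH V W) 0"
  using b(1,2) VW(2) unfolding diam_le_def by simp_all
 show "min (dst PH W (proj PH W x) (rho PH V W)) (dst PH V (proj PH V x) (rho PH W V)) <= 0"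
  if "x : CG" for x using b(2,3) that VW(2) by simp
next
 fix V W x assume VW: "V : domains PH" "W : domains PH" "pnested PH V W" and x: "x : CG"
 thus "dst PH W (proj PH W x) (rho PH V W) <= 0 |
   diam_le (sdist PH V) (proj PH V x \<union> (\<Union>p\<in>proj PH W x. rho_map PH W V p)) 0"
  using big_space(2,3)[OF _ pnested_big[of V W]] by simp
next
 fix U V W assume UVW: "U : domains PH" "V : domains PH" "W : domains PH"
  "nested PH U V & (pnested PH V W | transverse PH V W & ~ orth PH W U)"
 hence "pnested PH V W | transverse PH V W" "V : io ` fctrs n" "W : io ` fctrs n"
  using UVW(4) by (blast, simp_all)
 hence "\<nexists>i. dl W = {i}" using pnested_big[of V W] transverse_big(1)[of V W] by blast
 thus "dst PH W (rho PH U W) (rho PH V W) <= 0" using big_space(2)[of W] UVW(3) by simp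
qed

text \<open>As the space of \<open>W\<close> is a point, the list may contain every domain properly
  below \<open>W\<close>. It is padded to the required length \<open>c\<close> by repeating its
  first entry.\<close>

lemma prod_large_links: "EX lam>=1. EX E>=max 0 0. hhs_large_links (CG) PH lam E"
proof -
 define c where "c = Suc (card (io ` fctrs n))"
 have "hhs_large_links (CG) PH (real c) 0"
  unfolding hhs_large_links_def
 proof (intro ballI impI)
  fix W x x' assume W: "W : domains PH" and ne: "below PH W - {W} ~= {}" and x: "x : CG" "x' : CG"
  let ?Q = "below PH W - {W}"
  obtain V where "V : ?Q" using ne by blast
  hence "V : io ` fctrs n" "pnested PH V W" unfolding pnested_def by simp_all
  hence nb: "\<nexists>i. dl W = {i}" using pnested_big[of V W] W by simp
  have N: "real c * dst PH W (proj PH W x) (proj PH W x') + real c = real c"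
   using big_space(2,3)[OF _ nb] W x by simp
  have finQ: "finite ?Q" using fctrs_finite by simp
  obtain h where h: "bij_betw h {1..card ?Q} ?Q" using ex_bij_betw_nat_finite_1[OF finQ] by blast
  have "card ?Q <= card (io ` fctrs n)" by (rule card_mono[OF finite_imageI[OF fctrs_finite]]) auto
  hence cQ: "card ?Q <= c" unfolding c_def by simp
  have c1: "1 <= card ?Q" using ne finQ by (simp add: Suc_le_eq card_gt_0_iff)
  define T where "T i = h (if i <= card ?Q then i else 1)" for i
  have TQ: "T i : ?Q" if "i : {1..c}" for i
   using bij_betwE[OF h] that c1 unfolding T_def by (simp split: if_splits)
  have "EX i:{1..c}. V : below PH (T i)" if V: "V : ?Q" for V
  proof -
   obtain i where i: "i : {1..card ?Q}" "V = h i" using h V unfolding bij_betw_def by blast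
   hence "T i = V" unfolding T_def by simp
   thus ?thesis using i cQ V by (intro bexI[of _ i]) auto
  qed
  moreover have "dst PH W (proj PH W x) (rho PH (T i) W) <= real c" for i
   using big_space(2,3)[OF _ nb] W x by simp
  ultimately show "let N = real c * dst PH W (proj PH W x) (proj PH W x') + real c
   in EX T. (ALL i:{1..nat \<lfloor>N\<rfloor>}. T i : below PH W - {W} & dst PH W (proj PH W x) (rho PH (T i) W) <= N) &
   (ALL V:below PH W - {W}. (EX i:{1..nat \<lfloor>N\<rfloor>}. V : below PH (T i)) | dst PH V (proj PH V x) (proj PH V x') < 0)"
   unfolding N Let_def floor_of_nat nat_int using TQ by (intro exI[of _ T] conjI ballI) blast+
 qed
 thus ?thesis by (intro exI[of _ "real c"] conjI exI[of _ 0]) (auto simp: c_def)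
qed

lemma prod_bgi: "hhs_bounded_geodesic_image PH 1"
 unfolding hhs_bounded_geodesic_image_def diam_le_def by simp

lemma prod_complexity: "hhs_finite_complexity PH"
proof -
 have "finite \<U> & card \<U> <= card (io ` fctrs n)" if "\<U> <= io ` fctrs n" for \<U>
  using finite_subset[OF that] card_mono[OF _ that] fctrs_finite by simp
 thus ?thesis unfolding hhs_finite_complexity_def prod_sel(1) by blast
qed

lemma prod_realization: "EX al. hhs_partial_realization (CG) PH al"
proof -
 obtain al where al: "al >= 0" "!!q. (ALL B:fctrs n. q B : Sp B) ==> EX g:CG. ALL B:fctrs n. dd B (pr B g) (q B) <= al"
  using real by blast
 have "hhs_partial_realization (CG) PH al"
  unfolding hhs_partial_realization_def
 proof (intro allI impI)
  fix \<V> p assume a: "\<V> <= domains PH & (ALL V:\<V>. ALL W:\<V>. V ~= W --> orth PH V W) & (ALL V:\<V>. p V : (\<Union>x\<in>CG. proj PH V x))"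
  define q where "q B = (if io B : \<V> then inv_into UNIV j (p (io B)) else pr B \<one>)" for B
  have "q B : Sp B" if B: "B : fctrs n" for B
  proof (cases "io B : \<V>")
   case True
   then obtain x where "x : CG" "p (io B) : proj PH (io B) x" using a by blast
   thus ?thesis unfolding q_def using True pr[OF B] B by simp
  qed (use pr[OF B] in "simp add: q_def")
  then obtain g where g: "g : CG" "!!B. B : fctrs n ==> dd B (pr B g) (q B) <= al" using al(2)[of q] by blast
  have "dst PH V (proj PH V g) {p V} <= al" if V: "V : \<V>" for V
  proof -
   have "V : io ` fctrs n" using V a by auto
   hence "q (dl V) = inv_into UNIV j (p V)" "dl V : fctrs n" using V unfolding q_def by auto
   thus ?thesis using g(2)[of "dl V"] by simp
  qed
  moreover have "dst PH W (proj PH W g) (rho PH V W) <= al"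
   if V: "V : \<V>" "W : domains PH" "pnested PH V W | transverse PH W V" for V W
  proof -
   have "V : io ` fctrs n" "W : io ` fctrs n" using V a by auto
   hence "\<nexists>i. dl W = {i}" using pnested_big[of V W] transverse_big(2)[of W V] that(3) by blast
   thus ?thesis using big_space(2,3)[of W] V(2) g(1) al(1) by simp
  qed
  ultimately show "EX x:CG. ALL V:\<V>. dst PH V (proj PH V x) {p V} <= al &
   (ALL W:domains PH. pnested PH V W | transverse PH W V --> dst PH W (proj PH W x) (rho PH V W) <= al)"
   using g(1) by blast
 qed
 thus ?thesis by blast
qed

lemma prod_uniqueness: "hhs_uniqueness (CG) (word_metric G S) PH"
 unfolding hhs_uniqueness_def
proof (intro allI impI)
 fix kp :: real assume "0 <= kp"
 then obtain tht where "ALL g:CG. ALL h:CG. tht <= word_metric G S g h --> (EX B:fctrs n. kp <= dd B (pr B g) (pr B h))" using uniq by blast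
 thus "EX tht. ALL x:CG. ALL y:CG. tht <= word_metric G S x y --> (EX V:domains PH. kp <= dst PH V (proj PH V x) (proj PH V y))"
  by (intro exI[of _ tht]) auto
qed

lemma prod_structure: "hhs_structure (CG) (word_metric G S) PH"
proof -
 have "EX dl>=0. ALL W:domains PH. hyperbolic_space dl (space PH W) (sdist PH W)"
  using prod_hyperbolic by (intro exI[of _ 0]) auto
 moreover have "EX xi>=0. EX kp0>=0. (EX K. hhs_projections (CG) (word_metric G S) PH xi K) & hhs_nesting PH xi &
  hhs_consistency (CG) PH xi kp0 & (EX lam>=1. EX E>=max xi kp0. hhs_large_links (CG) PH lam E)"
  by (rule exI[of _ 0], intro conjI order_refl, rule exI[of _ 0], intro conjI order_refl prod_projections prod_nesting prod_consistency prod_large_links)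
 moreover have "EX E>0. hhs_bounded_geodesic_image PH E" using prod_bgi by (intro exI[of _ 1]) auto
 ultimately show ?thesis unfolding hhs_structure_def
  using word_metric_quasigeodesic[OF S(2,3)] prod_orthogonality prod_complexity prod_realization prod_uniqueness by simp
qed

lemma prod_hhg: "hierarchically_hyperbolic_group TYPE('s) TYPE('p) G"
proof -
 \<comment> \<open>All domains are fixed; the restriction makes the identity extensional, as
   \<open>BijGroup\<close> requires.\<close>
 define act :: "'g => 's => 's" where "act g = (\<lambda>U\<in>domains PH. U)" for g
 define isom where "isom g U p = j (im g (dl U) (inv_into UNIV j p))" for g U p
 have act: "act g U = U" if "U : domains PH" for g U unfolding act_def using that by simp
 interpret BG: group "BijGroup (domains PH)" by (rule group_BijGroup)
 have a1: "act g = \<one>\<^bsub>BijGroup (domains PH)\<^esub>" for g unfolding act_def BijGroup_def by simp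
 have "act : hom G (BijGroup (domains PH))"
  by (rule homI) (use BG.one_closed BG.r_one[OF BG.one_closed] in "simp_all only: a1")
 hence ga: "group_action G (domains PH) act"
  by (intro group_action.intro group_hom.intro group_hom_axioms.intro is_group BG.is_group)
 have "orbits G (domains PH) act = (%x. orbit G act x) ` domains PH" unfolding orbits_def by blast
 hence fo: "finite (orbits G (domains PH) act)" using fctrs_finite by simp
 have bij: "bij_betw (isom g U) (space PH U) (space PH U)" if "g : CG" "U : io ` fctrs n" for g U
 proof -
  have b: "bij_betw (im g (dl U)) (Sp (dl U)) (Sp (dl U))" by (rule im_bij[OF dl_in[OF that(2)] that(1)])
  have "isom g U ` j ` Sp (dl U) = j ` im g (dl U) ` Sp (dl U)" unfolding isom_def image_image by simp
  moreover have "inj_on (isom g U) (j ` Sp (dl U))"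
   using b j unfolding isom_def bij_betw_def inj_on_def by auto
  ultimately show ?thesis using b unfolding bij_betw_def by simp
 qed
 have "hhg_structure G S PH act isom"
  unfolding hhg_structure_def
 proof (intro conjI ballI impI prod_structure ga fo)
  fix g U assume g: "g : CG" and U: "U : domains PH"
  hence B: "dl U : fctrs n" by auto
  show "bij_betw (isom g U) (space PH U) (space PH (act g U))" using bij[OF g] U act[OF U] by simp
  show "sdist PH (act g U) (isom g U p) (isom g U q) = sdist PH U p q" if "p : space PH U" "q : space PH U" for p q
   using that im_dd[OF B g] unfolding act[OF U] isom_def by auto
  show "isom g U ` proj PH U x = proj PH (act g U) (g ** x)" if "x : CG" for x
   using im_pr[OF B g that] unfolding act[OF U] isom_def by simp
  show "isom (g ** h) U p = isom g (act h U) (isom h U p)" if "h : CG" "p : space PH U" for h p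
   using im_mult[OF B g that(1)] that(2) unfolding act[OF U] isom_def by auto
  fix V assume V: "V : domains PH"
  show "nested PH (act g U) (act g V) = nested PH U V" "orth PH (act g U) (act g V) = orth PH U V"
   "transverse PH (act g U) (act g V) = transverse PH U V" unfolding act[OF U] act[OF V] by simp_all
  assume "transverse PH U V | pnested PH U V"
  moreover have "U : io ` fctrs n" "V : io ` fctrs n" using U V by simp_all
  ultimately have "\<nexists>i. dl V = {i}" using pnested_big[of U V] transverse_big(1)[of U V] by blast
  hence "im g (dl V) (pr (dl V) \<one>) = 0" using im_pr[of "dl V" g \<one>] big_space(3)[of V g] g V by auto
  hence "im g (dl V) 0 = 0" using big_space(3)[of V \<one>] \<open>\<nexists>i. dl V = {i}\<close> V by simp
  thus "isom g V ` rho PH U V = rho PH (act g U) (act g V)" unfolding isom_def by simp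
 qed
 thus ?thesis unfolding hierarchically_hyperbolic_group_def using is_group S by blast
qed

end

section \<open>Groups acting on a tree and n lines\<close>

lemma tdist_triangle: "tdist x z <= tdist x y + tdist y z"
proof -
 have "lcp x y <= lcp x z | lcp y z <= lcp x z" using lcp_ultra[of x y z] by linarith
 hence "int (tdist x z) <= int (tdist x y) + int (tdist y z)"
  unfolding tdist_int using lcp_le[of x y] lcp_le[of y z] by linarith
 thus ?thesis by simp
qed

lemma tdist_sym: "tdist x y = tdist y x"
 unfolding tdist_def by (simp add: lcp_sym[of x])

text \<open>For partial realization, \<open>cobounded\<close> brings the root near a given vertex,
  and \<open>lattice\<close> then adjusts the lines by an element that fixes the root;
  \<open>proper\<close> yields uniqueness. The lattice is asked to lie in a subgroup with finitely
  many generators \<open>F\<close> because the group itself has to be finitely generated.\<close>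

locale tree_lines = group G + vertex_tree Om
 for G :: "('g, 'm) monoid_scheme" (structure) and Om :: "'q list set" +
 fixes act :: "'g => 'q list => 'q list" and f :: "'g => nat => real" and n :: nat
 assumes count: "countable Om"
  and act_isom: "g : CG ==> visom (act g)"
  and act_mult: "g : CG ==> h : CG ==> z : Om ==> act (g ** h) z = act g (act h z)"
  and f_mult: "g : CG ==> h : CG ==> i < n ==> f (g ** h) i = f g i + f h i"
  and cobounded: "EX D. ALL z:Om. EX g:CG. tdist (act g []) z <= D"
  and proper: "finite {g : CG. real (length (act g [])) <= C & (ALL i<n. abs(f g i) <= C)}"
  and lattice: "EX C F. finite F & F <= CG & (ALL w. EX y:generate G F. act y [] = [] & (ALL i<n. abs(f y i - w i) <= (C::real)))"
begin

lemma act_in: "g : CG ==> z : Om ==> act g z : Om"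
 using act_isom unfolding visom_def bij_betw_def by blast

lemma act_tdist: "g : CG ==> y : Om ==> z : Om ==> tdist (act g y) (act g z) = tdist y z"
 using act_isom unfolding visom_def by blast

lemma act_one: assumes "z : Om" shows "act \<one> z = z"
proof -
 have "act \<one> (act \<one> z) = act \<one> z" using act_mult[of \<one> \<one> z] assms by simp
 moreover have "inj_on (act \<one>) Om" using act_isom[of \<one>] unfolding visom_def bij_betw_def by simp
 ultimately show ?thesis using assms act_in[of \<one> z] by (meson inj_onD one_closed)
qed

lemma act_inv: "g : CG ==> z : Om ==> act (inv g) (act g z) = z"
 using act_mult[of "inv g" g z] act_one[of z] by simp

lemma f_one: "i < n ==> f \<one> i = 0" using f_mult[of \<one> \<one> i] by simp
lemma f_inv: "g : CG ==> i < n ==> f (inv g) i = - f g i"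
 using f_mult[of "inv g" g i] f_one[of i] by simp

lemma orbit_dist: assumes "g : CG" "h : CG" shows "length (act (inv g ** h) []) = tdist (act g []) (act h [])"
proof -
 have "tdist [] (act (inv g ** h) []) = tdist (act g []) (act g (act (inv g ** h) []))"
  using act_tdist[of g "[]" "act (inv g ** h) []"] assms nil act_in by simp
 also have "act g (act (inv g ** h) []) = act h []" using act_mult[of g "inv g ** h" "[]"] assms nil by (simp add: m_assoc[symmetric])
 finally show ?thesis by simp
qed

text \<open>The argument of Milnor and Svarc, along the geodesic in the tree from the root to its image.\<close>

lemma finitely_generated: "EX S. finite S & S <= CG & generate G S = CG"
proof -
 obtain D where D: "!!z. z : Om ==> EX g:CG. tdist (act g []) z <= D" using cobounded by blast
 obtain C :: real and F where F: "finite F" "F <= CG" "!!w. EX y:generate G F. act y [] = [] & (ALL i<n. abs(f y i - w i) <= C)"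
  using lattice by blast
 define C' where "C' = max (real (2 * D + 1)) C"
 define S where "S = {g : CG. real (length (act g [])) <= C' & (ALL i<n. abs(f g i) <= C')} \<union> F"
 have Sc: "S <= CG" unfolding S_def using F(2) by blast
 have Fc: "generate G F <= CG" by (rule generate_incl[OF F(2)])
 have FS: "generate G F <= generate G S" by (rule mono_generate) (simp add: S_def)
 \<comment> \<open>Correcting \<open>u\<close> by a lattice element, which fixes the root, makes all
   its line coordinates small, so that the corrected element belongs to \<open>S\<close>.\<close>
 have small: "u : generate G S" if u: "u : CG" "length (act u []) <= 2 * D + 1" for u
 proof -
  obtain y where y: "y : generate G F" "act y [] = []" "!!i. i < n ==> abs(f y i - f u i) <= C" using F(3)[of "f u"] by blast
  have yc: "y : CG" using y(1) Fc by blast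
  have "act (inv y) [] = []" using act_inv[OF yc nil] y(2) by simp
  hence "act (u ** inv y) [] = act u []" using act_mult[OF u(1) _ nil, of "inv y"] yc by simp
  moreover have "real (length (act u [])) <= C'" unfolding C'_def using u(2) by linarith
  moreover have "abs(f (u ** inv y) i) <= C'" if "i < n" for i
   using y(3)[OF that] f_mult[OF u(1) _ that, of "inv y"] f_inv[OF yc that] yc unfolding C'_def by simp
  ultimately have "u ** inv y : S" unfolding S_def using u(1) yc by simp
  hence "(u ** inv y) ** y : generate G S" using y(1) FS by (meson generate.incl generate.eng subsetD)
  thus ?thesis using u(1) yc by (simp add: m_assoc)
 qed
 have "g : generate G S" if g: "g : CG" for g
 proof -
  define w where "w = act g []"
  have w: "w : Om" unfolding w_def by (rule act_in[OF g nil])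
  have "k <= length w ==> EX h:generate G S. tdist (act h []) (take k w) <= D" for k
  proof (induction k)
   case 0
   show ?case using act_one[OF nil] generate.one by (intro bexI[of _ \<one>]) auto
  next
   case (Suc k)
   then obtain h where h: "h : generate G S" "tdist (act h []) (take k w) <= D" by auto
   have hc: "h : CG" using h(1) generate_incl[OF Sc] by blast
   obtain h' where h': "h' : CG" "tdist (act h' []) (take (Suc k) w) <= D" using D[OF take_closed[OF w]] by blast
   have "int (tdist (take k w) (take (Suc k) w)) = 1"
   unfolding tdist_int lcp_take using lcp_take[of "Suc k" w w] lcp_sym[of w "take (Suc k) w"] Suc.prems by simp
   hence "tdist (take k w) (take (Suc k) w) = 1" by simp
   hence "tdist (act h []) (act h' []) <= 2 * D + 1"
   using tdist_triangle[of "act h []" "act h' []" "take k w"] tdist_triangle[of "take k w" "act h' []" "take (Suc k) w"]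
   h(2) h'(2) tdist_sym[of "act h' []" "take (Suc k) w"] by linarith
   hence "inv h ** h' : generate G S" using small[of "inv h ** h'"] orbit_dist[OF hc h'(1)] hc h'(1) by simp
   hence "h ** (inv h ** h') : generate G S" using h(1) generate.eng by metis
   hence "h' : generate G S" using hc h'(1) by (simp add: m_assoc[symmetric])
   thus ?case using h'(2) by blast
  qed
  from this[of "length w"] obtain h where h: "h : generate G S" "tdist (act h []) (act g []) <= D" unfolding w_def by auto
  have hc: "h : CG" using h(1) generate_incl[OF Sc] by blast
  have "inv h ** g : generate G S" using small[of "inv h ** g"] orbit_dist[OF hc g] hc g h(2) by simp
  hence "h ** (inv h ** g) : generate G S" using h(1) generate.eng by metis
  thus ?thesis using hc g by (simp add: m_assoc[symmetric])
 qed
 hence "generate G S = CG" using generate_incl[OF Sc] by blast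
 moreover have "finite S" unfolding S_def using proper F(1) by simp
 ultimately show ?thesis using Sc by blast
qed

text \<open>Points of the tree are coded by reals, as a vertex has a number and \<open>t\<close> lies in \<open>[0, 1)\<close>.\<close>

definition rt :: "'q tpoint => real" where "rt p = real (to_nat_on Om (fst p)) + snd p"

lemma rt_inj: "inj_on rt pts"
proof (rule inj_onI)
 fix p q assume pq: "p : pts" "q : pts" "rt p = rt q"
 have b: "0 <= snd p" "snd p < 1" "0 <= snd q" "snd q < 1" "fst p : Om" "fst q : Om" using pq(1,2) unfolding pts_def by auto
 have "abs(real (to_nat_on Om (fst p)) - real (to_nat_on Om (fst q))) < 1" using pq(3) b unfolding rt_def by linarith
 hence e: "to_nat_on Om (fst p) = to_nat_on Om (fst q)" by linarith
 hence "fst p = fst q" using b(5,6) count by simp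
 thus "p = q" using pq(3) e unfolding rt_def by (simp add: prod_eq_iff)
qed

abbreviation "unrt == inv_into pts rt"
lemma unrt [simp]: "p : pts ==> unrt (rt p) = p" using rt_inj by simp

lemma rt_geodesic: "geodesic_space (rt ` pts) (%a b. td (unrt a) (unrt b))"
 by (rule geodesic_transport[OF _ td_geodesic]) simp

lemma rt_four_point: "four_point (rt ` pts) (%a b. td (unrt a) (unrt b))"
 using td_four_point unfolding four_point_def by auto

text \<open>Factor \<open>0\<close> is the tree, and factor \<open>Suc i\<close> is the line with
  coordinate \<open>i\<close>.\<close>

definition line :: "nat set => bool" where "line B \<longleftrightarrow> (EX i<n. B = {Suc i})"
definition lidx :: "nat set => nat" where "lidx B = the_elem B - 1"

lemma line_simps [simp]: "i < n ==> line {Suc i}" "lidx {Suc i} = i" "~ line {0}" "line B ==> lidx B < n"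
 unfolding line_def lidx_def by auto

definition Sp :: "nat set => real set" where "Sp B = (if B = {0} then rt ` pts else if line B then UNIV else {0})"
definition dd :: "nat set => real => real => real" where "dd B = (if B = {0} then (%a b. td (unrt a) (unrt b)) else (%a b. abs(a - b)))"
definition pr :: "nat set => 'g => real" where
 "pr B g = (if B = {0} then rt (act g [], 0) else if line B then f g (lidx B) else 0)"
definition im :: "'g => nat set => real => real" where
 "im g B a = (if B = {0} then rt (ext (act g) (unrt a)) else if line B then f g (lidx B) + a else a)"

lemma root_pt: "g : CG ==> (act g [], 0) : pts" by (rule vertex_pt[OF act_in[OF _ nil]])

lemma ext_act_mult: "g : CG ==> h : CG ==> p : pts ==> ext (act (g ** h)) p = ext (act g) (ext (act h) p)"
 by (rule ext_comp) (use act_isom act_mult in auto)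

lemma ext_act_inv: assumes "g : CG" "p : pts" shows "ext (act g) (ext (act (inv g)) p) = p"
 using ext_act_mult[of g "inv g" p] ext_id[of "act \<one>" p] act_isom act_one assms by simp

lemma pr_dist:
 assumes "g : CG" "h : CG"
 shows "dd B (pr B g) (pr B h) = (if B = {0} then real (length (act (inv g ** h) [])) else if line B then abs(f (inv g ** h) (lidx B)) else 0)"
proof -
 have "td (act g [], 0) (act h [], 0) = real (length (act (inv g ** h) []))"
  using vdist_vertex[of "act g []" "act h []"] orbit_dist[OF assms] unfolding vdist_def by simp
 moreover have "f (inv g ** h) i = f h i - f g i" if "i < n" for i using f_mult[of "inv g" h i] f_inv[of g i] assms that by simp
 ultimately show ?thesis unfolding dd_def pr_def using root_pt assms by (simp add: abs_minus_commute)
qed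

lemma tree_lines_family:
 assumes S: "finite S" "S <= CG" "generate G S = CG" and j: "inj j" and io: "inj_on io (fctrs n)"
 shows "product_family G S n Sp dd pr im j io"
proof (intro product_family.intro product_family_axioms.intro S j io is_group)
 fix B assume B: "B : fctrs n"
 show "geodesic_space (Sp B) (dd B)"
  unfolding Sp_def dd_def using rt_geodesic line_geodesic point_geodesic by simp
 show "four_point (Sp B) (dd B)"
  unfolding Sp_def dd_def using rt_four_point line_four_point by simp
 show "Sp B = {0}" if "\<nexists>i. B = {i}" using that unfolding Sp_def line_def by auto
 fix g assume g: "g : CG"
 note eg = ext(1)[OF act_isom[OF g]]
 show "pr B g : Sp B" unfolding pr_def Sp_def using root_pt[OF g] by simp
 show "bij_betw (im g B) (Sp B) (Sp B)"
 proof (rule bij_betw_byWitness[where f' = "im (inv g) B"])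
  have "im g B ` Sp B <= Sp B" if "g : CG" for g
   unfolding im_def Sp_def using ext(1)[OF act_isom[OF that]] by auto
  thus "im g B ` Sp B <= Sp B" "im (inv g) B ` Sp B <= Sp B" using g by auto
  have "im g B (im (inv g) B a) = a" if "g : CG" "a : Sp B" for g a
   using that ext_act_inv[OF that(1)] ext(1)[OF act_isom[of "inv g"]] f_inv[OF that(1)] unfolding im_def Sp_def by (auto split: if_splits)
  from this[of g] this[of "inv g"] show "ALL a:Sp B. im (inv g) B (im g B a) = a" "ALL a:Sp B. im g B (im (inv g) B a) = a"
   using g by simp_all
 qed
 show "dd B (im g B p) (im g B q) = dd B p q" if "p : Sp B" "q : Sp B" for p q
  using that ext_td[OF act_isom[OF g]] eg unfolding dd_def im_def Sp_def by (auto split: if_splits)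
 fix h assume h: "h : CG"
 show "im (g ** h) B p = im g B (im h B p)" if "p : Sp B" for p
  using that ext_act_mult[OF g h] ext(1)[OF act_isom[OF h]] f_mult[OF g h] unfolding im_def Sp_def by (auto split: if_splits)
 show "im g B (pr B h) = pr B (g ** h)"
  using ext_vertex[OF act_isom[OF g] act_in[OF h nil]] root_pt[OF h] act_mult[OF g h nil] f_mult[OF g h] unfolding im_def pr_def by simp
next
 define N where "N s = real (length (act s [])) + (\<Sum>i<n. abs(f s i))" for s
 define K where "K = (\<Sum>s\<in>letters S. N s)"
 have fl: "finite (letters S)" unfolding letters_def using S(1) by simp
 have N0: "0 <= N s" for s unfolding N_def by (simp add: sum_nonneg)
 have NK: "N s <= K" if "s : letters S" for s unfolding K_def using N0 by (intro member_le_sum[OF that _ fl]) auto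
 have fN: "abs(f s i) <= N s" if "i < n" for s i
  unfolding N_def using member_le_sum[of i "{..<n}" "%i. abs(f s i)"] that by simp
 have lN: "real (length (act s [])) <= N s" for s unfolding N_def by (simp add: sum_nonneg)
 have "dd B (pr B g) (pr B h) <= K * word_metric G S g h" if gh: "g : CG" "h : CG" for B g h
 proof (rule word_metric_lipschitz[OF S(2,3), of "%g h. dd B (pr B g) (pr B h)"])
  show "dd B (pr B x) (pr B z) <= dd B (pr B x) (pr B y) + dd B (pr B y) (pr B z)" if "x : CG" "y : CG" "z : CG" for x y z
   using td_triangle[of "(act x [], 0)" "(act z [], 0)" "(act y [], 0)"] root_pt that
   abs_triangle_ineq[of "f x (lidx B) - f y (lidx B)" "f y (lidx B) - f z (lidx B)"] unfolding dd_def pr_def by simp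
  show "dd B (pr B x) (pr B x) = 0" if "x : CG" for x using pr_dist[OF that that] that act_one[OF nil] f_one by simp
  show "dd B (pr B (g ** x)) (pr B (g ** y)) = dd B (pr B x) (pr B y)" if "g : CG" "x : CG" "y : CG" for g x y
  proof -
   have "inv (g ** x) ** (g ** y) = inv x ** y" using that by (simp add: inv_mult_group m_assoc)
   thus ?thesis using pr_dist[of "g ** x" "g ** y" B] pr_dist[OF that(2,3), of B] that by simp
  qed
  show "dd B (pr B \<one>) (pr B s) <= K" if s: "s : letters S" for s
   using pr_dist[of \<one> s B] letters_carr[OF S(2)] s NK[OF s] lN[of s] fN[of "lidx B" s] N0[of s] by (auto split: if_splits)
 qed (use gh in auto)
 moreover have "0 <= K" unfolding K_def using N0 by (simp add: sum_nonneg)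
 ultimately show "EX K>=0. ALL B:fctrs n. ALL g:CG. ALL h:CG. dd B (pr B g) (pr B h) <= K * word_metric G S g h" by blast
next
 obtain D where D: "!!z. z : Om ==> EX g:CG. tdist (act g []) z <= D" using cobounded by blast
 obtain C :: real and F where F: "finite F" "F <= CG" "!!w. EX y:generate G F. act y [] = [] & (ALL i<n. abs(f y i - w i) <= C)"
  using lattice by blast
 define al where "al = max (real D + 1) C"
 have "EX g:CG. ALL B:fctrs n. dd B (pr B g) (q B) <= al" if q: "ALL B:fctrs n. q B : Sp B" for q
 proof -
  have "{0} : fctrs n" unfolding fctrs_def by simp
  from bspec[OF q this] have "q {0} : rt ` pts" unfolding Sp_def by simp
  then obtain p where p: "p : pts" "q {0} = rt p" by blast
  have pO: "fst p : Om" "0 <= snd p" "snd p < 1" using p(1) unfolding pts_def by auto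
  obtain g where g: "g : CG" "tdist (act g []) (fst p) <= D" using D[OF pO(1)] by blast
  obtain y where y: "y : generate G F" "act y [] = []" "!!i. i < n ==> abs(f y i - (q {Suc i} - f g i)) <= C"
   using F(3)[of "%i. q {Suc i} - f g i"] by blast
  have yc: "y : CG" using y(1) generate_incl[OF F(2)] by blast
  have a: "act (g ** y) [] = act g []" using act_mult[OF g(1) yc nil] y(2) by simp
  have "td (fst p, 0) p = snd p" using pO unfolding td_def gp_def ht_def by simp
  hence "td (act g [], 0) p <= real D + 1"
   using td_triangle[of "(act g [], 0)" p "(fst p, 0)"] vdist_vertex[of "act g []" "fst p"] g(2) pO(3) unfolding vdist_def by linarith
  hence 0: "td (act (g ** y) [], 0) p <= al" unfolding a al_def by simp
  have l: "abs(f (g ** y) i - q {Suc i}) <= al" if "i < n" for i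
   using y(3)[OF that] f_mult[OF g(1) yc that] unfolding al_def by simp
  have gy: "g ** y : CG" using g(1) yc by simp
  have "dd B (pr B (g ** y)) (q B) <= al" if B: "B : fctrs n" for B
  proof -
   consider "B = {0}" | "line B" "B ~= {0}" | "~ line B" "B ~= {0}" by blast
   thus ?thesis
   proof cases
   case 1
   thus ?thesis using 0 p root_pt[OF gy] unfolding dd_def pr_def by simp
   next
   case 2
   then obtain i where "i < n" "B = {Suc i}" unfolding line_def by blast
   thus ?thesis using l[of i] unfolding dd_def pr_def by simp
   next
   case 3
   hence "q B = 0" using bspec[OF q B] unfolding Sp_def by simp
   thus ?thesis using 3 unfolding dd_def pr_def al_def by simp
   qed
  qed
  thus ?thesis using gy by blast
 qed
 moreover have "0 <= al" unfolding al_def by simp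
 ultimately show "EX al>=0. ALL q. (ALL B:fctrs n. q B : Sp B) --> (EX g:CG. ALL B:fctrs n. dd B (pr B g) (q B) <= al)" by blast
next
 show "ALL kp>=0. EX tht. ALL g:CG. ALL h:CG. tht <= word_metric G S g h --> (EX B:fctrs n. kp <= dd B (pr B g) (pr B h))"
 proof (intro allI impI)
  fix kp :: real assume "0 <= kp"
  let ?X = "{g : CG. real (length (act g [])) <= kp & (ALL i<n. abs(f g i) <= kp)}"
  \<comment> \<open>Exceeds the word length of each of the finitely many elements whose
    displacements in all factors are at most \<open>kp\<close>.\<close>
  define tht where "tht = (\<Sum>g\<in>?X. real (word_length G S g)) + 1"
  have "EX B:fctrs n. kp <= dd B (pr B g) (pr B h)" if gh: "g : CG" "h : CG" "tht <= word_metric G S g h" for g h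
  proof (rule ccontr)
   assume "~ ?thesis"
   hence c: "dd B (pr B g) (pr B h) < kp" if "B : fctrs n" for B using that by force
   have "{0} : fctrs n" unfolding fctrs_def by simp
   hence "real (length (act (inv g ** h) [])) <= kp" using c[of "{0}"] pr_dist[OF gh(1,2), of "{0}"] by simp
   moreover have "abs(f (inv g ** h) i) <= kp" if i: "i < n" for i
   proof -
   have "{Suc i} : fctrs n" unfolding fctrs_def using i by simp
   thus ?thesis using c[of "{Suc i}"] pr_dist[OF gh(1,2), of "{Suc i}"] i by simp
   qed
   ultimately have "inv g ** h : ?X" using gh by simp
   hence "real (word_length G S (inv g ** h)) <= (\<Sum>g\<in>?X. real (word_length G S g))"
   by (rule member_le_sum) (use proper in auto)
   thus False using gh unfolding tht_def word_metric_def by simp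
  qed
  thus "EX tht. ALL g:CG. ALL h:CG. tht <= word_metric G S g h --> (EX B:fctrs n. kp <= dd B (pr B g) (pr B h))" by blast
 qed
qed

theorem tree_lines_hhg:
 assumes "infinite (UNIV :: 's set)" "EX j :: real => 'p. inj j"
 shows "hierarchically_hyperbolic_group TYPE('s) TYPE('p) G"
proof -
 obtain S where S: "finite S" "S <= CG" "generate G S = CG" using finitely_generated by blast
 obtain j :: "real => 'p" where j: "inj j" using assms(2) by blast
 have "finite (fctrs n)" unfolding fctrs_def by simp
 moreover obtain X :: "'s set" where "finite X" "card X = card (fctrs n)" using infinite_arbitrarily_large[OF assms(1)] by blast
 ultimately obtain io :: "nat set => 's" where "bij_betw io (fctrs n) X" using finite_same_card_bij by metis
 hence io: "inj_on io (fctrs n)" unfolding bij_betw_def by blast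
 interpret product_family G S n Sp dd pr im j io by (rule tree_lines_family[OF S j io])
 show ?thesis by (rule prod_hhg)
qed

end

section \<open>The action of the fundamental group on the normal forms\<close>

context gog_paths
begin

lemma red_take: "red u L ==> red u (take k L)"
proof (induction u L arbitrary: k rule: red.induct)
 case (2 u c e L)
 show ?case
 proof (cases k)
  case 0
  thus ?thesis using red_verts[OF 2(2)] by simp
 next
  case (Suc l)
  have "~ starts (rv e) (take l L)" if "~ starts (rv e) L"
   using that unfolding starts_def by (cases L; cases l) auto
  thus ?thesis using 2 Suc by simp
 qed
qed simp

end

context gbs_group
begin

text \<open>The image of the edge group contains all \<open>m\<close>-th powers of the vertex group,
  so representatives are separated by their coordinates modulo \<open>m\<close>. This is the local
  finiteness of the tree.\<close>

lemma rep_finite: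
 assumes e: "e : Es" shows "finite {c : carrier (vs e). rep e c = c}"
proof -
 have u: "src e : Vs" and e': "rv e : Es" using e by auto
 interpret U: group "vs e" by (rule vgg[OF u])
 interpret Z: group "Z_power n" by simp
 obtain m :: nat where m: "m >= 1" "!!c. c : carrier (vs e) ==> EX b:carrier (eg (rv e)). c [^]\<^bsub>vs e\<^esub> m = em (rv e) b"
  using emb_cofinal[OF e'] e by auto
 have pm: "c [^]\<^bsub>vs e\<^esub> m : img e" if "c : carrier (vs e)" for c
  using m(2)[OF that] egrp_erev[OF e] unfolding img_def by auto
 obtain k where k: "k : iso (vs e) (Z_power n)" using vgrp_iso[OF u] unfolding is_iso_def by blast
 have kh: "group_hom (vs e) (Z_power n) k"
  using k unfolding iso_def by (intro group_hom.intro group_hom_axioms.intro U.is_group Z.is_group) auto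
 have kc: "k c : {..<n} \<rightarrow>\<^sub>E UNIV" if "c : carrier (vs e)" for c using k that unfolding iso_def hom_def by auto
 let ?R = "{c : carrier (vs e). rep e c = c}" and ?F = "%c. \<lambda>i\<in>{..<n}. k c i mod int m"
 have "inj_on ?F ?R"
 proof (rule inj_onI)
  fix c d assume cd: "c : ?R" "d : ?R" "?F c = ?F d"
  hence cdc: "c : carrier (vs e)" "d : carrier (vs e)" by auto
  define t where "t = (\<lambda>i\<in>{..<n}. (k c i - k d i) div int m)"
  have mt: "int m * t i = k c i - k d i" if "i < n" for i
  proof -
   have "k c i mod int m = k d i mod int m" using fun_cong[OF cd(3), of i] that by simp
   hence "int m dvd k c i - k d i" by (simp add: mod_eq_dvd_iff)
   thus ?thesis unfolding t_def using that by simp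
  qed
  have tZ: "t : carrier (Z_power n)" unfolding t_def by auto
  have "t : k ` carrier (vs e)" using k tZ unfolding iso_def bij_betw_def by blast
  then obtain z where z: "z : carrier (vs e)" "k z = t" by blast
  have zm: "z [^]\<^bsub>vs e\<^esub> m : carrier (vs e)" using z(1) by simp
  have "k (d **\<^bsub>vs e\<^esub> z [^]\<^bsub>vs e\<^esub> m) = k d **\<^bsub>Z_power n\<^esub> (t [^]\<^bsub>Z_power n\<^esub> m)"
   using group_hom.hom_mult[OF kh cdc(2) zm] group_hom.hom_nat_pow[OF kh z(1), of m] z(2) by simp
  also have "... = k c"
  proof (rule PiE_ext[of _ "{..<n}" "%_. UNIV"])
   show "(k d **\<^bsub>Z_power n\<^esub> (t [^]\<^bsub>Z_power n\<^esub> m)) i = k c i" if "i : {..<n}" for i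
   using mt[of i] that Z_power_pow[OF tZ, of i m] by simp
  qed (use kc[OF cdc(1)] in auto)
  finally have "d **\<^bsub>vs e\<^esub> z [^]\<^bsub>vs e\<^esub> m = c"
   using k zm cdc unfolding iso_def bij_betw_def inj_on_def by simp
  hence "rep e c = rep e d" using rep_coset[OF e cdc(2) pm[OF z(1)]] by simp
  thus "c = d" using cd by simp
 qed
 moreover have "?F ` ?R <= {..<n} \<rightarrow>\<^sub>E {0..<int m}"
  by (intro image_subsetI restrict_PiE_iff[THEN iffD2] ballI) (use m(1) in simp)
 hence "finite (?F ` ?R)" by (rule finite_subset) (simp add: finite_PiE)
 ultimately show ?thesis by (rule finite_imageD[rotated])
qed

lemma red_finite: "finite {L. red u L & length L <= N}"
proof (induction N arbitrary: u)
 case 0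
 have "{L. red u L & length L <= 0} <= {[]}" by auto
 thus ?case using finite_subset by blast
next
 case (Suc N)
 let ?X = "\<Union>e\<in>Es. (%(c, L). (c, e) # L) ` ({c : carrier (vs e). rep e c = c} \<times> {L. red (tgt e) L & length L <= N})"
 have "finite (Es)" using fin_digraph.finite_arcs[OF fin] .
 hence "finite ?X" using rep_finite Suc by auto
 moreover have "{L. red u L & length L <= Suc N} <= insert [] ?X"
 proof
  fix L assume L: "L : {L. red u L & length L <= Suc N}"
  show "L : insert [] ?X"
  proof (cases L)
   case (Cons ce M)
   obtain c e where "ce = (c, e)" by (cases ce)
   thus ?thesis using L Cons by (auto intro!: bexI[of _ e] image_eqI[of _ _ "(c, M)"])
  qed simp
 qed
 ultimately show ?case using finite_subset by blast
qed

lemma red_countable: "countable {L. red u L}"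
proof -
 have "{L. red u L} = (\<Union>N. {L. red u L & length L <= N})" by auto
 moreover have "countable (\<Union>N. {L. red u L & length L <= N})"
  by (intro countable_UN countableI_type countable_finite[OF red_finite])
 ultimately show ?thesis by simp
qed

end

context gog_group
begin

definition gact :: "'g => ('a \<times> 'e) list => ('a \<times> 'e) list" where
 "gact g L = snd (wact (SOME p. gpa v p v & \<phi> g = cls p) (v, L))"

lemma gact_eq:
 assumes "gpa v p v" "\<phi> g = cls p" "red v L" shows "gact g L = snd (wact p (v, L))"
proof -
 let ?q = "SOME p. gpa v p v & \<phi> g = cls p"
 have "gpa v ?q v & \<phi> g = cls ?q" by (rule someI[of _ p]) (use assms in auto)
 hence "geq ?q p" using assms(2) gog_class_eq_iff by metis
 thus ?thesis unfolding gact_def using wact_gog_eq[of ?q p "(v, L)"] assms(3) by simp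
qed

lemma gact_red: assumes "g : CG" "red v L" shows "red v (gact g L)"
proof -
 obtain p where p: "gpa v p v" "\<phi> g = cls p" using elem_surj[OF assms(1)] by blast
 thus ?thesis using gact_eq[OF p assms(2)] wact_red[of "(v, L)" p] wact_path_fst[OF p(1), of L] assms(2) by simp
qed

lemma gact_mult: assumes "g : CG" "h : CG" "red v L" shows "gact (g ** h) L = gact g (gact h L)"
proof -
 obtain p where p: "gpa v p v" "\<phi> g = cls p" using elem_surj[OF assms(1)] by blast
 obtain q where q: "gpa v q v" "\<phi> h = cls q" using elem_surj[OF assms(2)] by blast
 have "\<phi> (g ** h) = cls (p @ q)" using phi_mult[OF assms(1,2)] p q gog_mult_class by simp
 hence "gact (g ** h) L = snd (wact (p @ q) (v, L))" by (rule gact_eq[OF path_app[OF p(1) q(1)] _ assms(3)])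
 moreover have "wact q (v, L) = (v, gact h L)" using gact_eq[OF q assms(3)] wact_path_fst[OF q(1), of L] by (simp add: prod_eq_iff)
 ultimately show ?thesis using gact_eq[OF p gact_red[OF assms(2,3)]] by simp
qed

lemma gact_tdist: assumes "g : CG" "red v L" "red v M" shows "tdist (gact g L) (gact g M) = tdist L M"
proof -
 obtain p where p: "gpa v p v" "\<phi> g = cls p" using elem_surj[OF assms(1)] by blast
 show ?thesis using gact_eq[OF p] wact_path_tdist[OF p(1)] assms(2,3) by simp
qed

lemma gact_one: assumes "red v L" shows "gact \<one> L = L"
proof -
 have "\<phi> \<one> = cls []" using elem(2)[OF gog_path.path_Nil[OF v]] elem_Nil[OF v] by simp
 thus ?thesis using gact_eq[OF gog_path.path_Nil[OF v] _ assms] by simp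
qed

lemma gact_bij: assumes "g : CG" shows "bij_betw (gact g) {L. red v L} {L. red v L}"
proof (rule bij_betw_byWitness[where f' = "gact (inv g)"])
 show "ALL L:{L. red v L}. gact (inv g) (gact g L) = L" "ALL L:{L. red v L}. gact g (gact (inv g) L) = L"
  using gact_mult[of "inv g" g] gact_mult[of g "inv g"] gact_one assms by auto
qed (use gact_red assms in auto)

lemma red_root: "red v []" using v by simp

lemma gact_root_stabilizer: assumes "g : CG" shows "gact g [] = [] \<longleftrightarrow> g : VG v"
proof
 assume a: "gact g [] = []"
 obtain p where p: "gpa v p v" "\<phi> g = cls p" using elem_surj[OF assms] by blast
 have "snd (wact p (v, [])) = []" using gact_eq[OF p red_root] a by simp
 then obtain d where d: "d : carrier (vg v)" "geq p [Elt v d]" using path_normal_form[OF p(1)] by auto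
 have "\<phi> g = cls (pth v @ [Elt v d] @ winv (pth v))" unfolding p(2) gog_class_eq_iff using d(2) by simp
 hence "g = ve v d" unfolding ve_def by (rule elem_unique[OF assms])
 thus "g : VG v" unfolding VG_def using d(1) by blast
next
 assume "g : VG v"
 then obtain b where b: "b : carrier (vg v)" "g = ve v b" unfolding VG_def by auto
 have "\<phi> g = cls [Elt v b]" using elem(2)[OF pathl(1)[OF v b(1)]] b(2) unfolding ve_def by simp
 thus "gact g [] = []" using gact_eq[OF pathl(1)[OF v b(1)] _ red_root] by (simp split: if_splits)
qed

text \<open>The word of a normal form that ends over \<open>w\<close>, followed by the chosen path
  from \<open>w\<close> back to \<open>v\<close>, is an element taking the root near that normal
  form. The error depends only on \<open>w\<close>.\<close>

lemma gact_cobounded: assumes "finite (Vs)" shows "EX D. ALL z. red v z --> (EX g:CG. tdist (gact g []) z <= D)"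
proof -
 define l where "l w = length (snd (wact (winv (pth w)) (v, [])))" for w
 define D where "D = (\<Sum>w\<in>Vs. l w)"
 have "EX g:CG. tdist (gact g []) z <= D" if z: "red v z" for z
 proof -
  define w where "w = endv v z"
  have p: "gpa v (wrd z) w" unfolding w_def by (rule wrd_path[OF z])
  have w: "w : Vs" using path_verts[OF p] by simp
  have q: "gpa w (winv (pth w)) v" by (rule winv_path[OF pth[OF w]])
  have pq: "gpa v (wrd z @ winv (pth w)) v" by (rule path_app[OF p q])
  define g where "g = elem v (wrd z @ winv (pth w)) v"
  have g: "g : CG" "\<phi> g = cls (wrd z @ winv (pth w))" using elem[OF pq] unfolding g_def by simp_all
  obtain M where M: "wact (winv (pth w)) (v, []) = (w, M)" using wact_path_fst[OF q] by (metis prod.collapse)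
  have rM: "red w M" using wact_red[of "(v, [])" "winv (pth w)"] M red_root by simp
  have "gact g [] = snd (wact (wrd z) (w, M))" using gact_eq[OF pq g(2) red_root] M by simp
  moreover have "z = snd (wact (wrd z) (w, []))" using wrd_wact[OF z] unfolding w_def by simp
  ultimately have "tdist (gact g []) z = tdist M []" using wact_path_tdist[OF p rM, of "[]"] w by (metis red.simps(1))
  also have "... = l w" unfolding l_def M tdist_def by simp
  also have "... <= D" unfolding D_def using w assms by (intro member_le_sum) auto
  finally show ?thesis using g(1) by blast
 qed
 thus ?thesis by blast
qed

end

section \<open>The kernel of the modular homomorphism and the equivalence\<close>

context gbs_base
begin

lemma cen_carrier: "g : cen ==> g : CG" using subgroup.mem_carrier[OF cen_subgroup] .

text \<open>Elements that take the root to the same vertex differ by an element of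
  \<open>VG v\<close>, whose coordinates are bounded because \<open>tr\<close> is additive; and only
  finitely many vertices lie within \<open>C\<close> of the root.\<close>

lemma cen_proper: "finite {g : cen. real (length (gact g [])) <= C & (ALL i<n. abs(tr g i) <= C)}"
proof -
 define X where "X = {g : cen. real (length (gact g [])) <= C & (ALL i<n. abs(tr g i) <= C)}"
 have "finite {g : X. gact g [] = w}" for w
 proof (cases "{g : X. gact g [] = w} = {}")
  case False
  then obtain h where h: "h : X" "gact h [] = w" by blast
  have hc: "h : cen" "h : CG" using h cen_carrier unfolding X_def by auto
  have "{g : X. gact g [] = w} <= (%y. h ** y) ` {y : VG v. ALL i<n. abs(vec y i) <= 2 * C}"
  proof
   fix g assume g: "g : {g : X. gact g [] = w}"
   hence gc: "g : cen" "g : CG" using cen_carrier unfolding X_def by auto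
   define y where "y = inv h ** g"
   have yc: "y : CG" unfolding y_def using hc gc by simp
   have hy: "h ** y = g" unfolding y_def using hc gc by simp
   have "gact y [] = gact (inv h) (gact h [])" unfolding y_def using gact_mult[of "inv h" g "[]"] g h hc gc red_root by simp
   also have "... = []" using gact_mult[of "inv h" h "[]"] gact_one hc red_root by simp
   finally have yV: "y : VG v" using gact_root_stabilizer[OF yc] by simp
   have "abs(vec y i) <= 2 * C" if i: "i < n" for i
   proof -
   have "tr g i = tr h i + vec y i" using tr_cen_mult[OF hc(1) yc, of i] tr_VG[OF yV] hy by simp
   moreover have "abs(tr g i) <= C" "abs(tr h i) <= C" using g h i unfolding X_def by auto
   ultimately show ?thesis by linarith
   qed
   thus "g : (%y. h ** y) ` {y : VG v. ALL i<n. abs(vec y i) <= 2 * C}" using yV hy by blast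
  qed
  thus ?thesis using finite_subset VG_vec_finite by blast
 qed (simp only: finite.emptyI)
 moreover have "X <= (\<Union>w\<in>{L. red v L & length L <= nat \<lfloor>C\<rfloor>}. {g : X. gact g [] = w})"
 proof
  fix g assume g: "g : X"
  have "length (gact g []) <= nat \<lfloor>C\<rfloor>" using g unfolding X_def by (simp add: le_nat_floor)
  moreover have "red v (gact g [])" using gact_red[OF cen_carrier red_root] g unfolding X_def by blast
  ultimately show "g : (\<Union>w\<in>{L. red v L & length L <= nat \<lfloor>C\<rfloor>}. {g : X. gact g [] = w})" using g by blast
 qed
 ultimately have "finite X" using red_finite finite_subset by blast
 thus ?thesis unfolding X_def .
qed

text \<open>The powers \<open>a j [^] m\<close> lie in \<open>VG v\<close>, so they fix the root,
  and they translate by \<open>m\<close> times the unit vectors. Rounding \<open>w\<close> to the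
  lattice they span costs at most \<open>m\<close>.\<close>

lemma cen_lattice:
 "EX C F. finite F & F <= cen & (ALL w. EX y:generate (G(|carrier := cen|)) F. gact y [] = [] & (ALL i<n. abs(tr y i - w i) <= (C::real)))"
proof -
 obtain m :: nat where m: "m >= 1" "!!y. y : A ==> y [^] m : VG v" using A_pow_in_VG by blast
 let ?F = "{a j [^] m | j. j < n}"
 have F: "?F <= cen" using m(2) a_in VG_cen by blast
 have gen: "generate (G(|carrier := cen|)) ?F = generate G ?F" by (rule generate_consistent[OF F cen_subgroup])
 have "EX y:generate G ?F. gact y [] = [] & (ALL i<n. abs(tr y i - w i) <= real m)" for w
 proof -
  define k where "k i = \<lfloor>w i / m\<rfloor>" for i
  define y where "y = monomial n G a (%i. int m * k i)"
  have yA: "y : A" unfolding y_def by simp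
  have "y = monomial n G a k [^] m" unfolding y_def mono_pow by (simp add: int_pow_int)
  hence yV: "y : VG v" using m(2)[OF mono_in] by simp
  have "abs(tr y i - w i) <= real m" if i: "i < n" for i
  proof -
   have "tr y i = real m * of_int (k i)" using tr_VG[OF yV] vec_A[OF yA i] crd_unique[OF y_def[symmetric] i] by simp
   moreover have "w i / m - 1 <= of_int (k i)" "of_int (k i) <= w i / m" unfolding k_def by linarith+
   hence "w i - m <= m * of_int (k i)" "m * of_int (k i) <= w i" using m(1) by (auto simp: field_simps)
   ultimately show ?thesis by simp
  qed
  moreover have "y : generate G ?F" unfolding generate_pow_eq y_def by (intro CollectI exI[of _ k]) simp
  ultimately show ?thesis using gact_root_stabilizer[OF A_carr[OF yA]] yV by blast
 qed
 thus ?thesis using F unfolding gen[symmetric] by (intro exI[of _ "real m"] exI[of _ ?F]) auto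
qed

text \<open>Passing from \<open>G\<close> to the finite index subgroup adds at most the total
  displacement of the root by the coset representatives.\<close>

lemma cen_cobounded:
 assumes "finite (rcosets cen)" shows "EX D. ALL z:{L. red v L}. EX g:cen. tdist (gact g []) z <= D"
proof -
 obtain D where D: "!!z. red v z ==> EX g:CG. tdist (gact g []) z <= D"
  using gact_cobounded fin_digraph.finite_verts[OF fin] by blast
 define t where "t C = (SOME g. g : CG & C = cen #> g)" for C
 define D' where "D' = (\<Sum>C\<in>rcosets cen. length (gact (t C) []))"
 have "EX h:cen. tdist (gact h []) z <= D' + D" if z: "red v z" for z
 proof -
  obtain g where g: "g : CG" "tdist (gact g []) z <= D" using D[OF z] by blast
  define C where "C = cen #> g"
  have C: "C : rcosets cen" unfolding C_def RCOSETS_def using g by blast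
  have t: "t C : CG & C = cen #> t C" unfolding t_def by (rule someI[of _ g]) (use g C_def in auto)
  have "g : cen #> t C" using t rcos_self[OF g(1) cen_subgroup] unfolding C_def by simp
  then obtain h where h: "h : cen" "g = h ** t C" unfolding r_coset_def by auto
  have hc: "h : CG" by (rule cen_carrier[OF h(1)])
  have "tdist (gact h []) (gact g []) = tdist (gact h []) (gact h (gact (t C) []))" unfolding h(2) using gact_mult[OF hc _ red_root] t by simp
  also have "... = length (gact (t C) [])" using gact_tdist[OF hc red_root gact_red[OF _ red_root]] t by simp
  also have "... <= D'" unfolding D'_def using C assms by (intro member_le_sum) auto
  finally have "tdist (gact h []) z <= D' + D" using tdist_triangle[of "gact h []" z "gact g []"] g(2) by linarith
  thus ?thesis using h(1) by blast
 qed
 thus ?thesis by blast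
qed

lemma cen_tree_lines:
 assumes "finite (rcosets cen)" shows "tree_lines (G(|carrier := cen|)) {L. red v L} gact tr n"
proof -
 have vt: "vertex_tree {L. red v L}" by (rule vertex_tree.intro) (use red_root red_take in auto)
 have vi: "vertex_tree.visom {L. red v L} (gact g)" if "g : cen" for g
  unfolding vertex_tree.visom_def[OF vt] using gact_bij[OF cen_carrier[OF that]] gact_tdist[OF cen_carrier[OF that]] by auto
 show ?thesis
  by (intro tree_lines.intro tree_lines_axioms.intro subgroup_imp_group[OF cen_subgroup] vt red_countable)
   (use vi gact_mult cen_carrier tr_cen_mult cen_cobounded[OF assms] cen_proper cen_lattice in auto)
qed

theorem finite_monodromy_virtually_HHG:
 assumes "finite (monodromy n G A a)" "infinite (UNIV :: 's set)" "EX j :: real => 'p. inj j"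
 shows "virtually_HHG TYPE('s) TYPE('p) G"
proof -
 have fi: "finite (rcosets cen)" by (rule cen_finite_index[OF assms(1)])
 have "hierarchically_hyperbolic_group TYPE('s) TYPE('p) (G(|carrier := cen|))"
  by (rule tree_lines.tree_lines_hhg[OF cen_tree_lines[OF fi] assms(2,3)])
 thus ?thesis unfolding virtually_HHG_def finite_index_subgroup_def using cen_subgroup fi by (intro exI[of _ cen]) simp
qed

theorem virtually_HHG_finite_monodromy:
 assumes "virtually_HHG TYPE('s) TYPE('p) G" shows "finite (monodromy n G A a)"
proof -
 obtain H where H: "subgroup H G" "finite (rcosets H)" and hh: "hierarchically_hyperbolic_group TYPE('s) TYPE('p) (G(|carrier := H|))"
  using assms unfolding virtually_HHG_def finite_index_subgroup_def by auto
 obtain S and \<H> :: "('g, 's, 'p) hhs" and act isom where S: "finite S" "S <= carrier (G(|carrier := H|))"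
  "generate (G(|carrier := H|)) S = carrier (G(|carrier := H|))" and st: "hhg_structure (G(|carrier := H|)) S \<H> act isom"
  using hh unfolding hierarchically_hyperbolic_group_def by blast
 obtain N P R RR kp where hd: "hhg_distances (domains \<H>) (nested \<H>) (orth \<H>) N (G(|carrier := H|)) (word_metric (G(|carrier := H|)) S) P R RR kp act"
  using hhg_structure_distances[OF subgroup_imp_group[OF H(1)] S st] by blast
 obtain T where T: "T <= CG" "finite T" "!!g. g : CG ==> EX t:T. EX m>=(1::nat). ALL y:A. g ** y [^] m ** inv g = t ** y [^] m ** inv t"
  using finitely_many_conjugations[OF H hd sub comm _ A_commensurated] torsion_free by blast
 have "monodromy n G A a <= modular_hom n G A a ` T"
 proof
  fix M assume "M : monodromy n G A a"
  then obtain g where g: "g : CG" "M = modular_hom n G A a g" unfolding monodromy_def by blast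
  obtain t and m :: nat where t: "t : T" "m >= 1" "!!y. y : A ==> g ** y [^] m ** inv g = t ** y [^] m ** inv t" using T(3)[OF g(1)] by blast
  obtain k :: nat where k: "k >= 1" "!!y. y : A ==> g ** y [^] k ** inv g : A" using A_commensurated[OF g(1)] by blast
  have "modular_hom n G A a g = modular_hom n G A a t" by (rule modular_hom_cong[OF g(1) _ t(2,3) k]) (use t(1) T(1) in auto)
  thus "M : modular_hom n G A a ` T" using g(2) t(1) by blast
 qed
 thus ?thesis using T(2) finite_subset by blast
qed

end

theorem corollary5p2:
  fixes n :: nat
    and G :: "('g, 'm) monoid_scheme"
    and \<G> :: "('v, 'e, 'a, 'b) graph_of_groups"
    and v :: 'v
    and \<phi> :: "'g \<Rightarrow> ('v, 'e, 'a) gog_letter list set"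
    and x :: "'v \<times> ('v, 'e, 'a) gog_letter list set"
    and A :: "'g set"
    and a :: "nat \<Rightarrow> 'g"
  assumes "n \<ge> 1"
    and "GBS_decomposition n G \<G> v \<phi>"
    and "x \<in> bass_serre_verts \<G> v"
    and "finite_index_subgroup A (stabilizer G (\<lambda>g. bass_serre_act \<G> (\<phi> g)) x) G"
    and "ordered_basis n G A a"
    and "infinite (UNIV :: 's set)"
    and "\<exists>f :: real \<Rightarrow> 'p. inj f"
  shows "virtually_HHG TYPE('s) TYPE('p) G \<longleftrightarrow> finite (monodromy n G A a)"
proof -
 interpret gbs_base G \<G> v \<phi> n x A a
  using assms(2-5) unfolding GBS_decomposition_def
  by (intro gbs_base.intro gbs_base_axioms.intro gbs_group.intro gbs_group_axioms.intro gog_group.intro gog_group_axioms.intro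
   gog_paths.intro) auto
 show ?thesis using finite_monodromy_virtually_HHG[OF _ assms(6,7)] virtually_HHG_finite_monodromy by blast
qed

end
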